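(* Suppose the graphs $G_n$ (with vertex sets $[n]=\{1,\dots,n\}$) converge locally weakly to $\mu$, for some $\mu\in\mathcal U_*$. Then, at any continuity point $\beta\ge 0$ of the bounded, non-decreasing, right-continuous function $\beta\mapsto \mathsf U(\beta,0)$, the Ising measures $\nu_n^{\beta}$ on $G_n$ converge locally weakly, as $n\to\infty$, to $\overline{\mathfrak m}=\mu\circ\overline\varphi^{-1}$, where $\overline\varphi:\mathcal T_*\to\mathcal P(\overline{\mathcal T}_* )$ is given by $\overline\varphi(T)=\delta_T\otimes\big(\tfrac12\nu^{\beta}_{+,T}+\tfrac12\nu^{\beta}_{-,T}\big)$.
   Context: **Graph spaces.** Graphs are undirected and locally finite. For a vertex $v$, $\mathsf B_v(r)$ is the set of vertices at graph distance at most $r$ from $v$ (also the subgraph it induces), $\partial v$ is the set of neighbours of $v$, $\Delta_v=|\partial v|$. $\mathcal G_*$ is the space of rooted-isomorphism classes of connected locally finite rooted graphs $(G,o)$, with the metric giving distance $1/(\alpha+1)$ between two rooted graphs, $\alpha$ being the supremum of $r\in\mathbb N$ such that the balls of radius $r$ around the roots are isomorphic as rooted graphs. $\overline{\mathcal G}_*$ is the analogous space of rooted networks, i.e. rooted graphs with a mark in the finite set $\mathcal X=\{-1,1\}$ at each vertex (isomorphisms preserve marks). Both are Polish and carry Borel $\sigma$-algebras. $\mathcal T_*\subset\mathcal G_*$ and $\overline{\mathcal T}_*\subset\overline{\mathcal G}_*$ are the subspaces of trees and marked trees. $\mathcal P(\cdot)$ denotes Borel probability measures; $\mu[f]$ or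 $\mu\langle f\rangle$ denotes expectation. $\delta_G\otimes\nu_G$ is the law of the rooted network with deterministic underlying rooted graph $G$ and marks distributed as $\nu_G$ on $\mathcal X^{V(G)}$. **Local weak convergence of graphs.** For graphs $G_n$ on $[n]$, $\mu_n$ is the law in $\mathcal G_*$ of $(G_n,I_n)$ (the component of $I_n$, rooted at $I_n$) with $I_n$ uniform on $[n]$. $\{G_n\}$ is uniformly sparse if $\lim_{k\to\infty}\limsup_{n\to\infty}\frac1n\sum_{i\in[n]}\Delta_i(G_n)\mathbf 1(\Delta_i(G_n)\ge k)=0$. $\{G_n\}$ converges locally weakly to $\mu\in\mathcal P(\mathcal G_* )$ if it is uniformly sparse and $\mu_n\to\mu$ weakly. **Unimodularity.** $\mu\in\mathcal P(\mathcal G_* )$ is unimodular if $\int\sum_{x\in V(G)}f(G,o,x)\,d\mu=\int\sum_{x\in V(G)}f(G,x,o)\,d\mu$ for every Borel $f\ge0$ on the space of isomorphism classes of locally finite connected graphs with an ordered pair of distinguished vertices. $\mathcal U$ is the set of unimodular $\mu$ with $\mu\langle\Delta_o\rangle<\infty$; $\mathcal U_*=\{\mu\in\mathcal U:\mu(\mathcal T_* )=1\}$. **Ising measures.** $\nu_n^{\beta}$ is the measure on $\{-1,1\}^{[n]}$ with $\nu_n^\beta(\underline x)\propto\exp\{\beta\sum_{(i,j)\in E_n}x_ix_j\}$, $E_n$ the edge set of $G_n$. For a rooted tree $T$, let $T(t)$ be its subtree induced by vertices at distance at most $t$ from the root. $\nu^{\beta,B,t}_{+,T}$ (resp. $\nu^{\beta,B,t}_{-,T}$)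 is the Ising measure on $T(t)$ with weights $\exp\{\beta\sum_{(i,j)\in E(T(t))}x_ix_j+B\sum_{i\in V(T(t))}x_i\}$, conditioned on all spins outside $T(t-1)$ being $+1$ (resp. $-1$). As $t\to\infty$ these converge to probability measures $\nu^{\beta,B}_{\pm,T}$ on $\{-1,1\}^{V(T)}$; $\nu^\beta_{\pm,T}:=\nu^{\beta,0}_{\pm,T}$. For $\beta,B\ge0$, $$\mathsf U(\beta,B):=\tfrac12\,\mu\Big[\sum_{i\in\partial o}\nu^{\beta,B}_{+,T}\langle x_ox_i\rangle\Big].$$ **Local weak convergence of measures.** For $t\in\mathbb N$, $\overline{\mathcal G}_*(t)$ is the (discrete) space of rooted-isomorphism classes of rooted connected locally finite networks truncated at distance $t$ from the root; $\overline\nu^t$ is the law of the truncation at height $t$ of a network of law $\overline\nu\in\mathcal P(\overline{\mathcal G}_* )$, and for a probability measure $\overline{\mathfrak m}$ on $\mathcal P(\overline{\mathcal G}_* )$, $\overline{\mathfrak m}^t$ is its image under $\overline\nu\mapsto\overline\nu^t$. Given probability measures $\zeta_n$ on $\mathcal X^{[n]}$ and $i\in[n]$, $\overline{\mathsf P}_n^t(i)\in\mathcal P(\overline{\mathcal G}_*(t))$ is the law of $((\mathsf B_i(t),i),\underline x_{\mathsf B_i(t)})$ with $\underline x\sim\zeta_n$. $\{\zeta_n\}$ converges locally weakly to $\overline{\mathfrak m}$ if for each $t\in\mathbb N$ the law of the random measure $\overline{\mathsf P}_n^t(I_n)$ ($I_n$ uniform on $[n]$) converges weakly to $\overline{\mathfrak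 m}^t$. *)

theory Defs
  imports "HOL-Probability.Probability"
begin

section \<open>Graphs\<close>

text \<open>
  Graphs are simple and undirected. An edge is the two-element set of its end points, so that a
  sum over \<open>E\<close> is a sum over unordered pairs.
\<close>

definition graph_on :: "'v set \<Rightarrow> 'v set set \<Rightarrow> bool" where
  "graph_on V E \<longleftrightarrow> E \<subseteq> {{u, v} | u v. u \<in> V \<and> v \<in> V \<and> u \<noteq> v}"

definition adj :: "'v set set \<Rightarrow> ('v \<times> 'v) set" where
  "adj E = {(u, v). {u, v} \<in> E}"

definition nbrs :: "'v set set \<Rightarrow> 'v \<Rightarrow> 'v set" where
  "nbrs E v = {w. {v, w} \<in> E}"

definition gdist :: "'v set set \<Rightarrow> 'v \<Rightarrow> 'v \<Rightarrow> enat" where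
  "gdist E u v = (INF k\<in>{k. (u, v) \<in> adj E ^^ k}. enat k)"

definition gball :: "'v set set \<Rightarrow> 'v \<Rightarrow> nat \<Rightarrow> 'v set" where
  "gball E v r = {w. gdist E v w \<le> enat r}"

definition induced :: "'v set set \<Rightarrow> 'v set \<Rightarrow> 'v set set" where
  "induced E W = {e \<in> E. e \<subseteq> W}"

definition connected_graph :: "'v set \<Rightarrow> 'v set set \<Rightarrow> bool" where
  "connected_graph V E \<longleftrightarrow> (\<forall>u\<in>V. \<forall>v\<in>V. (u, v) \<in> (adj E)\<^sup>*)"

definition component :: "'v set set \<Rightarrow> 'v \<Rightarrow> 'v set" where
  "component E v = {w. (v, w) \<in> (adj E)\<^sup>*}"

definition acyclic_graph :: "'v set set \<Rightarrow> bool" where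
  "acyclic_graph E \<longleftrightarrow>
    \<not> (\<exists>c. 3 \<le> length c \<and> distinct c \<and> (\<forall>i<length c. {c ! i, c ! (Suc i mod length c)} \<in> E))"


section \<open>Rooted networks up to isomorphism\<close>

text \<open>
  A connected locally finite graph is countable, so every rooted-isomorphism class of rooted
  networks has a representative whose vertex set is a set of natural numbers. The values of
  \<open>mark\<close> outside \<open>verts\<close> are irrelevant, as \<open>net_iso\<close> ignores them.
\<close>

datatype 'm rnet =
  RNet (verts: "nat set") (edges: "nat set set") (rt: nat) (mark: "nat \<Rightarrow> 'm")

definition rooted_net :: "'m rnet \<Rightarrow> bool" where
  "rooted_net R \<longleftrightarrow> graph_on (verts R) (edges R) \<and> rt R \<in> verts R
     \<and> connected_graph (verts R) (edges R) \<and> (\<forall>v\<in>verts R. finite (nbrs (edges R) v))"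

definition net_iso :: "(nat \<Rightarrow> nat) \<Rightarrow> 'm rnet \<Rightarrow> 'm rnet \<Rightarrow> bool" where
  "net_iso f R S \<longleftrightarrow> bij_betw f (verts R) (verts S) \<and> f (rt R) = rt S
     \<and> (\<forall>u\<in>verts R. \<forall>v\<in>verts R. {f u, f v} \<in> edges S \<longleftrightarrow> {u, v} \<in> edges R)
     \<and> (\<forall>v\<in>verts R. mark S (f v) = mark R v)"

definition net_eq :: "'m rnet \<Rightarrow> 'm rnet \<Rightarrow> bool" where
  "net_eq R S \<longleftrightarrow> rooted_net R \<and> rooted_net S \<and> (\<exists>f. net_iso f R S)"

definition raw_trunc :: "nat \<Rightarrow> 'm rnet \<Rightarrow> 'm rnet" where
  "raw_trunc t R = (let W = gball (edges R) (rt R) t in RNet W (induced (edges R) W) (rt R) (mark R))"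

lemma gball_iff: "w \<in> gball E v r \<longleftrightarrow> (\<exists>k\<le>r. (v, w) \<in> adj E ^^ k)"
proof
  assume "w \<in> gball E v r"
  then have le: "gdist E v w \<le> enat r" by (simp add: gball_def)
  then have ne: "{k. (v, w) \<in> adj E ^^ k} \<noteq> {}"
    unfolding gdist_def by (metis Inf_empty enat_ord_simps(5) image_empty infinity_ileE top_enat_def)
  have "gdist E v w \<in> enat ` {k. (v, w) \<in> adj E ^^ k}"
    unfolding gdist_def using ne by (auto simp: Inf_enat_def intro: LeastI)
  then show "\<exists>k\<le>r. (v, w) \<in> adj E ^^ k" using le by auto
next
  assume "\<exists>k\<le>r. (v, w) \<in> adj E ^^ k"
  then obtain k where "k \<le> r" "(v, w) \<in> adj E ^^ k" by blast
  then have "gdist E v w \<le> enat k" unfolding gdist_def by (auto intro: INF_lower)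
  then show "w \<in> gball E v r" using \<open>k \<le> r\<close> by (simp add: gball_def order_trans)
qed

lemma sym_adj: "sym (adj E)"
  by (auto simp: sym_def adj_def insert_commute)

lemma adj_in_verts: "graph_on V E \<Longrightarrow> (u, v) \<in> adj E \<Longrightarrow> u \<in> V \<and> v \<in> V"
  unfolding graph_on_def adj_def by (fastforce simp: doubleton_eq_iff)

lemma walk_in_verts: "graph_on V E \<Longrightarrow> u \<in> V \<Longrightarrow> (u, v) \<in> adj E ^^ k \<Longrightarrow> v \<in> V"
  by (cases k) (auto dest: adj_in_verts)

lemma walk_iso:
  assumes "net_iso f R S" "graph_on (verts R) (edges R)" "rt R \<in> verts R"
  shows "(rt R, w) \<in> adj (edges R) ^^ k \<Longrightarrow> w \<in> verts R \<and> (rt S, f w) \<in> adj (edges S) ^^ k"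
proof (induction k arbitrary: w)
  case 0 then show ?case using assms by (auto simp: net_iso_def)
next
  case (Suc k)
  then obtain u where u: "(rt R, u) \<in> adj (edges R) ^^ k" "(u, w) \<in> adj (edges R)" by auto
  with Suc.IH have "u \<in> verts R" "(rt S, f u) \<in> adj (edges S) ^^ k" by auto
  moreover have "w \<in> verts R" using u adj_in_verts[OF assms(2)] by blast
  moreover have "(f u, f w) \<in> adj (edges S)"
    using u calculation assms(1) by (auto simp: net_iso_def adj_def)
  ultimately show ?case by auto
qed

lemma net_iso_inv:
  assumes "net_iso f R S" "rt R \<in> verts R"
  shows "net_iso (inv_into (verts R) f) S R"
proof -
  let ?g = "inv_into (verts R) f"
  have b: "bij_betw f (verts R) (verts S)" using assms by (simp add: net_iso_def)
  have g: "?g v \<in> verts R" "f (?g v) = v" if "v \<in> verts S" for v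
    using b that by (auto simp: bij_betw_def inv_into_into f_inv_into_f)
  have "?g (rt S) = rt R" using assms b by (metis bij_betw_inv_into_left net_iso_def)
  moreover have "{?g u, ?g v} \<in> edges R \<longleftrightarrow> {u, v} \<in> edges S"
    if "u \<in> verts S" "v \<in> verts S" for u v
    using g[OF that(1)] g[OF that(2)] assms(1) unfolding net_iso_def by metis
  moreover have "mark R (?g v) = mark S v" if "v \<in> verts S" for v
    using g[OF that] assms(1) unfolding net_iso_def by metis
  ultimately show ?thesis using bij_betw_inv_into[OF b] by (auto simp: net_iso_def)
qed

lemma net_iso_trans: "net_iso f R S \<Longrightarrow> net_iso g S T \<Longrightarrow> net_iso (g \<circ> f) R T"
  unfolding net_iso_def by (auto intro: bij_betw_trans dest: bij_betwE)

lemma net_iso_ball: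
  assumes "net_iso f R S" "rooted_net R" "rooted_net S"
  shows "f ` gball (edges R) (rt R) t = gball (edges S) (rt S) t"
proof -
  have R: "graph_on (verts R) (edges R)" "rt R \<in> verts R"
    and S: "graph_on (verts S) (edges S)" "rt S \<in> verts S"
    using assms by (auto simp: rooted_net_def)
  let ?g = "inv_into (verts R) f"
  have g: "net_iso ?g S R" by (rule net_iso_inv[OF assms(1) R(2)])
  have b: "f ` verts R = verts S" using assms by (simp add: net_iso_def bij_betw_def)
  show ?thesis
  proof (intro equalityI subsetI)
    fix y assume "y \<in> f ` gball (edges R) (rt R) t"
    then obtain x k where "y = f x" "k \<le> t" "(rt R, x) \<in> adj (edges R) ^^ k" by (auto simp: gball_iff)
    then show "y \<in> gball (edges S) (rt S) t"
      using walk_iso[OF assms(1) R, of x k] unfolding gball_iff by blast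
  next
    fix y assume "y \<in> gball (edges S) (rt S) t"
    then obtain k where k: "k \<le> t" "(rt S, y) \<in> adj (edges S) ^^ k" by (auto simp: gball_iff)
    note w = walk_iso[OF g S k(2)]
    have "y \<in> verts S" "?g y \<in> gball (edges R) (rt R) t"
      using w k(1) unfolding gball_iff by blast+
    then show "y \<in> f ` gball (edges R) (rt R) t"
      using b by (intro image_eqI[of _ f "?g y"]) (auto simp: f_inv_into_f)
  qed
qed

lemma gball_subset: "rooted_net R \<Longrightarrow> gball (edges R) (rt R) t \<subseteq> verts R"
  by (auto simp: gball_iff rooted_net_def dest: walk_in_verts)

lemma gball_mono: "k \<le> t \<Longrightarrow> gball E v k \<subseteq> gball E v t"
  by (auto simp: gball_def order_trans)

lemma walk_induced:
  "(v, w) \<in> adj E ^^ k \<Longrightarrow> k \<le> t \<Longrightarrow> (v, w) \<in> adj (induced E (gball E v t)) ^^ k"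
proof (induction k arbitrary: w)
  case (Suc k)
  then obtain u where u: "(v, u) \<in> adj E ^^ k" "(u, w) \<in> adj E" by auto
  have "u \<in> gball E v t" using u Suc.prems by (auto simp: gball_iff intro!: exI[of _ k])
  moreover have "w \<in> gball E v t"
    using Suc.prems unfolding gball_iff by blast
  ultimately have "(u, w) \<in> adj (induced E (gball E v t))"
    using u by (auto simp: adj_def induced_def)
  then show ?case using Suc u by auto
qed simp

lemma gball_induced:
  assumes "k \<le> t" shows "gball (induced E (gball E v t)) v k = gball E v k"
proof -
  have "adj (induced E X) \<subseteq> adj E" for X by (auto simp: adj_def induced_def)
  then have "(v, w) \<in> adj (induced E X) ^^ j \<Longrightarrow> (v, w) \<in> adj E ^^ j" for w j X
    by (induction j arbitrary: w) (simp, blast elim: relpow_Suc_E intro: relpow_Suc_I)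
  moreover have "(v, w) \<in> adj (induced E (gball E v t)) ^^ j" if "(v, w) \<in> adj E ^^ j" "j \<le> k" for w j
    using walk_induced that assms by fastforce
  ultimately show ?thesis by (intro set_eqI) (metis gball_iff)
qed

lemma finite_gball:
  assumes "rooted_net R" shows "finite (gball (edges R) (rt R) t)"
proof (induction t)
  case 0
  have "gball (edges R) (rt R) 0 = {rt R}" by (auto simp: gball_iff)
  then show ?case by simp
next
  case (Suc t)
  let ?B = "gball (edges R) (rt R)"
  have "?B (Suc t) \<subseteq> ?B t \<union> (\<Union>u\<in>?B t. nbrs (edges R) u)"
  proof
    fix w assume "w \<in> ?B (Suc t)"
    then obtain k where k: "k \<le> Suc t" "(rt R, w) \<in> adj (edges R) ^^ k" by (auto simp: gball_iff)
    show "w \<in> ?B t \<union> (\<Union>u\<in>?B t. nbrs (edges R) u)"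
    proof (cases k)
      case 0 then show ?thesis using k by (auto simp: gball_iff)
    next
      case (Suc j)
      then obtain u where "(rt R, u) \<in> adj (edges R) ^^ j" "(u, w) \<in> adj (edges R)" using k by auto
      then have "u \<in> ?B t" "w \<in> nbrs (edges R) u"
        using k Suc by (auto simp: gball_iff adj_def nbrs_def)
      then show ?thesis by auto
    qed
  qed
  moreover have "finite (\<Union>u\<in>?B t. nbrs (edges R) u)"
    using Suc gball_subset[OF assms] assms by (auto simp: rooted_net_def)
  ultimately show ?case using Suc finite_subset by blast
qed

lemma raw_trunc_sel [simp]:
  "verts (raw_trunc t R) = gball (edges R) (rt R) t"
  "edges (raw_trunc t R) = induced (edges R) (gball (edges R) (rt R) t)"
  "rt (raw_trunc t R) = rt R" "mark (raw_trunc t R) = mark R"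
  by (auto simp: raw_trunc_def Let_def)

lemma graph_on_induced:
  assumes "graph_on V E" shows "graph_on W (induced E W)"
  unfolding graph_on_def
proof
  fix e assume e: "e \<in> induced E W"
  then have "e \<in> {{u, v} | u v. u \<in> V \<and> v \<in> V \<and> u \<noteq> v}" and sub: "e \<subseteq> W"
    using assms by (auto simp: graph_on_def induced_def)
  then obtain u v where uv: "e = {u, v}" "u \<noteq> v" by auto
  then have "u \<in> W" "v \<in> W" using sub by auto
  then show "e \<in> {{u, v} | u v. u \<in> W \<and> v \<in> W \<and> u \<noteq> v}"
    using uv by auto
qed

lemma connected_from_root:
  assumes "\<And>v. v \<in> V \<Longrightarrow> (x, v) \<in> (adj E)\<^sup>*" shows "connected_graph V E"
  unfolding connected_graph_def
proof (intro ballI)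
  fix u v assume u: "u \<in> V" and v: "v \<in> V"
  have "(u, x) \<in> (adj E)\<^sup>*" by (rule symD[OF sym_rtrancl[OF sym_adj] assms[OF u]])
  then show "(u, v) \<in> (adj E)\<^sup>*" using assms[OF v] by (rule rtrancl_trans)
qed

lemma rooted_net_trunc:
  assumes "rooted_net R" shows "rooted_net (raw_trunc t R)"
proof -
  let ?B = "gball (edges R) (rt R) t"
  have r: "rt R \<in> ?B" by (auto simp: gball_iff)
  have "nbrs (induced (edges R) ?B) v \<subseteq> ?B" for v
    by (auto simp: nbrs_def induced_def)
  then have "finite (nbrs (induced (edges R) ?B) v)" for v
    using finite_gball[OF assms] finite_subset by blast
  moreover have "(rt R, v) \<in> (adj (induced (edges R) ?B))\<^sup>*" if "v \<in> ?B" for v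
    using that walk_induced by (fastforce simp: gball_iff intro: relpow_imp_rtrancl)
  ultimately show ?thesis
    using r assms connected_from_root[of ?B "rt R"] graph_on_induced[of "verts R" "edges R" ?B]
    by (simp add: rooted_net_def)
qed

lemma net_iso_trunc:
  assumes "net_iso f R S" "rooted_net R" "rooted_net S"
  shows "net_iso f (raw_trunc t R) (raw_trunc t S)"
proof -
  let ?B = "gball (edges R) (rt R) t" and ?C = "gball (edges S) (rt S) t"
  have im: "f ` ?B = ?C" by (rule net_iso_ball[OF assms])
  have sub: "?B \<subseteq> verts R" by (rule gball_subset[OF assms(2)])
  have "bij_betw f ?B ?C"
    using assms(1) im sub by (auto simp: net_iso_def bij_betw_def intro: inj_on_subset)
  then show ?thesis using assms(1) sub im
    by (auto simp: net_iso_def induced_def subset_iff)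
qed

lemma net_iso_refl: "net_iso id R R"
  by (simp add: net_iso_def)

lemma part_equivp_net_eq: "part_equivp (net_eq :: 'm rnet \<Rightarrow> _)"
proof (rule part_equivpI)
  let ?R = "RNet {0} {} 0 (\<lambda>_. undefined) :: 'm rnet"
  have "rooted_net ?R"
    by (auto simp: rooted_net_def graph_on_def connected_graph_def nbrs_def)
  then show "\<exists>R::'m rnet. net_eq R R" using net_iso_refl by (auto simp: net_eq_def)
  show "symp (net_eq :: 'm rnet \<Rightarrow> _)"
    using net_iso_inv by (fastforce simp: symp_def net_eq_def rooted_net_def)
  show "transp (net_eq :: 'm rnet \<Rightarrow> _)"
    using net_iso_trans by (fastforce simp: transp_def net_eq_def)
qed

quotient_type 'm network = "'m rnet" / partial: net_eq
  by (rule part_equivp_net_eq)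

lift_definition trunc :: "nat \<Rightarrow> 'm network \<Rightarrow> 'm network" is raw_trunc
  using net_iso_trunc rooted_net_trunc by (fastforce simp: net_eq_def)

lemma net_eq_rep: "net_eq (rep_network X) (rep_network X)"
  using Quotient_rep_reflp[OF Quotient_network] by blast

lemma rooted_net_rep: "rooted_net (rep_network X)"
  using net_eq_rep net_eq_def by blast

lemma abs_rep_network: "abs_network (rep_network X) = X"
  using Quotient_abs_rep[OF Quotient_network] .

lemma trunc_eq_iff:
  "trunc t X = trunc t Y \<longleftrightarrow>
     net_eq (raw_trunc t (rep_network X)) (raw_trunc t (rep_network Y))"
proof -
  have 1: "trunc t Z = abs_network (raw_trunc t (rep_network Z))" for Z :: "'a network"
    using trunc.abs_eq[OF net_eq_rep, of t Z] abs_rep_network[of Z] by simp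
  have 2: "net_eq (raw_trunc t (rep_network Z)) (raw_trunc t (rep_network Z))" for Z :: "'a network"
    using rooted_net_trunc[OF rooted_net_rep] net_iso_refl by (auto simp: net_eq_def)
  show ?thesis unfolding 1 using Quotient_rel[OF Quotient_network] 2 by metis
qed

lemma trunc_trunc: assumes "k \<le> t" shows "trunc k (trunc t X) = trunc k X"
  using assms
proof (transfer, goal_cases)
  case (1 k t R)
  then have R: "rooted_net R" by (auto simp: net_eq_def)
  let ?E = "edges R" and ?o = "rt R"
  have "induced (induced ?E (gball ?E ?o t)) (gball ?E ?o k) = induced ?E (gball ?E ?o k)"
    using gball_mono[OF 1(1), of ?E ?o] by (auto simp: induced_def)
  then have "raw_trunc k (raw_trunc t R) = raw_trunc k R"
    by (simp add: rnet.expand gball_induced[OF 1(1)])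
  then show ?case using rooted_net_trunc[OF R] net_iso_refl by (auto simp: net_eq_def)
qed

lemma in_some_gball:
  assumes "rooted_net R" "v \<in> verts R" shows "\<exists>k. v \<in> gball (edges R) (rt R) k"
proof -
  have "(rt R, v) \<in> (adj (edges R))\<^sup>*"
    using assms by (simp add: rooted_net_def connected_graph_def)
  then obtain k where "(rt R, v) \<in> adj (edges R) ^^ k" by (auto dest: rtrancl_imp_relpow)
  then show ?thesis unfolding gball_iff by blast
qed

lemma network_eqI:
  assumes "\<And>t. trunc t X = trunc t Y" shows "X = Y"
proof -
  define R where "R = rep_network X"
  define S where "S = rep_network Y"
  have R: "rooted_net R" and S: "rooted_net S" by (auto simp: R_def S_def rooted_net_rep)
  let ?B = "gball (edges R) (rt R)" and ?C = "gball (edges S) (rt S)"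
  have "\<exists>f. net_iso f (raw_trunc r R) (raw_trunc r S)" for r
    using assms[of r] unfolding trunc_eq_iff by (auto simp: R_def S_def net_eq_def)
  then obtain F where F: "\<And>r. net_iso (F r) (raw_trunc r R) (raw_trunc r S)" by metis
  have Fball: "F r ` ?B k = ?C k" if "k \<le> r" for r k
    using net_iso_ball[OF F[of r] rooted_net_trunc[OF R] rooted_net_trunc[OF S], of k]
    by (simp add: gball_induced[OF that])
  note dep = in_some_gball[OF R] and depS = in_some_gball[OF S]
  have step: "\<exists>J. infinite J \<and> J \<subseteq> I \<and> (n \<in> verts R \<longrightarrow> (\<exists>c. \<forall>r\<in>J. F r n = c))"
    if "infinite I" for I n
  proof (cases "n \<in> verts R")
    case True
    then obtain k where k: "n \<in> ?B k" using dep by blast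
    have inf: "infinite (I - {..<k})" using that by simp
    have "F r n \<in> ?C k" if "k \<le> r" for r using Fball[OF that] k by blast
    then have "(\<lambda>r. F r n) ` (I - {..<k}) \<subseteq> ?C k" using not_less by blast
    then have "finite ((\<lambda>r. F r n) ` (I - {..<k}))" using finite_gball[OF S] finite_subset by blast
    then obtain r0 where "infinite {r \<in> I - {..<k}. F r n = F r0 n}"
      using pigeonhole_infinite[OF inf] by blast
    then show ?thesis by (intro exI[of _ "{r \<in> I - {..<k}. F r n = F r0 n}"]) auto
  qed (use that in blast)
  have "\<exists>I. \<forall>n. infinite (I n :: nat set) \<and>
    (I (Suc n) \<subseteq> I n \<and> (n \<in> verts R \<longrightarrow> (\<exists>c. \<forall>r\<in>I (Suc n). F r n = c)))"
    by (rule dependent_nat_choice) (use step in \<open>auto intro: exI[of _ UNIV]\<close>)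
  then obtain I where I: "\<And>n. infinite (I n)" "\<And>n. I (Suc n) \<subseteq> I n"
    "\<And>n. n \<in> verts R \<Longrightarrow> \<exists>c. \<forall>r\<in>I (Suc n). F r n = c" by blast
  obtain f where f: "\<And>n r. n \<in> verts R \<Longrightarrow> r \<in> I (Suc n) \<Longrightarrow> F r n = f n" using I(3) by metis
  have I_mono: "I n \<subseteq> I m" if "m \<le> n" for m n using lift_Suc_antimono_le[of I, OF I(2) that] .
  have agree: "\<exists>r\<ge>k. \<forall>v\<in>A. F r v = f v" if "finite A" "A \<subseteq> verts R" for A k
  proof -
    obtain N where N: "\<And>v. v \<in> A \<Longrightarrow> v \<le> N" using \<open>finite A\<close> by (meson finite_nat_set_iff_bounded_le)
    have "infinite (I (Suc N))" by (rule I)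
    then obtain r where "r \<ge> k" "r \<in> I (Suc N)" by (meson infinite_nat_iff_unbounded_le)
    moreover have "I (Suc N) \<subseteq> I (Suc v)" if "v \<in> A" for v using N[OF that] by (intro I_mono) simp
    ultimately show ?thesis using f that by blast
  qed
  have sub: "?B k \<subseteq> verts R" for k by (rule gball_subset[OF R])
  have fB: "f ` ?B k = ?C k" for k
  proof -
    obtain r where "r \<ge> k" "\<forall>v\<in>?B k. F r v = f v" using agree[OF finite_gball[OF R] sub] by blast
    then show ?thesis using Fball[of k r] by (metis image_cong)
  qed
  have two: "\<exists>r. u \<in> ?B r \<and> v \<in> ?B r \<and> F r u = f u \<and> F r v = f v"
    if uv: "u \<in> verts R" "v \<in> verts R" for u v
  proof -
    obtain k l where kl: "u \<in> ?B k" "v \<in> ?B l" using dep uv by blast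
    obtain r where r: "r \<ge> max k l" "\<forall>w\<in>{u, v}. F r w = f w"
      using agree[of "{u, v}" "max k l"] uv by auto
    have "?B k \<subseteq> ?B r" "?B l \<subseteq> ?B r" using r by (auto intro!: gball_mono)
    then show ?thesis using kl r by blast
  qed
  have Fin: "F r u \<in> ?C r" if "u \<in> ?B r" for r u using Fball[of r r] that by blast
  have isoF: "inj_on (F r) (?B r)"
    "\<And>u v. u \<in> ?B r \<Longrightarrow> v \<in> ?B r \<Longrightarrow> {F r u, F r v} \<in> edges S \<longleftrightarrow> {u, v} \<in> edges R"
    "\<And>v. v \<in> ?B r \<Longrightarrow> mark S (F r v) = mark R v" for r
    using F[of r] Fin[of _ r] by (simp_all add: net_iso_def bij_betw_def induced_def)
  have "inj_on f (verts R)"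
    by (rule inj_onI) (metis two isoF(1) inj_onD)
  moreover have "f ` verts R = verts S"
  proof -
    have "verts R = (\<Union>k. ?B k)"
      by (intro equalityI subsetI) (use dep sub in blast)+
    moreover have "verts S = (\<Union>k. ?C k)"
      by (intro equalityI subsetI) (use depS gball_subset[OF S] in blast)+
    ultimately show ?thesis using fB by (simp add: image_UN)
  qed
  moreover have "f (rt R) = rt S"
  proof -
    have "rt R \<in> verts R" using R by (simp add: rooted_net_def)
    from two[OF this this] obtain r where "F r (rt R) = f (rt R)" by auto
    then show ?thesis using F[of r] by (simp add: net_iso_def)
  qed
  moreover have "{f u, f v} \<in> edges S \<longleftrightarrow> {u, v} \<in> edges R" if "u \<in> verts R" "v \<in> verts R" for u v
    using two[OF that] isoF(2) by metis
  moreover have "mark S (f v) = mark R v" if "v \<in> verts R" for v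
    using two[OF that that] isoF(3) by metis
  ultimately have "net_eq R S" using R S by (auto simp: net_eq_def net_iso_def bij_betw_def)
  then show ?thesis
    using Quotient_rel_abs[OF Quotient_network] abs_rep_network unfolding R_def S_def by metis
qed

text \<open>
  \<open>trunc r X = trunc r Y\<close> says that the balls of radius \<open>r\<close> around the two roots
  are isomorphic as rooted networks. The supremum over the empty set is 0.
\<close>

definition agree_radius :: "'m network \<Rightarrow> 'm network \<Rightarrow> enat" where
  "agree_radius X Y = (SUP r\<in>{r. trunc r X = trunc r Y}. enat r)"

instantiation network :: (type) metric_space
begin

definition dist_network :: "'a network \<Rightarrow> 'a network \<Rightarrow> real" where
  "dist X Y = (case agree_radius X Y of enat r \<Rightarrow> 1 / (real r + 1) | \<infinity> \<Rightarrow> 0)"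

definition uniformity_network_def:
  "(uniformity :: ('a network \<times> 'a network) filter) = (INF e\<in>{0<..}. principal {(X, Y). dist X Y < e})"

definition open_network_def:
  "open (U :: 'a network set) \<longleftrightarrow> (\<forall>X\<in>U. \<forall>\<^sub>F (X', Y) in uniformity. X' = X \<longrightarrow> Y \<in> U)"

instance
proof
  fix X Y Z :: "'a network"
  have down: "trunc k X = trunc k Y" if "trunc r X = trunc r Y" "k \<le> r" for k r and X Y :: "'a network"
    using trunc_trunc[OF that(2)] that(1) by metis
  have refl: "agree_radius X X = \<infinity>" for X :: "'a network"
  proof (rule ccontr)
    assume "agree_radius X X \<noteq> \<infinity>"
    then obtain r where r: "agree_radius X X = enat r" by auto
    have "enat (Suc r) \<le> agree_radius X X" unfolding agree_radius_def by (auto intro!: SUP_upper)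
    then show False using r by simp
  qed
  have inf: "X = Y" if "agree_radius X Y = \<infinity>" for X Y :: "'a network"
  proof (rule network_eqI)
    fix t
    have "enat t < agree_radius X Y" using that by simp
    then obtain r where "trunc r X = trunc r Y" "t < r"
      unfolding agree_radius_def by (auto simp: less_SUP_iff)
    then show "trunc t X = trunc t Y" using down by (meson less_imp_le)
  qed
  show "dist X Y = 0 \<longleftrightarrow> X = Y"
    using refl inf by (auto simp: dist_network_def split: enat.splits)
  have min: "min (agree_radius X Z) (agree_radius Y Z) \<le> agree_radius X Y"
  proof (rule ccontr)
    assume "\<not> ?thesis"
    then have "agree_radius X Y < agree_radius X Z" "agree_radius X Y < agree_radius Y Z"
      by (simp_all add: min_le_iff_disj not_le)
    then obtain r s where rs: "trunc r X = trunc r Z" "agree_radius X Y < enat r"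
      "trunc s Y = trunc s Z" "agree_radius X Y < enat s"
      unfolding agree_radius_def[of X Z] agree_radius_def[of Y Z] by (auto simp: less_SUP_iff)
    then have "trunc (min r s) X = trunc (min r s) Y"
      using down[of r X Z "min r s"] down[of s Y Z "min r s"] by simp
    then have "enat (min r s) \<le> agree_radius X Y" unfolding agree_radius_def by (auto intro: SUP_upper)
    then show False using rs by (auto simp: min_def split: if_splits)
  qed
  have anti: "(case b of enat r \<Rightarrow> 1 / (real r + 1) | \<infinity> \<Rightarrow> 0) \<le> (case a of enat r \<Rightarrow> 1 / (real r + 1) | \<infinity> \<Rightarrow> 0)"
    if "a \<le> b" for a b
    using that by (cases a; cases b) (auto intro!: divide_left_mono)
  have nonneg: "0 \<le> dist X Y" for X Y :: "'a network"
    by (auto simp: dist_network_def split: enat.splits)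
  have "dist X Y \<le> max (dist X Z) (dist Y Z)"
  proof (cases "agree_radius X Z \<le> agree_radius Y Z")
    case True
    then have "dist X Y \<le> dist X Z" unfolding dist_network_def using min by (intro anti) simp
    then show ?thesis by simp
  next
    case False
    then have "dist X Y \<le> dist Y Z" unfolding dist_network_def using min by (intro anti) simp
    then show ?thesis by simp
  qed
  then show "dist X Y \<le> dist X Z + dist Y Z" using nonneg[of X Z] nonneg[of Y Z] by linarith
qed (simp_all add: uniformity_network_def open_network_def)

end

text \<open>Unmarked rooted graphs are networks with trivial marks.\<close>

type_synonym rooted_graph = "unit network"

definition trees :: "'m network set" where
  "trees = {X. acyclic_graph (edges (rep_network X))}"

definition sub_network :: "nat set set \<Rightarrow> nat set \<Rightarrow> nat \<Rightarrow> (nat \<Rightarrow> 'm) \<Rightarrow> 'm network" where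
  "sub_network E W v m = abs_network (RNet W (induced E W) v m)"


section \<open>Weak convergence\<close>

definition weak_conv_on :: "'a topology \<Rightarrow> (nat \<Rightarrow> 'a measure) \<Rightarrow> 'a measure \<Rightarrow> bool" where
  "weak_conv_on X M_seq M \<longleftrightarrow>
    (\<forall>f. continuous_map X euclideanreal f \<and> bounded (f ` topspace X) \<longrightarrow>
      (\<lambda>n. \<integral>x. f x \<partial>M_seq n) \<longlonglongrightarrow> (\<integral>x. f x \<partial>M))"

definition prob_measures_on :: "'a topology \<Rightarrow> 'a measure set" where
  "prob_measures_on X =
    {\<nu>. prob_space \<nu> \<and> sets \<nu> = sigma_sets (topspace X) {U. openin X U}}"

text \<open>The topology of weak convergence on the Borel probability measures of \<open>X\<close>.\<close>

definition weak_topology :: "'a topology \<Rightarrow> 'a measure topology" where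
  "weak_topology X = topology_generated_by
    {{\<nu> \<in> prob_measures_on X. (\<integral>x. f x \<partial>\<nu>) \<in> U} | f U.
      continuous_map X euclideanreal f \<and> bounded (f ` topspace X) \<and> open (U :: real set)}"


section \<open>Local weak convergence of graphs and unimodularity\<close>

definition uniformly_sparse :: "(nat \<Rightarrow> nat set set) \<Rightarrow> bool" where
  "uniformly_sparse E \<longleftrightarrow>
    (\<lambda>k. limsup (\<lambda>n. ereal (1 / real n *
        (\<Sum>i\<in>{1..n}. if k \<le> card (nbrs (E n) i) then real (card (nbrs (E n) i)) else 0))))
      \<longlonglongrightarrow> 0"

definition graph_law :: "nat set set \<Rightarrow> nat \<Rightarrow> rooted_graph measure" where
  "graph_law E n = distr (measure_pmf (pmf_of_set {1..n})) borel
    (\<lambda>i. sub_network E (component E i) i (\<lambda>_. ()))"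

definition graphs_loc_weak_conv :: "(nat \<Rightarrow> nat set set) \<Rightarrow> rooted_graph measure \<Rightarrow> bool" where
  "graphs_loc_weak_conv E \<mu> \<longleftrightarrow>
    uniformly_sparse E \<and> weak_conv_on euclidean (\<lambda>n. graph_law (E n) n) \<mu>"

text \<open>
  A graph with an ordered pair \<open>(a, b)\<close> of distinguished vertices is encoded as the network
  with root \<open>a\<close> in which \<open>b\<close> is the only vertex with mark \<open>True\<close>. An isomorphism
  of such networks is the same as an isomorphism of graphs that respects both vertices.
\<close>

definition birooted_space :: "bool network measure" where
  "birooted_space = restrict_space borel
    {X. \<exists>!v. v \<in> verts (rep_network X) \<and> mark (rep_network X) v}"

definition birooted :: "'m rnet \<Rightarrow> nat \<Rightarrow> nat \<Rightarrow> bool network" where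
  "birooted R a b = abs_network (RNet (verts R) (edges R) a (\<lambda>v. v = b))"

definition unimodular :: "rooted_graph measure \<Rightarrow> bool" where
  "unimodular \<mu> \<longleftrightarrow> (\<forall>f \<in> borel_measurable birooted_space.
     (\<integral>\<^sup>+X. (let R = rep_network X in \<integral>\<^sup>+x. f (birooted R (rt R) x) \<partial>count_space (verts R)) \<partial>\<mu>)
   = (\<integral>\<^sup>+X. (let R = rep_network X in \<integral>\<^sup>+x. f (birooted R x (rt R)) \<partial>count_space (verts R)) \<partial>\<mu>
      :: ennreal))"

definition root_degree :: "'m network \<Rightarrow> nat" where
  "root_degree X = (let R = rep_network X in card (nbrs (edges R) (rt R)))"

definition U_set :: "rooted_graph measure set" where
  "U_set = {\<mu>. sets \<mu> = sets borel \<and> prob_space \<mu> \<and> unimodular \<mu>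
     \<and> (\<integral>\<^sup>+X. ennreal (real (root_degree X)) \<partial>\<mu>) < \<infinity>}"

definition U_star :: "rooted_graph measure set" where
  "U_star = {\<mu> \<in> U_set. emeasure \<mu> trees = 1}"


section \<open>Ising measures\<close>

datatype spin = Down | Up

definition spin_val :: "spin \<Rightarrow> real" where
  "spin_val s = (case s of Down \<Rightarrow> -1 | Up \<Rightarrow> 1)"

definition spin_space :: "nat set \<Rightarrow> (nat \<Rightarrow> spin) measure" where
  "spin_space V = PiM V (\<lambda>_. count_space UNIV)"

definition ising_weight :: "nat set \<Rightarrow> nat set set \<Rightarrow> real \<Rightarrow> real \<Rightarrow> (nat \<Rightarrow> spin) \<Rightarrow> real" where
  "ising_weight V E \<beta> B x =
    exp (\<beta> * (\<Sum>e\<in>E. \<Prod>v\<in>e. spin_val (x v)) + B * (\<Sum>v\<in>V. spin_val (x v)))"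

definition gibbs :: "'a measure \<Rightarrow> 'a set \<Rightarrow> ('a \<Rightarrow> real) \<Rightarrow> 'a measure" where
  "gibbs M S w = distr (point_measure S (\<lambda>x. ennreal (w x / (\<Sum>y\<in>S. w y)))) M (\<lambda>x. x)"

definition ising :: "nat set set \<Rightarrow> nat \<Rightarrow> real \<Rightarrow> (nat \<Rightarrow> spin) measure" where
  "ising E n \<beta> = gibbs (spin_space {1..n}) (space (spin_space {1..n})) (ising_weight {1..n} E \<beta> 0)"

text \<open>
  The finite-volume measure on \<open>T(t)\<close> with boundary spin \<open>s\<close>, regarded as a measure on the
  configurations of the whole tree by giving the vertices outside \<open>T(t)\<close> the spin \<open>s\<close> too.
  Thus all spins outside \<open>T(t - 1)\<close>, i.e. at distance at least \<open>t\<close> from the root, equal \<open>s\<close>.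
\<close>

definition ising_bc :: "'m rnet \<Rightarrow> spin \<Rightarrow> real \<Rightarrow> real \<Rightarrow> nat \<Rightarrow> (nat \<Rightarrow> spin) measure" where
  "ising_bc T s \<beta> B t =
    (let W = gball (edges T) (rt T) t in
     gibbs (spin_space (verts T))
       {x \<in> space (spin_space (verts T)).
          \<forall>v\<in>verts T. \<not> gdist (edges T) (rt T) v < enat t \<longrightarrow> x v = s}
       (ising_weight W (induced (edges T) W) \<beta> B))"

definition ising_limit :: "'m rnet \<Rightarrow> spin \<Rightarrow> real \<Rightarrow> real \<Rightarrow> (nat \<Rightarrow> spin) measure" where
  "ising_limit T s \<beta> B = (THE \<nu>. sets \<nu> = sets (spin_space (verts T)) \<and> prob_space \<nu>
     \<and> weak_conv_on (product_topology (\<lambda>_. discrete_topology UNIV) (verts T)) (ising_bc T s \<beta> B) \<nu>)"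

text \<open>
  The integral is over \<^term>\<open>trees\<close>, a set of full measure for \<^term>\<open>\<mu> \<in> U_star\<close>,
  because \<^const>\<open>ising_limit\<close> is meaningful for trees only.
\<close>

definition U_fun :: "rooted_graph measure \<Rightarrow> real \<Rightarrow> real \<Rightarrow> real" where
  "U_fun \<mu> \<beta> B = 1 / 2 * (LINT X:trees|\<mu>. (let T = rep_network X in
     \<Sum>i\<in>nbrs (edges T) (rt T).
       \<integral>x. spin_val (x (rt T)) * spin_val (x i) \<partial>ising_limit T Up \<beta> B))"


section \<open>Local weak convergence of measures\<close>

text \<open>The networks all of whose vertices are within distance \<open>t\<close> of the root.\<close>

definition trunc_space :: "nat \<Rightarrow> 'm network set" where
  "trunc_space t = {X. trunc t X = X}"

definition trunc_law :: "nat \<Rightarrow> 'm network measure \<Rightarrow> 'm network measure" where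
  "trunc_law t \<nu> = distr \<nu> (count_space (trunc_space t)) (trunc t)"

definition local_law :: "nat set set \<Rightarrow> (nat \<Rightarrow> 'm) measure \<Rightarrow> nat \<Rightarrow> nat \<Rightarrow> 'm network measure" where
  "local_law E \<zeta> t i = distr \<zeta> (count_space (trunc_space t)) (sub_network E (gball E i t) i)"

text \<open>
  On sets of probability measures we use the sigma-algebra \<^const>\<open>prob_algebra\<close>, which for a
  separable metric base space is the Borel sigma-algebra of the weak topology. A measure on
  \<open>P(X)\<close> is a measure on \<open>prob_algebra X\<close>.
\<close>

definition measures_loc_weak_conv ::
  "(nat \<Rightarrow> nat set set) \<Rightarrow> (nat \<Rightarrow> (nat \<Rightarrow> 'm) measure) \<Rightarrow> 'm network measure measure \<Rightarrow> bool" where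
  "measures_loc_weak_conv E \<zeta> M \<longleftrightarrow>
    (\<forall>t. weak_conv_on (weak_topology (discrete_topology (trunc_space t)))
      (\<lambda>n. distr (measure_pmf (pmf_of_set {1..n})) (prob_algebra (count_space (trunc_space t)))
             (local_law (E n) (\<zeta> n) t))
      (distr M (prob_algebra (count_space (trunc_space t))) (trunc_law t)))"

definition equal_mixture :: "'a measure \<Rightarrow> 'a measure \<Rightarrow> 'a measure" where
  "equal_mixture M N =
    measure_of (space M) (sets M) (\<lambda>A. (1 / 2) * emeasure M A + (1 / 2) * emeasure N A)"

text \<open>The measure \<open>\<delta>\<^sub>G \<otimes> \<nu>\<close>.\<close>

definition marked_law :: "'m rnet \<Rightarrow> (nat \<Rightarrow> 'n) measure \<Rightarrow> 'n network measure" where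
  "marked_law G \<nu> = distr \<nu> borel (\<lambda>x. abs_network (RNet (verts G) (edges G) (rt G) x))"

definition phi :: "real \<Rightarrow> rooted_graph \<Rightarrow> spin network measure" where
  "phi \<beta> X = (let T = rep_network X in
     marked_law T (equal_mixture (ising_limit T Up \<beta> 0) (ising_limit T Down \<beta> 0)))"

text \<open>
  The image of \<open>\<mu>\<close> under \<^const>\<open>phi\<close>, whose domain is the set of rooted trees.
\<close>

definition limit_law :: "rooted_graph measure \<Rightarrow> real \<Rightarrow> spin network measure measure" where
  "limit_law \<mu> \<beta> = distr (restrict_space \<mu> trees) (prob_algebra borel) (phi \<beta>)"

end

theory Submission
  imports Defs
begin

text \<open>
  Let \<open>D\<close> be the deficit at a vertex: the sum, over its edges, of the correlation under the plus boundary
  condition at distance \<open>d\<close> minus the correlation under the Ising measure of the whole graph. By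
  Griffiths' inequalities \<open>D\<close> is nonnegative. The proof shows that the mean of \<open>D\<close> over the vertices of
  \<open>G\<^sub>n\<close> is small, and that \<open>D\<close> controls all the correlations that matter.

  The mean deficit is small (\<open>energy_deficit\<close>). The plus correlations in a ball are a local function of
  the graph, so by local weak convergence and uniform sparsity their average tends to a number that
  is close to \<open>2 U(\<beta>)\<close> for large \<open>d\<close>. In the other direction, the logarithm of the partition function is
  convex in \<open>\<beta>\<close> and changes by at most \<open>n B\<close> when a field \<open>B\<close> is added. So the true energy at \<open>\<beta>\<close> is
  not much smaller than the energy at some \<open>b < \<beta>\<close> with a small field \<open>B > 0\<close>
  (\<open>energy_lower_bound\<close>). In a positive field the energy is local: the effect of a boundary on an edge
  is bounded by its effect on the two magnetizations (\<open>edge_vs_magnetization\<close>), and on a tree the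
  magnetizations for plus and free boundary conditions have the same limit, because the recursion for
  the effective fields is concave (\<open>plus_free_gap\<close>). Hence the energy density at \<open>\<beta>\<close> is, up to a small
  error, at least \<open>U(b)\<close>, and continuity at \<open>\<beta>\<close> closes the gap.

  The deficits control the even correlations (\<open>even_correlations\<close>). Around a vertex whose neighbourhood
  is a tree, every boundary condition at distance \<open>t + k\<close> acts on the ball of radius \<open>t\<close> through fields
  on its last level. Writing the change of a correlation as a sum over the overlap of two replicas
  shows that the change of any even correlation is at most a constant times the sum of the changes of
  the edge correlations, with a constant that depends only on \<open>\<beta>\<close> and the size of the ball.

  Without an external field the Ising measure is invariant under a global flip, so the law of the marked
  ball of radius \<open>t\<close> is a combination of even correlations. Consequently it is close to the law for the
  equal mixture of plus and minus boundary conditions at distance \<open>t + k\<close>, except near few vertices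
  (\<open>ball_mass_comparison\<close>). The latter law is again a local function of the graph. Its averages converge
  by local weak convergence, and as \<open>k\<close> grows the limit tends to the one given by the mixture of the
  two infinite-volume measures (\<open>limit_law_integral\<close>).
\<close>

section \<open>Finite spin systems\<close>

definition chi :: "nat set \<Rightarrow> (nat \<Rightarrow> spin) \<Rightarrow> real" where
  "chi A x = (\<Prod>v\<in>A. spin_val (x v))"

definition cfg :: "nat set \<Rightarrow> (nat \<Rightarrow> spin) \<Rightarrow> (nat \<Rightarrow> spin) set" where
  "cfg L \<xi> = {x. \<forall>v. v \<notin> L \<longrightarrow> x v = \<xi> v}"

definition gsum :: "nat set \<Rightarrow> (nat \<Rightarrow> spin) \<Rightarrow> ((nat \<Rightarrow> spin) \<Rightarrow> real) \<Rightarrow> ((nat \<Rightarrow> spin) \<Rightarrow> real) \<Rightarrow> real" where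
  "gsum L \<xi> H f = (\<Sum>x\<in>cfg L \<xi>. exp (H x) * f x)"

text \<open>
  \<open>gsum L \<xi> H f\<close> is the unnormalized and \<open>gex L \<xi> H f\<close> the normalized Gibbs average of \<open>f\<close>,
  with Hamiltonian \<open>H\<close>, over the configurations that agree with \<open>\<xi>\<close> outside \<open>L\<close>.
\<close>

definition gex :: "nat set \<Rightarrow> (nat \<Rightarrow> spin) \<Rightarrow> ((nat \<Rightarrow> spin) \<Rightarrow> real) \<Rightarrow> ((nat \<Rightarrow> spin) \<Rightarrow> real) \<Rightarrow> real" where
  "gex L \<xi> H f = gsum L \<xi> H f / gsum L \<xi> H (\<lambda>_. 1)"

abbreviation all_up :: "nat \<Rightarrow> spin" where "all_up \<equiv> \<lambda>_. Up"

lemma spin_val_simps [simp]: "spin_val Up = 1" "spin_val Down = -1"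
  by (auto simp: spin_val_def)

lemma spin_val_sq [simp]: "spin_val s * spin_val s = 1" by (cases s) auto

lemma abs_spin_val [simp]: "\<bar>spin_val s\<bar> = 1" by (cases s) auto

lemma UNIV_spin: "(UNIV :: spin set) = {Up, Down}"
  by (metis (full_types) UNIV_eq_I insertCI spin.exhaust)

instance spin :: finite
  by standard (simp add: UNIV_spin)

lemma abs_chi [simp]: "\<bar>chi A x\<bar> = 1"
  by (simp add: chi_def abs_prod)

lemma chi_le_1: "chi A x \<le> 1"
  using abs_chi[of A x] by linarith+

lemma chi_cases: "chi A x = 1 \<or> chi A x = -1"
  using abs_chi[of A x] by linarith

lemma chi_sq [simp]: "chi A x * chi A x = 1"
  using chi_cases[of A x] by auto

lemma chi_empty [simp]: "chi {} x = 1" by (simp add: chi_def)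

lemma chi_single [simp]: "chi {v} x = spin_val (x v)" by (simp add: chi_def)

lemma chi_pair: "u \<noteq> v \<Longrightarrow> chi {u, v} x = spin_val (x u) * spin_val (x v)" by (simp add: chi_def)

lemma chi_up [simp]: "chi A all_up = 1" by (simp add: chi_def)

lemma chi_Un: "finite A \<Longrightarrow> finite B \<Longrightarrow> A \<inter> B = {} \<Longrightarrow> chi (A \<union> B) x = chi A x * chi B x"
  by (simp add: chi_def prod.union_disjoint)

lemma chi_cong: "(\<And>v. v \<in> A \<Longrightarrow> x v = y v) \<Longrightarrow> chi A x = chi A y"
  by (simp add: chi_def)

lemma chi_sym_diff:
  assumes "finite A" "finite B" shows "chi A x * chi B x = chi (sym_diff A B) x"
proof -
  have A: "chi A x = chi (A - B) x * chi (A \<inter> B) x"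
    using assms by (subst chi_Un[symmetric]) (auto intro!: arg_cong[of _ _ "\<lambda>A. chi A x"])
  have B: "chi B x = chi (B - A) x * chi (A \<inter> B) x"
    using assms by (subst chi_Un[symmetric]) (auto intro!: arg_cong[of _ _ "\<lambda>A. chi A x"])
  have "chi (sym_diff A B) x = chi (A - B) x * chi (B - A) x"
    using assms by (subst chi_Un) auto
  then show ?thesis unfolding A B using chi_sq[of "A \<inter> B" x] by (simp add: algebra_simps)
qed

lemma chi_split: "finite A \<Longrightarrow> chi A x = chi (A \<inter> L) x * chi (A - L) x"
  by (subst chi_Un[symmetric]) (auto intro!: arg_cong[of _ _ "\<lambda>A. chi A x"])

lemma cfg_empty [simp]: "cfg {} \<xi> = {\<xi>}" by (auto simp: cfg_def)

lemma cfg_self [simp]: "\<xi> \<in> cfg L \<xi>" by (simp add: cfg_def)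

lemma cfg_off: "x \<in> cfg L \<xi> \<Longrightarrow> v \<notin> L \<Longrightarrow> x v = \<xi> v" by (simp add: cfg_def)

lemma cfg_insert:
  assumes "c \<notin> L"
  shows "cfg (insert c L) \<xi> = (\<lambda>x. x(c := Up)) ` cfg L \<xi> \<union> (\<lambda>x. x(c := Down)) ` cfg L \<xi>"
proof (intro equalityI subsetI)
  fix x assume x: "x \<in> cfg (insert c L) \<xi>"
  then have "x(c := \<xi> c) \<in> cfg L \<xi>" by (auto simp: cfg_def)
  moreover have "x = (x(c := \<xi> c))(c := x c)" by simp
  ultimately show "x \<in> (\<lambda>x. x(c := Up)) ` cfg L \<xi> \<union> (\<lambda>x. x(c := Down)) ` cfg L \<xi>"
    by (cases "x c") (metis UnI2 image_eqI, metis UnI1 image_eqI)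
qed (auto simp: cfg_def)

lemma finite_cfg [simp]: "finite L \<Longrightarrow> finite (cfg L \<xi>)"
  by (induction L rule: finite_induct) (simp_all add: cfg_insert)

lemma sum_cfg_insert:
  fixes g :: "(nat \<Rightarrow> spin) \<Rightarrow> real"
  assumes "finite L" "c \<notin> L"
  shows "(\<Sum>x\<in>cfg (insert c L) \<xi>. g x) = (\<Sum>x\<in>cfg L \<xi>. g (x(c := Up)) + g (x(c := Down)))"
proof -
  have inj: "inj_on (\<lambda>x. x(c := s)) (cfg L \<xi>)" for s
  proof (rule inj_onI)
    fix x y assume *: "x \<in> cfg L \<xi>" "y \<in> cfg L \<xi>" "x(c := s) = y(c := s)"
    have "x c = y c" using *(1,2) assms by (simp add: cfg_off)
    then show "x = y" using *(3) by (metis fun_upd_triv fun_upd_upd)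
  qed
  have disj: "(\<lambda>x. x(c := Up)) ` cfg L \<xi> \<inter> (\<lambda>x. x(c := Down)) ` cfg L \<xi> = {}"
    by (auto dest!: fun_cong[of _ _ c])
  show ?thesis unfolding cfg_insert[OF assms(2)]
    using assms(1) disj by (simp add: sum.union_disjoint sum.reindex[OF inj] sum.distrib)
qed

lemma sum_cfg_Un:
  fixes g :: "(nat \<Rightarrow> spin) \<Rightarrow> real"
  assumes "finite L" "finite M" "L \<inter> M = {}"
  shows "(\<Sum>x\<in>cfg (L \<union> M) \<xi>. g x) = (\<Sum>y\<in>cfg M \<xi>. \<Sum>x\<in>cfg L y. g x)"
proof -
  have eq: "cfg (L \<union> M) \<xi> = (\<Union>y\<in>cfg M \<xi>. cfg L y)"
  proof (intro equalityI subsetI)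
    fix x assume x: "x \<in> cfg (L \<union> M) \<xi>"
    let ?y = "\<lambda>v. if v \<in> M then x v else \<xi> v"
    have "?y \<in> cfg M \<xi>" "x \<in> cfg L ?y" using x by (auto simp: cfg_def)
    then show "x \<in> (\<Union>y\<in>cfg M \<xi>. cfg L y)" by blast
  qed (use assms in \<open>auto simp: cfg_def\<close>)
  have "cfg L y \<inter> cfg L y' = {}" if y: "y \<in> cfg M \<xi>" "y' \<in> cfg M \<xi>" "y \<noteq> y'" for y y'
  proof -
    obtain v where v: "y v \<noteq> y' v" using y(3) by blast
    have "v \<in> M"
    proof (rule ccontr)
      assume "v \<notin> M"
      then show False using v y(1,2) by (simp add: cfg_def)
    qed
    then have "v \<notin> L" using assms by blast
    then show ?thesis using v by (auto simp: cfg_def)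
  qed
  then show ?thesis unfolding eq using assms by (intro sum.UNION_disjoint) auto
qed

lemma sum_cfg_indep:
  fixes g :: "(nat \<Rightarrow> spin) \<Rightarrow> real"
  assumes "finite L" "\<And>x y. (\<And>v. v \<in> L \<Longrightarrow> x v = y v) \<Longrightarrow> g x = g y"
  shows "(\<Sum>x\<in>cfg L \<xi>. g x) = (\<Sum>x\<in>cfg L \<eta>. g x)"
  by (rule sum.reindex_bij_witness[of _ "\<lambda>x v. if v \<in> L then x v else \<xi> v" "\<lambda>x v. if v \<in> L then x v else \<eta> v"])
     (simp_all add: cfg_def fun_eq_iff, rule assms(2), simp)

lemma card_cfg: "finite L \<Longrightarrow> card (cfg L \<xi>) = 2 ^ card L"
proof (induction L arbitrary: \<xi> rule: finite_induct)
  case (insert c L)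
  have "real (card (cfg (insert c L) \<xi>)) = (\<Sum>x\<in>cfg (insert c L) \<xi>. 1)" by simp
  also have "\<dots> = 2 * real (card (cfg L \<xi>))"
    using insert.hyps by (subst sum_cfg_insert) auto
  also have "\<dots> = real (2 ^ card (insert c L))" using insert by simp
  finally show ?case by (metis of_nat_eq_iff)
qed simp

subsection \<open>Gibbs averages\<close>

lemma gsum_1_pos: assumes "finite L" shows "gsum L \<xi> H (\<lambda>_. 1) > 0"
proof -
  have "cfg L \<xi> \<noteq> {}" using cfg_self[of \<xi> L] by blast
  then show ?thesis unfolding gsum_def using finite_cfg[OF assms] by (intro sum_pos) simp_all
qed

lemma gsum_mult_gex: "finite L \<Longrightarrow> gsum L \<xi> H f = gex L \<xi> H f * gsum L \<xi> H (\<lambda>_. 1)"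
  using gsum_1_pos[of L \<xi> H] by (simp add: gex_def)

lemma gex_const: "finite L \<Longrightarrow> gex L \<xi> H (\<lambda>_. c) = c"
  using gsum_1_pos[of L \<xi> H] by (simp add: gex_def gsum_def sum_distrib_right[symmetric])

lemma gex_cong:
  "(\<And>x. x \<in> cfg L \<xi> \<Longrightarrow> f x = g x) \<Longrightarrow> gex L \<xi> H f = gex L \<xi> H g"
  by (simp add: gex_def gsum_def)

lemma gex_add: "gex L \<xi> H (\<lambda>x. f x + g x) = gex L \<xi> H f + gex L \<xi> H g"
  by (simp add: gex_def gsum_def distrib_left sum.distrib add_divide_distrib)

lemma gex_cmult: "gex L \<xi> H (\<lambda>x. c * f x) = c * gex L \<xi> H f"
  by (simp add: gex_def gsum_def sum_distrib_left algebra_simps)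

lemma gex_diff: "gex L \<xi> H (\<lambda>x. f x - g x) = gex L \<xi> H f - gex L \<xi> H g"
  by (simp add: gex_def gsum_def right_diff_distrib sum_subtractf diff_divide_distrib)

lemma gex_sum: "gex L \<xi> H (\<lambda>x. \<Sum>i\<in>I. f i x) = (\<Sum>i\<in>I. gex L \<xi> H (f i))"
  unfolding gex_def gsum_def by (simp add: sum_distrib_left sum_divide_distrib) (rule sum.swap)

lemma gex_mono:
  assumes "finite L" "\<And>x. x \<in> cfg L \<xi> \<Longrightarrow> f x \<le> g x"
  shows "gex L \<xi> H f \<le> gex L \<xi> H g"
  unfolding gex_def gsum_def using gsum_1_pos[OF assms(1), of \<xi> H] assms
  by (intro divide_right_mono sum_mono mult_left_mono) (auto simp: gsum_def)

lemma gex_abs_le: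
  assumes "finite L" "\<And>x. x \<in> cfg L \<xi> \<Longrightarrow> \<bar>f x\<bar> \<le> c" shows "\<bar>gex L \<xi> H f\<bar> \<le> c"
proof -
  have "gex L \<xi> H f \<le> gex L \<xi> H (\<lambda>_. c)" "gex L \<xi> H (\<lambda>_. -c) \<le> gex L \<xi> H f"
    using assms by (intro gex_mono; force simp: abs_le_iff)+
  then show ?thesis using assms(1) by (simp add: gex_const)
qed

lemma gex_shift:
  assumes "\<And>x. x \<in> cfg L \<xi> \<Longrightarrow> H x = H' x + c"
  shows "gex L \<xi> H f = gex L \<xi> H' f"
proof -
  have "gsum L \<xi> H g = exp c * gsum L \<xi> H' g" for g
    unfolding gsum_def sum_distrib_left by (rule sum.cong) (auto simp: assms exp_add)
  then show ?thesis by (simp add: gex_def)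
qed

text \<open>The consistency (DLR) property of finite-volume Gibbs averages.\<close>

lemma gex_tower:
  assumes "finite L" "finite M" "L \<subseteq> M"
  obtains p where "\<And>y. y \<in> cfg (M - L) \<xi> \<Longrightarrow> 0 \<le> p y" "(\<Sum>y\<in>cfg (M - L) \<xi>. p y) = 1"
    "\<And>f. gex M \<xi> H f = (\<Sum>y\<in>cfg (M - L) \<xi>. p y * gex L y H f)"
proof
  let ?Z = "gsum M \<xi> H (\<lambda>_. 1)"
  let ?p = "\<lambda>y. gsum L y H (\<lambda>_. 1) / ?Z"
  have Z: "?Z > 0" using assms by (intro gsum_1_pos)
  show "0 \<le> ?p y" for y using gsum_1_pos[OF assms(1), of y H] Z by simp
  have M: "M = L \<union> (M - L)" using assms by blast
  have eq: "gsum M \<xi> H f = (\<Sum>y\<in>cfg (M - L) \<xi>. gsum L y H f)" for f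
    unfolding gsum_def by (subst M, subst sum_cfg_Un) (use assms in auto)
  show "(\<Sum>y\<in>cfg (M - L) \<xi>. ?p y) = 1"
    unfolding sum_divide_distrib[symmetric] eq[of "\<lambda>_. 1", symmetric] using Z by simp
  show "gex M \<xi> H f = (\<Sum>y\<in>cfg (M - L) \<xi>. ?p y * gex L y H f)" for f
    unfolding gex_def[of M] eq[of f] sum_divide_distrib
  proof (rule sum.cong[OF refl])
    fix y
    show "gsum L y H f / ?Z = gsum L y H (\<lambda>_. 1) / ?Z * gex L y H f"
      by (subst gsum_mult_gex[OF assms(1), of y H f]) simp
  qed
qed

lemma gex_restrict:
  assumes "finite M" "L \<subseteq> M"
    and "\<And>x y. (\<And>v. v \<in> L \<Longrightarrow> x v = y v) \<Longrightarrow> H x = H y"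
    and "\<And>x y. (\<And>v. v \<in> L \<Longrightarrow> x v = y v) \<Longrightarrow> f x = f y"
  shows "gex M \<xi> H f = gex L \<eta> H f"
proof -
  have L: "finite L" using assms finite_subset by blast
  obtain p where p: "\<And>y. y \<in> cfg (M - L) \<xi> \<Longrightarrow> 0 \<le> p y" "(\<Sum>y\<in>cfg (M - L) \<xi>. p y) = 1"
    "\<And>f. gex M \<xi> H f = (\<Sum>y\<in>cfg (M - L) \<xi>. p y * gex L y H f)"
    using gex_tower[OF L assms(1,2)] by metis
  have "gsum L y H g = gsum L \<eta> H g"
    if g: "\<And>x y. (\<And>v. v \<in> L \<Longrightarrow> x v = y v) \<Longrightarrow> g x = g y" for g y
    unfolding gsum_def
  proof (rule sum_cfg_indep[OF L])
    fix x z :: "nat \<Rightarrow> spin" assume xz: "\<And>v. v \<in> L \<Longrightarrow> x v = z v"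
    show "exp (H x) * g x = exp (H z) * g z" using assms(3)[OF xz] g[OF xz] by simp
  qed
  note indep = this
  have "gex L y H f = gex L \<eta> H f" for y
    unfolding gex_def by (rule arg_cong2[of _ _ _ _ "(/)"]) (rule indep, rule assms(4) refl, assumption?)+
  then have "gex M \<xi> H f = (\<Sum>y\<in>cfg (M - L) \<xi>. p y) * gex L \<eta> H f"
    unfolding p(3) sum_distrib_right by (intro sum.cong refl) simp
  then show ?thesis by (simp add: p(2))
qed

text \<open>Jensen's inequality for the exponential: the slope of the log-partition function.\<close>

lemma ln_gsum_ge:
  assumes "finite L"
  shows "gex L \<xi> H g \<le> ln (gsum L \<xi> (\<lambda>x. H x + g x) (\<lambda>_. 1)) - ln (gsum L \<xi> H (\<lambda>_. 1))"
proof -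
  let ?Z = "gsum L \<xi> H (\<lambda>_. 1)" and ?Z' = "gsum L \<xi> (\<lambda>x. H x + g x) (\<lambda>_. 1)"
  let ?m = "gex L \<xi> H g"
  have Z: "?Z > 0" "?Z' > 0" using gsum_1_pos[OF assms] by auto
  have "exp ?m = gex L \<xi> H (\<lambda>x. exp ?m * (1 + (g x - ?m)))"
    using gex_cmult[of L \<xi> H "exp ?m" "\<lambda>x. 1 + (g x - ?m)"]
    by (simp only: gex_add gex_diff gex_const[OF assms]) simp
  also have "\<dots> \<le> gex L \<xi> H (\<lambda>x. exp (g x))"
  proof (rule gex_mono[OF assms])
    fix x
    have "exp ?m * (1 + (g x - ?m)) \<le> exp ?m * exp (g x - ?m)"
      by (intro mult_left_mono exp_ge_add_one_self) simp
    then show "exp ?m * (1 + (g x - ?m)) \<le> exp (g x)" by (simp add: exp_diff)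
  qed
  also have "\<dots> = ?Z' / ?Z" by (simp add: gex_def gsum_def exp_add)
  finally have "?m \<le> ln (?Z' / ?Z)" using Z by (simp add: ln_ge_iff)
  then show ?thesis using Z by (simp add: ln_div)
qed

subsection \<open>Griffiths and Ginibre inequalities\<close>

lemma sum_chi_zero:
  assumes "finite L" "C \<subseteq> L" "C \<noteq> {}"
  shows "(\<Sum>x\<in>cfg L \<xi>. chi C x) = 0"
proof -
  obtain v where v: "v \<in> C" using assms by blast
  have L: "L = insert v (L - {v})" using v assms by blast
  have "finite C" using assms finite_subset by blast
  then have z: "chi C (x(v := Up)) + chi C (x(v := Down)) = 0" for x
    using v by (simp add: chi_def prod.remove[of C v])
  have "(\<Sum>x\<in>cfg (insert v (L - {v})) \<xi>. chi C x) = (\<Sum>x\<in>cfg (L - {v}) \<xi>. 0)"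
    using assms(1) by (subst sum_cfg_insert) (simp_all add: z)
  then show ?thesis using L by simp
qed

lemma sum_chi_nonneg: "finite L \<Longrightarrow> C \<subseteq> L \<Longrightarrow> 0 \<le> (\<Sum>x\<in>cfg L \<xi>. chi C x)"
  using sum_chi_zero[of L C \<xi>] by (cases "C = {}") auto

lemma exp_chi: "exp (c * chi A x) = cosh c + sinh c * chi A x"
  using chi_cases[of A x] by (auto simp: cosh_plus_sinh cosh_minus_sinh)

text \<open>
  The first Griffiths inequality: after the expansion \<open>exp (c \<chi>) = cosh c + \<chi> sinh c\<close>, every term
  is a nonnegative multiple of a sum of a spin product, which is zero or a power of two.
\<close>

lemma gks1:
  assumes "finite L" "finite K" "\<And>k. k \<in> K \<Longrightarrow> A k \<subseteq> L" "\<And>k. k \<in> K \<Longrightarrow> 0 \<le> c k" "C \<subseteq> L"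
  shows "0 \<le> (\<Sum>x\<in>cfg L \<xi>. chi C x * exp (\<Sum>k\<in>K. c k * chi (A k) x))"
  using assms(2-5)
proof (induction K arbitrary: C rule: finite_induct)
  case empty then show ?case using sum_chi_nonneg[OF assms(1)] by simp
next
  case (insert k K)
  have fin: "finite C" "finite (A k)" using insert.prems assms(1) finite_subset[OF _ assms(1)] by auto
  have "chi C x * exp (\<Sum>k\<in>insert k K. c k * chi (A k) x)
    = cosh (c k) * (chi C x * exp (\<Sum>k\<in>K. c k * chi (A k) x))
      + sinh (c k) * (chi (sym_diff C (A k)) x * exp (\<Sum>k\<in>K. c k * chi (A k) x))" for x
    unfolding sum.insert[OF insert.hyps] exp_add exp_chi chi_sym_diff[OF fin, symmetric]
    by (simp add: distrib_left distrib_right mult.assoc mult.left_commute)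
  then have "(\<Sum>x\<in>cfg L \<xi>. chi C x * exp (\<Sum>k\<in>insert k K. c k * chi (A k) x))
    = cosh (c k) * (\<Sum>x\<in>cfg L \<xi>. chi C x * exp (\<Sum>k\<in>K. c k * chi (A k) x))
      + sinh (c k) * (\<Sum>x\<in>cfg L \<xi>. chi (sym_diff C (A k)) x * exp (\<Sum>k\<in>K. c k * chi (A k) x))"
    by (simp add: sum.distrib sum_distrib_left)
  also have "\<dots> \<ge> 0"
  proof (intro add_nonneg_nonneg mult_nonneg_nonneg)
    show "0 \<le> sinh (c k)" using insert.prems by simp
    show "0 \<le> (\<Sum>x\<in>cfg L \<xi>. chi (sym_diff C (A k)) x * exp (\<Sum>k\<in>K. c k * chi (A k) x))"
      by (rule insert.IH) (use insert.prems in auto)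
  qed (use insert in auto)
  finally show ?case .
qed

text \<open>
  Dropping the interactions in \<open>K\<close> and keeping, of each interaction in \<open>K'\<close>, only the term
  linear in its spin product decreases the sum.
\<close>

lemma gks1_lower:
  assumes "finite L" "finite K" "finite K'" "\<And>k. k \<in> K \<union> K' \<Longrightarrow> A k \<subseteq> L"
    "\<And>k. k \<in> K \<union> K' \<Longrightarrow> 0 \<le> c k" "C \<subseteq> L" "K \<inter> K' = {}"
    and one: "\<And>x. chi C x * (\<Prod>k\<in>K'. chi (A k) x) = 1"
  shows "2 ^ card L * (\<Prod>k\<in>K'. sinh (c k)) \<le> (\<Sum>x\<in>cfg L \<xi>. chi C x * exp (\<Sum>k\<in>K \<union> K'. c k * chi (A k) x))"
proof -
  have main: "(\<Prod>k\<in>K'. sinh (c k)) * (\<Sum>x\<in>cfg L \<xi>. chi D x * (\<Prod>k\<in>K'. chi (A k) x) * exp (\<Sum>k\<in>K. c k * chi (A k) x))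
      \<le> (\<Sum>x\<in>cfg L \<xi>. chi D x * exp (\<Sum>k\<in>K \<union> K'. c k * chi (A k) x))"
    if "D \<subseteq> L" for D
    using assms(3,4,5,7) that
  proof (induction K' arbitrary: D rule: finite_induct)
    case (insert k K')
    let ?E = "\<lambda>x. exp (\<Sum>k\<in>K \<union> K'. c k * chi (A k) x)"
    have fin: "finite D" "finite (A k)" using insert.prems assms(1) finite_subset[OF _ assms(1)] by auto
    have kn: "k \<notin> K \<union> K'" using insert by auto
    have fK: "finite (K \<union> K')" using assms(2) insert.hyps by simp
    have "chi D x * exp (\<Sum>k\<in>K \<union> insert k K'. c k * chi (A k) x)
      = cosh (c k) * (chi D x * ?E x) + sinh (c k) * (chi (sym_diff D (A k)) x * ?E x)" for x
      unfolding Un_insert_right sum.insert[OF fK kn] exp_add exp_chi chi_sym_diff[OF fin, symmetric]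
      by (simp add: distrib_left distrib_right mult.assoc mult.left_commute)
    then have eq: "(\<Sum>x\<in>cfg L \<xi>. chi D x * exp (\<Sum>k\<in>K \<union> insert k K'. c k * chi (A k) x))
      = cosh (c k) * (\<Sum>x\<in>cfg L \<xi>. chi D x * ?E x)
        + sinh (c k) * (\<Sum>x\<in>cfg L \<xi>. chi (sym_diff D (A k)) x * ?E x)"
      by (simp add: sum.distrib sum_distrib_left)
    have 1: "0 \<le> (\<Sum>x\<in>cfg L \<xi>. chi D x * ?E x)"
      by (rule gks1) (use assms(1,2) insert in auto)
    have ih: "(\<Prod>k\<in>K'. sinh (c k)) * (\<Sum>x\<in>cfg L \<xi>. chi (sym_diff D (A k)) x * (\<Prod>k\<in>K'. chi (A k) x) * exp (\<Sum>k\<in>K. c k * chi (A k) x))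
      \<le> (\<Sum>x\<in>cfg L \<xi>. chi (sym_diff D (A k)) x * ?E x)"
      by (rule insert.IH) (use insert.prems in auto)
    have "(\<Prod>k\<in>insert k K'. sinh (c k)) * (\<Sum>x\<in>cfg L \<xi>. chi D x * (\<Prod>k\<in>insert k K'. chi (A k) x) * exp (\<Sum>k\<in>K. c k * chi (A k) x))
      = sinh (c k) * ((\<Prod>k\<in>K'. sinh (c k)) * (\<Sum>x\<in>cfg L \<xi>. chi (sym_diff D (A k)) x * (\<Prod>k\<in>K'. chi (A k) x) * exp (\<Sum>k\<in>K. c k * chi (A k) x)))"
      unfolding prod.insert[OF insert.hyps(1,2)] chi_sym_diff[OF fin, symmetric]
      by (simp add: mult.assoc)
    also have "\<dots> \<le> sinh (c k) * (\<Sum>x\<in>cfg L \<xi>. chi (sym_diff D (A k)) x * ?E x)"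
      by (rule mult_left_mono[OF ih]) (use insert.prems in auto)
    also have "\<dots> \<le> (\<Sum>x\<in>cfg L \<xi>. chi D x * exp (\<Sum>k\<in>K \<union> insert k K'. c k * chi (A k) x))"
      unfolding eq using 1 by simp
    finally show ?case .
  qed simp
  have "1 * 2 ^ card L \<le> (\<Sum>x\<in>cfg L \<xi>. exp (\<Sum>k\<in>K. c k * chi (A k) x))"
    using assms(1,2)
  proof -
    have "(\<Sum>x\<in>cfg L \<xi>. 1 + (\<Sum>k\<in>K. c k * chi (A k) x)) \<le> (\<Sum>x\<in>cfg L \<xi>. exp (\<Sum>k\<in>K. c k * chi (A k) x))"
      by (intro sum_mono exp_ge_add_one_self)
    moreover have "(\<Sum>x\<in>cfg L \<xi>. 1 + (\<Sum>k\<in>K. c k * chi (A k) x))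
      = 2 ^ card L + (\<Sum>k\<in>K. c k * (\<Sum>x\<in>cfg L \<xi>. chi (A k) x))"
      using assms(1) by (simp add: sum.distrib card_cfg sum_distrib_left sum.swap[of _ K])
    moreover have "0 \<le> (\<Sum>k\<in>K. c k * (\<Sum>x\<in>cfg L \<xi>. chi (A k) x))"
      by (intro sum_nonneg mult_nonneg_nonneg sum_chi_nonneg) (use assms in auto)
    ultimately show ?thesis by linarith
  qed
  then have "(\<Prod>k\<in>K'. sinh (c k)) * 2 ^ card L \<le> (\<Prod>k\<in>K'. sinh (c k)) * (\<Sum>x\<in>cfg L \<xi>. exp (\<Sum>k\<in>K. c k * chi (A k) x))"
    by (intro mult_left_mono prod_nonneg) (use assms(5) in auto)
  with main[OF assms(6)] show ?thesis unfolding one by (simp add: mult.commute)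
qed

definition smul :: "spin \<Rightarrow> spin \<Rightarrow> spin" where "smul s t = (if s = t then Up else Down)"

lemma spin_val_smul [simp]: "spin_val (smul s t) = spin_val s * spin_val t"
  by (cases s; cases t) (auto simp: smul_def)

lemma chi_smul: "chi A (\<lambda>v. smul (x v) (y v)) = chi A x * chi A y"
  by (simp add: chi_def prod.distrib)

text \<open>
  The change of variables \<open>x' = x \<tau>\<close> in a pair of replicas.
\<close>

lemma sum_replicas:
  fixes G :: "(nat \<Rightarrow> spin) \<Rightarrow> (nat \<Rightarrow> spin) \<Rightarrow> real"
  shows "(\<Sum>x\<in>cfg L all_up. \<Sum>y\<in>cfg L all_up. G x y)
    = (\<Sum>\<tau>\<in>cfg L all_up. \<Sum>x\<in>cfg L all_up. G x (\<lambda>v. smul (x v) (\<tau> v)))"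
proof -
  have "(\<Sum>y\<in>cfg L all_up. G x y) = (\<Sum>\<tau>\<in>cfg L all_up. G x (\<lambda>v. smul (x v) (\<tau> v)))"
    if "x \<in> cfg L all_up" for x
  proof -
    have inv: "(\<lambda>v. smul (x v) (smul (x v) (y v))) = y" for y
      by (rule ext) (metis (full_types) smul_def spin.exhaust)
    have mem: "(\<lambda>v. smul (x v) (y v)) \<in> cfg L all_up" if "y \<in> cfg L all_up" for y
      using that \<open>x \<in> cfg L all_up\<close> by (simp add: cfg_def smul_def)
    show ?thesis
      by (rule sum.reindex_bij_witness[of _ "\<lambda>\<tau> v. smul (x v) (\<tau> v)" "\<lambda>\<tau> v. smul (x v) (\<tau> v)"])
         (simp_all only: inv mem)
  qed
  then have "(\<Sum>x\<in>cfg L all_up. \<Sum>y\<in>cfg L all_up. G x y)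
    = (\<Sum>x\<in>cfg L all_up. \<Sum>\<tau>\<in>cfg L all_up. G x (\<lambda>v. smul (x v) (\<tau> v)))"
    by (rule sum.cong[OF refl])
  also have "\<dots> = (\<Sum>\<tau>\<in>cfg L all_up. \<Sum>x\<in>cfg L all_up. G x (\<lambda>v. smul (x v) (\<tau> v)))"
    by (rule sum.swap)
  finally show ?thesis .
qed

text \<open>The weight of the first replica for a given overlap \<open>\<tau>\<close>.\<close>

definition overlap_sum :: "nat set \<Rightarrow> 'k set \<Rightarrow> ('k \<Rightarrow> nat set) \<Rightarrow> ('k \<Rightarrow> real) \<Rightarrow> ('k \<Rightarrow> real) \<Rightarrow> nat set \<Rightarrow> (nat \<Rightarrow> spin) \<Rightarrow> real" where
  "overlap_sum L K A J J' C \<tau> =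
    (\<Sum>x\<in>cfg L all_up. chi C x * exp (\<Sum>k\<in>K. (J k + J' k * chi (A k) \<tau>) * chi (A k) x))"

text \<open>
  For independent replicas \<open>x\<close> and \<open>x \<tau>\<close> of two systems, the difference of two averages of \<open>chi C\<close> is
  the average of \<open>chi C x (1 - chi C \<tau>)\<close>. With the overlap \<open>\<tau>\<close> fixed, \<open>x\<close> is the spin
  configuration of a ferromagnet with the couplings \<open>J k + J' k * chi (A k) \<tau>\<close>.
\<close>

lemma replica_difference:
  fixes K :: "'k set" and J J' :: "'k \<Rightarrow> real" and A :: "'k \<Rightarrow> nat set"
  assumes "finite L"
  defines "H \<equiv> \<lambda>x. \<Sum>k\<in>K. J k * chi (A k) x" and "H' \<equiv> \<lambda>x. \<Sum>k\<in>K. J' k * chi (A k) x"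
  shows "(gex L all_up H (chi C) - gex L all_up H' (chi C))
      * (gsum L all_up H (\<lambda>_. 1) * gsum L all_up H' (\<lambda>_. 1))
    = (\<Sum>\<tau>\<in>cfg L all_up. (1 - chi C \<tau>) * overlap_sum L K A J J' C \<tau>)"
proof -
  let ?Z = "gsum L all_up H (\<lambda>_. 1)" and ?Z' = "gsum L all_up H' (\<lambda>_. 1)"
  have "(gex L all_up H (chi C) - gex L all_up H' (chi C)) * (?Z * ?Z')
    = gsum L all_up H (chi C) * ?Z' - ?Z * gsum L all_up H' (chi C)"
    using gsum_1_pos[OF assms(1), of all_up H] gsum_1_pos[OF assms(1), of all_up H']
    by (simp add: gex_def field_simps)
  also have "\<dots> = (\<Sum>x\<in>cfg L all_up. \<Sum>y\<in>cfg L all_up. exp (H x) * exp (H' y) * (chi C x - chi C y))"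
    unfolding gsum_def sum_product sum_subtractf[symmetric]
    by (intro sum.cong refl) (simp add: algebra_simps)
  also have "\<dots> = (\<Sum>\<tau>\<in>cfg L all_up. \<Sum>x\<in>cfg L all_up. (1 - chi C \<tau>) *
      (chi C x * exp (\<Sum>k\<in>K. (J k + J' k * chi (A k) \<tau>) * chi (A k) x)))"
  proof (subst sum_replicas, intro sum.cong refl)
    fix \<tau> x
    have "H x + H' (\<lambda>v. smul (x v) (\<tau> v)) = (\<Sum>k\<in>K. (J k + J' k * chi (A k) \<tau>) * chi (A k) x)"
      unfolding H_def H'_def chi_smul sum.distrib[symmetric] by (simp add: algebra_simps)
    then show "exp (H x) * exp (H' (\<lambda>v. smul (x v) (\<tau> v))) * (chi C x - chi C (\<lambda>v. smul (x v) (\<tau> v)))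
      = (1 - chi C \<tau>) * (chi C x * exp (\<Sum>k\<in>K. (J k + J' k * chi (A k) \<tau>) * chi (A k) x))"
      unfolding exp_add[symmetric] chi_smul by (simp add: right_diff_distrib left_diff_distrib mult_ac)
  qed
  finally show ?thesis by (simp add: overlap_sum_def sum_distrib_left)
qed

lemma overlap_sum_nonneg:
  assumes "finite L" "finite K" "\<And>k. k \<in> K \<Longrightarrow> A k \<subseteq> L" "\<And>k. k \<in> K \<Longrightarrow> \<bar>J' k\<bar> \<le> J k" "C \<subseteq> L"
  shows "0 \<le> overlap_sum L K A J J' C \<tau>"
  unfolding overlap_sum_def
proof (rule gks1[OF assms(1,2,3) _ assms(5)])
  fix k assume "k \<in> K"
  then have "\<bar>J' k\<bar> \<le> J k" by (rule assms)
  then have "0 \<le> J k + J' k" "0 \<le> J k - J' k" by linarith+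
  then show "0 \<le> J k + J' k * chi (A k) \<tau>" using chi_cases[of "A k" \<tau>]
    by (metis add_uminus_conv_diff mult.right_neutral mult_minus1_right)
qed

text \<open>
  Ginibre's form of the second Griffiths inequality: every summand of the replica representation is
  nonnegative, by the first Griffiths inequality for each overlap.
\<close>

theorem ginibre:
  fixes K :: "'k set" and J J' :: "'k \<Rightarrow> real"
  assumes "finite L" "finite K" "\<And>k. k \<in> K \<Longrightarrow> A k \<subseteq> L" "\<And>k. k \<in> K \<Longrightarrow> \<bar>J' k\<bar> \<le> J k" "C \<subseteq> L"
  shows "gex L all_up (\<lambda>x. \<Sum>k\<in>K. J' k * chi (A k) x) (chi C)
    \<le> gex L all_up (\<lambda>x. \<Sum>k\<in>K. J k * chi (A k) x) (chi C)"
proof -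
  let ?H = "\<lambda>(J::'k \<Rightarrow> real) x. \<Sum>k\<in>K. J k * chi (A k) x"
  have "0 \<le> (\<Sum>\<tau>\<in>cfg L all_up. (1 - chi C \<tau>) * overlap_sum L K A J J' C \<tau>)"
  proof (rule sum_nonneg)
    fix \<tau>
    have "0 \<le> overlap_sum L K A J J' C \<tau>" by (rule overlap_sum_nonneg[OF assms])
    then show "0 \<le> (1 - chi C \<tau>) * overlap_sum L K A J J' C \<tau>" by (simp add: chi_le_1)
  qed
  then have "0 \<le> (gex L all_up (?H J) (chi C) - gex L all_up (?H J') (chi C))
      * (gsum L all_up (?H J) (\<lambda>_. 1) * gsum L all_up (?H J') (\<lambda>_. 1))"
    unfolding replica_difference[OF assms(1), where J = J and A = A and K = K and J' = J' and C = C] .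
  moreover have "0 < gsum L all_up (?H J) (\<lambda>_. 1) * gsum L all_up (?H J') (\<lambda>_. 1)"
    using gsum_1_pos[OF assms(1)] by simp
  ultimately show ?thesis by (simp add: zero_le_mult_iff)
qed

subsection \<open>The Ising Hamiltonian\<close>

definition ham :: "nat set set \<Rightarrow> nat set \<Rightarrow> real \<Rightarrow> real \<Rightarrow> (nat \<Rightarrow> spin) \<Rightarrow> real" where
  "ham E V \<beta> B x = \<beta> * (\<Sum>e\<in>E. chi e x) + B * (\<Sum>v\<in>V. spin_val (x v))"

text \<open>
  Pinning the spins outside \<open>L\<close> to \<open>\<xi>\<close> turns the interaction of an edge into a coupling of its
  part inside \<open>L\<close>, whose sign depends on \<open>\<xi>\<close>. The spins outside \<open>L\<close> may then be set to plus.
\<close>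

definition pin_set :: "nat set \<Rightarrow> nat set + nat \<Rightarrow> nat set" where
  "pin_set L = case_sum (\<lambda>e. e \<inter> L) (\<lambda>v. {v})"

definition pin_coupling :: "nat set \<Rightarrow> real \<Rightarrow> real \<Rightarrow> (nat \<Rightarrow> spin) \<Rightarrow> nat set + nat \<Rightarrow> real" where
  "pin_coupling L \<beta> B \<xi> = case_sum (\<lambda>e. \<beta> * chi (e - L) \<xi>) (\<lambda>v. B)"

lemma gex_change_bc:
  assumes "finite L"
    and "\<And>x y. (\<And>v. v \<in> L \<Longrightarrow> x v = y v) \<Longrightarrow> H x = H y"
    and "\<And>x y. (\<And>v. v \<in> L \<Longrightarrow> x v = y v) \<Longrightarrow> f x = f y"
  shows "gex L \<xi> H f = gex L \<eta> H f"
  by (rule gex_restrict[OF assms(1) subset_refl assms(2,3)])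

lemma gex_ham_pin:
  assumes "finite L" "finite E" "finite V" "\<And>e. e \<in> E \<Longrightarrow> finite e" "C \<subseteq> L"
  shows "gex L \<xi> (ham E V \<beta> B) (chi C)
    = gex L all_up (\<lambda>x. \<Sum>k\<in>E <+> (V \<inter> L). pin_coupling L \<beta> B \<xi> k * chi (pin_set L k) x) (chi C)"
proof -
  let ?H = "\<lambda>x. \<Sum>k\<in>E <+> (V \<inter> L). pin_coupling L \<beta> B \<xi> k * chi (pin_set L k) x"
  have H: "?H x = (\<Sum>e\<in>E. \<beta> * chi (e - L) \<xi> * chi (e \<inter> L) x) + (\<Sum>v\<in>V \<inter> L. B * spin_val (x v))" for x
    using assms(2,3) by (subst sum.Plus) (simp_all add: pin_coupling_def pin_set_def)
  have "ham E V \<beta> B x = ?H x + B * (\<Sum>v\<in>V - L. spin_val (\<xi> v))" if x: "x \<in> cfg L \<xi>" for x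
  proof -
    have "chi e x = chi (e - L) \<xi> * chi (e \<inter> L) x" if "e \<in> E" for e
    proof -
      have "chi (e - L) x = chi (e - L) \<xi>" by (rule chi_cong) (use x in \<open>auto simp: cfg_def\<close>)
      then show ?thesis using chi_split[OF assms(4)[OF that], of x L] by simp
    qed
    then have 1: "\<beta> * (\<Sum>e\<in>E. chi e x) = (\<Sum>e\<in>E. \<beta> * chi (e - L) \<xi> * chi (e \<inter> L) x)"
      by (simp add: sum_distrib_left mult.assoc)
    have "(\<Sum>v\<in>V. spin_val (x v)) = (\<Sum>v\<in>V \<inter> L. spin_val (x v)) + (\<Sum>v\<in>V - L. spin_val (x v))"
      using sum.Int_Diff[OF assms(3), of "\<lambda>v. spin_val (x v)" L] by simp
    moreover have "(\<Sum>v\<in>V - L. spin_val (x v)) = (\<Sum>v\<in>V - L. spin_val (\<xi> v))"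
      by (rule sum.cong) (use x in \<open>auto simp: cfg_def\<close>)
    ultimately have 2: "B * (\<Sum>v\<in>V. spin_val (x v)) = (\<Sum>v\<in>V \<inter> L. B * spin_val (x v))
        + B * (\<Sum>v\<in>V - L. spin_val (\<xi> v))"
      by (simp add: sum_distrib_left distrib_left)
    show ?thesis unfolding ham_def H 1 2 by simp
  qed
  then have "gex L \<xi> (ham E V \<beta> B) (chi C) = gex L \<xi> ?H (chi C)" by (rule gex_shift)
  also have "\<dots> = gex L all_up ?H (chi C)"
  proof (rule gex_change_bc[OF assms(1)])
    fix x y :: "nat \<Rightarrow> spin" assume xy: "\<And>v. v \<in> L \<Longrightarrow> x v = y v"
    have "chi (e \<inter> L) x = chi (e \<inter> L) y" for e by (rule chi_cong) (simp add: xy)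
    moreover have "(\<Sum>v\<in>V \<inter> L. B * spin_val (x v)) = (\<Sum>v\<in>V \<inter> L. B * spin_val (y v))"
      by (rule sum.cong) (simp_all add: xy)
    ultimately show "?H x = ?H y" unfolding H by simp
    show "chi C x = chi C y" by (rule chi_cong) (use xy assms(5) in blast)
  qed
  finally show ?thesis .
qed

text \<open>
  Griffiths' comparison: a plus boundary, more edges and a larger field increase the correlations.
\<close>

theorem griffiths:
  assumes "finite L" "finite E" "finite V" "\<And>e. e \<in> E \<Longrightarrow> finite e" "C \<subseteq> L"
    and "0 \<le> \<beta>" "0 \<le> B'" "B' \<le> B" "E' \<subseteq> E" "V' \<subseteq> V"
  shows "gex L \<xi> (ham E' V' \<beta> B') (chi C) \<le> gex L all_up (ham E V \<beta> B) (chi C)"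
proof -
  have fin: "finite E'" "finite V'" "\<And>e. e \<in> E' \<Longrightarrow> finite e"
    using assms(2,3,4,9,10) finite_subset by blast+
  let ?K = "E <+> (V \<inter> L)" and ?K' = "E' <+> (V' \<inter> L)"
  let ?J = "pin_coupling L \<beta> B all_up"
  let ?J' = "\<lambda>k. if k \<in> ?K' then pin_coupling L \<beta> B' \<xi> k else 0"
  have sub: "?K' \<subseteq> ?K" using assms(9,10) by auto
  have finK: "finite ?K" using assms by auto
  have eq: "(\<Sum>k\<in>?K'. pin_coupling L \<beta> B' \<xi> k * chi (pin_set L k) x) = (\<Sum>k\<in>?K. ?J' k * chi (pin_set L k) x)" for x
    by (rule sum.mono_neutral_cong_left[OF finK sub]) auto
  have "gex L \<xi> (ham E' V' \<beta> B') (chi C)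
      = gex L all_up (\<lambda>x. \<Sum>k\<in>?K'. pin_coupling L \<beta> B' \<xi> k * chi (pin_set L k) x) (chi C)"
    by (rule gex_ham_pin[OF assms(1) fin(1,2,3) assms(5)])
  also have "\<dots> = gex L all_up (\<lambda>x. \<Sum>k\<in>?K. ?J' k * chi (pin_set L k) x) (chi C)"
    by (simp only: eq)
  also have "\<dots> \<le> gex L all_up (\<lambda>x. \<Sum>k\<in>?K. ?J k * chi (pin_set L k) x) (chi C)"
  proof (rule ginibre[OF assms(1) finK _ _ assms(5)])
    fix k assume "k \<in> ?K"
    then show "pin_set L k \<subseteq> L" by (auto simp: pin_set_def)
    show "\<bar>?J' k\<bar> \<le> ?J k"
      using assms(6,7,8) by (cases k) (auto simp: pin_coupling_def abs_mult)
  qed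
  also have "\<dots> = gex L all_up (ham E V \<beta> B) (chi C)"
    by (rule gex_ham_pin[OF assms(1,2,3,4,5), symmetric])
  finally show ?thesis .
qed

text \<open>
  The measure on \<open>M\<close> is a mixture of measures on \<open>L\<close> with random boundary conditions, and plus is the
  largest of these.
\<close>

lemma plus_domain:
  assumes "finite M" "L \<subseteq> M" "finite E" "finite V" "\<And>e. e \<in> E \<Longrightarrow> finite e" "C \<subseteq> L" "0 \<le> \<beta>" "0 \<le> B"
  shows "gex M \<xi> (ham E V \<beta> B) (chi C) \<le> gex L all_up (ham E V \<beta> B) (chi C)"
proof -
  have L: "finite L" using assms finite_subset by blast
  obtain p where p: "\<And>y. y \<in> cfg (M - L) \<xi> \<Longrightarrow> 0 \<le> p y" "(\<Sum>y\<in>cfg (M - L) \<xi>. p y) = 1"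
    "\<And>f. gex M \<xi> (ham E V \<beta> B) f = (\<Sum>y\<in>cfg (M - L) \<xi>. p y * gex L y (ham E V \<beta> B) f)"
    by (rule gex_tower[OF L assms(1,2), where \<xi> = \<xi> and H = "ham E V \<beta> B"]) (rule that, assumption+)
  have "gex M \<xi> (ham E V \<beta> B) (chi C) \<le> (\<Sum>y\<in>cfg (M - L) \<xi>. p y * gex L all_up (ham E V \<beta> B) (chi C))"
    unfolding p(3)
    by (intro sum_mono mult_left_mono p(1) griffiths[OF L assms(3,4,5,6,7,8) order_refl subset_refl subset_refl])
  then show ?thesis by (simp add: sum_distrib_right[symmetric] p(2))
qed

lemma coth_identity:
  fixes c :: real assumes "0 < c" "s = 1 \<or> s = -1"
  shows "(cosh c / sinh c - s) * exp (c * s) = 1 / sinh c"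
proof -
  have s: "sinh c > 0" using assms by simp
  have "(cosh c / sinh c - s) = exp (- c * s) / sinh c"
  proof -
    have "cosh c - s * sinh c = exp (- c * s)"
      using assms(2) by (elim disjE) (simp_all add: cosh_minus_sinh cosh_plus_sinh)
    then show ?thesis using s by (simp add: diff_divide_distrib[symmetric] field_simps)
  qed
  then show ?thesis by (simp add: exp_add[symmetric])
qed

text \<open>
  The replicas agree at \<open>u\<close>, so the spin at \<open>u\<close> feels the field \<open>2 B\<close>. Since
  \<open>(coth c - s) exp (c s) = 1 / sinh c\<close> does not depend on \<open>s\<close>, the difference of the two sides is a
  positive multiple of a Griffiths sum without that field.
\<close>

lemma overlap_sum_field:
  fixes A :: "'k \<Rightarrow> nat set"
  assumes "finite L" "finite K" "\<And>k. k \<in> K \<Longrightarrow> A k \<subseteq> L" "\<And>k. k \<in> K \<Longrightarrow> \<bar>J' k\<bar> \<le> J k"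
    and "u \<in> L" "v \<in> L" "u \<noteq> v" "k \<in> K" "A k = {u}" "J k = B" "J' k = B" "0 < B" "\<tau> u = Up"
  shows "overlap_sum L K A J J' {u, v} \<tau> \<le> cosh (2 * B) / sinh (2 * B) * overlap_sum L K A J J' {v} \<tau>"
proof -
  let ?c = "\<lambda>k. J k + J' k * chi (A k) \<tau>"
  let ?R = "\<lambda>x. exp (\<Sum>k\<in>K - {k}. ?c k * chi (A k) x)"
  have ck: "?c k = 2 * B" using assms by simp
  have e: "exp (\<Sum>k\<in>K. ?c k * chi (A k) x) = exp (2 * B * spin_val (x u)) * ?R x" for x
    using assms(2,8,9) ck by (simp add: sum.remove[of K k] exp_add)
  have s: "spin_val (x u) = 1 \<or> spin_val (x u) = -1" for x :: "nat \<Rightarrow> spin" by (cases "x u") auto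
  have "cosh (2 * B) / sinh (2 * B) * overlap_sum L K A J J' {v} \<tau> - overlap_sum L K A J J' {u, v} \<tau>
    = (\<Sum>x\<in>cfg L all_up. chi {v} x * ((cosh (2 * B) / sinh (2 * B) - spin_val (x u)) * exp (2 * B * spin_val (x u))) * ?R x)"
    unfolding overlap_sum_def sum_distrib_left sum_subtractf[symmetric] e
    by (intro sum.cong refl) (simp add: chi_pair[OF assms(7)] algebra_simps)
  also have "\<dots> = (1 / sinh (2 * B)) * (\<Sum>x\<in>cfg L all_up. chi {v} x * ?R x)"
    unfolding sum_distrib_left using coth_identity[OF _ s, of "2 * B"] assms(12)
    by (intro sum.cong refl) (simp add: mult_ac)
  also have "\<dots> \<ge> 0"
  proof (intro mult_nonneg_nonneg)
    show "0 \<le> (\<Sum>x\<in>cfg L all_up. chi {v} x * ?R x)"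
    proof (rule gks1[OF assms(1)])
      fix k' assume "k' \<in> K - {k}"
      then have k': "k' \<in> K" by simp
      show "A k' \<subseteq> L" by (rule assms(3)[OF k'])
      have "0 \<le> J k' + J' k'" "0 \<le> J k' - J' k'" using assms(4)[OF k'] by linarith+
      then show "0 \<le> ?c k'" using chi_cases[of "A k'" \<tau>] by auto
    qed (use assms in auto)
  qed (use assms in simp)
  finally show ?thesis by simp
qed

text \<open>
  In a positive external field, an edge correlation feels the boundary only through the
  magnetizations of the end points: for each overlap, \<open>\<sigma>\<^sub>u\<close> costs at most a factor
  \<open>coth (2 B)\<close> since a field of strength \<open>2 B\<close> acts on it.
\<close>

theorem edge_vs_magnetization:
  fixes \<beta> B :: real and \<xi> :: "nat \<Rightarrow> spin"
  assumes "finite L" "finite E" "finite V" "\<And>e. e \<in> E \<Longrightarrow> finite e"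
    and "0 \<le> \<beta>" "0 < B" "u \<in> L \<inter> V" "v \<in> L \<inter> V" "u \<noteq> v"
  defines "D \<equiv> \<lambda>C. gex L all_up (ham E V \<beta> B) (chi C) - gex L \<xi> (ham E V \<beta> B) (chi C)"
  shows "D {u, v} \<le> cosh (2 * B) / sinh (2 * B) * (D {u} + D {v})"
proof -
  let ?K = "E <+> (V \<inter> L)" and ?A = "pin_set L"
  let ?J = "pin_coupling L \<beta> B all_up" and ?J' = "pin_coupling L \<beta> B \<xi>"
  let ?H = "\<lambda>x. \<Sum>k\<in>?K. ?J k * chi (?A k) x" and ?H' = "\<lambda>x. \<Sum>k\<in>?K. ?J' k * chi (?A k) x"
  let ?Z = "gsum L all_up ?H (\<lambda>_. 1) * gsum L all_up ?H' (\<lambda>_. 1)"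
  define c where c_def: "c = cosh (2 * B) / sinh (2 * B)"
  let ?O = "\<lambda>C \<tau>. overlap_sum L ?K ?A ?J ?J' C \<tau>"
  have finK: "finite ?K" using assms by auto
  have sub: "?A k \<subseteq> L" if "k \<in> ?K" for k using that by (auto simp: pin_set_def)
  have J: "\<bar>?J' k\<bar> \<le> ?J k" if "k \<in> ?K" for k
    using that assms(5,6) by (cases k) (auto simp: pin_coupling_def abs_mult)
  have Zpos: "?Z > 0" using gsum_1_pos[OF assms(1)] by simp
  have c: "c \<ge> 0" unfolding c_def using assms(6) by simp
  have pin: "gex L \<eta> (ham E V \<beta> B) (chi C)
      = gex L all_up (\<lambda>x. \<Sum>k\<in>?K. pin_coupling L \<beta> B \<eta> k * chi (?A k) x) (chi C)" if "C \<subseteq> L" for C \<eta>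
    by (rule gex_ham_pin[OF assms(1,2,3,4) that])
  have D: "D C * ?Z = (\<Sum>\<tau>\<in>cfg L all_up. (1 - chi C \<tau>) * ?O C \<tau>)" if "C \<subseteq> L" for C
    unfolding D_def pin[OF that, of all_up] pin[OF that, of \<xi>]
    by (rule replica_difference[OF assms(1), where J = ?J and A = ?A and K = ?K and J' = ?J' and C = C])
  have term_le: "(1 - chi {u, v} \<tau>) * ?O {u, v} \<tau>
      \<le> c * ((1 - chi {u} \<tau>) * ?O {u} \<tau> + (1 - chi {v} \<tau>) * ?O {v} \<tau>)" for \<tau>
  proof -
    have pos: "0 \<le> ?O {w} \<tau>" if "w \<in> L" for w
      by (rule overlap_sum_nonneg[OF assms(1) finK sub J]) (use that in auto)
    have U: "?O {u, v} \<tau> \<le> c * ?O {v} \<tau>" if "\<tau> u = Up"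
      unfolding c_def by (rule overlap_sum_field[OF assms(1) finK sub J, where k = "Inr u" and u = u and v = v])
         (use assms(6-9) that in \<open>auto simp: pin_set_def pin_coupling_def\<close>)
    have V: "?O {v, u} \<tau> \<le> c * ?O {u} \<tau>" if "\<tau> v = Up"
      unfolding c_def by (rule overlap_sum_field[OF assms(1) finK sub J, where k = "Inr v" and u = v and v = u])
         (use assms(6-9) that in \<open>auto simp: pin_set_def pin_coupling_def\<close>)
    show ?thesis
    proof (cases "\<tau> u"; cases "\<tau> v")
      assume "\<tau> u = Down" "\<tau> v = Down"
      then show ?thesis using pos[of u] pos[of v] c assms(7-9) by (simp add: chi_pair)
    next
      assume "\<tau> u = Down" "\<tau> v = Up"
      then show ?thesis using V assms(9) by (simp add: chi_pair insert_commute)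
    next
      assume "\<tau> u = Up" "\<tau> v = Down"
      then show ?thesis using U assms(9) by (simp add: chi_pair)
    next
      assume "\<tau> u = Up" "\<tau> v = Up"
      then show ?thesis using assms(9) by (simp add: chi_pair)
    qed
  qed
  have "D {u, v} * ?Z \<le> c * (D {u} * ?Z + D {v} * ?Z)"
  proof -
    have "D {u, v} * ?Z = (\<Sum>\<tau>\<in>cfg L all_up. (1 - chi {u, v} \<tau>) * ?O {u, v} \<tau>)"
      by (rule D) (use assms in auto)
    also have "\<dots> \<le> (\<Sum>\<tau>\<in>cfg L all_up. c * ((1 - chi {u} \<tau>) * ?O {u} \<tau> + (1 - chi {v} \<tau>) * ?O {v} \<tau>))"
      by (intro sum_mono term_le)
    also have "\<dots> = c * (D {u} * ?Z + D {v} * ?Z)"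
      using D[of "{u}"] D[of "{v}"] assms(7,8)
      by (simp only: sum_distrib_left[symmetric] sum.distrib IntD1 empty_subsetI insert_subset simp_thms)
    finally show ?thesis .
  qed
  then have "D {u, v} * ?Z \<le> (c * (D {u} + D {v})) * ?Z" by (simp add: algebra_simps)
  then show ?thesis using Zpos by (simp only: mult_le_cancel_right_pos c_def)
qed

subsection \<open>Edge correlations determine even correlations\<close>

definition fham :: "real \<Rightarrow> nat set set \<Rightarrow> nat set \<Rightarrow> (nat \<Rightarrow> real) \<Rightarrow> (nat \<Rightarrow> spin) \<Rightarrow> real" where
  "fham \<beta> E L h x = \<beta> * (\<Sum>e\<in>E. chi e x) + (\<Sum>v\<in>L. h v * spin_val (x v))"

lemma sum_cfg_smul:
  fixes G :: "(nat \<Rightarrow> spin) \<Rightarrow> real"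
  assumes "r \<in> cfg L all_up"
  shows "(\<Sum>x\<in>cfg L all_up. G (\<lambda>v. smul (x v) (r v))) = (\<Sum>x\<in>cfg L all_up. G x)"
proof -
  have inv: "(\<lambda>v. smul (smul (x v) (r v)) (r v)) = x" for x
    by (rule ext) (metis (full_types) smul_def spin.exhaust)
  have mem: "(\<lambda>v. smul (x v) (r v)) \<in> cfg L all_up" if "x \<in> cfg L all_up" for x
    using that assms by (simp add: cfg_def smul_def)
  show ?thesis
    by (rule sum.reindex_bij_witness[of _ "\<lambda>x v. smul (x v) (r v)" "\<lambda>x v. smul (x v) (r v)"])
       (simp_all only: inv mem)
qed

lemma abs_sinh_le: "\<bar>sinh (y::real)\<bar> \<le> \<bar>y\<bar> * exp \<bar>y\<bar>"
proof -
  have *: "sinh y \<le> y * exp y" if "0 \<le> y" for y :: real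
  proof -
    have "1 - exp (- 2 * y) \<le> 2 * y" using exp_ge_add_one_self[of "- 2 * y"] by simp
    then have "exp y * (1 - exp (- 2 * y)) \<le> exp y * (2 * y)" by (intro mult_left_mono) auto
    moreover have "exp y * (1 - exp (- 2 * y)) = exp y - exp (- y)"
      by (simp add: right_diff_distrib exp_add[symmetric])
    ultimately show ?thesis by (simp add: sinh_field_def field_simps)
  qed
  show ?thesis using *[of y] *[of "- y"] by (cases "0 \<le> y") (auto simp: abs_if)
qed

lemma sinh_ge_self: "0 \<le> y \<Longrightarrow> y \<le> sinh (y::real)"
proof -
  assume y: "0 \<le> y"
  have "sinh 0 - 0 \<le> sinh y - y"
  proof (rule DERIV_nonneg_imp_nondecreasing[OF y])
    fix x :: real assume "0 \<le> x" "x \<le> y"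
    have "((\<lambda>x. sinh x - x) has_real_derivative cosh x - 1) (at x)"
      by (auto intro!: derivative_eq_intros)
    then show "\<exists>d. ((\<lambda>x. sinh x - x) has_real_derivative d) (at x) \<and> 0 \<le> d"
      using cosh_real_ge_1[of x] by fastforce
  qed
  then show ?thesis by simp
qed

lemma adj_path:
  assumes "(u, v) \<in> (adj F)\<^sup>*"
  obtains y :: "nat \<Rightarrow> 'v" and m where "y 0 = u" "y m = v" "inj_on y {..m}"
    "\<And>j. j < m \<Longrightarrow> {y j, y (Suc j)} \<in> F"
proof -
  define m where "m = (LEAST n. (u, v) \<in> adj F ^^ n)"
  have "\<exists>n. (u, v) \<in> adj F ^^ n" using assms rtrancl_imp_relpow by blast
  then have m: "(u, v) \<in> adj F ^^ m" unfolding m_def by (rule LeastI_ex)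
  then obtain y where y: "y 0 = u" "y m = v" "\<And>i. i < m \<Longrightarrow> (y i, y (Suc i)) \<in> adj F"
    unfolding relpow_fun_conv by blast
  have walk: "(y i, y (i + d)) \<in> adj F ^^ d" if "i + d \<le> m" for i d
    using that
  proof (induction d)
    case (Suc d)
    then have "(y i, y (i + d)) \<in> adj F ^^ d" "(y (i + d), y (Suc (i + d))) \<in> adj F" using y(3) by auto
    then show ?case by auto
  qed simp
  have no: "y i \<noteq> y j" if "i < j" "j \<le> m" for i j
  proof
    assume eq: "y i = y j"
    have "(y 0, y i) \<in> adj F ^^ i" using walk[of 0 i] that by simp
    moreover have "(y i, y m) \<in> adj F ^^ (m - j)" using walk[of j "m - j"] that eq by simp
    ultimately have "(u, v) \<in> adj F ^^ (i + (m - j))" using y by (auto simp: relpow_add)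
    then have "m \<le> i + (m - j)" unfolding m_def by (rule Least_le)
    then show False using that by simp
  qed
  have "inj_on y {..m}"
    by (rule inj_onI) (metis atMost_iff linorder_neqE_nat no)
  then show ?thesis using that y by (auto simp: adj_def)
qed

text \<open>
  The quotient of an upper bound for the weight of an overlap with \<open>chi C \<tau> = -1\<close> and a lower bound
  for the weights that enter the edge correlations. Here \<open>n\<close> is the number of vertices, \<open>M\<close> bounds
  the fields, and the factor \<open>n^2\<close> counts pairs of vertices.
\<close>

definition leb_const :: "real \<Rightarrow> real \<Rightarrow> nat \<Rightarrow> real" where
  "leb_const \<beta> M n = 2 ^ n * exp (2 * \<beta> * real n ^ 2 + 4 * M * real n) * real n ^ 2 / min 1 (sinh (2 * \<beta>)) ^ n"

context
  fixes W :: "nat set" and F :: "nat set set" and h hp :: "nat \<Rightarrow> real" and \<beta> M :: real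
  assumes W: "finite W" and F: "graph_on W F" and conn: "connected_graph W F" and \<beta>: "0 < \<beta>"
    and h: "\<And>v. v \<in> W \<Longrightarrow> \<bar>h v\<bar> \<le> hp v" and hp: "\<And>v. v \<in> W \<Longrightarrow> hp v \<le> M"
begin

private abbreviation "K \<equiv> F <+> W"
private abbreviation "A \<equiv> case_sum (\<lambda>e. e) (\<lambda>v. {v :: nat})"
private abbreviation "J \<equiv> case_sum (\<lambda>e :: nat set. \<beta>) hp"
private abbreviation "J' \<equiv> case_sum (\<lambda>e :: nat set. \<beta>) h"
private abbreviation "OS \<equiv> overlap_sum W K A J J'"
private abbreviation "a v \<equiv> hp v + h v"
private abbreviation "g v \<equiv> hp v - h v"

private lemma edgeE: assumes "e \<in> F" obtains u v where "e = {u, v}" "u \<in> W" "v \<in> W" "u \<noteq> v"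
  using assms F unfolding graph_on_def by blast

private lemma finF: "finite F"
proof (rule finite_subset)
  show "F \<subseteq> Pow W" by (auto elim: edgeE)
qed (use W in simp)

private lemma finK: "finite K" using finF W by simp

private lemma support_subset: "k \<in> K \<Longrightarrow> A k \<subseteq> W" by (auto elim: edgeE)

private lemma coupling_le: "k \<in> K \<Longrightarrow> \<bar>J' k\<bar> \<le> J k" using h \<beta> by auto

private lemma fields_bounded: "v \<in> W \<Longrightarrow> 0 \<le> a v \<and> a v \<le> 2 * M \<and> 0 \<le> g v \<and> g v \<le> 2 * M"
  using h[of v] hp[of v] by (simp add: abs_le_iff)

private lemma H_eq:
  "(\<lambda>x. \<Sum>k\<in>K. case_sum (\<lambda>e. \<beta>) f k * chi (A k) x) = fham \<beta> F W f"
  using finF W by (simp add: fun_eq_iff sum.Plus fham_def sum_distrib_left)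

text \<open>
  If \<open>C\<close> is even and \<open>chi C \<tau> = -1\<close>, then \<open>C\<close> has an odd number of vertices both where the replicas
  agree and where they disagree. No edge couples these two regions, so flipping either of them changes
  only the sign of its field term and of \<open>chi C\<close>. Hence both field terms contribute a factor: \<open>hp + h\<close>
  from the agreement region and \<open>hp - h\<close> from the disagreement region.
\<close>

private lemma overlap_upper:
  assumes "C \<subseteq> W" "even (card C)" "\<tau> \<in> cfg W all_up" "chi C \<tau> = -1"
  shows "OS C \<tau> \<le> 2 ^ card W * exp (2 * \<beta> * real (card F) + 4 * M * real (card W))
    * (\<Sum>u\<in>{v\<in>W. \<tau> v = Up}. \<Sum>v\<in>{v\<in>W. \<tau> v = Down}. a u * g v)"
proof -
  let ?R = "{v\<in>W. \<tau> v = Up}" and ?Q = "{v\<in>W. \<tau> v = Down}"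
  define E where "E x = (\<Sum>e\<in>F. (\<beta> + \<beta> * chi e \<tau>) * chi e x)" for x
  define S where "S x = (\<Sum>v\<in>?R. a v * spin_val (x v))" for x
  define T where "T x = (\<Sum>v\<in>?Q. g v * spin_val (x v))" for x
  let ?\<rho> = "\<lambda>v. if v \<in> W then smul Down (\<tau> v) else Up"
  have RQ: "W = ?R \<union> ?Q" "?R \<inter> ?Q = {}" by (auto intro: spin.exhaust)
  have split: "(\<Sum>k\<in>K. (J k + J' k * chi (A k) \<tau>) * chi (A k) x) = E x + S x + T x" for x
  proof -
    have "(\<Sum>v\<in>W. (hp v + h v * spin_val (\<tau> v)) * spin_val (x v)) = S x + T x"
      unfolding S_def T_def using W by (subst RQ(1), subst sum.union_disjoint) (auto intro!: sum.cong)
    then show ?thesis using finF W by (simp add: sum.Plus E_def)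
  qed
  have \<tau>_\<rho>: "chi e ?\<rho> = chi e \<tau>" if e: "e \<subseteq> W" "even (card e)" for e
  proof -
    have "chi e ?\<rho> = (\<Prod>v\<in>e. - 1 * spin_val (\<tau> v))"
      unfolding chi_def by (rule prod.cong) (use e in auto)
    also have "\<dots> = (-1) ^ card e * chi e \<tau>" by (simp only: prod.distrib prod_constant chi_def)
    finally show ?thesis using e by simp
  qed
  have card2: "e \<subseteq> W \<and> even (card e)" if "e \<in> F" for e using that by (auto elim!: edgeE)
  have c\<tau>: "(\<beta> + \<beta> * chi e \<tau>) * chi e \<tau> = (\<beta> + \<beta> * chi e \<tau>)" for e
    using chi_cases[of e \<tau>] by auto
  have E\<tau>: "E (\<lambda>v. smul (x v) (\<tau> v)) = E x" for x
    unfolding E_def chi_smul by (intro sum.cong refl) (metis c\<tau> mult.commute mult.left_commute)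
  have E\<rho>: "E (\<lambda>v. smul (x v) (?\<rho> v)) = E x" for x
    unfolding E_def chi_smul
  proof (intro sum.cong refl)
    fix e assume "e \<in> F"
    then have "chi e ?\<rho> = chi e \<tau>" using \<tau>_\<rho> card2 by blast
    then show "(\<beta> + \<beta> * chi e \<tau>) * (chi e x * chi e ?\<rho>) = (\<beta> + \<beta> * chi e \<tau>) * chi e x"
      using c\<tau>[of e] by (metis mult.commute mult.left_commute)
  qed
  have S\<tau>: "S (\<lambda>v. smul (x v) (\<tau> v)) = S x" and T\<tau>: "T (\<lambda>v. smul (x v) (\<tau> v)) = - T x" for x
    unfolding S_def T_def by (simp_all add: sum_negf[symmetric])
  have S\<rho>: "S (\<lambda>v. smul (x v) (?\<rho> v)) = - S x" and T\<rho>: "T (\<lambda>v. smul (x v) (?\<rho> v)) = T x" for x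
    unfolding S_def T_def by (simp_all add: sum_negf[symmetric])
  have C\<rho>: "chi C ?\<rho> = -1" using \<tau>_\<rho>[OF assms(1,2)] assms(4) by simp
  have \<rho>: "?\<rho> \<in> cfg W all_up" by (simp add: cfg_def)
  have 1: "OS C \<tau> = (\<Sum>x\<in>cfg W all_up. chi C x * exp (E x + S x) * sinh (T x))"
  proof -
    let ?G = "\<lambda>x. chi C x * exp (E x + S x + T x)"
    have "2 * OS C \<tau> = (\<Sum>x\<in>cfg W all_up. ?G x) + (\<Sum>x\<in>cfg W all_up. ?G (\<lambda>v. smul (x v) (\<tau> v)))"
      unfolding sum_cfg_smul[OF assms(3), of ?G] overlap_sum_def split by simp
    also have "\<dots> = (\<Sum>x\<in>cfg W all_up. 2 * (chi C x * exp (E x + S x) * sinh (T x)))"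
      unfolding sum.distrib[symmetric] E\<tau> S\<tau> T\<tau> chi_smul assms(4) exp_add sinh_field_def
      by (intro sum.cong refl) (simp add: algebra_simps)
    finally show ?thesis by (simp add: sum_distrib_left[symmetric])
  qed
  have 2: "OS C \<tau> = (\<Sum>x\<in>cfg W all_up. chi C x * exp (E x) * sinh (S x) * sinh (T x))"
  proof -
    let ?G = "\<lambda>x. chi C x * exp (E x + S x) * sinh (T x)"
    have "2 * OS C \<tau> = (\<Sum>x\<in>cfg W all_up. ?G x) + (\<Sum>x\<in>cfg W all_up. ?G (\<lambda>v. smul (x v) (?\<rho> v)))"
      unfolding sum_cfg_smul[OF \<rho>, of ?G] 1 by simp
    also have "\<dots> = (\<Sum>x\<in>cfg W all_up. 2 * (chi C x * exp (E x) * sinh (S x) * sinh (T x)))"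
      unfolding sum.distrib[symmetric] E\<rho> S\<rho> T\<rho> chi_smul C\<rho> exp_add sinh_field_def
      by (intro sum.cong refl) (simp add: algebra_simps)
    finally show ?thesis by (simp add: sum_distrib_left[symmetric])
  qed
  let ?sa = "\<Sum>v\<in>?R. a v" and ?sg = "\<Sum>v\<in>?Q. g v"
  have M0: "0 \<le> M" if "v \<in> W" for v using fields_bounded[OF that] by linarith
  have sa: "0 \<le> ?sa" "?sa \<le> 2 * M * real (card W)" and sg: "0 \<le> ?sg" "?sg \<le> 2 * M * real (card W)"
  proof -
    show "0 \<le> ?sa" "0 \<le> ?sg" by (auto intro!: sum_nonneg dest: fields_bounded)
    have "?sa \<le> (\<Sum>v\<in>W. 2 * M)"
      by (rule order_trans[OF sum_mono sum_mono2]) (use W fields_bounded M0 in auto)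
    then show "?sa \<le> 2 * M * real (card W)" by (simp add: mult.commute)
    have "?sg \<le> (\<Sum>v\<in>W. 2 * M)"
      by (rule order_trans[OF sum_mono sum_mono2]) (use W fields_bounded M0 in auto)
    then show "?sg \<le> 2 * M * real (card W)" by (simp add: mult.commute)
  qed
  have E: "E x \<le> 2 * \<beta> * real (card F)" for x
  proof -
    have "E x \<le> (\<Sum>e\<in>F. 2 * \<beta>)" unfolding E_def
    proof (rule sum_mono)
      fix e
      show "(\<beta> + \<beta> * chi e \<tau>) * chi e x \<le> 2 * \<beta>"
        using chi_cases[of e \<tau>] chi_cases[of e x] \<beta> by auto
    qed
    then show ?thesis by (simp add: mult.commute)
  qed
  have S: "\<bar>S x\<bar> \<le> ?sa" and T: "\<bar>T x\<bar> \<le> ?sg" for x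
    unfolding S_def T_def
    by (rule order_trans[OF sum_abs], rule sum_mono, use fields_bounded in \<open>simp add: abs_mult\<close>)+
  have "OS C \<tau> \<le> (\<Sum>x\<in>cfg W all_up. exp (2 * \<beta> * real (card F)) * (?sa * exp (2 * M * real (card W)))
      * (?sg * exp (2 * M * real (card W))))"
    unfolding 2
  proof (rule sum_mono)
    fix x
    have s1: "\<bar>sinh (S x)\<bar> \<le> ?sa * exp (2 * M * real (card W))"
      by (rule order_trans[OF abs_sinh_le mult_mono]) (use S[of x] sa in auto)
    have s2: "\<bar>sinh (T x)\<bar> \<le> ?sg * exp (2 * M * real (card W))"
      by (rule order_trans[OF abs_sinh_le mult_mono]) (use T[of x] sg in auto)
    have "chi C x * exp (E x) * sinh (S x) * sinh (T x) \<le> \<bar>chi C x * exp (E x) * sinh (S x) * sinh (T x)\<bar>"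
      by simp
    also have "\<dots> = exp (E x) * \<bar>sinh (S x)\<bar> * \<bar>sinh (T x)\<bar>" by (simp add: abs_mult)
    also have "\<dots> \<le> exp (2 * \<beta> * real (card F)) * (?sa * exp (2 * M * real (card W)))
      * (?sg * exp (2 * M * real (card W)))"
      using E[of x] sa sg by (intro mult_mono s1 s2) auto
    finally show "chi C x * exp (E x) * sinh (S x) * sinh (T x) \<le> \<dots>" .
  qed
  also have "\<dots> = 2 ^ card W * exp (2 * \<beta> * real (card F) + 4 * M * real (card W)) * (?sa * ?sg)"
  proof -
    have "exp (4 * M * real (card W)) = exp (2 * M * real (card W)) * exp (2 * M * real (card W))"
      by (simp add: exp_add[symmetric])
    then show ?thesis using W by (simp add: card_cfg exp_add mult_ac)
  qed
  also have "?sa * ?sg = (\<Sum>u\<in>?R. \<Sum>v\<in>?Q. a u * g v)" by (rule sum_product)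
  finally show ?thesis .
qed

text \<open>
  Conversely, if the replicas agree at \<open>u\<close> only, then the first edge of a path from \<open>u\<close> to \<open>v\<close>
  disagrees, and the interactions along the rest of the path carry the field at \<open>v\<close> to it.
\<close>

private lemma overlap_lower:
  assumes "u \<in> W" "v \<in> W" "u \<noteq> v"
  shows "\<exists>e\<in>F. \<exists>\<tau>\<in>cfg W all_up. chi e \<tau> = -1
    \<and> 2 ^ card W * min 1 (sinh (2 * \<beta>)) ^ card W * (a u * g v) \<le> OS e \<tau>"
proof -
  have "(u, v) \<in> (adj F)\<^sup>*" using conn assms by (simp add: connected_graph_def)
  from adj_path[OF this] obtain y m where
    y: "y 0 = u" "y m = v" "inj_on y {..m}" "\<And>j. j < m \<Longrightarrow> {y j, y (Suc j)} \<in> F" by metis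
  have m: "0 < m" using y assms by (cases m) auto
  have yne: "y i \<noteq> y j" if "i \<le> m" "j \<le> m" "i \<noteq> j" for i j
    using inj_onD[OF y(3), of i j] that by auto
  have yW: "y j \<in> W" if "j \<le> m" for j
  proof (cases "j = m")
    case False
    then have "{y j, y (Suc j)} \<in> F" using y(4) that by simp
    then show ?thesis by (metis edgeE insertI1 insertE singletonD)
  qed (use y assms in simp)
  define \<tau> where "\<tau> = (\<lambda>w. if w \<in> W - {u} then Down else Up)"
  let ?e = "{y 0, y 1}"
  let ?P = "\<lambda>j. {y j, y (Suc j)}"
  let ?K' = "Inl ` ?P ` {1..<m} \<union> {Inr u, Inr v}"
  let ?c = "\<lambda>k. J k + J' k * chi (A k) \<tau>"
  have e: "?e \<in> F" using y(4)[of 0] m by simp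
  have \<tau>u: "\<tau> u = Up" and \<tau>y: "\<tau> (y j) = Down" if "1 \<le> j" "j \<le> m" for j
    using yne[of 0 j] yW[of j] that y(1) by (auto simp: \<tau>_def)
  have \<tau>u: "\<tau> u = Up" by (simp add: \<tau>_def)
  have e\<tau>: "chi ?e \<tau> = -1"
    using yne[of 0 1] m \<tau>u \<tau>y[of 1] y(1) by (simp add: chi_pair)
  have injP: "inj_on ?P {1..<m}"
  proof (rule inj_onI)
    fix i j assume ij: "i \<in> {1..<m}" "j \<in> {1..<m}" "?P i = ?P j"
    show "i = j"
    proof (rule ccontr)
      assume ne: "i \<noteq> j"
      have "y i \<noteq> y j" "y (Suc i) \<noteq> y (Suc j)"
        using yne[of i j] yne[of "Suc i" "Suc j"] ij(1,2) ne by simp_all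
      then have "y i = y (Suc j)" "y (Suc i) = y j" using ij(3) by (auto simp: doubleton_eq_iff)
      then have "i = Suc j" "Suc i = j" using yne[of i "Suc j"] yne[of "Suc i" j] ij by auto
      then show False by simp
    qed
  qed
  have K': "?K' \<subseteq> K" using y(4) assms by auto
  have cu: "?c (Inr u) = a u" using \<tau>u by simp
  have cv: "?c (Inr v) = g v" using \<tau>y[of m] m y(2) by simp
  have cP: "?c (Inl (?P j)) = 2 * \<beta>" if "j \<in> {1..<m}" for j
    using \<tau>y[of j] \<tau>y[of "Suc j"] yne[of j "Suc j"] that by (simp add: chi_pair)
  have chiP: "(\<Prod>j\<in>{1..<m}. chi (?P j) x) = spin_val (x (y 1)) * spin_val (x (y m))" for x
  proof -
    have "(\<Prod>j\<in>{1..<n}. chi (?P j) x) = spin_val (x (y 1)) * spin_val (x (y n))"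
      if "1 \<le> n" "n \<le> m" for n
      using that
    proof (induction n rule: dec_induct)
      case (step n)
      have "y n \<noteq> y (Suc n)" using step by (intro yne) auto
      moreover have "spin_val (x (y n)) * (spin_val (x (y n)) * z) = z" for z :: real
        by (simp add: mult.assoc[symmetric])
      ultimately show ?case using step by (simp add: chi_pair mult_ac)
    qed simp
    then show ?thesis using m by simp
  qed
  have prodK': "(\<Prod>k\<in>?K'. f k) = (\<Prod>j\<in>{1..<m}. f (Inl (?P j))) * (f (Inr u) * f (Inr v))" for f :: "nat set + nat \<Rightarrow> real"
    using assms(3) injP
    by (subst prod.union_disjoint) (auto simp: image_comp prod.reindex inj_on_def comp_def)
  have one: "chi ?e x * (\<Prod>k\<in>?K'. chi (A k) x) = 1" for x
  proof -
    have "spin_val s * (spin_val s * z) = z" for s and z :: real by (simp add: mult.assoc[symmetric])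
    then show ?thesis
      unfolding prodK' using chiP[of x] yne[of 0 1] m y(1,2) by (simp add: chi_pair mult_ac)
  qed
  have "2 ^ card W * (\<Prod>k\<in>?K'. sinh (?c k)) \<le> (\<Sum>x\<in>cfg W all_up. chi ?e x * exp (\<Sum>k\<in>(K - ?K') \<union> ?K'. ?c k * chi (A k) x))"
  proof (rule gks1_lower[OF W])
    fix k assume "k \<in> K - ?K' \<union> ?K'"
    then have k: "k \<in> K" using K' by blast
    show "A k \<subseteq> W" by (rule support_subset[OF k])
    have "0 \<le> J k + J' k" "0 \<le> J k - J' k" using coupling_le[OF k] by linarith+
    then show "0 \<le> ?c k" using chi_cases[of "A k" \<tau>] by auto
  next
    show "chi ?e x * (\<Prod>k\<in>?K'. chi (A k) x) = 1" for x by (rule one)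
  qed (use finK e yW[of 0] yW[of 1] m in auto)
  also have "K - ?K' \<union> ?K' = K" using K' by blast
  finally have low: "2 ^ card W * (\<Prod>k\<in>?K'. sinh (?c k)) \<le> OS ?e \<tau>" unfolding overlap_sum_def .
  have mW: "m \<le> card W"
  proof -
    have "card (y ` {..m}) \<le> card W" by (rule card_mono[OF W]) (use yW in auto)
    then show ?thesis by (simp add: card_image[OF y(3)])
  qed
  let ?q = "min 1 (sinh (2 * \<beta>))"
  have q: "0 < ?q" "?q \<le> 1" using \<beta> by auto
  have "?q ^ card W * (a u * g v) \<le> sinh (2 * \<beta>) ^ (m - 1) * (sinh (a u) * sinh (g v))"
  proof (intro mult_mono)
    have "?q ^ card W \<le> ?q ^ (m - 1)" using q mW by (intro power_decreasing) auto
    also have "\<dots> \<le> sinh (2 * \<beta>) ^ (m - 1)" using q by (intro power_mono) auto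
    finally show "?q ^ card W \<le> sinh (2 * \<beta>) ^ (m - 1)" .
  qed (use fields_bounded assms sinh_ge_self \<beta> in auto)
  also have "\<dots> = (\<Prod>k\<in>?K'. sinh (?c k))"
  proof -
    have "(\<Prod>j\<in>{1..<m}. sinh (?c (Inl (?P j)))) = (\<Prod>j\<in>{1..<m}. sinh (2 * \<beta>))"
      by (rule prod.cong) (simp_all only: cP)
    also have "\<dots> = sinh (2 * \<beta>) ^ (m - 1)" by (simp only: prod_constant card_atLeastLessThan)
    finally show ?thesis unfolding prodK' cu cv by (simp only:)
  qed
  finally have "2 ^ card W * (?q ^ card W * (a u * g v)) \<le> OS ?e \<tau>"
    using low by (meson mult_left_mono order_trans zero_le_numeral zero_le_power)
  moreover have "\<tau> \<in> cfg W all_up" by (simp add: \<tau>_def cfg_def)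
  ultimately show ?thesis using e e\<tau>
    by (intro bexI[of _ ?e] bexI[of _ \<tau>] conjI) (simp_all only: mult.assoc)
qed

text \<open>
  Two systems on a connected graph differ only in their fields. By the replica representation, the
  change of an even correlation is at most a multiple of the sum of the products
  \<open>(hp u + h u) (hp v - h v)\<close> over pairs \<open>u \<noteq> v\<close>, and each such product is at most a multiple of the
  change of some edge correlation.
\<close>

theorem even_correlations:
  assumes "C \<subseteq> W" "even (card C)"
  shows "gex W all_up (fham \<beta> F W hp) (chi C) - gex W all_up (fham \<beta> F W h) (chi C)
    \<le> leb_const \<beta> M (card W) *
      (\<Sum>e\<in>F. gex W all_up (fham \<beta> F W hp) (chi e) - gex W all_up (fham \<beta> F W h) (chi e))"
proof -
  let ?Z = "gsum W all_up (fham \<beta> F W hp) (\<lambda>_. 1) * gsum W all_up (fham \<beta> F W h) (\<lambda>_. 1)"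
  define D where "D C = gex W all_up (fham \<beta> F W hp) (chi C) - gex W all_up (fham \<beta> F W h) (chi C)" for C
  let ?q = "min 1 (sinh (2 * \<beta>))" and ?n = "card W"
  have q: "0 < ?q" using \<beta> by auto
  have Z: "?Z > 0" using gsum_1_pos[OF W] by simp
  have D: "D C * ?Z = (\<Sum>\<tau>\<in>cfg W all_up. (1 - chi C \<tau>) * OS C \<tau>)" for C
    using replica_difference[OF W, where K = K and A = A and J = J and J' = J' and C = C]
    unfolding H_eq D_def .
  have pos: "0 \<le> OS C \<tau>" if "C \<subseteq> W" for C \<tau>
    by (rule overlap_sum_nonneg[OF W finK support_subset coupling_le that])
  have eW: "e \<subseteq> W" if "e \<in> F" for e using support_subset[of "Inl e"] that by auto
  define X where "X = (\<Sum>e\<in>F. D e * ?Z)"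
  have De: "(1 - chi e \<tau>) * OS e \<tau> \<le> D e * ?Z" if "e \<in> F" "\<tau> \<in> cfg W all_up" for e \<tau>
    unfolding D using that W
    by (intro member_le_sum mult_nonneg_nonneg pos eW) (auto simp: chi_le_1)
  have De0: "0 \<le> D e * ?Z" if "e \<in> F" for e
    unfolding D using that by (intro sum_nonneg mult_nonneg_nonneg pos eW) (auto simp: chi_le_1)
  have X0: "0 \<le> X" unfolding X_def by (intro sum_nonneg De0)
  have pair: "a u * g v \<le> X / (2 * 2 ^ ?n * ?q ^ ?n)" if uv: "u \<in> W" "v \<in> W" "u \<noteq> v" for u v
  proof -
    obtain e \<tau> where e: "e \<in> F" "\<tau> \<in> cfg W all_up" "chi e \<tau> = -1"
      "2 ^ ?n * ?q ^ ?n * (a u * g v) \<le> OS e \<tau>" using overlap_lower[OF uv] by blast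
    have "2 * OS e \<tau> \<le> D e * ?Z" using De[OF e(1,2)] e(3) by simp
    also have "\<dots> \<le> X" unfolding X_def using e(1) finF De0 by (intro member_le_sum) auto
    finally have "(a u * g v) * (2 * 2 ^ ?n * ?q ^ ?n) \<le> X" using e(4) by (simp add: mult_ac)
    then show ?thesis using q by (simp add: pos_le_divide_eq)
  qed
  let ?c1 = "2 ^ ?n * exp (2 * \<beta> * real (card F) + 4 * M * real ?n)"
  have term_le: "(1 - chi C \<tau>) * OS C \<tau> \<le> 2 * (?c1 * (real ?n ^ 2 * (X / (2 * 2 ^ ?n * ?q ^ ?n))))"
    if \<tau>: "\<tau> \<in> cfg W all_up" for \<tau>
  proof (cases "chi C \<tau> = 1")
    case True then show ?thesis using X0 q by simp
  next
    case False
    then have c: "chi C \<tau> = -1" using chi_cases by blast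
    let ?R = "{v\<in>W. \<tau> v = Up}" and ?Q = "{v\<in>W. \<tau> v = Down}"
    have "(\<Sum>u\<in>?R. \<Sum>v\<in>?Q. a u * g v) \<le> (\<Sum>u\<in>?R. \<Sum>v\<in>?Q. X / (2 * 2 ^ ?n * ?q ^ ?n))"
      by (intro sum_mono pair) auto
    also have "\<dots> = real (card ?R) * real (card ?Q) * (X / (2 * 2 ^ ?n * ?q ^ ?n))" by simp
    also have "\<dots> \<le> real ?n ^ 2 * (X / (2 * 2 ^ ?n * ?q ^ ?n))"
    proof (rule mult_right_mono)
      have "card ?R \<le> ?n" "card ?Q \<le> ?n" using W by (auto intro!: card_mono)
      then show "real (card ?R) * real (card ?Q) \<le> real ?n ^ 2"
        unfolding power2_eq_square by (intro mult_mono) auto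
    qed (use X0 q in simp)
    finally have "?c1 * (\<Sum>u\<in>?R. \<Sum>v\<in>?Q. a u * g v) \<le> ?c1 * (real ?n ^ 2 * (X / (2 * 2 ^ ?n * ?q ^ ?n)))"
      by (intro mult_left_mono) auto
    with overlap_upper[OF assms \<tau> c]
    have "OS C \<tau> \<le> ?c1 * (real ?n ^ 2 * (X / (2 * 2 ^ ?n * ?q ^ ?n)))" by (rule order_trans)
    moreover have "1 - (-1) = (2::real)" by simp
    ultimately show ?thesis unfolding c by (simp only: mult_left_mono zero_le_numeral)
  qed
  have "D C * ?Z \<le> (\<Sum>\<tau>\<in>cfg W all_up. 2 * (?c1 * (real ?n ^ 2 * (X / (2 * 2 ^ ?n * ?q ^ ?n)))))"
    unfolding D by (intro sum_mono term_le)
  also have "\<dots> = (2 ^ ?n * exp (2 * \<beta> * real (card F) + 4 * M * real ?n) * real ?n ^ 2 / ?q ^ ?n) * X"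
    using W by (simp add: card_cfg field_simps)
  also have "\<dots> \<le> leb_const \<beta> M ?n * X"
  proof (rule mult_right_mono[OF _ X0])
    have "card F \<le> ?n ^ 2"
    proof -
      have "F \<subseteq> (\<lambda>(u, v). {u, v}) ` (W \<times> W)" by (auto elim!: edgeE)
      then have "card F \<le> card ((\<lambda>(u, v). {u, v}) ` (W \<times> W))" using W by (intro card_mono) auto
      also have "\<dots> \<le> card (W \<times> W)" using W by (intro card_image_le) auto
      finally show ?thesis by (simp add: card_cartesian_product power2_eq_square)
    qed
    then have "real (card F) \<le> real ?n ^ 2" by (metis of_nat_le_iff of_nat_power)
    then show "2 ^ ?n * exp (2 * \<beta> * real (card F) + 4 * M * real ?n) * real ?n ^ 2 / ?q ^ ?n \<le> leb_const \<beta> M ?n"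
      unfolding leb_const_def using q \<beta> by (intro divide_right_mono mult_right_mono mult_left_mono) auto
  qed
  also have "\<dots> = (leb_const \<beta> M ?n * (\<Sum>e\<in>F. D e)) * ?Z"
    by (simp add: X_def sum_distrib_right[symmetric] sum_distrib_left mult_ac)
  finally have "D C \<le> leb_const \<beta> M ?n * (\<Sum>e\<in>F. D e)"
    using Z by (simp only: mult_le_cancel_right_pos)
  then show ?thesis by (simp add: D_def)
qed

end

subsection \<open>Elimination of leaves\<close>

text \<open>The field that a spin in the field \<open>h\<close> exerts on a neighbour.\<close>

definition uf :: "real \<Rightarrow> real \<Rightarrow> real" where
  "uf \<beta> h = (ln (cosh (\<beta> + h)) - ln (cosh (\<beta> - h))) / 2"

lemma uf_0 [simp]: "uf \<beta> 0 = 0" by (simp add: uf_def)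

lemma uf_minus: "uf \<beta> (- h) = - uf \<beta> h"
  by (simp add: uf_def diff_divide_distrib)

lemma DERIV_uf: "(uf \<beta> has_real_derivative (tanh (\<beta> + h) + tanh (\<beta> - h)) / 2) (at h)"
proof -
  have c: "cosh x \<noteq> 0" "0 < cosh x" for x :: real using cosh_real_pos[of x] by auto
  show ?thesis unfolding uf_def [abs_def]
    by (auto intro!: derivative_eq_intros simp: c(1) tanh_def add_divide_distrib)
qed

lemma uf_mono: assumes "0 \<le> \<beta>" "h \<le> h'" shows "uf \<beta> h \<le> uf \<beta> h'"
proof (rule DERIV_nonneg_imp_nondecreasing[OF assms(2)])
  fix x :: real
  have "tanh (- (\<beta> - x)) \<le> tanh (\<beta> + x)" using assms(1) by (subst tanh_real_le_iff) simp
  then have "0 \<le> (tanh (\<beta> + x) + tanh (\<beta> - x)) / 2" by (simp only: tanh_minus) simp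
  with DERIV_uf show "\<exists>y. (uf \<beta> has_real_derivative y) (at x) \<and> 0 \<le> y" by blast
qed

lemma uf_nonneg: "0 \<le> \<beta> \<Longrightarrow> 0 \<le> h \<Longrightarrow> 0 \<le> uf \<beta> h"
  using uf_mono[of \<beta> 0 h] by simp

lemma uf_abs: "0 \<le> \<beta> \<Longrightarrow> \<bar>h\<bar> \<le> h' \<Longrightarrow> \<bar>uf \<beta> h\<bar> \<le> uf \<beta> h'"
  using uf_mono[of \<beta> h h'] uf_mono[of \<beta> "- h" h'] by (auto simp: abs_le_iff uf_minus)

lemma uf_pos: assumes "0 < \<beta>" "0 < h" shows "0 < uf \<beta> h"
proof -
  have "cosh \<bar>\<beta> - h\<bar> < cosh (\<beta> + h)"
    using assms by (subst cosh_real_nonneg_less_iff) auto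
  then have "cosh (\<beta> - h) < cosh (\<beta> + h)" by (simp only: cosh_real_abs)
  then show ?thesis using cosh_real_pos[of "\<beta> - h"] by (simp add: uf_def)
qed

lemma uf_le: assumes "0 \<le> \<beta>" shows "uf \<beta> h \<le> \<beta>"
proof -
  have "cosh (\<beta> + h) \<le> exp (2 * \<beta>) * cosh (\<beta> - h)"
  proof -
    have e: "exp (2 * \<beta>) * exp (\<beta> - h) = exp (3 * \<beta> - h)" "exp (2 * \<beta>) * exp (- (\<beta> - h)) = exp (\<beta> + h)"
      by (simp_all add: exp_add[symmetric])
    have "exp (2 * \<beta>) * cosh (\<beta> - h) = (exp (3 * \<beta> - h) + exp (\<beta> + h)) / 2"
      unfolding cosh_field_def e[symmetric] by (simp add: algebra_simps)
    moreover have "exp (- (\<beta> + h)) \<le> exp (3 * \<beta> - h)" using assms by simp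
    ultimately show ?thesis by (simp add: cosh_field_def)
  qed
  then have "ln (cosh (\<beta> + h)) \<le> ln (exp (2 * \<beta>) * cosh (\<beta> - h))"
    using cosh_real_pos[of "\<beta> + h"] by (intro ln_mono) auto
  also have "\<dots> = 2 * \<beta> + ln (cosh (\<beta> - h))"
    using cosh_real_pos[of "\<beta> - h"] by (simp add: ln_mult)
  finally show ?thesis by (simp add: uf_def)
qed

text \<open>
  Concavity on the half line is what makes the plus and the free recursion meet in a positive field.
\<close>

lemma concave_uf: assumes "0 \<le> \<beta>" shows "concave_on {0..} (uf \<beta>)"
proof (rule f''_le0_imp_concave)
  fix x :: real assume x: "x \<in> {0..}"
  show "(uf \<beta> has_real_derivative (tanh (\<beta> + x) + tanh (\<beta> - x)) / 2) (at x)" by (rule DERIV_uf)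
  have c: "cosh y \<noteq> 0" for y :: real using cosh_real_pos[of y] by auto
  show "((\<lambda>x. (tanh (\<beta> + x) + tanh (\<beta> - x)) / 2) has_real_derivative
    (tanh (\<beta> - x) ^ 2 - tanh (\<beta> + x) ^ 2) / 2) (at x)"
    by (auto intro!: derivative_eq_intros simp: c)
  have "tanh (\<beta> - x) \<le> tanh (\<beta> + x)" "tanh (- (\<beta> - x)) \<le> tanh (\<beta> + x)"
    unfolding tanh_real_le_iff using assms x by auto
  then have "\<bar>tanh (\<beta> - x)\<bar> \<le> tanh (\<beta> + x)" by (simp only: tanh_minus abs_le_iff)
  then have "tanh (\<beta> - x) ^ 2 \<le> tanh (\<beta> + x) ^ 2" by (metis abs_le_square_iff abs_of_nonneg abs_ge_zero order_trans)
  then show "(tanh (\<beta> - x) ^ 2 - tanh (\<beta> + x) ^ 2) / 2 \<le> 0" by simp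
qed auto

lemma concave_tanh: "concave_on {0..} (tanh :: real \<Rightarrow> real)"
proof (rule f''_le0_imp_concave)
  fix x :: real assume x: "x \<in> {0..}"
  have c: "cosh y \<noteq> 0" for y :: real using cosh_real_pos[of y] by auto
  show "(tanh has_real_derivative 1 - tanh x ^ 2) (at x)"
    by (auto intro!: derivative_eq_intros simp: c)
  show "((\<lambda>x. 1 - tanh x ^ 2) has_real_derivative - (2 * tanh x * (1 - tanh x ^ 2))) (at x)"
    by (auto intro!: derivative_eq_intros simp: c)
  have "0 \<le> 1 - tanh x ^ 2" using tanh_real_bounds[of x] by (simp add: abs_square_le_1 abs_le_iff)
  then show "- (2 * tanh x * (1 - tanh x ^ 2)) \<le> 0" using x by simp
qed auto

lemma exp_uf:
  "exp (\<beta> * spin_val s + h) + exp (- (\<beta> * spin_val s + h))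
    = 2 * exp ((ln (cosh (\<beta> + h)) + ln (cosh (\<beta> - h))) / 2) * exp (uf \<beta> h * spin_val s)"
proof (cases s)
  case Up
  have "exp ((ln (cosh (\<beta> + h)) + ln (cosh (\<beta> - h))) / 2) * exp (uf \<beta> h) = cosh (\<beta> + h)"
    unfolding exp_add[symmetric] uf_def using cosh_real_pos[of "\<beta> + h"] by (simp add: field_simps)
  then show ?thesis using Up by (simp add: cosh_field_def mult.assoc)
next
  case Down
  have "exp ((ln (cosh (\<beta> + h)) + ln (cosh (\<beta> - h))) / 2) * exp (- uf \<beta> h) = cosh (\<beta> - h)"
    unfolding exp_add[symmetric] uf_def using cosh_real_pos[of "\<beta> - h"] by (simp add: field_simps)
  then show ?thesis using Down by (simp add: cosh_field_def mult.assoc)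
qed

text \<open>
  Summing out the spin of a leaf \<open>c\<close> leaves a constant and an additional field \<open>uf \<beta> (h c)\<close> at its
  neighbour \<open>p\<close>.
\<close>

lemma gsum_leaf:
  assumes "finite L" "c \<notin> L" "p \<in> L" "finite E" "\<And>e. e \<in> E \<Longrightarrow> c \<notin> e" "\<And>x s. g (x(c := s)) = g x"
  shows "gsum (insert c L) \<xi> (fham \<beta> (insert {c, p} E) (insert c L) h) g
    = 2 * exp ((ln (cosh (\<beta> + h c)) + ln (cosh (\<beta> - h c))) / 2)
      * gsum L \<xi> (fham \<beta> E L (h(p := h p + uf \<beta> (h c)))) g"
proof -
  have cp: "c \<noteq> p" using assms by blast
  have ne: "{c, p} \<notin> E" using assms(5) by blast
  have H: "fham \<beta> (insert {c, p} E) (insert c L) h (x(c := s))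
      = fham \<beta> E L h x + spin_val s * (\<beta> * spin_val (x p) + h c)" for x s
  proof -
    have "chi e (x(c := s)) = chi e x" if "e \<in> E" for e
      by (rule chi_cong) (use assms(5)[OF that] in auto)
    then have "(\<Sum>e\<in>insert {c, p} E. chi e (x(c := s))) = spin_val s * spin_val (x p) + (\<Sum>e\<in>E. chi e x)"
      using assms(4) ne cp by (simp add: chi_pair)
    moreover have "(\<Sum>v\<in>L. h v * spin_val ((x(c := s)) v)) = (\<Sum>v\<in>L. h v * spin_val (x v))"
      by (rule sum.cong) (use assms(2) in auto)
    ultimately show ?thesis using assms(1,2) by (simp add: fham_def algebra_simps)
  qed
  have H': "fham \<beta> E L (h(p := h p + uf \<beta> (h c))) x = fham \<beta> E L h x + uf \<beta> (h c) * spin_val (x p)" for x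
    using assms(1,3) by (simp add: fham_def sum.remove[of L p] algebra_simps)
  have "exp (fham \<beta> (insert {c, p} E) (insert c L) h (x(c := Up))) * g (x(c := Up))
      + exp (fham \<beta> (insert {c, p} E) (insert c L) h (x(c := Down))) * g (x(c := Down))
    = 2 * exp ((ln (cosh (\<beta> + h c)) + ln (cosh (\<beta> - h c))) / 2)
      * (exp (fham \<beta> E L (h(p := h p + uf \<beta> (h c))) x) * g x)" for x
  proof -
    have e1: "exp (fham \<beta> (insert {c, p} E) (insert c L) h (x(c := Up)))
        = exp (fham \<beta> E L h x) * exp (\<beta> * spin_val (x p) + h c)"
      unfolding H exp_add[symmetric] by simp
    have e2: "exp (fham \<beta> (insert {c, p} E) (insert c L) h (x(c := Down)))
        = exp (fham \<beta> E L h x) * exp (- (\<beta> * spin_val (x p) + h c))"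
      unfolding H exp_add[symmetric] by simp
    have "exp (fham \<beta> (insert {c, p} E) (insert c L) h (x(c := Up))) * g (x(c := Up))
      + exp (fham \<beta> (insert {c, p} E) (insert c L) h (x(c := Down))) * g (x(c := Down))
      = exp (fham \<beta> E L h x) * (exp (\<beta> * spin_val (x p) + h c) + exp (- (\<beta> * spin_val (x p) + h c))) * g x"
      unfolding e1 e2 assms(6) by (simp only: distrib_left distrib_right)
    then show ?thesis unfolding exp_uf H' by (simp only: exp_add mult_ac)
  qed
  then show ?thesis unfolding gsum_def by (subst sum_cfg_insert[OF assms(1,2)]) (simp only: sum_distrib_left)
qed

lemma gex_leaf:
  assumes "finite L" "c \<notin> L" "p \<in> L" "finite E" "\<And>e. e \<in> E \<Longrightarrow> c \<notin> e" "\<And>x s. f (x(c := s)) = f x"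
  shows "gex (insert c L) \<xi> (fham \<beta> (insert {c, p} E) (insert c L) h) f
    = gex L \<xi> (fham \<beta> E L (h(p := h p + uf \<beta> (h c)))) f"
proof -
  have 1: "gsum (insert c L) \<xi> (fham \<beta> (insert {c, p} E) (insert c L) h) f
    = 2 * exp ((ln (cosh (\<beta> + h c)) + ln (cosh (\<beta> - h c))) / 2)
      * gsum L \<xi> (fham \<beta> E L (h(p := h p + uf \<beta> (h c)))) f"
    by (rule gsum_leaf) (use assms in auto)
  have 2: "gsum (insert c L) \<xi> (fham \<beta> (insert {c, p} E) (insert c L) h) (\<lambda>_. 1)
    = 2 * exp ((ln (cosh (\<beta> + h c)) + ln (cosh (\<beta> - h c))) / 2)
      * gsum L \<xi> (fham \<beta> E L (h(p := h p + uf \<beta> (h c)))) (\<lambda>_. 1)"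
    by (rule gsum_leaf) (use assms in auto)
  show ?thesis unfolding gex_def 1 2 by simp
qed

lemma gex_leaves:
  assumes "finite C" "finite L" "C \<inter> L = {}" "\<And>c. c \<in> C \<Longrightarrow> p c \<in> L" "finite E"
    "\<And>e. e \<in> E \<Longrightarrow> e \<inter> C = {}" "\<And>x c s. c \<in> C \<Longrightarrow> f (x(c := s)) = f x"
  shows "gex (C \<union> L) \<xi> (fham \<beta> ((\<lambda>c. {c, p c}) ` C \<union> E) (C \<union> L) h) f
    = gex L \<xi> (fham \<beta> E L (\<lambda>v. h v + (\<Sum>c\<in>{c\<in>C. p c = v}. uf \<beta> (h c)))) f"
  using assms(1,3,4,6,7)
proof (induction C arbitrary: h rule: finite_induct)
  case empty then show ?case by simp
next
  case (insert c C)
  let ?h = "h(p c := h (p c) + uf \<beta> (h c))"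
  have pC: "p c' \<noteq> c''" if "c' \<in> insert c C" "c'' \<in> insert c C" for c' c''
    using insert.prems(1,2) that by blast
  have "gex (insert c (C \<union> L)) \<xi> (fham \<beta> (insert {c, p c} ((\<lambda>c. {c, p c}) ` C \<union> E)) (insert c (C \<union> L)) h) f
    = gex (C \<union> L) \<xi> (fham \<beta> ((\<lambda>c. {c, p c}) ` C \<union> E) (C \<union> L) ?h) f"
  proof (rule gex_leaf)
    show "c \<notin> e" if "e \<in> (\<lambda>c. {c, p c}) ` C \<union> E" for e
      using that insert.hyps(2) insert.prems(3)[of e] pC[of _ c] by auto
    show "f (x(c := s)) = f x" for x s by (rule insert.prems(4)) simp
    show "p c \<in> C \<union> L" using insert.prems(2)[of c] by simp
  qed (use insert.hyps insert.prems(1) assms(2,5) in auto)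
  also have "\<dots> = gex L \<xi> (fham \<beta> E L (\<lambda>v. ?h v + (\<Sum>c\<in>{c\<in>C. p c = v}. uf \<beta> (?h c)))) f"
  proof (rule insert.IH)
    show "f (x(c' := s)) = f x" if "c' \<in> C" for x c' s by (rule insert.prems(4)) (use that in simp)
  qed (use insert.prems(1,2,3) in auto)
  also have "(\<lambda>v. ?h v + (\<Sum>c\<in>{c\<in>C. p c = v}. uf \<beta> (?h c)))
    = (\<lambda>v. h v + (\<Sum>c'\<in>{c'\<in>insert c C. p c' = v}. uf \<beta> (h c')))"
  proof
    fix v
    have s: "(\<Sum>c\<in>{c\<in>C. p c = v}. uf \<beta> (?h c)) = (\<Sum>c\<in>{c\<in>C. p c = v}. uf \<beta> (h c))"
      by (rule sum.cong) (use pC[of c] in auto)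
    have "{c'\<in>insert c C. p c' = v} = (if p c = v then insert c {c'\<in>C. p c' = v} else {c'\<in>C. p c' = v})" by auto
    then show "?h v + (\<Sum>c\<in>{c\<in>C. p c = v}. uf \<beta> (?h c)) = h v + (\<Sum>c'\<in>{c'\<in>insert c C. p c' = v}. uf \<beta> (h c'))"
      unfolding s using insert.hyps by auto
  qed
  finally show ?case by simp
qed

subsection \<open>The recursion of effective fields on a tree\<close>

text \<open>
  One step of the recursion for the fields on a tree in which \<open>ch v\<close> are the children of \<open>v\<close>.
\<close>

definition Phi :: "(nat \<Rightarrow> nat set) \<Rightarrow> real \<Rightarrow> real \<Rightarrow> (nat \<Rightarrow> real) \<Rightarrow> nat \<Rightarrow> real" where
  "Phi ch \<beta> B g v = B + (\<Sum>c\<in>ch v. uf \<beta> (g c))"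

lemma Phi_abs:
  assumes "0 \<le> \<beta>" "\<And>v. \<bar>g v\<bar> \<le> g' v"
  shows "\<bar>(Phi ch \<beta> 0 ^^ k) g v\<bar> \<le> (Phi ch \<beta> 0 ^^ k) g' v"
proof (induction k arbitrary: v)
  case (Suc k)
  have "\<bar>\<Sum>c\<in>ch v. uf \<beta> ((Phi ch \<beta> 0 ^^ k) g c)\<bar> \<le> (\<Sum>c\<in>ch v. uf \<beta> ((Phi ch \<beta> 0 ^^ k) g' c))"
    by (rule order_trans[OF sum_abs sum_mono]) (rule uf_abs[OF assms(1) Suc])
  then show ?case by (simp add: Phi_def[where v = v])
qed (use assms in simp)

lemma Phi_iter_concave:
  assumes "0 \<le> \<beta>" "0 \<le> B" "0 \<le> c" "c \<le> 1"
    and "\<And>v. 0 \<le> g0 v" "\<And>v. 0 \<le> g1 v" "\<And>v. (1 - c) * g0 v + c * g1 v \<le> gc v"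
  shows "0 \<le> (Phi ch \<beta> B ^^ k) g0 v \<and> 0 \<le> (Phi ch \<beta> B ^^ k) g1 v \<and>
    (1 - c) * (Phi ch \<beta> B ^^ k) g0 v + c * (Phi ch \<beta> B ^^ k) g1 v \<le> (Phi ch \<beta> B ^^ k) gc v"
proof (induction k arbitrary: v)
  case (Suc k)
  let ?G = "\<lambda>g. (Phi ch \<beta> B ^^ k) g"
  have uc: "(1 - c) * uf \<beta> (?G g0 w) + c * uf \<beta> (?G g1 w) \<le> uf \<beta> (?G gc w)" for w
  proof -
    have "(1 - c) * uf \<beta> (?G g0 w) + c * uf \<beta> (?G g1 w) \<le> uf \<beta> ((1 - c) * ?G g0 w + c * ?G g1 w)"
      using concave_onD[OF concave_uf[OF assms(1)] assms(3,4), of "?G g0 w" "?G g1 w"] Suc[of w] by simp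
    also have "\<dots> \<le> uf \<beta> (?G gc w)" using Suc[of w] by (intro uf_mono assms) auto
    finally show ?thesis .
  qed
  have "(1 - c) * (\<Sum>w\<in>ch v. uf \<beta> (?G g0 w)) + c * (\<Sum>w\<in>ch v. uf \<beta> (?G g1 w)) \<le> (\<Sum>w\<in>ch v. uf \<beta> (?G gc w))"
    unfolding sum_distrib_left sum.distrib[symmetric] by (intro sum_mono uc)
  moreover have "0 \<le> (\<Sum>w\<in>ch v. uf \<beta> (?G g0 w))" "0 \<le> (\<Sum>w\<in>ch v. uf \<beta> (?G g1 w))"
    using Suc by (auto intro!: sum_nonneg uf_nonneg assms)
  ultimately show ?case using assms(2) by (simp add: Phi_def[where v = v] algebra_simps)
qed (use assms in simp)

text \<open>
  In a positive field the free and the plus boundary conditions agree in the limit. Replacing the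
  free boundary at level \<open>d\<close> by a free boundary at level \<open>d + 1\<close> adds to the fields at level \<open>d\<close> a
  fixed fraction of what the plus boundary adds. By concavity, each step closes a fixed fraction of
  the gap, but the total increase is bounded.
\<close>

theorem plus_free_gap:
  fixes ch :: "nat \<Rightarrow> nat set" and o' :: nat
  assumes "0 < \<beta>" "0 < B"
  defines "p \<equiv> \<lambda>d. tanh ((Phi ch \<beta> B ^^ d) (\<lambda>v. B + \<beta> * real (card (ch v))) o')"
    and "f \<equiv> \<lambda>d. tanh ((Phi ch \<beta> B ^^ d) (\<lambda>_. B) o')"
  shows "(\<lambda>d. p d - f d) \<longlonglongrightarrow> 0"
proof -
  define c where "c = uf \<beta> B / \<beta>"
  have c: "0 < c" "c \<le> 1" using uf_pos[OF assms(1,2)] uf_le[of \<beta> B] assms(1) by (auto simp: c_def)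
  have cb: "uf \<beta> B = c * \<beta>" using assms(1) by (simp add: c_def)
  let ?g1 = "\<lambda>v. B + \<beta> * real (card (ch v))"
  have step: "(1 - c) * f d + c * p d \<le> f (Suc d) \<and> f d \<le> p d" for d
  proof -
    let ?G = "\<lambda>g. (Phi ch \<beta> B ^^ d) g o'"
    have fs: "(Phi ch \<beta> B ^^ Suc d) (\<lambda>_. B) o' = ?G (\<lambda>v. B + real (card (ch v)) * (c * \<beta>))"
      by (simp only: funpow_Suc_right comp_def) (simp add: Phi_def[abs_def] cb)
    have conc: "0 \<le> ?G (\<lambda>_. B) \<and> 0 \<le> ?G ?g1 \<and>
      (1 - c) * ?G (\<lambda>_. B) + c * ?G ?g1 \<le> ?G (\<lambda>v. B + real (card (ch v)) * (c * \<beta>))"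
      by (rule Phi_iter_concave) (use assms(1,2) c in \<open>auto simp: algebra_simps\<close>)
    have "(1 - 1) * ?G (\<lambda>_. B) + 1 * ?G (\<lambda>_. B) \<le> ?G ?g1"
      by (rule Phi_iter_concave[THEN conjunct2, THEN conjunct2]) (use assms(1,2) in auto)
    then have "f d \<le> p d" by (simp add: f_def p_def)
    moreover have "(1 - c) * f d + c * p d \<le> tanh ((1 - c) * ?G (\<lambda>_. B) + c * ?G ?g1)"
      using concave_onD[OF concave_tanh, of c "?G (\<lambda>_. B)" "?G ?g1"] conc c by (simp add: f_def p_def)
    moreover have "\<dots> \<le> f (Suc d)" unfolding f_def fs using conc by simp
    ultimately show ?thesis by linarith
  qed
  have inc: "f d \<le> f (Suc d)" for d
  proof -
    have "c * f d \<le> c * p d" using step[of d] c by simp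
    then show ?thesis using step[of d] by (simp add: left_diff_distrib)
  qed
  have "convergent f"
  proof (rule Bseq_mono_convergent)
    show "Bseq f" by (rule BseqI'[of _ 1]) (use tanh_real_bounds in \<open>auto simp: f_def abs_le_iff less_imp_le minus_less_iff\<close>)
    show "\<forall>m n. m \<le> n \<longrightarrow> f m \<le> f n" using lift_Suc_mono_le[of f] inc by blast
  qed
  then obtain l where l: "f \<longlonglongrightarrow> l" by (auto simp: convergent_def)
  have "(\<lambda>d. (f (Suc d) - f d) / c) \<longlonglongrightarrow> (l - l) / c"
    by (intro tendsto_intros l LIMSEQ_Suc) (use c in auto)
  then have lim: "(\<lambda>d. (f (Suc d) - f d) / c) \<longlonglongrightarrow> 0" by simp
  show ?thesis
  proof (rule tendsto_sandwich[OF _ _ tendsto_const lim])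
    show "\<forall>\<^sub>F d in sequentially. 0 \<le> p d - f d" using step by simp
    show "\<forall>\<^sub>F d in sequentially. p d - f d \<le> (f (Suc d) - f d) / c"
    proof (rule always_eventually, rule allI)
      fix d
      show "p d - f d \<le> (f (Suc d) - f d) / c"
      proof -
        have "(p d - f d) * c \<le> f (Suc d) - f d" using step[of d] by (simp add: algebra_simps)
        then show ?thesis using c by (simp only: pos_le_divide_eq)
      qed
    qed
  qed
qed

section \<open>Balls that are trees\<close>

definition simple_lf :: "nat set set \<Rightarrow> bool" where
  "simple_lf E \<longleftrightarrow> (\<forall>e\<in>E. \<exists>u v. u \<noteq> v \<and> e = {u, v}) \<and> (\<forall>v. finite (nbrs E v))"

text \<open>
  The ball of radius \<open>s\<close> is a tree: every vertex but the root has exactly one neighbour that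
  is not further from the root.
\<close>

definition treelike :: "nat set set \<Rightarrow> nat \<Rightarrow> nat \<Rightarrow> bool" where
  "treelike E o' s \<longleftrightarrow> (\<forall>v\<in>gball E o' s. \<forall>w w'. {v, w} \<in> E \<longrightarrow> {v, w'} \<in> E \<longrightarrow>
     gdist E o' w \<le> gdist E o' v \<longrightarrow> gdist E o' w' \<le> gdist E o' v \<longrightarrow> w = w')"

definition children :: "nat set set \<Rightarrow> nat \<Rightarrow> nat \<Rightarrow> nat set" where
  "children E o' v = {w. {v, w} \<in> E \<and> gdist E o' w = gdist E o' v + 1}"

definition level :: "nat set set \<Rightarrow> nat \<Rightarrow> nat \<Rightarrow> nat set" where
  "level E o' d = {v. gdist E o' v = enat d}"

lemma gball_gdist: "v \<in> gball E o' r \<longleftrightarrow> gdist E o' v \<le> enat r" by (simp add: gball_def)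

lemma gdist_self [simp]: "gdist E o' o' = 0"
proof -
  have "o' \<in> gball E o' 0" by (auto simp: gball_iff)
  then show ?thesis by (simp add: gball_gdist zero_enat_def[symmetric])
qed

lemma root_in_gball [simp]: "o' \<in> gball E o' r" by (simp add: gball_gdist)

lemma gdist_0: "gdist E o' v = 0 \<longleftrightarrow> v = o'"
proof
  assume "gdist E o' v = 0"
  then have "v \<in> gball E o' 0" by (simp add: gball_gdist)
  then show "v = o'" by (auto simp: gball_iff)
qed simp

lemma gball_0 [simp]: "gball E o' 0 = {o'}"
  by (auto simp: gball_iff)

lemma gball_nbr:
  assumes "u \<in> gball E o' r" "{u, w} \<in> E" shows "w \<in> gball E o' (Suc r)"
proof -
  obtain k where k: "k \<le> r" "(o', u) \<in> adj E ^^ k" using assms by (auto simp: gball_iff)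
  then have "(o', w) \<in> adj E ^^ Suc k" using assms(2) by (auto simp: adj_def)
  then show ?thesis unfolding gball_iff using k(1) by (intro exI[of _ "Suc k"]) simp
qed

lemma gdist_nbr: assumes "{u, w} \<in> E" shows "gdist E o' w \<le> gdist E o' u + 1"
proof (cases "gdist E o' u")
  case (enat r)
  then have "u \<in> gball E o' r" by (simp add: gball_gdist)
  from gball_nbr[OF this assms] show ?thesis using enat by (simp add: gball_gdist plus_1_eSuc eSuc_enat)
qed simp

lemma gdist_pred:
  assumes "gdist E o' w = enat (Suc d)" shows "\<exists>u. {w, u} \<in> E \<and> gdist E o' u = enat d"
proof -
  have "w \<in> gball E o' (Suc d)" using assms by (simp add: gball_gdist)
  then obtain k where k: "k \<le> Suc d" "(o', w) \<in> adj E ^^ k" by (auto simp: gball_iff)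
  have "\<not> k \<le> d"
  proof
    assume "k \<le> d"
    then have "w \<in> gball E o' d" using k by (auto simp: gball_iff)
    then show False using assms by (simp add: gball_gdist)
  qed
  then have "k = Suc d" using k by simp
  then obtain u where u: "(o', u) \<in> adj E ^^ d" "(u, w) \<in> adj E" using k by auto
  then have "u \<in> gball E o' d" by (auto simp: gball_iff)
  then have le: "gdist E o' u \<le> enat d" by (simp add: gball_gdist)
  have e: "{u, w} \<in> E" using u by (simp add: adj_def)
  have "enat (Suc d) \<le> gdist E o' u + 1" using gdist_nbr[OF e, of o'] assms by simp
  then have "gdist E o' u = enat d" using le by (cases "gdist E o' u") (auto simp: one_enat_def)
  then show ?thesis using e by (auto simp: insert_commute)
qed

lemma finite_gball_lf: assumes "simple_lf E" shows "finite (gball E o' r)"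
proof (induction r)
  case (Suc r)
  have "gball E o' (Suc r) \<subseteq> gball E o' r \<union> (\<Union>u\<in>gball E o' r. nbrs E u)"
  proof
    fix w assume w: "w \<in> gball E o' (Suc r)"
    show "w \<in> gball E o' r \<union> (\<Union>u\<in>gball E o' r. nbrs E u)"
    proof (cases "gdist E o' w = enat (Suc r)")
      case True
      from gdist_pred[OF this] obtain u where "{w, u} \<in> E" "gdist E o' u = enat r" by blast
      then show ?thesis by (auto simp: nbrs_def gball_gdist insert_commute)
    next
      case False
      then have "gdist E o' w \<le> enat r" using w by (cases "gdist E o' w") (auto simp: gball_gdist)
      then show ?thesis by (simp add: gball_gdist)
    qed
  qed
  moreover have "finite (\<Union>u\<in>gball E o' r. nbrs E u)" using Suc assms by (auto simp: simple_lf_def)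
  ultimately show ?case using Suc finite_subset by blast
qed simp

lemma edge_pair: "simple_lf E \<Longrightarrow> e \<in> E \<Longrightarrow> \<exists>u v. u \<noteq> v \<and> e = {u, v}" by (simp add: simple_lf_def)

lemma edge_finite: "simple_lf E \<Longrightarrow> e \<in> E \<Longrightarrow> finite e" by (auto dest: edge_pair)

lemma finite_induced: "finite W \<Longrightarrow> finite (induced E W)"
  by (rule finite_subset[of _ "Pow W"]) (auto simp: induced_def)

lemma simple_lf_net: assumes "graph_on V E" "\<And>v. v \<in> V \<Longrightarrow> finite (nbrs E v)" shows "simple_lf E"
proof -
  have "finite (nbrs E v)" for v
  proof (cases "v \<in> V")
    case False
    then have "nbrs E v = {}" using assms(1) by (auto simp: nbrs_def graph_on_def doubleton_eq_iff)
    then show ?thesis by simp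
  qed (use assms in simp)
  moreover have "\<exists>u v. u \<noteq> v \<and> e = {u, v}" if "e \<in> E" for e
    using assms(1) that unfolding graph_on_def by blast
  ultimately show ?thesis by (simp add: simple_lf_def)
qed

lemma graph_on_gball: assumes "simple_lf E" shows "graph_on W (induced E W)"
  unfolding graph_on_def
proof
  fix e assume "e \<in> induced E W"
  then show "e \<in> {{u, v} |u v. u \<in> W \<and> v \<in> W \<and> u \<noteq> v}"
    using edge_pair[OF assms, of e] by (auto simp: induced_def)
qed

lemma connected_gball: "connected_graph (gball E o' r) (induced E (gball E o' r))"
proof (rule connected_from_root[of _ o'])
  fix v assume "v \<in> gball E o' r"
  then obtain k where "k \<le> r" "(o', v) \<in> adj E ^^ k" by (auto simp: gball_iff)
  then have "(o', v) \<in> adj (induced E (gball E o' r)) ^^ k" by (intro walk_induced)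
  then show "(o', v) \<in> (adj (induced E (gball E o' r)))\<^sup>*" by (rule relpow_imp_rtrancl)
qed

text \<open>
  In an acyclic graph, two neighbours of \<open>v\<close> that are not further from the root than \<open>v\<close> are
  joined by shortest paths to the root, which avoid \<open>v\<close>; so they coincide.
\<close>

lemma acyclic_treelike:
  assumes "simple_lf E" "acyclic_graph E" shows "treelike E o' s"
  unfolding treelike_def
proof (intro ballI allI impI)
  fix v w w'
  assume v: "v \<in> gball E o' s" and e: "{v, w} \<in> E" "{v, w'} \<in> E"
    and le: "gdist E o' w \<le> gdist E o' v" "gdist E o' w' \<le> gdist E o' v"
  define F where "F = {e \<in> E. v \<notin> e}"
  have vw: "w \<noteq> v" "w' \<noteq> v" using edge_pair[OF assms(1) e(1)] edge_pair[OF assms(1) e(2)] by auto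
  have path: "u \<noteq> v \<Longrightarrow> gdist E o' u = enat d \<Longrightarrow> enat d \<le> gdist E o' v \<Longrightarrow> (o', u) \<in> (adj F)\<^sup>*" for u d
  proof (induction d arbitrary: u)
    case 0
    then have "gdist E o' u = 0" by (simp add: zero_enat_def)
    then have "u = o'" by (simp only: gdist_0)
    then show ?case by simp
  next
    case (Suc d)
    from gdist_pred[OF Suc.prems(2)] obtain z where z: "{u, z} \<in> E" "gdist E o' z = enat d" by blast
    have zv: "z \<noteq> v" using z(2) Suc.prems(3) by auto
    have "enat d \<le> enat (Suc d)" by simp
    then have "enat d \<le> gdist E o' v" using Suc.prems(3) order_trans by blast
    then have "(o', z) \<in> (adj F)\<^sup>*" using Suc.IH[OF zv z(2)] by simp
    moreover have "(z, u) \<in> adj F" using z(1) zv Suc.prems(1) by (auto simp: F_def adj_def insert_commute)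
    ultimately show ?case by (rule rtrancl_into_rtrancl)
  qed
  obtain dv where dv: "gdist E o' v = enat dv" using v by (cases "gdist E o' v") (auto simp: gball_gdist)
  obtain d d' where d: "gdist E o' w = enat d" "gdist E o' w' = enat d'"
    using le dv by (cases "gdist E o' w"; cases "gdist E o' w'") auto
  have "(o', w) \<in> (adj F)\<^sup>*" "(o', w') \<in> (adj F)\<^sup>*"
    using path[OF vw(1) d(1)] path[OF vw(2) d(2)] le d by auto
  then have "(w, w') \<in> (adj F)\<^sup>*"
    by (meson rtrancl_trans sym_adj sym_rtrancl symD)
  from adj_path[OF this] obtain y m where
    y: "y 0 = w" "y m = w'" "inj_on y {..m}" "\<And>j. j < m \<Longrightarrow> {y j, y (Suc j)} \<in> F" by metis
  show "w = w'"
  proof (rule ccontr)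
    assume "w \<noteq> w'"
    then have m: "0 < m" using y by (cases m) auto
    have yv: "y j \<noteq> v" if "j \<le> m" for j
    proof (cases "j = m")
      case True then show ?thesis using vw y by simp
    next
      case False
      then have "{y j, y (Suc j)} \<in> F" using that y(4) by simp
      then show ?thesis by (auto simp: F_def)
    qed
    let ?c = "v # map y [0..<Suc m]"
    have "distinct ?c" using y(3) yv by (auto simp: distinct_map atLeast0LessThan lessThan_Suc_atMost simp del: upt_Suc)
    moreover have "3 \<le> length ?c" using m by simp
    moreover have "{?c ! i, ?c ! (Suc i mod length ?c)} \<in> E" if i: "i < length ?c" for i
    proof -
      consider "i = 0" | j where "i = Suc j" "j < m" | "i = Suc m" using i by (cases i) (auto simp: less_Suc_eq)
      then show ?thesis
      proof cases
        case 1 then show ?thesis using m e(1) y(1) by (simp del: upt_Suc)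
      next
        case 2
        then have "{y j, y (Suc j)} \<in> E" using y(4) by (auto simp: F_def)
        then show ?thesis using 2 by (simp del: upt_Suc)
      next
        case 3 then show ?thesis using e(2) y(2) by (simp del: upt_Suc add: insert_commute)
      qed
    qed
    ultimately show False using assms(2) unfolding acyclic_graph_def by blast
  qed
qed

section \<open>Ising measures on balls that are trees\<close>

definition parent :: "nat set set \<Rightarrow> nat \<Rightarrow> nat \<Rightarrow> nat" where
  "parent E o' c = (SOME u. {c, u} \<in> E \<and> gdist E o' u + 1 = gdist E o' c)"

lemma parent:
  assumes "c \<in> level E o' (Suc d)"
  shows "{c, parent E o' c} \<in> E" "gdist E o' (parent E o' c) = enat d"
proof -
  have c: "gdist E o' c = enat (Suc d)" using assms by (simp add: level_def)
  from gdist_pred[OF this] obtain u where u: "{c, u} \<in> E" "gdist E o' u = enat d" by blast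
  have "{c, u} \<in> E \<and> gdist E o' u + 1 = gdist E o' c" using u c by (simp add: one_enat_def)
  then have *: "{c, parent E o' c} \<in> E \<and> gdist E o' (parent E o' c) + 1 = gdist E o' c"
    unfolding parent_def by (rule someI)
  then show "{c, parent E o' c} \<in> E" by simp
  show "gdist E o' (parent E o' c) = enat d" using * c
    by (cases "gdist E o' (parent E o' c)") (auto simp: one_enat_def)
qed

lemma gball_Suc: "gball E o' (Suc d) = level E o' (Suc d) \<union> gball E o' d"
proof (intro set_eqI)
  fix v show "v \<in> gball E o' (Suc d) \<longleftrightarrow> v \<in> level E o' (Suc d) \<union> gball E o' d"
    by (cases "gdist E o' v") (auto simp: gball_gdist level_def)
qed

lemma level_gball_disjoint: "level E o' (Suc d) \<inter> gball E o' d = {}"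
  by (auto simp: gball_gdist level_def)

lemma parent_unique:
  assumes "treelike E o' (Suc d)" "c \<in> level E o' (Suc d)" "{c, u} \<in> E" "gdist E o' u \<le> enat (Suc d)"
  shows "u = parent E o' c"
proof -
  note p = parent[OF assms(2)]
  have c: "gdist E o' c = enat (Suc d)" "c \<in> gball E o' (Suc d)" using assms(2) by (auto simp: level_def gball_gdist)
  show ?thesis using assms(1,3,4) p c unfolding treelike_def by (metis enat_ord_simps(1) le_SucI order_refl)
qed

lemma children_parent:
  assumes "treelike E o' (Suc d)"
  shows "{c\<in>level E o' (Suc d). parent E o' c = v} = (if gdist E o' v = enat d then children E o' v else {})"
proof (cases "gdist E o' v = enat d")
  case True
  have "c \<in> children E o' v" if "c \<in> level E o' (Suc d)" "parent E o' c = v" for c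
    using parent[OF that(1)] that True by (auto simp: children_def level_def insert_commute one_enat_def)
  moreover have "c \<in> level E o' (Suc d) \<and> parent E o' c = v" if "c \<in> children E o' v" for c
  proof -
    have c: "c \<in> level E o' (Suc d)" using that True by (simp add: children_def level_def one_enat_def)
    moreover have "v = parent E o' c"
      by (rule parent_unique[OF assms c]) (use that True in \<open>auto simp: children_def insert_commute\<close>)
    ultimately show ?thesis by simp
  qed
  ultimately show ?thesis using True by auto
next
  case False
  then show ?thesis using parent(2) by fastforce
qed

lemma induced_Suc:
  assumes "simple_lf E" "treelike E o' (Suc d)"
  shows "induced E (gball E o' (Suc d))
    = (\<lambda>c. {c, parent E o' c}) ` level E o' (Suc d) \<union> induced E (gball E o' d)"
proof (intro equalityI subsetI)
  fix e assume e: "e \<in> induced E (gball E o' (Suc d))"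
  then have "e \<in> E" by (simp add: induced_def)
  then obtain u v where uv: "e = {u, v}" using edge_pair[OF assms(1)] by blast
  have *: "{a, b} \<in> (\<lambda>c. {c, parent E o' c}) ` level E o' (Suc d)"
    if "a \<in> level E o' (Suc d)" "{a, b} = e" for a b
  proof -
    have "b = parent E o' a"
      by (rule parent_unique[OF assms(2) that(1)]) (use e that in \<open>auto simp: induced_def gball_gdist\<close>)
    then show ?thesis using that by blast
  qed
  show "e \<in> (\<lambda>c. {c, parent E o' c}) ` level E o' (Suc d) \<union> induced E (gball E o' d)"
  proof (cases "u \<in> level E o' (Suc d) \<or> v \<in> level E o' (Suc d)")
    case True
    then show ?thesis using *[of u v] *[of v u] uv by (auto simp: insert_commute)
  next
    case False
    then show ?thesis using e uv by (auto simp: induced_def gball_Suc)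
  qed
next
  fix e assume "e \<in> (\<lambda>c. {c, parent E o' c}) ` level E o' (Suc d) \<union> induced E (gball E o' d)"
  then show "e \<in> induced E (gball E o' (Suc d))"
  proof
    assume "e \<in> (\<lambda>c. {c, parent E o' c}) ` level E o' (Suc d)"
    then obtain c where c: "c \<in> level E o' (Suc d)" "e = {c, parent E o' c}" by blast
    then show ?thesis using parent[OF c(1)] by (auto simp: induced_def gball_gdist level_def)
  next
    assume "e \<in> induced E (gball E o' d)"
    then show ?thesis by (auto simp: induced_def gball_Suc)
  qed
qed

text \<open>
  The fields on the ball of radius \<open>d\<close>: at the last level they are \<open>g\<close>, which contains the effect of
  everything further away, and elsewhere the external field \<open>B\<close>.
\<close>

definition hlev :: "nat set set \<Rightarrow> nat \<Rightarrow> nat \<Rightarrow> real \<Rightarrow> (nat \<Rightarrow> real) \<Rightarrow> nat \<Rightarrow> real" where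
  "hlev E o' d B g v = (if gdist E o' v = enat d then g v else B)"

abbreviation bham :: "real \<Rightarrow> nat set set \<Rightarrow> nat \<Rightarrow> nat \<Rightarrow> (nat \<Rightarrow> real) \<Rightarrow> (nat \<Rightarrow> spin) \<Rightarrow> real" where
  "bham \<beta> E o' d h \<equiv> fham \<beta> (induced E (gball E o' d)) (gball E o' d) h"

definition local_on :: "nat set \<Rightarrow> ((nat \<Rightarrow> spin) \<Rightarrow> real) \<Rightarrow> bool" where
  "local_on W f \<longleftrightarrow> (\<forall>x y. (\<forall>v\<in>W. x v = y v) \<longrightarrow> f x = f y)"

lemma local_on_chi: "C \<subseteq> W \<Longrightarrow> local_on W (chi C)"
  unfolding local_on_def by (blast intro: chi_cong)

lemma local_on_mono: "local_on W f \<Longrightarrow> W \<subseteq> W' \<Longrightarrow> local_on W' f"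
  unfolding local_on_def by blast

lemma fham_cong: "(\<And>v. v \<in> L \<Longrightarrow> h v = h' v) \<Longrightarrow> fham \<beta> E L h = fham \<beta> E L h'"
  by (simp add: fham_def fun_eq_iff)

text \<open>
  The vertices at level \<open>d + 1\<close> of a tree are leaves of the ball of radius \<open>d + 1\<close>, and summing out
  their spins is one step of the field recursion.
\<close>

lemma peel_level:
  assumes "simple_lf E" "treelike E o' (Suc d)" "local_on (gball E o' d) f"
  shows "gex (gball E o' (Suc d)) \<xi> (bham \<beta> E o' (Suc d) (hlev E o' (Suc d) B g)) f
    = gex (gball E o' d) \<xi> (bham \<beta> E o' d (hlev E o' d B (Phi (children E o') \<beta> B g))) f"
proof -
  let ?L = "level E o' (Suc d)"
  have fin: "finite ?L" "finite (gball E o' d)"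
    using finite_gball_lf[OF assms(1), of o' "Suc d"] by (auto simp: gball_Suc)
  have "gex (?L \<union> gball E o' d) \<xi> (fham \<beta> ((\<lambda>c. {c, parent E o' c}) ` ?L \<union> induced E (gball E o' d)) (?L \<union> gball E o' d)
      (hlev E o' (Suc d) B g)) f
    = gex (gball E o' d) \<xi> (fham \<beta> (induced E (gball E o' d)) (gball E o' d)
      (\<lambda>v. hlev E o' (Suc d) B g v + (\<Sum>c\<in>{c\<in>?L. parent E o' c = v}. uf \<beta> (hlev E o' (Suc d) B g c)))) f"
  proof (rule gex_leaves[OF fin level_gball_disjoint])
    show "parent E o' c \<in> gball E o' d" if "c \<in> ?L" for c using parent[OF that] by (simp add: gball_gdist)
    show "finite (induced E (gball E o' d))" by (rule finite_induced[OF fin(2)])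
    show "e \<inter> ?L = {}" if "e \<in> induced E (gball E o' d)" for e
      using that level_gball_disjoint[of E o' d] by (auto simp: induced_def)
    show "f (x(c := s)) = f x" if "c \<in> ?L" for x c s
    proof -
      have "\<forall>v\<in>gball E o' d. (x(c := s)) v = x v" using that level_gball_disjoint[of E o' d] by auto
      then show ?thesis using assms(3) unfolding local_on_def by blast
    qed
  qed
  also have "fham \<beta> (induced E (gball E o' d)) (gball E o' d)
      (\<lambda>v. hlev E o' (Suc d) B g v + (\<Sum>c\<in>{c\<in>?L. parent E o' c = v}. uf \<beta> (hlev E o' (Suc d) B g c)))
    = bham \<beta> E o' d (hlev E o' d B (Phi (children E o') \<beta> B g))"
  proof (rule fham_cong)
    fix v assume v: "v \<in> gball E o' d"
    then have h: "hlev E o' (Suc d) B g v = B" by (auto simp: hlev_def gball_gdist)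
    have "(\<Sum>c\<in>children E o' v. uf \<beta> (hlev E o' (Suc d) B g c)) = (\<Sum>c\<in>children E o' v. uf \<beta> (g c))"
      if "gdist E o' v = enat d"
      by (rule sum.cong) (use that in \<open>auto simp: children_def hlev_def one_enat_def\<close>)
    then show "hlev E o' (Suc d) B g v + (\<Sum>c\<in>{c\<in>?L. parent E o' c = v}. uf \<beta> (hlev E o' (Suc d) B g c))
      = hlev E o' d B (Phi (children E o') \<beta> B g) v"
      unfolding h children_parent[OF assms(2)] by (simp add: hlev_def Phi_def)
  qed
  finally show ?thesis by (simp add: gball_Suc[symmetric] induced_Suc[OF assms(1,2), symmetric])
qed

lemma treelike_mono: assumes "treelike E o' s" "r \<le> s" shows "treelike E o' r"
  using assms(1) gball_mono[OF assms(2), of E o'] unfolding treelike_def by (meson subsetD)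

lemma peel:
  assumes "simple_lf E" "treelike E o' (d + k)" "local_on (gball E o' d) f"
  shows "gex (gball E o' (d + k)) \<xi> (bham \<beta> E o' (d + k) (hlev E o' (d + k) B g)) f
    = gex (gball E o' d) \<xi> (bham \<beta> E o' d (hlev E o' d B ((Phi (children E o') \<beta> B ^^ k) g))) f"
  using assms(2)
proof (induction k arbitrary: g)
  case (Suc k)
  have f: "local_on (gball E o' (d + k)) f" by (rule local_on_mono[OF assms(3)]) (simp add: gball_mono)
  have t: "treelike E o' (Suc (d + k))" "treelike E o' (d + k)" using Suc.prems treelike_mono[of E o' "Suc (d + k)" "d + k"] by simp_all
  show ?case
    using peel_level[OF assms(1) t(1) f, of \<xi> \<beta> B g] Suc.IH[OF t(2), of "Phi (children E o') \<beta> B g"]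
    by (simp only: funpow_Suc_right comp_def add_Suc_right)
qed simp

lemma gex_root: "gex (gball E o' 0) \<xi> (bham \<beta> E o' 0 (hlev E o' 0 B g)) (chi {o'}) = tanh (g o')"
  if "simple_lf E"
proof -
  have "induced E {o'} = {}" using edge_pair[OF that] by (fastforce simp: induced_def)
  then have H: "bham \<beta> E o' 0 (hlev E o' 0 B g) x = g o' * spin_val (x o')" for x
    by (simp add: fham_def hlev_def zero_enat_def)
  have s: "(\<Sum>x\<in>cfg {o'} \<xi>. G x) = G (\<xi>(o' := Up)) + G (\<xi>(o' := Down))" for G :: "(nat \<Rightarrow> spin) \<Rightarrow> real"
    using sum_cfg_insert[of "{}" o' G \<xi>] by simp
  have H2: "fham \<beta> (induced E {o'}) {o'} (hlev E o' 0 B g) x = g o' * spin_val (x o')" for x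
    using H[of x] by simp
  show ?thesis unfolding gex_def gsum_def gball_0 s H2
    by (simp add: tanh_altdef)
qed

text \<open>
  Given the spins outside a ball, only the edges that meet the ball matter, and these lie in the ball
  whose radius is larger by one.
\<close>

lemma ham_local:
  assumes "simple_lf E" "finite E'" "induced E (gball E o' (Suc d)) \<subseteq> E'" "E' \<subseteq> E" "finite V" "gball E o' d \<subseteq> V"
  shows "gex (gball E o' d) \<xi> (ham E' V \<beta> B) f
    = gex (gball E o' d) \<xi> (ham (induced E (gball E o' (Suc d))) (gball E o' d) \<beta> B) f"
proof (rule gex_shift)
  fix x assume x: "x \<in> cfg (gball E o' d) \<xi>"
  let ?F = "induced E (gball E o' (Suc d))" and ?W = "gball E o' d"
  have "chi e x = chi e \<xi>" if e: "e \<in> E' - ?F" for e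
  proof (rule chi_cong)
    fix v assume v: "v \<in> e"
    have "v \<notin> ?W"
    proof
      assume vW: "v \<in> ?W"
      have eE: "e \<in> E" using e assms(4) by blast
      from edge_pair[OF assms(1) this] obtain u1 u2 where "e = {u1, u2}" by blast
      then have "e = {v, u1} \<or> e = {v, u2}" using v by auto
      then obtain w where w: "e = {v, w}" by blast
      then have "w \<in> gball E o' (Suc d)" using gball_nbr[OF vW, of w] eE by simp
      then have "e \<in> ?F" using w vW eE gball_Suc[of E o' d] by (auto simp: induced_def)
      then show False using e by simp
    qed
    then show "x v = \<xi> v" using x by (simp add: cfg_def)
  qed
  then have 1: "(\<Sum>e\<in>E'. chi e x) = (\<Sum>e\<in>E' - ?F. chi e \<xi>) + (\<Sum>e\<in>?F. chi e x)"
    using sum.subset_diff[OF assms(3,2), of "\<lambda>e. chi e x"] by simp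
  have "(\<Sum>v\<in>V - ?W. spin_val (x v)) = (\<Sum>v\<in>V - ?W. spin_val (\<xi> v))"
    by (rule sum.cong) (use x in \<open>auto simp: cfg_def\<close>)
  then have 2: "(\<Sum>v\<in>V. spin_val (x v)) = (\<Sum>v\<in>V - ?W. spin_val (\<xi> v)) + (\<Sum>v\<in>?W. spin_val (x v))"
    using sum.subset_diff[OF assms(6,5), of "\<lambda>v. spin_val (x v)"] by simp
  show "ham E' V \<beta> B x = ham ?F ?W \<beta> B x + (\<beta> * (\<Sum>e\<in>E' - ?F. chi e \<xi>) + B * (\<Sum>v\<in>V - ?W. spin_val (\<xi> v)))"
    unfolding ham_def 1 2 by (simp add: distrib_left)
qed

lemma boundary_field:
  assumes "simple_lf E" "treelike E o' (Suc d)"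
  shows "gex (gball E o' d) \<xi> (ham (induced E (gball E o' (Suc d))) (gball E o' d) \<beta> B) f
    = gex (gball E o' d) \<xi> (bham \<beta> E o' d (hlev E o' d B (\<lambda>v. B + \<beta> * (\<Sum>c\<in>children E o' v. spin_val (\<xi> c))))) f"
proof (rule gex_shift[where c = 0])
  fix x assume x: "x \<in> cfg (gball E o' d) \<xi>"
  let ?L = "level E o' (Suc d)" and ?W = "gball E o' d" and ?p = "parent E o'"
  let ?F = "induced E ?W"
  have fin: "finite ?L" "finite ?W"
    using finite_gball_lf[OF assms(1), of o' "Suc d"] by (auto simp: gball_Suc)
  have pW: "?p c \<in> ?W" if "c \<in> ?L" for c using parent[OF that] by (simp add: gball_gdist)
  have LW: "c \<notin> ?W" if "c \<in> ?L" for c using that level_gball_disjoint[of E o' d] by auto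
  have inj: "inj_on (\<lambda>c. {c, ?p c}) ?L"
  proof (rule inj_onI)
    fix c c' assume c: "c \<in> ?L" "c' \<in> ?L" "{c, ?p c} = {c', ?p c'}"
    then show "c = c'" using pW LW by (metis doubleton_eq_iff)
  qed
  have disj: "(\<lambda>c. {c, ?p c}) ` ?L \<inter> ?F = {}" using LW by (auto simp: induced_def)
  have "(\<Sum>e\<in>induced E (gball E o' (Suc d)). chi e x) = (\<Sum>c\<in>?L. chi {c, ?p c} x) + (\<Sum>e\<in>?F. chi e x)"
    unfolding induced_Suc[OF assms] using fin finite_induced[OF fin(2)] disj
    by (subst sum.union_disjoint) (auto simp: sum.reindex[OF inj])
  also have "(\<Sum>c\<in>?L. chi {c, ?p c} x) = (\<Sum>c\<in>?L. spin_val (\<xi> c) * spin_val (x (?p c)))"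
  proof (rule sum.cong[OF refl])
    fix c assume c: "c \<in> ?L"
    have "c \<noteq> ?p c" using pW[OF c] LW[OF c] by metis
    moreover have "x c = \<xi> c" using LW[OF c] x by (simp add: cfg_def)
    ultimately show "chi {c, ?p c} x = spin_val (\<xi> c) * spin_val (x (?p c))" by (simp add: chi_pair)
  qed
  also have "\<dots> = (\<Sum>v\<in>?W. \<Sum>c\<in>{c\<in>?L. ?p c = v}. spin_val (\<xi> c) * spin_val (x (?p c)))"
    by (rule sum.group[symmetric]) (use fin pW in auto)
  also have "\<dots> = (\<Sum>v\<in>?W. (hlev E o' d 0 (\<lambda>v. \<Sum>c\<in>children E o' v. spin_val (\<xi> c)) v) * spin_val (x v))"
  proof (rule sum.cong[OF refl])
    fix v
    have "(\<Sum>c\<in>{c\<in>?L. ?p c = v}. spin_val (\<xi> c) * spin_val (x (?p c)))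
      = (\<Sum>c\<in>{c\<in>?L. ?p c = v}. spin_val (\<xi> c)) * spin_val (x v)"
      by (simp add: sum_distrib_right)
    then show "(\<Sum>c\<in>{c\<in>?L. ?p c = v}. spin_val (\<xi> c) * spin_val (x (?p c)))
      = (hlev E o' d 0 (\<lambda>v. \<Sum>c\<in>children E o' v. spin_val (\<xi> c)) v) * spin_val (x v)"
      unfolding children_parent[OF assms(2)] by (simp add: hlev_def)
  qed
  finally have 1: "(\<Sum>e\<in>induced E (gball E o' (Suc d)). chi e x)
    = (\<Sum>v\<in>?W. (hlev E o' d 0 (\<lambda>v. \<Sum>c\<in>children E o' v. spin_val (\<xi> c)) v) * spin_val (x v)) + (\<Sum>e\<in>?F. chi e x)" .
  have "(\<Sum>v\<in>?W. hlev E o' d B (\<lambda>v. B + \<beta> * (\<Sum>c\<in>children E o' v. spin_val (\<xi> c))) v * spin_val (x v))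
    = (\<Sum>v\<in>?W. \<beta> * (hlev E o' d 0 (\<lambda>v. \<Sum>c\<in>children E o' v. spin_val (\<xi> c)) v * spin_val (x v)) + B * spin_val (x v))"
    by (rule sum.cong) (auto simp: hlev_def algebra_simps)
  then show "ham (induced E (gball E o' (Suc d))) ?W \<beta> B x
    = bham \<beta> E o' d (hlev E o' d B (\<lambda>v. B + \<beta> * (\<Sum>c\<in>children E o' v. spin_val (\<xi> c)))) x + 0"
    unfolding ham_def fham_def 1 by (simp add: sum.distrib sum_distrib_left distrib_left)
qed

text \<open>The expectation for the plus boundary condition outside the ball of radius \<open>d\<close>.\<close>

definition plus_ex :: "nat set set \<Rightarrow> nat \<Rightarrow> nat \<Rightarrow> real \<Rightarrow> real \<Rightarrow> ((nat \<Rightarrow> spin) \<Rightarrow> real) \<Rightarrow> real" where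
  "plus_ex E o' d \<beta> B =
    gex (gball E o' d) all_up (ham (induced E (gball E o' (Suc d))) (gball E o' d) \<beta> B)"

definition free_ex :: "nat set set \<Rightarrow> nat \<Rightarrow> nat \<Rightarrow> real \<Rightarrow> real \<Rightarrow> ((nat \<Rightarrow> spin) \<Rightarrow> real) \<Rightarrow> real" where
  "free_ex E o' d \<beta> B =
    gex (gball E o' d) all_up (ham (induced E (gball E o' d)) (gball E o' d) \<beta> B)"

text \<open>
  Eliminating the levels one by one turns both magnetizations of the root into the hyperbolic tangent
  of an iterate of the same recursion, with different starting values.
\<close>

theorem tree_plus_free:
  assumes "simple_lf E" "\<And>s. treelike E o' s" "0 < \<beta>" "0 < B"
  shows "(\<lambda>d. plus_ex E o' d \<beta> B (chi {o'}) - free_ex E o' d \<beta> B (chi {o'})) \<longlonglongrightarrow> 0"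
proof -
  have loc: "local_on (gball E o' 0) (chi {o'})" by (rule local_on_chi) simp
  have p: "plus_ex E o' d \<beta> B (chi {o'})
    = tanh ((Phi (children E o') \<beta> B ^^ d) (\<lambda>v. B + \<beta> * real (card (children E o' v))) o')" for d
    using peel[OF assms(1) assms(2) loc, of d all_up \<beta> B "\<lambda>v. B + \<beta> * real (card (children E o' v))"]
    unfolding plus_ex_def boundary_field[OF assms(1,2)] gex_root[OF assms(1)]
    by (simp del: gball_0)
  have f: "free_ex E o' d \<beta> B (chi {o'}) = tanh ((Phi (children E o') \<beta> B ^^ d) (\<lambda>_. B) o')" for d
  proof -
    have "ham (induced E (gball E o' d)) (gball E o' d) \<beta> B = bham \<beta> E o' d (hlev E o' d B (\<lambda>_. B))"
      by (simp add: ham_def fham_def hlev_def fun_eq_iff sum_distrib_left)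
    then show ?thesis
      using peel[OF assms(1) assms(2) loc, of d all_up \<beta> B "\<lambda>_. B"]
      unfolding free_ex_def gex_root[OF assms(1)] by (simp del: gball_0)
  qed
  show ?thesis unfolding p f by (rule plus_free_gap[OF assms(3,4)])
qed

text \<open>
  Eliminating the levels beyond \<open>r\<close> turns a boundary condition at the distance \<open>r + k\<close> into fields at
  the level \<open>r\<close>, which are dominated by those of the plus boundary. So the comparison of two systems
  that differ in their fields applies to the ball of radius \<open>r\<close>.
\<close>

theorem tree_even_correlations:
  assumes "simple_lf E" "treelike E o' (Suc (r + k))" "0 < \<beta>" "C \<subseteq> gball E o' r" "even (card C)"
    and "\<And>v. v \<in> gball E o' r \<Longrightarrow> \<beta> * real (card (nbrs E v)) \<le> M"
  defines "H \<equiv> ham (induced E (gball E o' (Suc (r + k)))) (gball E o' (r + k)) \<beta> 0"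
    and "L \<equiv> gball E o' (r + k)"
  shows "gex L all_up H (chi C) - gex L \<xi> H (chi C) \<le> leb_const \<beta> M (card (gball E o' r)) *
    (\<Sum>e\<in>induced E (gball E o' r). gex L all_up H (chi e) - gex L \<xi> H (chi e))"
proof -
  let ?W = "gball E o' r" and ?ch = "children E o'"
  let ?b = "\<lambda>\<xi> v. \<beta> * (\<Sum>c\<in>?ch v. spin_val (\<xi> c))"
  let ?g = "\<lambda>\<xi>. hlev E o' r 0 ((Phi ?ch \<beta> 0 ^^ k) (?b \<xi>))"
  have t: "treelike E o' (r + k)" by (rule treelike_mono[OF assms(2)]) simp
  have finch: "finite (?ch v)" "card (?ch v) \<le> card (nbrs E v)" for v
  proof -
    have "?ch v \<subseteq> nbrs E v" by (auto simp: children_def nbrs_def)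
    moreover have "finite (nbrs E v)" using assms(1) by (simp add: simple_lf_def)
    ultimately show "finite (?ch v)" "card (?ch v) \<le> card (nbrs E v)" by (auto intro: finite_subset card_mono)
  qed
  have red: "gex L \<xi> H (chi A) = gex ?W all_up (fham \<beta> (induced E ?W) ?W (?g \<xi>)) (chi A)" if "A \<subseteq> ?W" for A \<xi>
  proof -
    have "gex L \<xi> H (chi A) = gex L \<xi> (bham \<beta> E o' (r + k) (hlev E o' (r + k) 0 (?b \<xi>))) (chi A)"
      unfolding H_def L_def boundary_field[OF assms(1,2)] by simp
    also have "\<dots> = gex ?W \<xi> (bham \<beta> E o' r (?g \<xi>)) (chi A)"
      unfolding L_def by (rule peel[OF assms(1) t local_on_chi[OF that]])
    also have "\<dots> = gex ?W all_up (bham \<beta> E o' r (?g \<xi>)) (chi A)"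
    proof (rule gex_change_bc[OF finite_gball_lf[OF assms(1)]])
      fix x y :: "nat \<Rightarrow> spin" assume xy: "\<And>v. v \<in> ?W \<Longrightarrow> x v = y v"
      have "chi e x = chi e y" if "e \<in> induced E ?W" for e
        by (rule chi_cong) (use that xy in \<open>auto simp: induced_def\<close>)
      then show "bham \<beta> E o' r (?g \<xi>) x = bham \<beta> E o' r (?g \<xi>) y" using xy by (simp add: fham_def)
      show "chi A x = chi A y" by (rule chi_cong) (use that xy in auto)
    qed
    finally show ?thesis .
  qed
  have bb: "\<bar>?b \<xi> v\<bar> \<le> ?b all_up v" for v
  proof -
    have "\<bar>\<Sum>c\<in>?ch v. spin_val (\<xi> c)\<bar> \<le> (\<Sum>c\<in>?ch v. 1)"
      by (rule order_trans[OF sum_abs]) simp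
    then show ?thesis using assms(3) by (simp add: abs_mult)
  qed
  have abs: "\<bar>(Phi ?ch \<beta> 0 ^^ k) (?b \<xi>) v\<bar> \<le> (Phi ?ch \<beta> 0 ^^ k) (?b all_up) v" for v
    by (rule Phi_abs) (use bb assms(3) in auto)
  have bound: "(Phi ?ch \<beta> 0 ^^ k) (?b all_up) v \<le> \<beta> * real (card (?ch v))" for v
  proof (cases k)
    case (Suc j)
    have "(\<Sum>c\<in>?ch v. uf \<beta> ((Phi ?ch \<beta> 0 ^^ j) (?b all_up) c)) \<le> (\<Sum>c\<in>?ch v. \<beta>)"
      by (intro sum_mono uf_le) (use assms(3) in simp)
    then show ?thesis using Suc by (simp add: Phi_def[where v = v] mult.commute)
  qed simp
  have M0: "0 \<le> M" if "v \<in> ?W" for v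
    using assms(3) assms(6)[OF that] by (smt (verit) mult_nonneg_nonneg of_nat_0_le_iff)
  have "gex ?W all_up (fham \<beta> (induced E ?W) ?W (?g all_up)) (chi C)
      - gex ?W all_up (fham \<beta> (induced E ?W) ?W (?g \<xi>)) (chi C)
    \<le> leb_const \<beta> M (card ?W) * (\<Sum>e\<in>induced E ?W.
      gex ?W all_up (fham \<beta> (induced E ?W) ?W (?g all_up)) (chi e)
      - gex ?W all_up (fham \<beta> (induced E ?W) ?W (?g \<xi>)) (chi e))"
  proof (rule even_correlations[OF finite_gball_lf[OF assms(1)] graph_on_gball[OF assms(1)] connected_gball assms(3) _ _ assms(4,5)])
    fix v assume v: "v \<in> ?W"
    show "\<bar>?g \<xi> v\<bar> \<le> ?g all_up v" using abs[of v] by (simp add: hlev_def)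
    have "\<beta> * real (card (?ch v)) \<le> \<beta> * real (card (nbrs E v))" using finch(2)[of v] assms(3) by simp
    then have "(Phi ?ch \<beta> 0 ^^ k) (?b all_up) v \<le> M" using bound[of v] assms(6)[OF v] by linarith
    then show "?g all_up v \<le> M" using M0[OF v] by (simp add: hlev_def)
  qed
  moreover have "(\<Sum>e\<in>induced E ?W. gex L all_up H (chi e) - gex L \<xi> H (chi e)) = (\<Sum>e\<in>induced E ?W.
      gex ?W all_up (fham \<beta> (induced E ?W) ?W (?g all_up)) (chi e)
      - gex ?W all_up (fham \<beta> (induced E ?W) ?W (?g \<xi>)) (chi e))"
  proof (rule sum.cong[OF refl])
    fix e assume "e \<in> induced E ?W"
    then have "e \<subseteq> ?W" by (simp add: induced_def)
    from red[OF this] show "gex L all_up H (chi e) - gex L \<xi> H (chi e)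
      = gex ?W all_up (fham \<beta> (induced E ?W) ?W (?g all_up)) (chi e)
      - gex ?W all_up (fham \<beta> (induced E ?W) ?W (?g \<xi>)) (chi e)" by simp
  qed
  ultimately show ?thesis unfolding red[OF assms(4)] by simp
qed

section \<open>Local functions of rooted graphs\<close>

lemma adj_induced_subset: "adj (induced E W) \<subseteq> adj E" by (auto simp: adj_def induced_def)

lemma gball_induced_sup:
  assumes "gball E o' s \<subseteq> W" "r \<le> s" shows "gball (induced E W) o' r = gball E o' r"
proof -
  have mono: "(a, b) \<in> adj F ^^ k \<Longrightarrow> adj F \<subseteq> adj F' \<Longrightarrow> (a, b) \<in> adj F' ^^ k" for a b k and F F' :: "'a set set"
    by (induction k arbitrary: b) auto
  show ?thesis
  proof (intro set_eqI iffI)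
    fix v assume "v \<in> gball (induced E W) o' r"
    then show "v \<in> gball E o' r" using mono[OF _ adj_induced_subset] by (auto simp: gball_iff)
  next
    fix v assume "v \<in> gball E o' r"
    then obtain k where k: "k \<le> r" "(o', v) \<in> adj E ^^ k" by (auto simp: gball_iff)
    have "(o', v) \<in> adj (induced E (gball E o' s)) ^^ k" using walk_induced[OF k(2)] k(1) assms(2) by simp
    moreover have "adj (induced E (gball E o' s)) \<subseteq> adj (induced E W)" using assms(1) by (auto simp: adj_def induced_def)
    ultimately have "(o', v) \<in> adj (induced E W) ^^ k" by (rule mono)
    then show "v \<in> gball (induced E W) o' r" using k(1) by (auto simp: gball_iff)
  qed
qed

lemma gdist_eqI:
  assumes "\<And>r. r \<le> s \<Longrightarrow> (v \<in> gball E o' r \<longleftrightarrow> w \<in> gball E' o'' r)" "v \<in> gball E o' s"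
  shows "gdist E' o'' w = gdist E o' v"
proof -
  obtain a where a: "gdist E o' v = enat a" "a \<le> s" using assms(2) by (cases "gdist E o' v") (auto simp: gball_gdist)
  have "w \<in> gball E' o'' a" using assms(1)[OF a(2)] a by (simp add: gball_gdist)
  then obtain b where b: "gdist E' o'' w = enat b" "b \<le> a" by (cases "gdist E' o'' w") (auto simp: gball_gdist)
  have "v \<in> gball E o' b" using assms(1)[of b] a(2) b by (simp add: gball_gdist)
  then show ?thesis using a b by (simp add: gball_gdist)
qed

lemma gdist_induced_sup:
  assumes "gball E o' s \<subseteq> W" "v \<in> gball E o' s" shows "gdist (induced E W) o' v = gdist E o' v"
  by (rule gdist_eqI[of s]) (use gball_induced_sup[OF assms(1)] assms(2) in auto)

lemma induced_induced: "A \<subseteq> W \<Longrightarrow> induced (induced E W) A = induced E A"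
  by (auto simp: induced_def)

lemma nbrs_subset_gball: "nbrs E o' \<subseteq> gball E o' 1"
  using gball_nbr[of o' E o' 0] by (auto simp: nbrs_def)

lemma nbrs_induced_sup: assumes "gball E o' 1 \<subseteq> W" shows "nbrs (induced E W) o' = nbrs E o'"
  using nbrs_subset_gball[of E o'] assms root_in_gball[of o' E 1] by (auto simp: nbrs_def induced_def)

text \<open>
  A function of a graph and a vertex which depends on the ball of radius \<open>s\<close> only, up to
  isomorphism.
\<close>

definition local_fun :: "nat \<Rightarrow> (nat set set \<Rightarrow> nat \<Rightarrow> 'b) \<Rightarrow> bool" where
  "local_fun s Q \<longleftrightarrow> (\<forall>E o' W. simple_lf E \<longrightarrow> gball E o' s \<subseteq> W \<longrightarrow> Q (induced E W) o' = Q E o')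
    \<and> (\<forall>(R :: unit rnet) S f. rooted_net R \<longrightarrow> rooted_net S \<longrightarrow> net_iso f R S \<longrightarrow> Q (edges S) (rt S) = Q (edges R) (rt R))"

text \<open>
  A local function does not see which representative of an isomorphism class is chosen, so it
  defines a function of rooted graphs up to isomorphism.
\<close>

definition at_root :: "(nat set set \<Rightarrow> nat \<Rightarrow> 'b) \<Rightarrow> 'm network \<Rightarrow> 'b" where
  "at_root Q X = Q (edges (rep_network X)) (rt (rep_network X))"

lemma rooted_simple: "rooted_net R \<Longrightarrow> simple_lf (edges R)"
  by (rule simple_lf_net) (auto simp: rooted_net_def)

lemma at_root_abs:
  assumes "local_fun s Q" "rooted_net R" shows "at_root Q (abs_network (R :: unit rnet)) = Q (edges R) (rt R)"
proof -
  have "net_eq R R" using assms(2) net_iso_refl by (auto simp: net_eq_def)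
  then have "net_eq R (rep_network (abs_network R))"
    using Quotient_rep_abs[OF Quotient_network] part_equivp_symp[OF part_equivp_net_eq] by blast
  then show ?thesis using assms unfolding net_eq_def local_fun_def at_root_def by metis
qed

lemma at_root_trunc:
  assumes "local_fun s Q" shows "at_root Q (trunc s X) = at_root Q (X :: unit network)"
proof -
  let ?R = "rep_network X"
  have R: "rooted_net ?R" by (rule rooted_net_rep)
  have "trunc s X = abs_network (raw_trunc s ?R)"
    using trunc.abs_eq[OF net_eq_rep, of s X] abs_rep_network[of X] by simp
  then have "at_root Q (trunc s X) = Q (edges (raw_trunc s ?R)) (rt (raw_trunc s ?R))"
    using at_root_abs[OF assms rooted_net_trunc[OF R]] by simp
  also have "\<dots> = at_root Q X"
    using assms rooted_simple[OF R] by (simp add: local_fun_def at_root_def)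
  finally show ?thesis .
qed

lemma dist_trunc:
  assumes "dist X Y < 1 / (real s + 1)" shows "trunc s X = trunc s (Y :: 'm network)"
proof -
  have "enat s < agree_radius X Y"
  proof (cases "agree_radius X Y")
    case (enat r)
    then have "1 / (real r + 1) < 1 / (real s + 1)" using assms by (simp add: dist_network_def)
    then have "real s + 1 < real r + 1" by (simp add: field_simps)
    then show ?thesis using enat by simp
  qed simp
  then obtain r where r: "trunc r X = trunc r Y" "s < r"
    unfolding agree_radius_def by (auto simp: less_SUP_iff)
  then show ?thesis using trunc_trunc[of s r X] trunc_trunc[of s r Y] by simp
qed

lemma trunc_fun_continuous:
  fixes g :: "'m network \<Rightarrow> 'b :: topological_space"
  assumes "\<And>X Y. trunc s X = trunc s Y \<Longrightarrow> g X = g Y"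
  shows "continuous_on UNIV g"
proof -
  have "isCont g X" for X
    unfolding isCont_def
  proof (rule tendsto_eventually)
    have gY: "g Y = g X" if "dist Y X < 1 / (real s + 1)" for Y
      using assms[OF dist_trunc[OF that]] .
    show "\<forall>\<^sub>F Y in at X. g Y = g X"
      unfolding eventually_at
    proof (intro exI conjI ballI impI)
      show "0 < 1 / (real s + 1)" by simp
      fix Y assume "Y \<noteq> X \<and> dist Y X < 1 / (real s + 1)"
      then show "g Y = g X" by (intro gY) (rule conjunct2)
    qed
  qed
  then show ?thesis by (intro continuous_at_imp_continuous_on ballI)
qed

lemma at_root_continuous:
  fixes Q :: "nat set set \<Rightarrow> nat \<Rightarrow> 'b :: topological_space"
  assumes "local_fun s Q" shows "continuous_on UNIV (at_root Q :: unit network \<Rightarrow> 'b)"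
proof (rule trunc_fun_continuous[of s])
  fix X Y :: "unit network" assume "trunc s X = trunc s Y"
  then show "at_root Q X = at_root Q Y"
    using at_root_trunc[OF assms, of X] at_root_trunc[OF assms, of Y] by simp
qed

lemma at_root_measurable:
  fixes Q :: "nat set set \<Rightarrow> nat \<Rightarrow> 'b :: topological_space"
  assumes "local_fun s Q" shows "(at_root Q :: unit network \<Rightarrow> 'b) \<in> borel_measurable borel"
  by (rule borel_measurable_continuous_onI[OF at_root_continuous[OF assms]])

lemma local_fun_comp: "local_fun s Q \<Longrightarrow> local_fun s (\<lambda>E o'. h (Q E o'))"
  unfolding local_fun_def by metis

lemma local_fun_induced: "local_fun s Q \<Longrightarrow> simple_lf E \<Longrightarrow> gball E v s \<subseteq> W \<Longrightarrow> Q (induced E W) v = Q E v"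
  unfolding local_fun_def by blast

lemma local_fun_iso:
  fixes R S :: "unit rnet"
  shows "local_fun s Q \<Longrightarrow> rooted_net R \<Longrightarrow> rooted_net S \<Longrightarrow> net_iso f R S
    \<Longrightarrow> Q (edges S) (rt S) = Q (edges R) (rt R)"
  unfolding local_fun_def by blast

lemma local_funI:
  assumes "\<And>E v W. simple_lf E \<Longrightarrow> gball E v s \<subseteq> W \<Longrightarrow> Q (induced E W) v = Q E v"
    and "\<And>(R :: unit rnet) S f. rooted_net R \<Longrightarrow> rooted_net S \<Longrightarrow> net_iso f R S \<Longrightarrow> Q (edges S) (rt S) = Q (edges R) (rt R)"
  shows "local_fun s Q"
  unfolding local_fun_def using assms by blast

lemma local_fun_comp2:
  assumes "local_fun s Q" "local_fun s Q'" shows "local_fun s (\<lambda>E o'. h (Q E o') (Q' E o'))"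
proof (rule local_funI)
  fix E v W assume *: "simple_lf E" "gball E v s \<subseteq> W"
  show "h (Q (induced E W) v) (Q' (induced E W) v) = h (Q E v) (Q' E v)"
    using local_fun_induced[OF assms(1) *] local_fun_induced[OF assms(2) *] by simp
next
  fix R S :: "unit rnet" and f assume *: "rooted_net R" "rooted_net S" "net_iso f R S"
  show "h (Q (edges S) (rt S)) (Q' (edges S) (rt S)) = h (Q (edges R) (rt R)) (Q' (edges R) (rt R))"
    using local_fun_iso[OF assms(1) *] local_fun_iso[OF assms(2) *] by simp
qed

lemma local_fun_mono:
  assumes "local_fun s Q" "s \<le> s'" shows "local_fun s' Q"
proof (rule local_funI)
  fix E v W assume *: "simple_lf E" "gball E v s' \<subseteq> W"
  then have "gball E v s \<subseteq> W" using gball_mono[OF assms(2), of E v] by blast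
  then show "Q (induced E W) v = Q E v" by (rule local_fun_induced[OF assms(1) *(1)])
qed (rule local_fun_iso[OF assms(1)])

subsection \<open>Isomorphism invariance\<close>

context
  fixes f :: "nat \<Rightarrow> nat" and R S :: "'m rnet"
  assumes iso: "net_iso f R S" and R: "rooted_net R" and S: "rooted_net S"
begin

private abbreviation "E \<equiv> edges R"
private abbreviation "E' \<equiv> edges S"
private abbreviation "oR \<equiv> rt R"
private abbreviation "oS \<equiv> rt S"

lemma iso_inj: "inj_on f (verts R)" and iso_root: "f oR = oS"
  using iso by (auto simp: net_iso_def bij_betw_def)

lemma iso_gball: "f ` gball E oR r = gball E' oS r" by (rule net_iso_ball[OF iso R S])

lemma iso_edge: "u \<in> verts R \<Longrightarrow> v \<in> verts R \<Longrightarrow> {f u, f v} \<in> E' \<longleftrightarrow> {u, v} \<in> E"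
  using iso by (simp add: net_iso_def)

lemma iso_in_gball: assumes "v \<in> verts R" shows "f v \<in> gball E' oS r \<longleftrightarrow> v \<in> gball E oR r"
  using gball_subset[OF R, of r] iso_inj assms unfolding iso_gball[symmetric] by (auto dest: inj_onD)

lemma iso_gdist: assumes "v \<in> verts R" shows "gdist E' oS (f v) = gdist E oR v"
proof -
  obtain k where "v \<in> gball E oR k" using in_some_gball[OF R assms] by blast
  then show ?thesis by (intro gdist_eqI[of k]) (auto simp: iso_in_gball[OF assms])
qed

lemma iso_induced: "(`) f ` induced E (gball E oR r) = induced E' (gball E' oS r)"
proof (intro equalityI subsetI)
  fix e assume "e \<in> (`) f ` induced E (gball E oR r)"
  then obtain e0 where e0: "e = f ` e0" "e0 \<in> E" "e0 \<subseteq> gball E oR r" by (auto simp: induced_def)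
  obtain u v where uv: "e0 = {u, v}" using edge_pair[OF rooted_simple[OF R] e0(2)] by blast
  have "u \<in> verts R" "v \<in> verts R" using uv e0 gball_subset[OF R] by auto
  then have "e \<in> E'" using e0 uv iso_edge by simp
  moreover have "e \<subseteq> gball E' oS r" unfolding iso_gball[symmetric] using e0 by blast
  ultimately show "e \<in> induced E' (gball E' oS r)" by (simp add: induced_def)
next
  fix e assume "e \<in> induced E' (gball E' oS r)"
  then have e: "e \<in> E'" "e \<subseteq> f ` gball E oR r" unfolding iso_gball by (auto simp: induced_def)
  obtain u' v' where "e = {u', v'}" using edge_pair[OF rooted_simple[OF S] e(1)] by blast
  then obtain u v where uv: "e = {f u, f v}" "u \<in> gball E oR r" "v \<in> gball E oR r" using e(2) by auto
  then have "{u, v} \<in> E" using e(1) iso_edge gball_subset[OF R] by blast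
  then have "{u, v} \<in> induced E (gball E oR r)" using uv by (simp add: induced_def)
  then show "e \<in> (`) f ` induced E (gball E oR r)" using uv(1) by (intro image_eqI[of _ _ "{u, v}"]) auto
qed

lemma iso_nbrs: assumes "v \<in> verts R" shows "f ` nbrs E v = nbrs E' (f v)"
proof (intro equalityI subsetI)
  fix w assume "w \<in> f ` nbrs E v"
  then obtain u where u: "w = f u" "{v, u} \<in> E" by (auto simp: nbrs_def)
  have "u \<in> verts R" using R u(2) by (auto simp: rooted_net_def graph_on_def doubleton_eq_iff)
  then show "w \<in> nbrs E' (f v)" using iso_edge[OF assms] u by (simp add: nbrs_def)
next
  fix w assume "w \<in> nbrs E' (f v)"
  then have w: "{f v, w} \<in> E'" by (simp add: nbrs_def)
  then have "w \<in> verts S" using S by (auto simp: rooted_net_def graph_on_def doubleton_eq_iff)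
  then have "w \<in> f ` verts R" using iso by (simp add: net_iso_def bij_betw_def)
  then obtain u where "w = f u" "u \<in> verts R" by blast
  then show "w \<in> f ` nbrs E v" using iso_edge[OF assms] w by (auto simp: nbrs_def)
qed

lemma iso_card_gball: "card (gball E' oS r) = card (gball E oR r)"
  unfolding iso_gball[symmetric] by (rule card_image[OF inj_on_subset[OF iso_inj gball_subset[OF R]]])

lemma iso_card_nbrs: "card (nbrs E' oS) = card (nbrs E oR)"
proof -
  have oR: "oR \<in> verts R" using R by (simp add: rooted_net_def)
  have "nbrs E oR \<subseteq> verts R" using nbrs_subset_gball[of E oR] gball_subset[OF R, of 1] by blast
  then have "inj_on f (nbrs E oR)" by (rule inj_on_subset[OF iso_inj])
  then show ?thesis using iso_nbrs[OF oR] iso_root by (metis card_image)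
qed

lemma iso_treelike: "treelike E' oS r \<longleftrightarrow> treelike E oR r"
proof -
  have e: "u \<in> verts R" if "{v, u} \<in> E" for u v
    using R that by (auto simp: rooted_net_def graph_on_def doubleton_eq_iff)
  have e': "\<exists>u\<in>verts R. w = f u" if "{v, w} \<in> E'" for w v
  proof -
    have "w \<in> verts S" using S that by (auto simp: rooted_net_def graph_on_def doubleton_eq_iff)
    then show ?thesis using iso by (auto simp: net_iso_def bij_betw_def)
  qed
  show ?thesis
  proof
    assume t: "treelike E' oS r"
    show "treelike E oR r" unfolding treelike_def
    proof (intro ballI allI impI)
      fix v w w' assume v: "v \<in> gball E oR r" and vw: "{v, w} \<in> E" "{v, w'} \<in> E"
        and le: "gdist E oR w \<le> gdist E oR v" "gdist E oR w' \<le> gdist E oR v"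
      have vR: "v \<in> verts R" "w \<in> verts R" "w' \<in> verts R" using v gball_subset[OF R] e[OF vw(1)] e[OF vw(2)] by auto
      have "f w = f w'"
        using t[unfolded treelike_def, rule_format, of "f v" "f w" "f w'"] v vw le vR
        by (simp add: iso_in_gball iso_edge iso_gdist)
      then show "w = w'" using iso_inj vR by (auto dest: inj_onD)
    qed
  next
    assume t: "treelike E oR r"
    show "treelike E' oS r" unfolding treelike_def
    proof (intro ballI allI impI)
      fix v w w' assume v: "v \<in> gball E' oS r" and vw: "{v, w} \<in> E'" "{v, w'} \<in> E'"
        and le: "gdist E' oS w \<le> gdist E' oS v" "gdist E' oS w' \<le> gdist E' oS v"
      obtain v0 where v0: "v0 \<in> gball E oR r" "v = f v0" using v unfolding iso_gball[symmetric] by blast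
      obtain w0 w0' where w0: "w0 \<in> verts R" "w = f w0" "w0' \<in> verts R" "w' = f w0'"
        using e'[OF vw(1)] e'[OF vw(2)] by blast
      have vR: "v0 \<in> verts R" using v0 gball_subset[OF R] by blast
      have "w0 = w0'"
        using t[unfolded treelike_def, rule_format, of v0 w0 w0'] v0 w0 vw le vR
        by (simp add: iso_edge iso_gdist)
      then show "w = w'" using w0 by simp
    qed
  qed
qed

text \<open>
  Outside of the region \<open>L\<close> the spins are up, so an isomorphism transports configurations on \<open>L\<close>
  although it is defined on the vertices of \<open>R\<close> only.
\<close>

lemma gex_iso:
  assumes "U \<subseteq> verts R" "L \<subseteq> U" "finite L" "finite F" "\<And>e. e \<in> F \<Longrightarrow> e \<subseteq> U"
    and "\<And>x. x \<in> cfg (f ` L) all_up \<Longrightarrow> G' x = G (\<lambda>v. if v \<in> L then x (f v) else Up)"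
  shows "gex (f ` L) all_up (ham ((`) f ` F) (f ` L) \<beta> B) G' = gex L all_up (ham F L \<beta> B) G"
proof -
  have injU: "inj_on f U" by (rule inj_on_subset[OF iso_inj assms(1)])
  have injL: "inj_on f L" by (rule inj_on_subset[OF injU assms(2)])
  let ?p = "\<lambda>x v. if v \<in> L then x (f v) else Up"
  let ?q = "\<lambda>x v. if v \<in> f ` L then x (inv_into L f v) else Up"
  have H: "ham ((`) f ` F) (f ` L) \<beta> B x = ham F L \<beta> B (?p x)" if x: "x \<in> cfg (f ` L) all_up" for x
  proof -
    have injF: "inj_on ((`) f) F"
      by (rule inj_onI) (metis assms(5) injU inj_on_image_eq_iff)
    have xf: "x (f v) = ?p x v" if "v \<in> U" for v
    proof (cases "v \<in> L")
      case False
      then have "f v \<notin> f ` L" using injU that assms(2) by (auto dest: inj_onD)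
      then show ?thesis using x False by (simp add: cfg_def)
    qed simp
    have "chi (f ` e) x = chi e (?p x)" if "e \<in> F" for e
    proof -
      have eU: "e \<subseteq> U" using assms(5)[OF that] .
      then have "inj_on f e" by (rule inj_on_subset[OF injU])
      then have "chi (f ` e) x = (\<Prod>v\<in>e. spin_val (x (f v)))" by (simp add: chi_def prod.reindex)
      also have "\<dots> = chi e (?p x)" unfolding chi_def
        by (rule prod.cong[OF refl]) (use eU xf in \<open>simp only: subsetD\<close>)
      finally show ?thesis .
    qed
    then have "(\<Sum>e\<in>(`) f ` F. chi e x) = (\<Sum>e\<in>F. chi e (?p x))" by (simp add: sum.reindex[OF injF])
    moreover have "(\<Sum>v\<in>f ` L. spin_val (x v)) = (\<Sum>v\<in>L. spin_val (?p x v))" by (simp add: sum.reindex[OF injL])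
    ultimately show ?thesis by (simp add: ham_def)
  qed
  have "gsum (f ` L) all_up (ham ((`) f ` F) (f ` L) \<beta> B) g' = gsum L all_up (ham F L \<beta> B) g"
    if g: "\<And>x. x \<in> cfg (f ` L) all_up \<Longrightarrow> g' x = g (?p x)" for g' g
    unfolding gsum_def
  proof (rule sum.reindex_bij_witness[of _ ?q ?p])
    fix x assume x: "x \<in> cfg (f ` L) all_up"
    show "?q (?p x) = x" using x injL by (auto simp: fun_eq_iff cfg_def)
    show "?p x \<in> cfg L all_up" by (simp add: cfg_def)
    show "exp (ham F L \<beta> B (?p x)) * g (?p x) = exp (ham ((`) f ` F) (f ` L) \<beta> B x) * g' x"
      using H[OF x] g[OF x] by simp
  next
    fix x assume x: "x \<in> cfg L all_up"
    show "?p (?q x) = x" using x injL by (auto simp: fun_eq_iff cfg_def)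
    show "?q x \<in> cfg (f ` L) all_up" by (simp add: cfg_def)
  qed
  from this[of G' G] this[of "\<lambda>_. 1" "\<lambda>_. 1"] show ?thesis using assms(6) by (simp add: gex_def)
qed

lemma plus_ex_iso:
  assumes "\<And>x. x \<in> cfg (gball E' oS d) all_up \<Longrightarrow> G' x = G (\<lambda>v. if v \<in> gball E oR d then x (f v) else Up)"
  shows "plus_ex E' oS d \<beta> B G' = plus_ex E oR d \<beta> B G"
proof -
  have 1: "induced E' (gball E' oS (Suc d)) = (`) f ` induced E (gball E oR (Suc d))"
    and 2: "gball E' oS d = f ` gball E oR d" by (simp_all only: iso_induced iso_gball)
  show ?thesis unfolding plus_ex_def 1 2
  proof (rule gex_iso[OF gball_subset[OF R, of "Suc d"]])
    show "finite (induced E (gball E oR (Suc d)))" by (rule finite_induced[OF finite_gball[OF R]])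
    show "e \<subseteq> gball E oR (Suc d)" if "e \<in> induced E (gball E oR (Suc d))" for e using that by (simp add: induced_def)
  qed (use assms in \<open>auto simp: iso_gball finite_gball[OF R] gball_Suc\<close>)
qed

lemma free_ex_iso:
  assumes "\<And>x. x \<in> cfg (gball E' oS d) all_up \<Longrightarrow> G' x = G (\<lambda>v. if v \<in> gball E oR d then x (f v) else Up)"
  shows "free_ex E' oS d \<beta> B G' = free_ex E oR d \<beta> B G"
proof -
  have 1: "induced E' (gball E' oS d) = (`) f ` induced E (gball E oR d)"
    and 2: "gball E' oS d = f ` gball E oR d" by (simp_all only: iso_induced iso_gball)
  show ?thesis unfolding free_ex_def 1 unfolding 2
  proof (rule gex_iso[OF gball_subset[OF R, of d]])
    show "finite (induced E (gball E oR d))" by (rule finite_induced[OF finite_gball[OF R]])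
    show "e \<subseteq> gball E oR d" if "e \<in> induced E (gball E oR d)" for e using that by (simp add: induced_def)
  qed (use assms in \<open>auto simp: iso_gball finite_gball[OF R]\<close>)
qed

lemma chi_iso:
  assumes "C \<subseteq> gball E oR d"
  shows "chi (f ` C) x = chi C (\<lambda>v. if v \<in> gball E oR d then x (f v) else Up)"
proof -
  have "inj_on f C" by (rule inj_on_subset[OF iso_inj]) (use assms gball_subset[OF R] in blast)
  then have "chi (f ` C) x = (\<Prod>v\<in>C. spin_val (x (f v)))" by (simp add: chi_def prod.reindex)
  also have "\<dots> = chi C (\<lambda>v. if v \<in> gball E oR d then x (f v) else Up)"
    unfolding chi_def by (rule prod.cong) (use assms in auto)
  finally show ?thesis .
qed

end

definition vdeg :: "nat set set \<Rightarrow> nat \<Rightarrow> nat" where "vdeg E v = card (nbrs E v)"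

definition edge_sum :: "nat \<Rightarrow> real \<Rightarrow> real \<Rightarrow> nat set set \<Rightarrow> nat \<Rightarrow> real" where
  "edge_sum d \<beta> B E v = (\<Sum>w\<in>nbrs E v. plus_ex E v d \<beta> B (chi {v, w}))"

definition mag_gap :: "nat \<Rightarrow> real \<Rightarrow> real \<Rightarrow> nat set set \<Rightarrow> nat \<Rightarrow> real" where
  "mag_gap d \<beta> B E v = plus_ex E v d \<beta> B (chi {v}) - free_ex E v d \<beta> B (chi {v})"

lemma plus_ex_induced:
  assumes "gball E o' s \<subseteq> W" "Suc d \<le> s" shows "plus_ex (induced E W) o' d = plus_ex E o' d"
proof -
  have "gball E o' (Suc d) \<subseteq> W" using gball_mono[OF assms(2), of E o'] assms(1) by blast
  then show ?thesis using assms(2) by (simp add: plus_ex_def fun_eq_iff gball_induced_sup[OF assms(1)] induced_induced)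
qed

lemma free_ex_induced:
  assumes "gball E o' s \<subseteq> W" "d \<le> s" shows "free_ex (induced E W) o' d = free_ex E o' d"
proof -
  have "gball E o' d \<subseteq> W" using gball_mono[OF assms(2), of E o'] assms(1) by blast
  then show ?thesis using assms(2) by (simp add: free_ex_def fun_eq_iff gball_induced_sup[OF assms(1)] induced_induced)
qed

lemma local_fun_degree: "local_fun 1 vdeg"
  by (rule local_funI) (simp_all add: vdeg_def nbrs_induced_sup iso_card_nbrs)

lemma local_fun_card_gball: "local_fun r (\<lambda>E v. card (gball E v r))"
  by (rule local_funI) (simp_all add: gball_induced_sup iso_card_gball)

lemma local_fun_treelike: "local_fun r (\<lambda>E v. treelike E v r)"
proof -
  have "treelike (induced E W) v r = treelike E v r" if sub: "gball E v r \<subseteq> W" for E W v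
  proof -
    have in_ball: "w \<in> gball E v r" if "u \<in> gball E v r" "gdist E v w \<le> gdist E v u" for u w
      using that order_trans by (auto simp: gball_gdist)
    have in_ball': "w \<in> gball E v r" if "u \<in> gball E v r" "gdist (induced E W) v w \<le> gdist (induced E W) v u" for u w
    proof -
      have "gdist (induced E W) v w \<le> gdist E v u" using that gdist_induced_sup[OF sub] by simp
      then have "w \<in> gball (induced E W) v r" using that(1) order_trans by (auto simp: gball_gdist)
      then show ?thesis by (simp add: gball_induced_sup[OF sub])
    qed
    have e: "{u, w} \<in> induced E W \<longleftrightarrow> {u, w} \<in> E" if "u \<in> gball E v r" "w \<in> gball E v r" for u w
      using that sub by (auto simp: induced_def)
    show ?thesis unfolding treelike_def gball_induced_sup[OF sub order_refl]
      by (intro ball_cong refl iffI allI impI; metis in_ball in_ball' e gdist_induced_sup[OF sub])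
  qed
  then show ?thesis by (intro local_funI) (simp_all add: iso_treelike)
qed

lemma local_fun_edge_sum:
  assumes "1 \<le> d" shows "local_fun (Suc d) (edge_sum d \<beta> B)"
proof -
  have 1: "edge_sum d \<beta> B (induced E W) v = edge_sum d \<beta> B E v" if "gball E v (Suc d) \<subseteq> W" for E W v
  proof -
    have "gball E v 1 \<subseteq> W" using gball_mono[of 1 "Suc d" E v] that by auto
    then show ?thesis unfolding edge_sum_def by (simp add: nbrs_induced_sup plus_ex_induced[OF that order_refl])
  qed
  have 2: "edge_sum d \<beta> B (edges S) (rt S) = edge_sum d \<beta> B (edges R) (rt R)"
    if R: "rooted_net R" and S: "rooted_net S" and f: "net_iso f R S" for R S :: "unit rnet" and f
  proof -
    note iso = f R S
    have a: "rt R \<in> verts R" using R by (simp add: rooted_net_def)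
    have nb: "nbrs (edges R) (rt R) \<subseteq> gball (edges R) (rt R) d"
      using nbrs_subset_gball[of "edges R" "rt R"] gball_mono[OF assms, of "edges R" "rt R"] by blast
    have inj: "inj_on f (nbrs (edges R) (rt R))"
      by (rule inj_on_subset[OF iso_inj[OF iso]]) (use nb gball_subset[OF R] in blast)
    have "edge_sum d \<beta> B (edges S) (rt S) = (\<Sum>w\<in>f ` nbrs (edges R) (rt R). plus_ex (edges S) (rt S) d \<beta> B (chi {rt S, w}))"
      unfolding edge_sum_def iso_nbrs[OF iso a] iso_root[OF iso] ..
    also have "\<dots> = (\<Sum>w\<in>nbrs (edges R) (rt R). plus_ex (edges S) (rt S) d \<beta> B (chi (f ` {rt R, w})))"
      by (simp add: sum.reindex[OF inj] iso_root[OF iso])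
    also have "\<dots> = edge_sum d \<beta> B (edges R) (rt R)"
      unfolding edge_sum_def
    proof (rule sum.cong[OF refl])
      fix w assume w: "w \<in> nbrs (edges R) (rt R)"
      show "plus_ex (edges S) (rt S) d \<beta> B (chi (f ` {rt R, w})) = plus_ex (edges R) (rt R) d \<beta> B (chi {rt R, w})"
        by (rule plus_ex_iso[OF iso], rule chi_iso[OF iso]) (use w nb in auto)
    qed
    finally show ?thesis .
  qed
  show ?thesis by (rule local_funI[OF 1 2])
qed

lemma local_fun_mag_gap: "local_fun (Suc d) (mag_gap d \<beta> B)"
proof -
  have 2: "mag_gap d \<beta> B (edges S) (rt S) = mag_gap d \<beta> B (edges R) (rt R)"
    if R: "rooted_net R" and S: "rooted_net S" and f: "net_iso f R S" for R S :: "unit rnet" and f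
  proof -
    note iso = f R S
    have "chi {rt S} x = chi {rt R} (\<lambda>v. if v \<in> gball (edges R) (rt R) d then x (f v) else Up)" for x
      using chi_iso[OF iso, of "{rt R}" d x] iso_root[OF iso] by simp
    then show ?thesis unfolding mag_gap_def
      by (intro arg_cong2[of _ _ _ _ "(-)"] plus_ex_iso[OF iso] free_ex_iso[OF iso])
  qed
  show ?thesis
    by (rule local_funI, simp add: mag_gap_def plus_ex_induced free_ex_induced, rule 2)
qed

subsection \<open>Local weak convergence\<close>

definition comp_net :: "nat set set \<Rightarrow> nat \<Rightarrow> unit rnet" where
  "comp_net E i = RNet (component E i) (induced E (component E i)) i (\<lambda>_. ())"

lemma gball_component: "gball E i r \<subseteq> component E i"
  by (auto simp: gball_iff component_def intro: relpow_imp_rtrancl)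

lemma rooted_comp_net: assumes "simple_lf E" shows "rooted_net (comp_net E i)"
proof -
  let ?W = "component E i"
  have "(i, v) \<in> (adj (induced E ?W))\<^sup>*" if "v \<in> ?W" for v
  proof -
    have "(i, v) \<in> (adj E)\<^sup>*" using that by (simp add: component_def)
    then show ?thesis
    proof (induction rule: rtrancl_induct)
      case (step y z)
      then have "y \<in> ?W" "z \<in> ?W" by (auto simp: component_def intro: rtrancl_into_rtrancl)
      then have "(y, z) \<in> adj (induced E ?W)" using step(2) by (auto simp: adj_def induced_def)
      then show ?case using step(3) by (rule rtrancl_into_rtrancl[rotated])
    qed simp
  qed
  moreover have "finite (nbrs (induced E ?W) v)" for v
    by (rule finite_subset[of _ "nbrs E v"]) (use assms in \<open>auto simp: nbrs_def induced_def simple_lf_def\<close>)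
  ultimately show ?thesis
    using connected_from_root[of ?W i] graph_on_gball[OF assms, of ?W]
    by (simp add: rooted_net_def comp_net_def component_def)
qed

lemma graph_on_simple: assumes "graph_on {1..n} E" shows "simple_lf E" "finite E"
proof -
  have "nbrs E v \<subseteq> {1..n}" for v using assms by (auto simp: nbrs_def graph_on_def doubleton_eq_iff)
  then show "simple_lf E" by (intro simple_lf_net[OF assms] finite_subset[OF _ finite_atLeastAtMost])
  show "finite E" by (rule finite_subset[of _ "Pow {1..n}"]) (use assms in \<open>auto simp: graph_on_def\<close>)
qed

lemma at_root_component:
  assumes "simple_lf E" "local_fun s Q"
  shows "at_root Q (sub_network E (component E i) i (\<lambda>_. ())) = Q E i"
proof -
  have "sub_network E (component E i) i (\<lambda>_. ()) = abs_network (comp_net E i)"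
    by (simp add: sub_network_def comp_net_def)
  then have "at_root Q (sub_network E (component E i) i (\<lambda>_. ())) = Q (induced E (component E i)) i"
    using at_root_abs[OF assms(2) rooted_comp_net[OF assms(1), of i]] by (simp add: comp_net_def)
  then show ?thesis using assms gball_component[of E i s] by (simp add: local_fun_def)
qed

definition avg :: "nat \<Rightarrow> (nat \<Rightarrow> real) \<Rightarrow> real" where "avg n g = (\<Sum>i\<in>{1..n}. g i) / real n"

lemma avg_mono: "(\<And>i. i \<in> {1..n} \<Longrightarrow> g i \<le> g' i) \<Longrightarrow> avg n g \<le> avg n g'"
  unfolding avg_def by (intro divide_right_mono sum_mono) auto

lemma avg_add: "avg n (\<lambda>i. g i + g' i) = avg n g + avg n g'"
  by (simp add: avg_def sum.distrib add_divide_distrib)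

lemma avg_diff: "avg n (\<lambda>i. g i - g' i) = avg n g - avg n g'"
  by (simp add: avg_def sum_subtractf diff_divide_distrib)

lemma avg_cmult: "avg n (\<lambda>i. c * g i) = c * avg n g"
  by (simp add: avg_def sum_distrib_left)

lemma avg_abs: "\<bar>avg n g\<bar> \<le> avg n (\<lambda>i. \<bar>g i\<bar>)"
  by (simp add: avg_def abs_divide divide_right_mono)

lemma abs_triangle3:
  fixes a b c d \<epsilon> :: real
  shows "\<bar>a - b\<bar> \<le> \<epsilon> / 3 \<Longrightarrow> \<bar>c - d\<bar> < \<epsilon> / 3 \<Longrightarrow> \<bar>b - c\<bar> < \<epsilon> / 3 \<Longrightarrow> \<bar>a - d\<bar> < \<epsilon>"
  by linarith

lemma integral_graph_law:
  assumes "graph_on {1..n} E" "n \<ge> 1" "local_fun s Q"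
  shows "(\<integral>X. at_root Q X \<partial>graph_law E n) = avg n (\<lambda>i. Q E i :: real)"
proof -
  have "(\<integral>X. at_root Q X \<partial>graph_law E n)
    = measure_pmf.expectation (pmf_of_set {1..n}) (\<lambda>i. at_root Q (sub_network E (component E i) i (\<lambda>_. ())))"
    unfolding graph_law_def by (rule integral_distr) (auto intro: at_root_measurable[OF assms(3)])
  also have "\<dots> = (\<Sum>i\<in>{1..n}. at_root Q (sub_network E (component E i) i (\<lambda>_. ()))) / real (card {1..n})"
    by (rule integral_pmf_of_set) (use assms(2) in auto)
  also have "\<dots> = avg n (\<lambda>i. Q E i)"
    using at_root_component[OF graph_on_simple(1)[OF assms(1)] assms(3)] by (simp add: avg_def)
  finally show ?thesis .
qed

context
  fixes E :: "nat \<Rightarrow> nat set set" and \<mu> :: "rooted_graph measure"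
  assumes E: "\<And>n. graph_on {1..n} (E n)" and \<mu>: "\<mu> \<in> U_star" and lwc: "graphs_loc_weak_conv E \<mu>"
begin

lemma \<mu>_sets [measurable_cong]: "sets \<mu> = sets borel" and \<mu>_prob: "prob_space \<mu>"
  and \<mu>_degree: "(\<integral>\<^sup>+X. ennreal (real (root_degree X)) \<partial>\<mu>) < \<infinity>"
  using \<mu> by (auto simp: U_star_def U_set_def)

lemma E_simple: "simple_lf (E n)"
  using graph_on_simple[OF E] by auto

lemma lwc_bounded:
  assumes "local_fun s Q" "\<And>F v. simple_lf F \<Longrightarrow> \<bar>Q F v\<bar> \<le> C"
  shows "(\<lambda>n. avg n (\<lambda>i. Q (E n) i)) \<longlonglongrightarrow> (\<integral>X. at_root Q X \<partial>\<mu>)"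
proof -
  have "continuous_map euclidean euclideanreal (at_root Q :: unit network \<Rightarrow> real)"
    using at_root_continuous[OF assms(1)] by simp
  moreover have "bounded (range (at_root Q :: unit network \<Rightarrow> real))"
    by (rule boundedI[of _ C]) (auto simp: at_root_def intro!: assms(2) rooted_simple rooted_net_rep)
  ultimately have "(\<lambda>n. \<integral>X. at_root Q X \<partial>graph_law (E n) n) \<longlonglongrightarrow> (\<integral>X. at_root Q X \<partial>\<mu>)"
    using lwc unfolding graphs_loc_weak_conv_def weak_conv_on_def by auto
  moreover have "\<forall>\<^sub>F n in sequentially. (\<integral>X. at_root Q X \<partial>graph_law (E n) n) = avg n (\<lambda>i. Q (E n) i)"
    using eventually_ge_at_top[of 1] by eventually_elim (rule integral_graph_law[OF E _ assms(1)])
  ultimately show ?thesis by (rule Lim_transform_eventually)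
qed

text \<open>
  Uniform sparsity is stated with a limit superior; this is the form in which it is used.
\<close>

lemma degree_tail:
  assumes "0 < \<epsilon>"
  shows "\<exists>k. \<forall>\<^sub>F n in sequentially. avg n (\<lambda>i. if k \<le> vdeg (E n) i then real (vdeg (E n) i) else 0) < \<epsilon>"
proof -
  let ?t = "\<lambda>n k. 1 / real n * (\<Sum>i\<in>{1..n}. if k \<le> card (nbrs (E n) i) then real (card (nbrs (E n) i)) else 0)"
  have "(\<lambda>k. limsup (\<lambda>n. ereal (?t n k))) \<longlonglongrightarrow> 0"
    using lwc unfolding graphs_loc_weak_conv_def uniformly_sparse_def by simp
  then have "\<forall>\<^sub>F k in sequentially. limsup (\<lambda>n. ereal (?t n k)) < ereal \<epsilon>"
    using assms by (intro order_tendstoD(2)) auto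
  then obtain k where "limsup (\<lambda>n. ereal (?t n k)) < ereal \<epsilon>"
    by (auto simp: eventually_sequentially)
  then have ev: "\<forall>\<^sub>F n in sequentially. ereal (?t n k) < ereal \<epsilon>" by (rule Limsup_lessD)
  have "?t n k = avg n (\<lambda>i. if k \<le> vdeg (E n) i then real (vdeg (E n) i) else 0)" for n
    unfolding avg_def vdeg_def by simp
  then show ?thesis using ev by (intro exI[of _ k]) (simp only: less_ereal.simps)
qed

lemma integrable_degree: "integrable \<mu> (at_root (\<lambda>F v. real (vdeg F v)))"
proof (rule integrableI_bounded)
  show "at_root (\<lambda>F v. real (vdeg F v)) \<in> borel_measurable \<mu>"
    using at_root_measurable[OF local_fun_comp[OF local_fun_degree, of real]]
    by (simp cong: measurable_cong_sets[OF \<mu>_sets refl])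
  show "(\<integral>\<^sup>+X. ennreal (norm (at_root (\<lambda>F v. real (vdeg F v)) X)) \<partial>\<mu>) < \<infinity>"
    using \<mu>_degree by (simp add: at_root_def vdeg_def root_degree_def Let_def)
qed

lemma at_root_measurable_\<mu>: "local_fun s Q \<Longrightarrow> at_root Q \<in> borel_measurable \<mu>"
  for Q :: "nat set set \<Rightarrow> nat \<Rightarrow> real"
  using at_root_measurable[of s Q] by (simp cong: measurable_cong_sets[OF \<mu>_sets refl])

lemma integrable_degree_bound:
  assumes "local_fun s Q" "\<And>F v. simple_lf F \<Longrightarrow> \<bar>Q F v\<bar> \<le> C * real (vdeg F v)"
  shows "integrable \<mu> (at_root Q :: unit network \<Rightarrow> real)"
  by (rule Bochner_Integration.integrable_bound[OF integrable_mult_right[OF integrable_degree, of C]])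
     (auto simp: at_root_def intro!: at_root_measurable_\<mu>[OF assms(1)] AE_I2
        order_trans[OF assms(2)[OF rooted_simple[OF rooted_net_rep]]])

text \<open>Uniform sparsity extends the convergence to functions dominated by the degree.\<close>

theorem lwc_degree:
  assumes "local_fun s Q" "\<And>F v. simple_lf F \<Longrightarrow> \<bar>Q F v\<bar> \<le> C * real (vdeg F v)" "0 \<le> C"
  shows "(\<lambda>n. avg n (\<lambda>i. Q (E n) i)) \<longlonglongrightarrow> (\<integral>X. at_root Q X \<partial>\<mu>)"
proof (rule LIMSEQ_I)
  fix \<epsilon> :: real assume \<epsilon>: "0 < \<epsilon>"
  define Qk where "Qk k F v = (if simple_lf F \<and> vdeg F v < k then Q F v else 0)" for k :: nat and F v
  let ?loc = "local_fun (max s 1)"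
  have locQ: "?loc Q" and locD: "?loc vdeg"
    using local_fun_mono[OF assms(1), of "max s 1"] local_fun_mono[OF local_fun_degree, of "max s 1"] by auto
  have simple_ind: "simple_lf (induced F W)" if "simple_lf F" for F W
  proof -
    have sub: "nbrs (induced F W) v \<subseteq> nbrs F v" for v by (auto simp: nbrs_def induced_def)
    have fin: "finite (nbrs F v)" for v using that by (simp add: simple_lf_def)
    show ?thesis unfolding simple_lf_def
    proof (intro conjI ballI allI)
      show "finite (nbrs (induced F W) v)" for v by (rule finite_subset[OF sub fin])
      show "\<exists>u v. u \<noteq> v \<and> e = {u, v}" if "e \<in> induced F W" for e
        using edge_pair[OF \<open>simple_lf F\<close>, of e] that by (simp add: induced_def)
    qed
  qed
  have locQk: "?loc (Qk k)" for k
  proof (rule local_funI)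
    fix F v W assume F: "simple_lf F" and b: "gball F v (max s 1) \<subseteq> W"
    have "Q (induced F W) v = Q F v" "vdeg (induced F W) v = vdeg F v"
      using local_fun_induced[OF locQ F b] local_fun_induced[OF locD F b] by simp_all
    then show "Qk k (induced F W) v = Qk k F v" using F simple_ind[OF F] by (simp add: Qk_def)
  next
    fix R S :: "unit rnet" and f assume iso: "rooted_net R" "rooted_net S" "net_iso f R S"
    have "Q (edges S) (rt S) = Q (edges R) (rt R)" "vdeg (edges S) (rt S) = vdeg (edges R) (rt R)"
      using local_fun_iso[OF locQ iso] local_fun_iso[OF locD iso] by simp_all
    then show "Qk k (edges S) (rt S) = Qk k (edges R) (rt R)"
      using rooted_simple[OF iso(1)] rooted_simple[OF iso(2)] by (simp add: Qk_def)
  qed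
  have bk: "\<bar>Qk k F v\<bar> \<le> C * real k" for k F v
  proof (cases "simple_lf F \<and> vdeg F v < k")
    case True
    then have "\<bar>Q F v\<bar> \<le> C * real (vdeg F v)" using assms(2) by blast
    also have "\<dots> \<le> C * real k" using True assms(3) by (intro mult_left_mono) auto
    finally show ?thesis using True by (simp add: Qk_def)
  qed (use assms(3) in \<open>auto simp: Qk_def\<close>)
  have "(\<lambda>k. \<integral>X. at_root (Qk k) X \<partial>\<mu>) \<longlonglongrightarrow> (\<integral>X. at_root Q X \<partial>\<mu>)"
  proof (rule integral_dominated_convergence[where w = "\<lambda>X. C * at_root (\<lambda>F v. real (vdeg F v)) X"])
    show "integrable \<mu> (\<lambda>X. C * at_root (\<lambda>F v. real (vdeg F v)) X)"
      by (intro integrable_mult_right integrable_degree)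
    show "AE X in \<mu>. (\<lambda>k. at_root (Qk k) X) \<longlonglongrightarrow> at_root Q X"
    proof (rule AE_I2, rule tendsto_eventually)
      fix X :: "unit network"
      show "\<forall>\<^sub>F k in sequentially. at_root (Qk k) X = at_root Q X"
        using eventually_gt_at_top[of "at_root vdeg X"]
        by eventually_elim (simp add: at_root_def Qk_def rooted_simple[OF rooted_net_rep])
    qed
    show "AE X in \<mu>. norm (at_root (Qk k) X) \<le> C * at_root (\<lambda>F v. real (vdeg F v)) X" for k
    proof (rule AE_I2)
      fix X :: "unit network"
      show "norm (at_root (Qk k) X) \<le> C * at_root (\<lambda>F v. real (vdeg F v)) X"
        using assms(2)[OF rooted_simple[OF rooted_net_rep[of X]], of "rt (rep_network X)"] assms(3)
        by (auto simp: at_root_def Qk_def)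
    qed
  qed (intro at_root_measurable_\<mu>[OF locQ] at_root_measurable_\<mu>[OF locQk])+
  from tendstoD[OF this, of "\<epsilon> / 3"] \<epsilon>
  have "\<forall>\<^sub>F k in sequentially. \<bar>(\<integral>X. at_root (Qk k) X \<partial>\<mu>) - (\<integral>X. at_root Q X \<partial>\<mu>)\<bar> < \<epsilon> / 3"
    by (simp add: dist_real_def)
  then obtain k0 where k0: "\<And>k. k \<ge> k0 \<Longrightarrow> \<bar>(\<integral>X. at_root (Qk k) X \<partial>\<mu>) - (\<integral>X. at_root Q X \<partial>\<mu>)\<bar> < \<epsilon> / 3"
    by (auto simp: eventually_sequentially)
  obtain k1 where k1: "\<forall>\<^sub>F n in sequentially. avg n (\<lambda>i. if k1 \<le> vdeg (E n) i then real (vdeg (E n) i) else 0) < \<epsilon> / (3 * (C + 1))"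
    using degree_tail[of "\<epsilon> / (3 * (C + 1))"] \<epsilon> assms(3) by auto
  define k where "k = max k0 k1"
  have "(\<lambda>n. avg n (\<lambda>i. Qk k (E n) i)) \<longlonglongrightarrow> (\<integral>X. at_root (Qk k) X \<partial>\<mu>)"
    by (rule lwc_bounded[OF locQk bk])
  from tendstoD[OF this, of "\<epsilon> / 3"] \<epsilon>
  have ev: "\<forall>\<^sub>F n in sequentially. \<bar>avg n (\<lambda>i. Qk k (E n) i) - (\<integral>X. at_root (Qk k) X \<partial>\<mu>)\<bar> < \<epsilon> / 3"
    by (simp add: dist_real_def)
  have "\<forall>\<^sub>F n in sequentially. norm (avg n (\<lambda>i. Q (E n) i) - (\<integral>X. at_root Q X \<partial>\<mu>)) < \<epsilon>"
    using ev k1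
  proof eventually_elim
    case (elim n)
    have "\<bar>avg n (\<lambda>i. Q (E n) i) - avg n (\<lambda>i. Qk k (E n) i)\<bar> \<le> avg n (\<lambda>i. \<bar>Q (E n) i - Qk k (E n) i\<bar>)"
      unfolding avg_diff[symmetric] by (rule avg_abs)
    also have "\<dots> \<le> avg n (\<lambda>i. C * (if k1 \<le> vdeg (E n) i then real (vdeg (E n) i) else 0))"
    proof (rule avg_mono)
      fix i
      show "\<bar>Q (E n) i - Qk k (E n) i\<bar> \<le> C * (if k1 \<le> vdeg (E n) i then real (vdeg (E n) i) else 0)"
        using assms(2)[OF E_simple, of n i] assms(3) E_simple[of n] by (auto simp: Qk_def k_def)
    qed
    also have "\<dots> = C * avg n (\<lambda>i. if k1 \<le> vdeg (E n) i then real (vdeg (E n) i) else 0)" by (rule avg_cmult)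
    also have "\<dots> \<le> C * (\<epsilon> / (3 * (C + 1)))" using elim(2) assms(3) by (intro mult_left_mono) auto
    also have "\<dots> \<le> \<epsilon> / 3" using assms(3) \<epsilon> by (simp add: field_simps)
    finally have "\<bar>avg n (\<lambda>i. Q (E n) i) - avg n (\<lambda>i. Qk k (E n) i)\<bar> \<le> \<epsilon> / 3" .
    moreover have "\<bar>(\<integral>X. at_root (Qk k) X \<partial>\<mu>) - (\<integral>X. at_root Q X \<partial>\<mu>)\<bar> < \<epsilon> / 3" by (rule k0) (simp add: k_def)
    ultimately show ?case using elim(1) unfolding real_norm_def by (rule abs_triangle3)
  qed
  then show "\<exists>no. \<forall>n\<ge>no. norm (avg n (\<lambda>i. Q (E n) i) - (\<integral>X. at_root Q X \<partial>\<mu>)) < \<epsilon>"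
    by (simp add: eventually_sequentially)
qed

end

section \<open>The infinite-volume measures\<close>

subsection \<open>Measures on spin configurations from consistent cylinder averages\<close>

definition ind_on :: "nat set \<Rightarrow> (nat \<Rightarrow> spin) \<Rightarrow> (nat \<Rightarrow> spin) \<Rightarrow> real" where
  "ind_on W \<xi> y = (if \<forall>v\<in>W. y v = \<xi> v then 1 else 0)"

definition cyl :: "nat set \<Rightarrow> nat set \<Rightarrow> (nat \<Rightarrow> spin) \<Rightarrow> (nat \<Rightarrow> spin) set" where
  "cyl V W \<xi> = {y \<in> space (spin_space V). \<forall>v\<in>W. y v = \<xi> v}"

lemma space_spin_space: "space (spin_space V) = PiE V (\<lambda>_. UNIV)"
  by (simp add: spin_space_def space_PiM)

lemma local_on_ind: "local_on W (ind_on W \<xi>)"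
  unfolding local_on_def ind_on_def by simp

lemma local_expansion:
  assumes "finite W" "local_on W f"
  shows "f y = (\<Sum>\<xi>\<in>cfg W all_up. f \<xi> * ind_on W \<xi> y)"
proof -
  let ?y = "\<lambda>v. if v \<in> W then y v else Up"
  have y: "?y \<in> cfg W all_up" by (simp add: cfg_def)
  have z: "f \<xi> * ind_on W \<xi> y = (if \<xi> = ?y then f \<xi> else 0)" if "\<xi> \<in> cfg W all_up" for \<xi>
  proof -
    have "(\<forall>v\<in>W. y v = \<xi> v) \<longleftrightarrow> \<xi> = ?y" using that by (auto simp: cfg_def fun_eq_iff)
    then show ?thesis by (simp add: ind_on_def)
  qed
  have "(\<Sum>\<xi>\<in>cfg W all_up. f \<xi> * ind_on W \<xi> y) = (\<Sum>\<xi>\<in>cfg W all_up. if \<xi> = ?y then f \<xi> else 0)"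
    by (rule sum.cong[OF refl z])
  also have "\<dots> = f ?y" using y assms(1) by (simp add: sum.delta)
  also have "\<dots> = f y" using assms(2) unfolding local_on_def by simp
  finally show ?thesis ..
qed

lemma cyl_sets: assumes "finite W" "W \<subseteq> V" shows "cyl V W \<xi> \<in> sets (spin_space V)"
proof -
  have "cyl V W \<xi> = prod_emb V (\<lambda>_. count_space UNIV) W (PiE W (\<lambda>v. {\<xi> v}))"
    using assms(2) by (auto simp: cyl_def prod_emb_def spin_space_def space_PiM PiE_iff extensional_def)
  then show ?thesis unfolding spin_space_def using assms by (simp add: sets_PiM_I)
qed

lemma local_measurable:
  assumes "finite W" "W \<subseteq> V" "local_on W f" shows "f \<in> borel_measurable (spin_space V)"
proof -
  have "(\<lambda>y. \<Sum>\<xi>\<in>cfg W all_up. f \<xi> * indicator (cyl V W \<xi>) y) \<in> borel_measurable (spin_space V)"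
    using cyl_sets[OF assms(1,2)] by (intro borel_measurable_sum borel_measurable_times borel_measurable_const borel_measurable_indicator) auto
  moreover have "f y = (\<Sum>\<xi>\<in>cfg W all_up. f \<xi> * indicator (cyl V W \<xi>) y)" if "y \<in> space (spin_space V)" for y
    unfolding local_expansion[OF assms(1,3), of y] using that
    by (intro sum.cong refl) (simp add: ind_on_def cyl_def indicator_def)
  ultimately show ?thesis by (simp cong: measurable_cong)
qed

lemma local_bounded: assumes "finite W" "local_on W f" shows "\<exists>c. \<forall>x. \<bar>f x\<bar> \<le> c"
proof -
  have "\<bar>f y\<bar> \<le> (\<Sum>\<xi>\<in>cfg W all_up. \<bar>f \<xi>\<bar>)" for y
    unfolding local_expansion[OF assms, of y]
    by (rule order_trans[OF sum_abs sum_mono]) (simp add: ind_on_def)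
  then show ?thesis by blast
qed

lemma integral_local:
  assumes "finite W" "W \<subseteq> V" "local_on W f" "sets \<nu> = sets (spin_space V)" "prob_space \<nu>"
  shows "(\<integral>x. f x \<partial>\<nu>) = (\<Sum>\<xi>\<in>cfg W all_up. f \<xi> * measure \<nu> (cyl V W \<xi>))"
proof -
  interpret prob_space \<nu> by fact
  have sp: "space \<nu> = space (spin_space V)" by (rule sets_eq_imp_space_eq[OF assms(4)])
  have c: "cyl V W \<xi> \<in> sets \<nu>" for \<xi> using cyl_sets[OF assms(1,2)] assms(4) by simp
  have "(\<integral>x. f x \<partial>\<nu>) = (\<integral>x. (\<Sum>\<xi>\<in>cfg W all_up. f \<xi> * indicator (cyl V W \<xi>) x) \<partial>\<nu>)"
  proof (rule Bochner_Integration.integral_cong[OF refl])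
    fix y assume "y \<in> space \<nu>"
    then show "f y = (\<Sum>\<xi>\<in>cfg W all_up. f \<xi> * indicator (cyl V W \<xi>) y)"
      unfolding local_expansion[OF assms(1,3), of y] sp
      by (intro sum.cong refl) (simp add: ind_on_def cyl_def indicator_def)
  qed
  also have "\<dots> = (\<Sum>\<xi>\<in>cfg W all_up. f \<xi> * measure \<nu> (cyl V W \<xi>))"
    using c by (subst Bochner_Integration.integral_sum) (auto simp: emeasure_eq_measure)
  finally show ?thesis .
qed

lemma spin_measure_eqI:
  assumes "sets \<nu> = sets (spin_space V)" "prob_space \<nu>" "sets \<nu>' = sets (spin_space V)" "prob_space \<nu>'"
    and "\<And>W f. finite W \<Longrightarrow> W \<subseteq> V \<Longrightarrow> local_on W f \<Longrightarrow> (\<integral>x. f x \<partial>\<nu>) = (\<integral>x. f x \<partial>\<nu>')"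
  shows "\<nu> = \<nu>'"
proof (rule measure_eqI_PiM_infinite)
  show "sets \<nu> = sets (Pi\<^sub>M V (\<lambda>_. count_space UNIV))" "sets \<nu>' = sets (Pi\<^sub>M V (\<lambda>_. count_space UNIV))"
    using assms(1,3) by (simp_all add: spin_space_def)
  show "finite_measure \<nu>" by (rule prob_space.finite_measure[OF assms(2)])
  fix A :: "nat \<Rightarrow> spin set" and J assume J: "finite J" "J \<subseteq> V"
  let ?S = "prod_emb V (\<lambda>_. count_space UNIV) J (Pi\<^sub>E J A)"
  let ?f = "\<lambda>y. if \<forall>v\<in>J. y v \<in> A v then 1 else 0 :: real"
  have f: "local_on J ?f" unfolding local_on_def by simp
  have "emeasure \<rho> ?S = ennreal (\<integral>x. ?f x \<partial>\<rho>)" if \<rho>: "sets \<rho> = sets (spin_space V)" "prob_space \<rho>" for \<rho>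
  proof -
    interpret prob_space \<rho> by fact
    have sp: "space \<rho> = PiE V (\<lambda>_. UNIV)" using sets_eq_imp_space_eq[OF \<rho>(1)] by (simp add: space_spin_space)
    have "?S \<in> sets \<rho>" using J by (simp add: \<rho> spin_space_def sets_PiM_I)
    moreover have "(\<integral>x. ?f x \<partial>\<rho>) = (\<integral>x. indicator ?S x \<partial>\<rho>)"
      by (rule Bochner_Integration.integral_cong[OF refl])
         (use J(2) sp in \<open>auto simp: prod_emb_def indicator_def PiE_iff subset_iff\<close>)
    ultimately show ?thesis by (simp add: emeasure_eq_measure)
  qed
  then show "emeasure \<nu> ?S = emeasure \<nu>' ?S" using assms(1-4) assms(5)[OF J f] by simp
qed

text \<open>
  A limit of positive normalized functionals on local functions gives consistent laws of finitely
  many spins, hence a measure by Kolmogorov's extension theorem.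
\<close>

theorem cylinder_extension:
  fixes \<Phi> :: "nat \<Rightarrow> ((nat \<Rightarrow> spin) \<Rightarrow> real) \<Rightarrow> real"
  assumes lin: "\<And>d W c f. finite W \<Longrightarrow> \<Phi> d (\<lambda>y. \<Sum>\<xi>\<in>cfg W all_up. c \<xi> * f \<xi> y) = (\<Sum>\<xi>\<in>cfg W all_up. c \<xi> * \<Phi> d (f \<xi>))"
    and one: "\<And>d. \<Phi> d (\<lambda>_. 1) = 1" and pos: "\<And>d f. (\<And>x. 0 \<le> f x) \<Longrightarrow> 0 \<le> \<Phi> d f"
    and conv: "\<And>W f. finite W \<Longrightarrow> W \<subseteq> V \<Longrightarrow> local_on W f \<Longrightarrow> convergent (\<lambda>d. \<Phi> d f)"
  obtains \<nu> where "sets \<nu> = sets (spin_space V)" "prob_space \<nu>"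
    "\<And>W f. finite W \<Longrightarrow> W \<subseteq> V \<Longrightarrow> local_on W f \<Longrightarrow> (\<lambda>d. \<Phi> d f) \<longlonglongrightarrow> (\<integral>x. f x \<partial>\<nu>)"
proof -
  define Lf where "Lf f = lim (\<lambda>d. \<Phi> d f)" for f
  have Lf: "(\<lambda>d. \<Phi> d f) \<longlonglongrightarrow> Lf f" if "finite W" "W \<subseteq> V" "local_on W f" for W f
    unfolding Lf_def using conv[OF that] convergent_LIMSEQ_iff by blast
  have Lf_sum: "Lf f = (\<Sum>\<xi>\<in>cfg W all_up. f \<xi> * Lf (ind_on W \<xi>))" if W: "finite W" "W \<subseteq> V" "local_on W f" for W f
  proof (rule LIMSEQ_unique[OF Lf[OF W]])
    have fe: "f = (\<lambda>y. \<Sum>\<xi>\<in>cfg W all_up. f \<xi> * ind_on W \<xi> y)"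
      by (rule ext) (rule local_expansion[OF W(1,3)])
    have "\<Phi> d f = (\<Sum>\<xi>\<in>cfg W all_up. f \<xi> * \<Phi> d (ind_on W \<xi>))" for d
      using lin[OF W(1), of d f "ind_on W"] fe by simp
    moreover have "(\<lambda>d. \<Sum>\<xi>\<in>cfg W all_up. f \<xi> * \<Phi> d (ind_on W \<xi>)) \<longlonglongrightarrow> (\<Sum>\<xi>\<in>cfg W all_up. f \<xi> * Lf (ind_on W \<xi>))"
      by (intro tendsto_intros Lf[OF W(1,2)] local_on_ind)
    ultimately show "(\<lambda>d. \<Phi> d f) \<longlonglongrightarrow> (\<Sum>\<xi>\<in>cfg W all_up. f \<xi> * Lf (ind_on W \<xi>))" by simp
  qed
  have Lf_one: "Lf (\<lambda>_. 1) = 1" unfolding Lf_def one by simp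
  have Lf_pos: "0 \<le> Lf f" if "finite W" "W \<subseteq> V" "local_on W f" "\<And>x. 0 \<le> f x" for W f
    by (rule LIMSEQ_le_const[OF Lf[OF that(1-3)]]) (use pos[OF that(4)] in auto)
  have m0: "0 \<le> Lf (ind_on W \<xi>)" if "finite W" "W \<subseteq> V" for W \<xi>
    by (rule Lf_pos[OF that local_on_ind]) (simp add: ind_on_def)
  let ?\<phi> = "\<lambda>J (x :: nat \<Rightarrow> spin). \<lambda>i\<in>J. spin_val (x i)"
  define pm where "pm J = point_measure (cfg J all_up) (\<lambda>\<xi>. ennreal (Lf (ind_on J \<xi>)))" for J
  define P where "P J = distr (pm J) (PiM J (\<lambda>_. borel :: real measure)) (?\<phi> J)" for J
  have loc: "local_on J (\<lambda>y. indicator A (?\<phi> J y))" for J and A :: "(nat \<Rightarrow> real) set"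
    unfolding local_on_def
  proof (intro allI impI)
    fix x y :: "nat \<Rightarrow> spin" assume "\<forall>v\<in>J. x v = y v"
    then have "?\<phi> J x = ?\<phi> J y" by (auto simp: restrict_def)
    then show "indicator A (?\<phi> J x) = (indicator A (?\<phi> J y) :: real)" by simp
  qed
  have meas: "?\<phi> J \<in> measurable (pm J) (PiM J (\<lambda>_. borel))" for J
    by (simp add: pm_def space_PiM)
  have emP: "emeasure (P J) A = ennreal (Lf (\<lambda>y. indicator A (?\<phi> J y)))"
    if J: "finite J" "J \<subseteq> V" and A: "A \<in> sets (PiM J (\<lambda>_. borel))" for J and A :: "(nat \<Rightarrow> real) set"
  proof -
    have "emeasure (P J) A = emeasure (pm J) (?\<phi> J -` A \<inter> cfg J all_up)"
      unfolding P_def using A meas[of J] by (subst emeasure_distr) (auto simp: pm_def space_point_measure)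
    also have "\<dots> = (\<Sum>\<xi>\<in>?\<phi> J -` A \<inter> cfg J all_up. ennreal (Lf (ind_on J \<xi>)))"
      unfolding pm_def using J by (subst emeasure_point_measure_finite) auto
    also have "\<dots> = ennreal (\<Sum>\<xi>\<in>?\<phi> J -` A \<inter> cfg J all_up. Lf (ind_on J \<xi>))"
      by (rule sum_ennreal) (rule m0[OF J])
    also have "(\<Sum>\<xi>\<in>?\<phi> J -` A \<inter> cfg J all_up. Lf (ind_on J \<xi>))
      = (\<Sum>\<xi>\<in>cfg J all_up. indicator A (?\<phi> J \<xi>) * Lf (ind_on J \<xi>))"
      using J by (intro sum.mono_neutral_cong_left) (auto simp: indicator_def)
    also have "\<dots> = Lf (\<lambda>y. indicator A (?\<phi> J y))" by (rule Lf_sum[OF J loc, symmetric])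
    finally show ?thesis .
  qed
  have probP: "prob_space (P J)" if "finite J" "J \<subseteq> V" for J
  proof (rule prob_spaceI)
    have "?\<phi> J y \<in> space (PiM J (\<lambda>_. borel :: real measure))" for y by (simp add: space_PiM)
    then have "(\<lambda>y. indicator (space (PiM J (\<lambda>_. borel :: real measure))) (?\<phi> J y)) = (\<lambda>_. 1 :: real)"
      by (simp add: indicator_def)
    then show "emeasure (P J) (space (P J)) = 1"
      using emP[OF that sets.top] Lf_one by (simp add: P_def)
  qed
  have "projective_family V P (\<lambda>_. borel :: real measure)"
  proof (rule projective_family.intro)
    fix J H assume JH: "J \<subseteq> H" "finite H" "H \<subseteq> V"
    then have J: "finite J" "J \<subseteq> V" using finite_subset by auto
    show "P J = distr (P H) (PiM J (\<lambda>_. borel)) (\<lambda>f. restrict f J)"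
    proof (rule measure_eqI)
      fix A assume "A \<in> sets (P J)"
      then have A: "A \<in> sets (PiM J (\<lambda>_. borel))" by (simp add: P_def)
      have r: "(\<lambda>f. restrict f J) \<in> measurable (PiM H (\<lambda>_. borel)) (PiM J (\<lambda>_. borel :: real measure))"
        by (rule measurable_restrict_subset[OF JH(1)])
      have spH: "space (P H) = space (PiM H (\<lambda>_. borel))" by (simp add: P_def)
      have A': "(\<lambda>f. restrict f J) -` A \<inter> space (PiM H (\<lambda>_. borel)) \<in> sets (PiM H (\<lambda>_. borel :: real measure))"
        by (rule measurable_sets[OF r A])
      have "emeasure (distr (P H) (PiM J (\<lambda>_. borel)) (\<lambda>f. restrict f J)) A
        = emeasure (P H) ((\<lambda>f. restrict f J) -` A \<inter> space (PiM H (\<lambda>_. borel)))"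
        using A r by (subst emeasure_distr) (auto simp: spH P_def)
      also have "\<dots> = ennreal (Lf (\<lambda>y. indicator A (?\<phi> J y)))"
        unfolding emP[OF JH(2,3) A']
      proof (intro arg_cong[of _ _ "\<lambda>f. ennreal (Lf f)"] ext)
        fix y
        have "restrict (?\<phi> H y) J = ?\<phi> J y" using JH(1) by (auto simp: restrict_def fun_eq_iff)
        moreover have "?\<phi> H y \<in> space (PiM H (\<lambda>_. borel :: real measure))" by (simp add: space_PiM)
        ultimately show "indicator ((\<lambda>f. restrict f J) -` A \<inter> space (PiM H (\<lambda>_. borel))) (?\<phi> H y)
          = (indicator A (?\<phi> J y) :: real)" by (simp add: indicator_def)
      qed
      finally show "emeasure (P J) A = emeasure (distr (P H) (PiM J (\<lambda>_. borel)) (\<lambda>f. restrict f J)) A"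
        using emP[OF J A] by simp
    qed (simp add: P_def)
  qed (rule probP)
  then interpret pp: polish_projective V P by (rule polish_projective.intro)
  define \<psi> where "\<psi> = (\<lambda>(x :: nat \<Rightarrow> real). \<lambda>v\<in>V. if 0 < x v then Up else Down)"
  define \<nu> where "\<nu> = distr pp.lim (spin_space V) \<psi>"
  have m\<psi>: "\<psi> \<in> measurable pp.lim (spin_space V)"
    unfolding \<psi>_def spin_space_def
  proof (rule measurable_restrict)
    fix v assume v: "v \<in> V"
    have "(\<lambda>x. x v) \<in> measurable (PiM V (\<lambda>_. borel)) (borel :: real measure)"
      by (rule measurable_component_singleton[OF v])
    then have c: "(\<lambda>x. x v) \<in> measurable pp.lim (borel :: real measure)" by (simp cong: measurable_cong_sets)
    have "(\<lambda>r :: real. if 0 < r then Up else Down) \<in> measurable borel (count_space UNIV)" by measurable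
    from measurable_compose[OF c this]
    show "(\<lambda>x. if 0 < x v then Up else Down) \<in> measurable pp.lim (count_space UNIV)" .
  qed
  have sets\<nu>: "sets \<nu> = sets (spin_space V)" by (simp add: \<nu>_def)
  have prob\<nu>: "prob_space \<nu>" unfolding \<nu>_def by (rule pp.P.prob_space_distr[OF m\<psi>])
  have cylm: "measure \<nu> (cyl V W \<xi>) = Lf (ind_on W \<xi>)" if W: "finite W" "W \<subseteq> V" for W \<xi>
  proof -
    let ?X = "{z \<in> space (PiM W (\<lambda>_. borel :: real measure)). \<forall>v\<in>W. (0 < z v) = (\<xi> v = Up)}"
    have X: "?X \<in> sets (PiM W (\<lambda>_. borel :: real measure))" using W(1) by measurable
    have sp: "space pp.lim = space (PiM V (\<lambda>_. borel))" by simp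
    have down: "(if b then Up else Down) = s \<longleftrightarrow> (b = (s = Up))" for b s by (cases s) auto
    have "\<psi> -` cyl V W \<xi> \<inter> space pp.lim = prod_emb V (\<lambda>_. borel) W ?X"
      using W(2) measurable_space[OF m\<psi>] unfolding sp
      by (auto simp: cyl_def prod_emb_def space_PiM \<psi>_def down subset_iff PiE_iff space_spin_space)
    then have "measure \<nu> (cyl V W \<xi>) = measure (P W) ?X"
      unfolding \<nu>_def using cyl_sets[OF W] m\<psi> X W by (subst measure_distr) (simp_all add: pp.measure_lim_emb)
    also have "\<dots> = Lf (\<lambda>y. indicator ?X (?\<phi> W y))"
      unfolding measure_def emP[OF W X] by (rule enn2real_ennreal, rule Lf_pos[OF W loc]) simp
    also have "(\<lambda>y. indicator ?X (?\<phi> W y)) = ind_on W \<xi>"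
    proof
      fix y :: "nat \<Rightarrow> spin"
      have s: "(0 < spin_val a) = (b = Up) \<longleftrightarrow> a = b" for a b by (cases a; cases b) auto
      have "(\<forall>v\<in>W. (0 < ?\<phi> W y v) = (\<xi> v = Up)) \<longleftrightarrow> (\<forall>v\<in>W. y v = \<xi> v)"
        by (intro ball_cong refl) (simp add: s)
      then show "indicator ?X (?\<phi> W y) = ind_on W \<xi> y" by (simp add: indicator_def ind_on_def space_PiM)
    qed
    finally show ?thesis .
  qed
  show ?thesis
  proof (rule that[OF sets\<nu> prob\<nu>])
    fix W f assume W: "finite W" "W \<subseteq> V" "local_on W f"
    have "(\<integral>x. f x \<partial>\<nu>) = Lf f"
      unfolding integral_local[OF W sets\<nu> prob\<nu>] Lf_sum[OF W] cylm[OF W(1,2)] ..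
    then show "(\<lambda>d. \<Phi> d f) \<longlonglongrightarrow> (\<integral>x. f x \<partial>\<nu>)" using Lf[OF W] by simp
  qed
qed

subsection \<open>Continuous functions of spin configurations\<close>

text \<open>
  The configuration space is compact, so a continuous function depends, up to \<open>\<epsilon>\<close>, on finitely many
  spins.
\<close>

lemma continuous_near_local:
  assumes "continuous_map (product_topology (\<lambda>_. discrete_topology (UNIV :: spin set)) V) euclideanreal f" "0 < \<epsilon>"
  shows "\<exists>W. finite W \<and> W \<subseteq> V \<and> (\<forall>x\<in>PiE V (\<lambda>_. UNIV). \<forall>y\<in>PiE V (\<lambda>_. UNIV). (\<forall>v\<in>W. x v = y v) \<longrightarrow> \<bar>f x - f y\<bar> < \<epsilon>)"
proof -
  let ?X = "product_topology (\<lambda>_. discrete_topology (UNIV :: spin set)) V"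
  let ?S = "PiE V (\<lambda>_. UNIV :: spin set)"
  let ?cyl = "\<lambda>W x. {y \<in> ?S. \<forall>v\<in>W. y v = x v}"
  have top: "topspace ?X = ?S" by simp
  have comp: "compact_space ?X"
    by (simp add: compact_space_product_topology compact_space_discrete_topology)
  have ocyl: "openin ?X (?cyl W x)" if "finite W" "W \<subseteq> V" for W x
  proof -
    have "?cyl W x = PiE V (\<lambda>v. if v \<in> W then {x v} else UNIV)"
      using that(2) by (auto simp: PiE_iff subset_iff extensional_def split: if_splits)
    moreover have "finite {v \<in> V. (if v \<in> W then {x v} else UNIV) \<noteq> topspace (discrete_topology (UNIV :: spin set))}"
      by (rule finite_subset[OF _ that(1)]) auto
    ultimately show ?thesis by (simp add: openin_PiE_gen)
  qed
  have near: "\<exists>W. finite W \<and> W \<subseteq> V \<and> (\<forall>y\<in>?cyl W x. \<bar>f y - f x\<bar> < \<epsilon> / 2)" if x: "x \<in> ?S" for x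
  proof -
    have "openin ?X {y \<in> topspace ?X. f y \<in> ball (f x) (\<epsilon> / 2)}"
      using assms(1) by (rule openin_continuous_map_preimage) simp
    then have o: "openin ?X {y \<in> ?S. f y \<in> ball (f x) (\<epsilon> / 2)}" by (simp only: top)
    have "x \<in> {y \<in> ?S. f y \<in> ball (f x) (\<epsilon> / 2)}" using x assms(2) by simp
    with o obtain U where U: "finite {i \<in> V. U i \<noteq> (UNIV :: spin set)}" "x \<in> PiE V U"
      "PiE V U \<subseteq> {y \<in> ?S. f y \<in> ball (f x) (\<epsilon> / 2)}"
      unfolding openin_product_topology_alt by auto
    let ?W = "{i \<in> V. U i \<noteq> UNIV}"
    have "\<bar>f y - f x\<bar> < \<epsilon> / 2" if y: "y \<in> ?cyl ?W x" for y
    proof -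
      have "y \<in> PiE V U"
      proof (rule PiE_I)
        fix v assume "v \<in> V"
        then show "y v \<in> U v" using y U(2) by (cases "U v = UNIV") (auto simp: PiE_iff)
      next
        fix v assume "v \<notin> V" then show "y v = undefined" using y by (auto simp: PiE_iff extensional_def)
      qed
      then show ?thesis using U(3) by (auto simp: dist_real_def abs_minus_commute)
    qed
    then show ?thesis using U(1) by (intro exI[of _ ?W]) auto
  qed
  define good where "good x w \<longleftrightarrow> finite w \<and> w \<subseteq> V \<and> (\<forall>y\<in>?cyl w x. \<bar>f y - f x\<bar> < \<epsilon> / 2)" for x w
  have near': "\<exists>w. good x w" if "x \<in> ?S" for x using near[OF that] unfolding good_def .
  define W where "W x = (SOME w. good x w)" for x
  have Wg: "good x (W x)" if "x \<in> ?S" for x unfolding W_def by (rule someI_ex[OF near'[OF that]])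
  have W: "\<forall>x\<in>?S. finite (W x) \<and> W x \<subseteq> V \<and> (\<forall>y\<in>?cyl (W x) x. \<bar>f y - f x\<bar> < \<epsilon> / 2)"
    using Wg unfolding good_def by (rule ballI)
  let ?U = "(\<lambda>x. ?cyl (W x) x) ` ?S"
  have "openin ?X U" if U: "U \<in> ?U" for U
  proof -
    from U obtain x where x: "x \<in> ?S" "U = ?cyl (W x) x" by (rule imageE) simp
    then have "finite (W x)" "W x \<subseteq> V" using W by simp_all
    then show ?thesis unfolding x(2) by (rule ocyl)
  qed
  moreover have "?S \<subseteq> \<Union>?U" by auto
  moreover have "compactin ?X ?S" using comp by (simp only: compact_space_def top)
  ultimately have "\<exists>\<F>. finite \<F> \<and> \<F> \<subseteq> ?U \<and> ?S \<subseteq> \<Union>\<F>" by (intro compactinD)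
  then obtain \<F> where \<F>: "finite \<F>" "\<F> \<subseteq> ?U" "?S \<subseteq> \<Union>\<F>" by (elim exE conjE)
  then obtain T where T: "finite T" "T \<subseteq> ?S" "\<F> = (\<lambda>x. ?cyl (W x) x) ` T"
    using finite_subset_image[OF \<F>(1,2)] by blast
  let ?W = "\<Union>x\<in>T. W x"
  have close: "\<bar>f x - f y\<bar> < \<epsilon>" if x: "x \<in> ?S" and y: "y \<in> ?S" and xy: "\<forall>v\<in>?W. x v = y v" for x y
  proof -
    obtain z where z: "z \<in> T" "x \<in> ?cyl (W z) z" using subsetD[OF \<F>(3) x] unfolding T(3) by auto
    then have "y \<in> ?cyl (W z) z" using xy y by auto
    then have "\<bar>f x - f z\<bar> < \<epsilon> / 2" "\<bar>f y - f z\<bar> < \<epsilon> / 2" using bspec[OF W, of z] z T(2) by auto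
    then show ?thesis by linarith
  qed
  have finW: "finite ?W" using T W by (intro finite_UN_I) auto
  have "W x \<subseteq> V" if "x \<in> T" for x using bspec[OF W, of x] subsetD[OF T(2) that] by simp
  then have subW: "?W \<subseteq> V" by (rule UN_least)
  show ?thesis
  proof (intro exI[of _ ?W] conjI ballI impI finW subW)
    fix x y assume "x \<in> ?S" "y \<in> ?S" "\<forall>v\<in>?W. x v = y v"
    then show "\<bar>f x - f y\<bar> < \<epsilon>" by (rule close)
  qed
qed

lemma local_continuous:
  assumes "finite W" "W \<subseteq> V" "local_on W f"
  shows "continuous_map (product_topology (\<lambda>_. discrete_topology (UNIV :: spin set)) V) euclideanreal f"
proof -
  have "continuous_map (product_topology (\<lambda>_. discrete_topology (UNIV :: spin set)) V) euclideanreal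
    (\<lambda>y. \<Sum>\<xi>\<in>cfg W all_up. f \<xi> * (\<Prod>v\<in>W. if y v = \<xi> v then 1 else 0))"
  proof (intro continuous_map_sum continuous_map_real_mult continuous_map_prod continuous_map_const[THEN iffD2])
    fix v and \<xi> :: "nat \<Rightarrow> spin" assume "v \<in> W"
    then have "continuous_map (product_topology (\<lambda>_. discrete_topology (UNIV :: spin set)) V) (discrete_topology UNIV) (\<lambda>y :: nat \<Rightarrow> spin. y v)"
      using assms(2) by (intro continuous_map_product_projection) auto
    moreover have "continuous_map (discrete_topology UNIV) euclideanreal (\<lambda>s :: spin. if s = \<xi> v then 1 else 0)"
      by simp
    ultimately have "continuous_map (product_topology (\<lambda>_. discrete_topology (UNIV :: spin set)) V) euclideanreal
        ((\<lambda>s :: spin. if s = \<xi> v then 1 else 0) \<circ> (\<lambda>y :: nat \<Rightarrow> spin. y v))"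
      by (rule continuous_map_compose)
    then show "continuous_map (product_topology (\<lambda>_. discrete_topology (UNIV :: spin set)) V) euclideanreal
        (\<lambda>y. if y v = \<xi> v then 1 else 0)" by (simp add: comp_def)
  qed (use assms(1) in auto)
  moreover have "(\<lambda>y. \<Sum>\<xi>\<in>cfg W all_up. f \<xi> * (\<Prod>v\<in>W. if y v = \<xi> v then 1 else 0)) = f"
  proof
    fix y
    have "(\<Prod>v\<in>W. if y v = \<xi> v then 1 else 0) = ind_on W \<xi> y" for \<xi>
      using assms(1) by (auto simp: ind_on_def prod_zero_iff)
    then show "(\<Sum>\<xi>\<in>cfg W all_up. f \<xi> * (\<Prod>v\<in>W. if y v = \<xi> v then 1 else 0)) = f y"
      using local_expansion[OF assms(1,3), of y] by simp
  qed
  ultimately show ?thesis by simp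
qed

text \<open>
  By compactness, convergence of the averages of local functions is weak convergence.
\<close>

lemma weak_conv_local:
  assumes "\<And>d. sets (M d) = sets (spin_space V)" "\<And>d. prob_space (M d)" "sets \<nu> = sets (spin_space V)" "prob_space \<nu>"
    and "\<And>W f. finite W \<Longrightarrow> W \<subseteq> V \<Longrightarrow> local_on W f \<Longrightarrow> (\<lambda>d. \<integral>x. f x \<partial>M d) \<longlonglongrightarrow> (\<integral>x. f x \<partial>\<nu>)"
  shows "weak_conv_on (product_topology (\<lambda>_. discrete_topology UNIV) V) M \<nu>"
  unfolding weak_conv_on_def
proof (intro allI impI, elim conjE)
  fix f :: "(nat \<Rightarrow> spin) \<Rightarrow> real"
  let ?S = "PiE V (\<lambda>_. UNIV :: spin set)"
  assume cont: "continuous_map (product_topology (\<lambda>_. discrete_topology UNIV) V) euclideanreal f"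
  define ext where "ext W x = (\<lambda>v\<in>V. if v \<in> W then x v else Up)" for W and x :: "nat \<Rightarrow> spin"
  have approx: "\<exists>W. finite W \<and> W \<subseteq> V \<and> local_on W (\<lambda>x. f (ext W x)) \<and> (\<forall>x\<in>?S. \<bar>f x - f (ext W x)\<bar> < \<epsilon>)" if "0 < \<epsilon>" for \<epsilon>
  proof -
    from continuous_near_local[OF cont that] obtain W where W0: "finite W \<and> W \<subseteq> V \<and>
      (\<forall>x\<in>?S. \<forall>y\<in>?S. (\<forall>v\<in>W. x v = y v) \<longrightarrow> \<bar>f x - f y\<bar> < \<epsilon>)" by (rule exE)
    have W: "finite W" "W \<subseteq> V"
      "\<And>x y. x \<in> ?S \<Longrightarrow> y \<in> ?S \<Longrightarrow> \<forall>v\<in>W. x v = y v \<Longrightarrow> \<bar>f x - f y\<bar> < \<epsilon>"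
      using W0 by simp_all
    have loc: "local_on W (\<lambda>x. f (ext W x))"
      unfolding local_on_def
    proof (intro allI impI)
      fix x y :: "nat \<Rightarrow> spin" assume "\<forall>v\<in>W. x v = y v"
      then have "ext W x = ext W y" by (auto simp: ext_def restrict_def)
      then show "f (ext W x) = f (ext W y)" by simp
    qed
    have cl: "\<bar>f x - f (ext W x)\<bar> < \<epsilon>" if "x \<in> ?S" for x
      by (rule W(3)[OF that]) (use W(2) in \<open>auto simp: ext_def\<close>)
    show ?thesis by (intro exI[of _ W] conjI ballI W(1,2) loc cl)
  qed
  define good where "good \<epsilon> w \<longleftrightarrow> finite w \<and> w \<subseteq> V \<and> local_on w (\<lambda>x. f (ext w x))
    \<and> (\<forall>x\<in>?S. \<bar>f x - f (ext w x)\<bar> < \<epsilon>)" for \<epsilon> w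
  define W where "W n = (SOME w. good (inverse (real (Suc n))) w)" for n
  have Wg: "good (inverse (real (Suc n))) (W n)" for n
    unfolding W_def by (rule someI_ex, unfold good_def, rule approx) simp
  have W: "finite (W n)" "W n \<subseteq> V" "local_on (W n) (\<lambda>x. f (ext (W n) x))"
    "x \<in> ?S \<Longrightarrow> \<bar>f x - f (ext (W n) x)\<bar> < inverse (real (Suc n))" for n x
    using Wg[of n] by (simp_all add: good_def)
  have fm: "f \<in> borel_measurable (spin_space V)"
  proof (rule borel_measurable_LIMSEQ_real)
    show "(\<lambda>x. f (ext (W n) x)) \<in> borel_measurable (spin_space V)" for n by (rule local_measurable[OF W(1) W(2) W(3)])
    fix x assume "x \<in> space (spin_space V)"
    then have x: "x \<in> ?S" by (simp add: space_spin_space)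
    show "(\<lambda>n. f (ext (W n) x)) \<longlonglongrightarrow> f x"
    proof (rule LIM_zero_cancel, rule Lim_null_comparison)
      show "\<forall>\<^sub>F n in sequentially. norm (f (ext (W n) x) - f x) \<le> inverse (real (Suc n))"
        using W(4)[OF x] by (intro always_eventually allI) (simp add: abs_minus_commute less_imp_le)
    qed (rule LIMSEQ_inverse_real_of_nat)
  qed
  have close: "\<bar>(\<integral>x. f x \<partial>N) - (\<integral>x. f (ext (W n) x) \<partial>N)\<bar> \<le> inverse (real (Suc n))"
    if N: "sets N = sets (spin_space V)" "prob_space N" for N n
  proof -
    interpret prob_space N by fact
    have sp: "space N = ?S" using sets_eq_imp_space_eq[OF N(1)] by (simp add: space_spin_space)
    obtain c where c: "\<And>x. \<bar>f (ext (W n) x)\<bar> \<le> c" using local_bounded[OF W(1,3)] by blast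
    have m1: "(\<lambda>x. f (ext (W n) x)) \<in> borel_measurable N" and m2: "f \<in> borel_measurable N"
      using local_measurable[OF W(1-3)] fm by (simp_all cong: measurable_cong_sets[OF N(1) refl])
    have i1: "integrable N (\<lambda>x. f (ext (W n) x))"
      by (rule integrable_const_bound[of _ c]) (use c m1 in auto)
    have i2: "integrable N f"
    proof (rule integrable_const_bound[of _ "c + inverse (real (Suc n))"])
      show "AE x in N. norm (f x) \<le> c + inverse (real (Suc n))"
      proof (rule AE_I2)
        fix x assume "x \<in> space N"
        then show "norm (f x) \<le> c + inverse (real (Suc n))" using W(4)[of x n] c[of x] sp by (simp add: abs_le_iff abs_less_iff)
      qed
    qed (rule m2)
    have "\<bar>(\<integral>x. f x \<partial>N) - (\<integral>x. f (ext (W n) x) \<partial>N)\<bar> = \<bar>\<integral>x. f x - f (ext (W n) x) \<partial>N\<bar>"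
      using i1 i2 by simp
    also have "\<dots> \<le> (\<integral>x. \<bar>f x - f (ext (W n) x)\<bar> \<partial>N)" by (rule integral_abs_bound)
    also have "\<dots> \<le> (\<integral>x. inverse (real (Suc n)) \<partial>N)"
      by (rule integral_mono) (use i1 i2 W(4) sp in \<open>auto intro: less_imp_le\<close>)
    finally show ?thesis by (simp add: prob_space)
  qed
  show "(\<lambda>d. \<integral>x. f x \<partial>M d) \<longlonglongrightarrow> (\<integral>x. f x \<partial>\<nu>)"
  proof (rule LIMSEQ_I)
    fix \<epsilon> :: real assume "0 < \<epsilon>"
    then obtain n where n: "inverse (real (Suc n)) < \<epsilon> / 3" using reals_Archimedean[of "\<epsilon> / 3"] by auto
    from LIMSEQ_D[OF assms(5)[OF W(1-3)], of "\<epsilon> / 3" n] \<open>0 < \<epsilon>\<close> obtain d0 where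
      d0: "\<And>d. d \<ge> d0 \<Longrightarrow> \<bar>(\<integral>x. f (ext (W n) x) \<partial>M d) - (\<integral>x. f (ext (W n) x) \<partial>\<nu>)\<bar> < \<epsilon> / 3" by auto
    have "\<bar>(\<integral>x. f x \<partial>M d) - (\<integral>x. f x \<partial>\<nu>)\<bar> < \<epsilon>" if "d \<ge> d0" for d
    proof (rule abs_triangle3[where b = "\<integral>x. f (ext (W n) x) \<partial>M d" and c = "\<integral>x. f (ext (W n) x) \<partial>\<nu>"])
      show "\<bar>(\<integral>x. f x \<partial>M d) - (\<integral>x. f (ext (W n) x) \<partial>M d)\<bar> \<le> \<epsilon> / 3" using close[OF assms(1,2), of d n] n by linarith
      show "\<bar>(\<integral>x. f (ext (W n) x) \<partial>\<nu>) - (\<integral>x. f x \<partial>\<nu>)\<bar> < \<epsilon> / 3" using close[OF assms(3,4), of n] n by (subst abs_minus_commute) linarith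
    qed (rule d0[OF that])
    then show "\<exists>no. \<forall>d\<ge>no. norm ((\<integral>x. f x \<partial>M d) - (\<integral>x. f x \<partial>\<nu>)) < \<epsilon>" by auto
  qed
qed

subsection \<open>The limit of the plus and minus boundary conditions\<close>

definition bc_ex :: "nat set set \<Rightarrow> nat \<Rightarrow> nat \<Rightarrow> spin \<Rightarrow> real \<Rightarrow> ((nat \<Rightarrow> spin) \<Rightarrow> real) \<Rightarrow> real" where
  "bc_ex E o' d s \<beta> =
    gex (gball E o' d) (\<lambda>_. s) (ham (induced E (gball E o' (Suc d))) (gball E o' d) \<beta> 0)"

definition sflip :: "(nat \<Rightarrow> spin) \<Rightarrow> nat \<Rightarrow> spin" where "sflip x = (\<lambda>v. smul Down (x v))"

lemma chi_sflip: "chi A (sflip x) = (-1) ^ card A * chi A x"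
  by (simp add: sflip_def chi_def prod.distrib[symmetric] prod_constant[symmetric] del: prod_constant)

lemma sflip_sflip [simp]: "sflip (sflip x) = x"
  by (rule ext) (simp add: sflip_def smul_def, metis (full_types) spin.exhaust)

lemma gex_sflip:
  assumes "simple_lf E" "F \<subseteq> E"
  shows "gex L (sflip \<xi>) (ham F V \<beta> 0) f = gex L \<xi> (ham F V \<beta> 0) (\<lambda>x. f (sflip x))"
proof -
  have "chi e (sflip x) = chi e x" if "e \<in> F" for e x
  proof -
    from edge_pair[OF assms(1) subsetD[OF assms(2) that]] have "card e = 2" by auto
    then show ?thesis by (simp add: chi_sflip)
  qed
  then have H: "ham F V \<beta> 0 (sflip x) = ham F V \<beta> 0 x" for x by (simp add: ham_def)
  have mem: "sflip x \<in> cfg L (sflip \<xi>) \<longleftrightarrow> x \<in> cfg L \<xi>" for x \<xi>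
    by (auto simp: cfg_def sflip_def smul_def) (metis (full_types) spin.exhaust)+
  have mem': "sflip x \<in> cfg L \<xi> \<longleftrightarrow> x \<in> cfg L (sflip \<xi>)" for x using mem[of x "sflip \<xi>"] by simp
  have "gsum L (sflip \<xi>) (ham F V \<beta> 0) g = gsum L \<xi> (ham F V \<beta> 0) (\<lambda>x. g (sflip x))" for g
    unfolding gsum_def
    by (rule sum.reindex_bij_witness[of _ sflip sflip]) (simp_all add: H mem mem')
  then show ?thesis by (simp add: gex_def)
qed

lemma bc_ex_up: "bc_ex E o' d Up \<beta> = plus_ex E o' d \<beta> 0"
  by (simp add: bc_ex_def plus_ex_def fun_eq_iff)

text \<open>
  Without an external field, a global flip of the spins exchanges the two boundary conditions.
\<close>

lemma bc_ex_down:
  assumes "simple_lf E" shows "bc_ex E o' d Down \<beta> f = plus_ex E o' d \<beta> 0 (\<lambda>x. f (sflip x))"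
proof -
  have eq: "(\<lambda>_. Down) = sflip all_up" by (simp add: sflip_def smul_def fun_eq_iff)
  have "induced E (gball E o' (Suc d)) \<subseteq> E" by (auto simp: induced_def)
  then show ?thesis unfolding bc_ex_def plus_ex_def eq by (rule gex_sflip[OF assms])
qed

lemma plus_ex_decreasing:
  assumes "simple_lf E" "C \<subseteq> gball E o' d" "0 \<le> \<beta>" "0 \<le> B"
  shows "plus_ex E o' (Suc d) \<beta> B (chi C) \<le> plus_ex E o' d \<beta> B (chi C)"
proof -
  let ?F = "induced E (gball E o' (Suc (Suc d)))" and ?M = "gball E o' (Suc d)"
  have fin: "finite (gball E o' r)" for r by (rule finite_gball_lf[OF assms(1)])
  have sub: "gball E o' d \<subseteq> gball E o' (Suc d)" "gball E o' (Suc d) \<subseteq> gball E o' (Suc (Suc d))" by (auto simp: gball_Suc)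
  have "plus_ex E o' (Suc d) \<beta> B (chi C) \<le> gex (gball E o' d) all_up (ham ?F ?M \<beta> B) (chi C)"
    unfolding plus_ex_def
    by (rule plus_domain) (use assms fin sub finite_induced edge_finite[OF assms(1)] in \<open>auto simp: induced_def\<close>)
  also have "\<dots> = plus_ex E o' d \<beta> B (chi C)"
    unfolding plus_ex_def
    by (rule ham_local[OF assms(1)]) (use fin sub finite_induced in \<open>auto simp: induced_def\<close>)
  finally show ?thesis .
qed

lemma plus_ex_antimono:
  assumes "simple_lf E" "C \<subseteq> gball E o' d" "0 \<le> \<beta>" "0 \<le> B" "d \<le> d'"
  shows "plus_ex E o' d' \<beta> B (chi C) \<le> plus_ex E o' d \<beta> B (chi C)"
  using assms(5)
proof (induction d' rule: dec_induct)
  case (step m)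
  have "C \<subseteq> gball E o' m" using assms(2) gball_mono[OF step(1), of E o'] by blast
  then show ?case using plus_ex_decreasing[OF assms(1) _ assms(3,4), of C o' m] step(3) by linarith
qed simp

text \<open>
  The Walsh expansion into spin products, whose coefficients are averages against spin products.
\<close>

lemma walsh:
  assumes "finite W" "local_on W f"
  shows "f x = (\<Sum>A\<in>Pow W. (\<Sum>\<xi>\<in>cfg W all_up. f \<xi> * chi A \<xi>) / 2 ^ card W * chi A x)"
proof -
  have ind: "ind_on W \<xi> x = (\<Sum>A\<in>Pow W. chi A \<xi> * chi A x) / 2 ^ card W" for \<xi>
  proof -
    have "(\<Prod>v\<in>W. spin_val (\<xi> v) * spin_val (x v) + 1) = (\<Sum>A\<in>Pow W. chi A \<xi> * chi A x)"
      using prod_add[OF assms(1), of "\<lambda>v. spin_val (\<xi> v) * spin_val (x v)" "\<lambda>_. 1"]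
      by (simp add: chi_def prod.distrib)
    moreover have "(\<Prod>v\<in>W. spin_val (\<xi> v) * spin_val (x v) + 1) = 2 ^ card W * ind_on W \<xi> x"
    proof (cases "\<forall>v\<in>W. x v = \<xi> v")
      case True
      then have "(\<Prod>v\<in>W. spin_val (\<xi> v) * spin_val (x v) + 1) = (\<Prod>v\<in>W. 2)" by (intro prod.cong) auto
      then show ?thesis using True by (simp add: ind_on_def)
    next
      case False
      then obtain v where v: "v \<in> W" "x v \<noteq> \<xi> v" by blast
      then have "spin_val (\<xi> v) * spin_val (x v) + 1 = 0" by (cases "x v"; cases "\<xi> v") auto
      then have "(\<Prod>v\<in>W. spin_val (\<xi> v) * spin_val (x v) + 1) = 0"
        by (intro prod_zero[OF assms(1)] bexI[OF _ v(1)])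
      then show ?thesis using False by (simp add: ind_on_def)
    qed
    ultimately have "2 ^ card W * ind_on W \<xi> x = (\<Sum>A\<in>Pow W. chi A \<xi> * chi A x)" by simp
    then show ?thesis by (simp add: eq_divide_eq mult.commute)
  qed
  have "f x = (\<Sum>\<xi>\<in>cfg W all_up. \<Sum>A\<in>Pow W. f \<xi> * (chi A \<xi> * chi A x / 2 ^ card W))"
    unfolding local_expansion[OF assms, of x] ind by (simp add: sum_distrib_left sum_divide_distrib)
  also have "\<dots> = (\<Sum>A\<in>Pow W. \<Sum>\<xi>\<in>cfg W all_up. f \<xi> * (chi A \<xi> * chi A x / 2 ^ card W))" by (rule sum.swap)
  also have "\<dots> = (\<Sum>A\<in>Pow W. (\<Sum>\<xi>\<in>cfg W all_up. f \<xi> * chi A \<xi>) / 2 ^ card W * chi A x)"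
    by (intro sum.cong refl) (simp add: sum_distrib_right sum_divide_distrib mult.assoc)
  finally show ?thesis .
qed

text \<open>
  The averages of spin products decrease with the radius, and local functions are linear combinations
  of spin products.
\<close>

lemma plus_ex_convergent:
  assumes "simple_lf E" "0 \<le> \<beta>" "0 \<le> B" "finite W" "\<And>v. v \<in> W \<Longrightarrow> \<exists>k. v \<in> gball E o' k" "local_on W f"
  shows "convergent (\<lambda>d. plus_ex E o' d \<beta> B f)"
proof -
  obtain k where k: "\<And>v. v \<in> W \<Longrightarrow> v \<in> gball E o' (k v)" using assms(5) by metis
  define r where "r = (if W = {} then 0 else Max (k ` W))"
  have W: "W \<subseteq> gball E o' r"
  proof
    fix v assume v: "v \<in> W"
    then have kr: "k v \<le> r" using assms(4) by (auto simp: r_def)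
    show "v \<in> gball E o' r" by (rule subsetD[OF gball_mono[OF kr] k[OF v]])
  qed
  have chi: "convergent (\<lambda>d. plus_ex E o' d \<beta> B (chi A))" if A: "A \<subseteq> W" for A
  proof -
    have "convergent (\<lambda>d. plus_ex E o' (d + r) \<beta> B (chi A))"
    proof (rule Bseq_monoseq_convergent)
      show "Bseq (\<lambda>d. plus_ex E o' (d + r) \<beta> B (chi A))"
      proof (rule BseqI'[of _ 1])
        show "norm (plus_ex E o' (d + r) \<beta> B (chi A)) \<le> 1" for d
          unfolding plus_ex_def real_norm_def by (rule gex_abs_le[OF finite_gball_lf[OF assms(1)]]) simp
      qed
      have "plus_ex E o' (Suc d + r) \<beta> B (chi A) \<le> plus_ex E o' (d + r) \<beta> B (chi A)" for d
        using plus_ex_decreasing[OF assms(1) _ assms(2,3), of A o' "d + r"] A W gball_mono[of r "d + r" E o'] by auto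
      then show "monoseq (\<lambda>d. plus_ex E o' (d + r) \<beta> B (chi A))" by (intro decseq_imp_monoseq decseq_SucI)
    qed
    then show ?thesis
      using convergent_ignore_initial_segment[of "\<lambda>d. plus_ex E o' d \<beta> B (chi A)" r] by simp
  qed
  define c where "c A = (\<Sum>\<xi>\<in>cfg W all_up. f \<xi> * chi A \<xi>) / 2 ^ card W" for A
  have fe: "f = (\<lambda>x. \<Sum>A\<in>Pow W. c A * chi A x)" unfolding c_def by (rule ext) (rule walsh[OF assms(4,6)])
  have "plus_ex E o' d \<beta> B f = (\<Sum>A\<in>Pow W. c A * plus_ex E o' d \<beta> B (chi A))" for d
    unfolding plus_ex_def by (subst fe) (simp only: gex_sum gex_cmult)
  moreover have "convergent (\<lambda>d. \<Sum>A\<in>Pow W. c A * plus_ex E o' d \<beta> B (chi A))"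
    by (intro convergent_sum convergent_mult convergent_const chi) auto
  ultimately show ?thesis by simp
qed

lemma gibbs_finite:
  assumes S: "finite S" "S \<subseteq> space M" and w: "\<And>x. 0 \<le> w x" "0 < (\<Sum>x\<in>S. w x :: real)"
  shows "sets (gibbs M S w) = sets M" "prob_space (gibbs M S w)"
    and "f \<in> borel_measurable M \<Longrightarrow> (\<integral>x. f x \<partial>gibbs M S w) = (\<Sum>x\<in>S. w x * f x :: real) / (\<Sum>x\<in>S. w x)"
proof -
  let ?p = "\<lambda>x. w x / (\<Sum>y\<in>S. w y)"
  have m: "(\<lambda>x. x) \<in> measurable (point_measure S (\<lambda>x. ennreal (?p x))) M"
    using S(2) by (auto simp: space_point_measure)
  show "sets (gibbs M S w) = sets M" by (simp add: gibbs_def)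
  have "prob_space (point_measure S (\<lambda>x. ennreal (?p x)))"
  proof (rule prob_spaceI)
    have "emeasure (point_measure S (\<lambda>x. ennreal (?p x))) S = (\<Sum>x\<in>S. ennreal (?p x))"
      by (rule emeasure_point_measure_finite[OF S(1) order_refl])
    also have "\<dots> = ennreal (\<Sum>x\<in>S. ?p x)" by (rule sum_ennreal) (use w in simp)
    also have "(\<Sum>x\<in>S. ?p x) = 1" using w(2) by (simp add: sum_divide_distrib[symmetric])
    finally show "emeasure (point_measure S (\<lambda>x. ennreal (?p x))) (space (point_measure S (\<lambda>x. ennreal (?p x)))) = 1"
      by (simp add: space_point_measure)
  qed
  then show "prob_space (gibbs M S w)" unfolding gibbs_def by (rule prob_space.prob_space_distr[OF _ m])
  assume f: "f \<in> borel_measurable M"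
  have "(\<integral>x. f x \<partial>gibbs M S w) = (\<integral>x. f x \<partial>point_measure S (\<lambda>x. ennreal (?p x)))"
    unfolding gibbs_def by (rule integral_distr[OF m f])
  also have "\<dots> = (\<Sum>x\<in>S. ?p x * f x)" using lebesgue_integral_point_measure_finite[OF S(1), of ?p f] w by simp
  finally show "(\<integral>x. f x \<partial>gibbs M S w) = (\<Sum>x\<in>S. w x * f x) / (\<Sum>x\<in>S. w x)" by (simp add: sum_divide_distrib)
qed

lemma integral_ising_bc:
  fixes R :: "'m rnet" and d :: nat and s :: spin and \<beta> :: real
  assumes "rooted_net R"
  defines "N \<equiv> ising_bc R s \<beta> 0 (Suc d)"
  shows "sets N = sets (spin_space (verts R))" "prob_space N"
    "finite W \<Longrightarrow> W \<subseteq> verts R \<Longrightarrow> local_on W f \<Longrightarrow> (\<integral>x. f x \<partial>N) = bc_ex (edges R) (rt R) d s \<beta> f"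
proof -
  let ?E = "edges R" and ?o = "rt R" and ?V = "verts R"
  let ?L = "gball ?E ?o d" and ?U = "gball ?E ?o (Suc d)"
  let ?S = "{x \<in> space (spin_space ?V). \<forall>v\<in>?V. \<not> gdist ?E ?o v < enat (Suc d) \<longrightarrow> x v = s}"
  let ?w = "ising_weight ?U (induced ?E ?U) \<beta> 0"
  let ?H = "ham (induced ?E ?U) ?L \<beta> 0"
  have lt: "gdist ?E ?o v < enat (Suc d) \<longleftrightarrow> v \<in> ?L" for v by (cases "gdist ?E ?o v") (auto simp: gball_gdist)
  have N: "N = gibbs (spin_space ?V) ?S ?w" by (simp add: N_def ising_bc_def Let_def)
  have LV: "?L \<subseteq> ?V" "?U \<subseteq> ?V" using gball_subset[OF assms(1)] by auto
  have finL: "finite ?L" by (rule finite_gball[OF assms(1)])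
  let ?i = "\<lambda>x :: nat \<Rightarrow> spin. restrict x ?V" and ?j = "\<lambda>(x :: nat \<Rightarrow> spin) v. if v \<in> ?V then x v else s"
  have S: "?S = {x \<in> PiE ?V (\<lambda>_. UNIV). \<forall>v\<in>?V. v \<notin> ?L \<longrightarrow> x v = s}" by (simp add: lt space_spin_space)
  have bij: "bij_betw ?i (cfg ?L (\<lambda>_. s)) ?S"
    by (rule bij_betw_byWitness[of _ ?j]) (use LV in \<open>auto simp: S cfg_def fun_eq_iff PiE_iff extensional_def\<close>)
  have finS: "finite ?S" using bij_betw_finite[OF bij] finite_cfg[OF finL] by simp
  have w: "?w (?i x) = exp (?H x)" if "x \<in> cfg ?L (\<lambda>_. s)" for x
  proof -
    have "(\<Prod>v\<in>e. spin_val (?i x v)) = chi e x" if "e \<in> induced ?E ?U" for e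
      unfolding chi_def by (rule prod.cong) (use that LV in \<open>auto simp: induced_def\<close>)
    then show ?thesis by (simp add: ising_weight_def ham_def)
  qed
  have sumS: "(\<Sum>x\<in>?S. ?w x * g x) = gsum ?L (\<lambda>_. s) ?H (\<lambda>x. g (?i x))" for g :: "_ \<Rightarrow> real"
    unfolding gsum_def sum.reindex_bij_betw[OF bij, symmetric] by (intro sum.cong refl) (simp add: w)
  have Z: "(\<Sum>x\<in>?S. ?w x) = gsum ?L (\<lambda>_. s) ?H (\<lambda>_. 1)" using sumS[of "\<lambda>_. 1"] by simp
  have Zpos: "0 < (\<Sum>x\<in>?S. ?w x)" unfolding Z by (rule gsum_1_pos[OF finL])
  have w0: "0 \<le> ?w x" for x by (simp add: ising_weight_def)
  have sub: "?S \<subseteq> space (spin_space ?V)" by blast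
  note G = gibbs_finite[OF finS sub w0 Zpos, folded N]
  show "sets N = sets (spin_space ?V)" "prob_space N" by (rule G)+
  assume W: "finite W" "W \<subseteq> ?V" "local_on W f"
  have "(\<integral>x. f x \<partial>N) = (\<Sum>x\<in>?S. ?w x * f x) / (\<Sum>y\<in>?S. ?w y)" by (rule G(3)[OF local_measurable[OF W]])
  also have "\<dots> = gex ?L (\<lambda>_. s) ?H (\<lambda>x. f (?i x))" unfolding gex_def Z sumS ..
  also have "\<dots> = bc_ex ?E ?o d s \<beta> f"
    unfolding bc_ex_def
  proof (rule gex_cong)
    fix x
    have "\<forall>v\<in>W. ?i x v = x v" using W(2) by auto
    then show "f (?i x) = f x" using W(3) unfolding local_on_def by blast
  qed
  finally show "(\<integral>x. f x \<partial>N) = bc_ex ?E ?o d s \<beta> f" .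
qed

lemma bc_ex_convergent:
  assumes "rooted_net R" "0 \<le> \<beta>" "finite W" "W \<subseteq> verts R" "local_on W f"
  shows "convergent (\<lambda>d. bc_ex (edges R) (rt R) d s \<beta> f)"
proof -
  have conv: "convergent (\<lambda>d. plus_ex (edges R) (rt R) d \<beta> 0 g)" if "local_on W g" for g
    by (rule plus_ex_convergent[OF rooted_simple[OF assms(1)] assms(2) order_refl assms(3) _ that])
       (use in_some_gball[OF assms(1)] assms(4) in blast)
  show ?thesis
  proof (cases s)
    case Up then show ?thesis using conv[OF assms(5)] by (simp add: bc_ex_up)
  next
    case Down
    have "local_on W (\<lambda>x. f (sflip x))" using assms(5) unfolding local_on_def by (simp add: sflip_def)
    then show ?thesis using conv Down by (simp add: bc_ex_down[OF rooted_simple[OF assms(1)]])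
  qed
qed

text \<open>
  The limit exists and is determined by the averages of local functions, so that the definite
  description in \<^const>\<open>ising_limit\<close> refers to it.
\<close>

theorem ising_limit:
  fixes R :: "'m rnet"
  assumes R: "rooted_net R" and \<beta>: "0 \<le> \<beta>"
  shows "sets (ising_limit R s \<beta> 0) = sets (spin_space (verts R))" "prob_space (ising_limit R s \<beta> 0)"
    "finite W \<Longrightarrow> W \<subseteq> verts R \<Longrightarrow> local_on W f \<Longrightarrow>
      (\<lambda>d. bc_ex (edges R) (rt R) d s \<beta> f) \<longlonglongrightarrow> (\<integral>x. f x \<partial>ising_limit R s \<beta> 0)"
proof -
  let ?V = "verts R" and ?\<Phi> = "\<lambda>d. bc_ex (edges R) (rt R) d s \<beta>"
  let ?P = "\<lambda>\<nu>. sets \<nu> = sets (spin_space ?V) \<and> prob_space \<nu>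
     \<and> weak_conv_on (product_topology (\<lambda>_. discrete_topology UNIV) ?V) (ising_bc R s \<beta> 0) \<nu>"
  have finL: "finite (gball (edges R) (rt R) d)" for d by (rule finite_gball[OF R])
  note bc = integral_ising_bc[OF R]
  have lin: "?\<Phi> d (\<lambda>y. \<Sum>\<xi>\<in>I. c \<xi> * f \<xi> y) = (\<Sum>\<xi>\<in>I. c \<xi> * ?\<Phi> d (f \<xi>))" for d I and c :: "_ \<Rightarrow> real" and f
    unfolding bc_ex_def gex_sum gex_cmult ..
  have one: "?\<Phi> d (\<lambda>_. 1) = 1" for d unfolding bc_ex_def by (rule gex_const[OF finL])
  have pos: "0 \<le> ?\<Phi> d f" if "\<And>x. 0 \<le> f x" for d f
    using gex_mono[OF finL, of _ _ "\<lambda>_. 0" f] that unfolding bc_ex_def gex_const[OF finL] by blast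
  obtain \<nu> where \<nu>: "sets \<nu> = sets (spin_space ?V)" "prob_space \<nu>"
    "\<And>W f. finite W \<Longrightarrow> W \<subseteq> ?V \<Longrightarrow> local_on W f \<Longrightarrow> (\<lambda>d. ?\<Phi> d f) \<longlonglongrightarrow> (\<integral>x. f x \<partial>\<nu>)"
    by (rule cylinder_extension[OF lin one pos bc_ex_convergent[OF R \<beta>], where V = ?V]) auto
  have shift: "weak_conv_on X (\<lambda>d. M (Suc d)) \<rho> \<longleftrightarrow> weak_conv_on X M \<rho>" for X M \<rho>
    unfolding weak_conv_on_def by (simp add: filterlim_sequentially_Suc[of "\<lambda>n. \<integral>x. _ x \<partial>M n"])
  have "weak_conv_on (product_topology (\<lambda>_. discrete_topology UNIV) ?V) (\<lambda>d. ising_bc R s \<beta> 0 (Suc d)) \<nu>"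
    by (rule weak_conv_local[OF bc(1,2) \<nu>(1,2)]) (simp add: bc(3) \<nu>(3))
  then have P: "?P \<nu>" using \<nu>(1,2) shift by blast
  have uniq: "\<rho> = \<nu>" if \<rho>: "?P \<rho>" for \<rho>
  proof (rule spin_measure_eqI)
    fix W f assume W: "finite W" "W \<subseteq> ?V" "local_on W f"
    have "bounded (f ` A)" for A using local_bounded[OF W(1,3)] by (auto simp: bounded_iff)
    then have "(\<lambda>t. \<integral>x. f x \<partial>ising_bc R s \<beta> 0 t) \<longlonglongrightarrow> (\<integral>x. f x \<partial>\<rho>)"
      using \<rho> local_continuous[OF W] unfolding weak_conv_on_def by blast
    then have "(\<lambda>d. \<integral>x. f x \<partial>ising_bc R s \<beta> 0 (Suc d)) \<longlonglongrightarrow> (\<integral>x. f x \<partial>\<rho>)" by (rule LIMSEQ_Suc)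
    then have "(\<lambda>d. ?\<Phi> d f) \<longlonglongrightarrow> (\<integral>x. f x \<partial>\<rho>)" by (simp add: bc(3)[OF W])
    then show "(\<integral>x. f x \<partial>\<rho>) = (\<integral>x. f x \<partial>\<nu>)" by (rule LIMSEQ_unique[OF _ \<nu>(3)[OF W]])
  qed (use \<rho> \<nu> in auto)
  have "ising_limit R s \<beta> 0 = \<nu>"
    unfolding ising_limit_def by (rule the_equality[of ?P, OF P uniq])
  then show "sets (ising_limit R s \<beta> 0) = sets (spin_space (verts R))" "prob_space (ising_limit R s \<beta> 0)"
    "finite W \<Longrightarrow> W \<subseteq> verts R \<Longrightarrow> local_on W f \<Longrightarrow>
      (\<lambda>d. bc_ex (edges R) (rt R) d s \<beta> f) \<longlonglongrightarrow> (\<integral>x. f x \<partial>ising_limit R s \<beta> 0)"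
    using \<nu> by auto
qed

section \<open>The energy density\<close>

text \<open>
  The Ising average on the whole finite graph with vertex set \<open>{1..n}\<close>.
\<close>

definition nex :: "nat set set \<Rightarrow> nat \<Rightarrow> real \<Rightarrow> real \<Rightarrow> ((nat \<Rightarrow> spin) \<Rightarrow> real) \<Rightarrow> real" where
  "nex E n \<beta> B = gex {1..n} all_up (ham E {1..n} \<beta> B)"

lemma sum_edges:
  fixes g :: "nat set \<Rightarrow> real"
  assumes "graph_on {1..n} E"
  shows "(\<Sum>i\<in>{1..n}. \<Sum>w\<in>nbrs E i. g {i, w}) = 2 * (\<Sum>e\<in>E. g e)"
proof -
  note S = graph_on_simple[OF assms]
  have card2: "card e = 2" if "e \<in> E" for e using edge_pair[OF S(1) that] by auto
  have inV: "e \<subseteq> {1..n}" if "e \<in> E" for e using assms that unfolding graph_on_def by blast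
  have "(\<Sum>w\<in>nbrs E i. g {i, w}) = (\<Sum>e\<in>{e\<in>E. i \<in> e}. g e)" for i
  proof (rule sum.reindex_cong[of "\<lambda>w. {i, w}", symmetric])
    show "inj_on (\<lambda>w. {i, w}) (nbrs E i)" by (rule inj_onI) (auto simp: doubleton_eq_iff)
    show "{e\<in>E. i \<in> e} = (\<lambda>w. {i, w}) ` nbrs E i"
    proof (intro equalityI subsetI)
      fix e assume e: "e \<in> {e\<in>E. i \<in> e}"
      then have "e \<in> E" by simp
      from edge_pair[OF S(1) this] obtain u v where uv: "e = {u, v}" by blast
      then have "e = {i, u} \<or> e = {i, v}" using e by auto
      then show "e \<in> (\<lambda>w. {i, w}) ` nbrs E i" using e by (auto simp: nbrs_def)
    qed (auto simp: nbrs_def)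
  qed simp
  then have "(\<Sum>i\<in>{1..n}. \<Sum>w\<in>nbrs E i. g {i, w}) = (\<Sum>i\<in>{1..n}. \<Sum>e\<in>{e\<in>E. i \<in> e}. g e)" by simp
  also have "\<dots> = (\<Sum>e\<in>E. \<Sum>i\<in>{i\<in>{1..n}. i \<in> e}. g e)"
    by (rule sum.swap_restrict) (use S in auto)
  also have "\<dots> = (\<Sum>e\<in>E. 2 * g e)"
  proof (rule sum.cong[OF refl])
    fix e assume e: "e \<in> E"
    have "{i\<in>{1..n}. i \<in> e} = e" using inV[OF e] by auto
    then show "(\<Sum>i\<in>{i\<in>{1..n}. i \<in> e}. g e) = 2 * g e" using card2[OF e] by simp
  qed
  finally show ?thesis by (simp add: sum_distrib_left)
qed

text \<open>
  The logarithm of the partition function is convex in \<open>\<beta>\<close>, and it varies by at most \<open>n B\<close>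
  with the field. So the energy at \<open>\<beta>\<close> without field is bounded below by the energy at a smaller
  \<open>\<beta>'\<close> with a small field.
\<close>

lemma energy_lower_bound:
  assumes "graph_on {1..n} E" "\<beta>' < \<beta>" "0 \<le> B"
  shows "(\<beta> - \<beta>') * (\<Sum>e\<in>E. nex E n \<beta>' B (chi e)) \<le> (\<beta> - \<beta>') * (\<Sum>e\<in>E. nex E n \<beta> 0 (chi e)) + 2 * real n * B"
proof -
  define S where "S x = (\<Sum>e\<in>E. chi e x)" for x
  define M where "M x = (\<Sum>v\<in>{1..n}. spin_val (x v))" for x
  let ?V = "{1..n} :: nat set"
  let ?H = "\<lambda>b B. ham E ?V b B"
  let ?Z = "\<lambda>b B. ln (gsum ?V all_up (?H b B) (\<lambda>_. 1))"
  have H: "?H b B x = b * S x + B * M x" for b B x by (simp add: ham_def S_def M_def)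
  have Mb: "\<bar>M x\<bar> \<le> real n" for x
  proof -
    have "\<bar>M x\<bar> \<le> (\<Sum>v\<in>?V. 1)" unfolding M_def by (rule order_trans[OF sum_abs]) simp
    then show ?thesis by simp
  qed
  have gM: "\<bar>gex ?V all_up H' M\<bar> \<le> real n" for H' by (rule gex_abs_le) (use Mb in auto)
  have gS: "gex ?V all_up (?H b B) S = (\<Sum>e\<in>E. nex E n b B (chi e))" for b B
    unfolding S_def nex_def by (rule gex_sum)
  have jen: "c * gex ?V all_up (?H b B) G \<le> ?Z b' B' - ?Z b B"
    if "\<And>x. ?H b' B' x = ?H b B x + c * G x" for b B b' B' c G
  proof -
    have eq: "?H b' B' = (\<lambda>x. ?H b B x + c * G x)" by (rule ext) (rule that)
    show ?thesis unfolding eq gex_cmult[symmetric] by (rule ln_gsum_ge) simp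
  qed
  have 1: "(\<beta>' - \<beta>) * gex ?V all_up (?H \<beta> 0) S \<le> ?Z \<beta>' 0 - ?Z \<beta> 0"
    by (rule jen, unfold H) (simp add: algebra_simps)
  have 2: "(\<beta> - \<beta>') * gex ?V all_up (?H \<beta>' B) S \<le> ?Z \<beta> B - ?Z \<beta>' B"
    by (rule jen, unfold H) (simp add: algebra_simps)
  have 3: "- B * gex ?V all_up (?H \<beta> B) M \<le> ?Z \<beta> 0 - ?Z \<beta> B"
    by (rule jen, unfold H) (simp add: algebra_simps)
  have 4: "B * gex ?V all_up (?H \<beta>' 0) M \<le> ?Z \<beta>' B - ?Z \<beta>' 0"
    by (rule jen, unfold H) (simp add: algebra_simps)
  have "gex ?V all_up (?H \<beta> B) M \<le> real n" "- real n \<le> gex ?V all_up (?H \<beta>' 0) M"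
    using gM[of "?H \<beta> B"] gM[of "?H \<beta>' 0"] by linarith+
  then have 5: "B * gex ?V all_up (?H \<beta> B) M \<le> B * real n" "B * (- real n) \<le> B * gex ?V all_up (?H \<beta>' 0) M"
    using assms(3) by (intro mult_left_mono; simp)+
  have "(\<beta> - \<beta>') * gex ?V all_up (?H \<beta>' B) S \<le> (\<beta> - \<beta>') * gex ?V all_up (?H \<beta> 0) S + 2 * real n * B"
    using 1 2 3 4 5 by (simp add: algebra_simps)
  then show ?thesis unfolding gS .
qed

context
  fixes E :: "nat set set" and n :: nat
  assumes E: "graph_on {1..n} E"
begin

private lemma lf: "simple_lf E" and finE: "finite E" using graph_on_simple[OF E] by auto

private lemma edge_fin: "e \<in> E \<Longrightarrow> finite e" by (rule edge_finite[OF lf])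

lemma gball_in_V: assumes "i \<in> {1..n}" shows "gball E i d \<subseteq> {1..n}"
proof
  fix v assume "v \<in> gball E i d"
  then obtain k where "(i, v) \<in> adj E ^^ k" by (auto simp: gball_iff)
  then show "v \<in> {1..n}" by (rule walk_in_verts[OF E assms])
qed

lemma plus_ex_full:
  assumes "i \<in> {1..n}"
  shows "plus_ex E i d \<beta> B f = gex (gball E i d) all_up (ham E {1..n} \<beta> B) f"
  unfolding plus_ex_def
  by (rule ham_local[OF lf, symmetric]) (use finE gball_in_V[OF assms] in \<open>auto simp: induced_def\<close>)

lemma nex_le_plus:
  assumes "i \<in> {1..n}" "C \<subseteq> gball E i d" "0 \<le> \<beta>" "0 \<le> B"
  shows "nex E n \<beta> B (chi C) \<le> plus_ex E i d \<beta> B (chi C)"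
  unfolding nex_def plus_ex_full[OF assms(1)]
  by (rule plus_domain) (use gball_in_V[OF assms(1)] finE edge_fin assms in auto)

lemma plus_le_plus:
  assumes "i \<in> {1..n}" "j \<in> {1..n}" "gball E j d' \<subseteq> gball E i d" "C \<subseteq> gball E j d'" "0 \<le> \<beta>" "0 \<le> B"
  shows "plus_ex E i d \<beta> B (chi C) \<le> plus_ex E j d' \<beta> B (chi C)"
  unfolding plus_ex_full[OF assms(1)] plus_ex_full[OF assms(2)]
  by (rule plus_domain) (use finite_gball_lf[OF lf] finE edge_fin assms in auto)

lemma free_le_nex:
  assumes "i \<in> {1..n}" "C \<subseteq> gball E i d" "0 \<le> \<beta>" "0 \<le> B"
  shows "free_ex E i d \<beta> B (chi C) \<le> nex E n \<beta> B (chi C)"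
proof -
  let ?L = "gball E i d"
  let ?H = "ham (induced E ?L) ?L \<beta> B"
  have "gex {1..n} all_up ?H (chi C) = gex ?L all_up ?H (chi C)"
  proof (rule gex_restrict)
    fix x y :: "nat \<Rightarrow> spin" assume xy: "\<And>v. v \<in> ?L \<Longrightarrow> x v = y v"
    have "chi e x = chi e y" if "e \<in> induced E ?L" for e
      by (rule chi_cong) (use that xy in \<open>auto simp: induced_def\<close>)
    then show "?H x = ?H y" using xy by (simp add: ham_def)
    show "chi C x = chi C y" by (rule chi_cong) (use assms(2) xy in auto)
  qed (use gball_in_V[OF assms(1)] in auto)
  then have "free_ex E i d \<beta> B (chi C) = gex {1..n} all_up ?H (chi C)" by (simp add: free_ex_def)
  also have "\<dots> \<le> nex E n \<beta> B (chi C)"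
    unfolding nex_def
    by (rule griffiths) (use gball_in_V[OF assms(1)] finE edge_fin assms in \<open>auto simp: induced_def\<close>)
  finally show ?thesis .
qed

text \<open>In a positive field, the energy is local up to the gap between plus and free magnetizations.\<close>

lemma energy_local:
  assumes "0 \<le> \<beta>" "0 < B"
  shows "(\<Sum>i\<in>{1..n}. edge_sum (Suc d) \<beta> B E i) - 2 * (\<Sum>e\<in>E. nex E n \<beta> B (chi e))
    \<le> 2 * (cosh (2 * B) / sinh (2 * B)) * (\<Sum>i\<in>{1..n}. real (vdeg E i) * mag_gap d \<beta> B E i)"
proof -
  let ?c = "cosh (2 * B) / sinh (2 * B)" and ?g = "mag_gap d \<beta> B E"
  have c: "0 \<le> ?c" using assms(2) by simp
  have pair: "plus_ex E i (Suc d) \<beta> B (chi {i, w}) - nex E n \<beta> B (chi {i, w}) \<le> ?c * (?g i + ?g w)"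
    if i: "i \<in> {1..n}" and w: "w \<in> nbrs E i" for i w
  proof -
    let ?L = "gball E i (Suc d)"
    let ?D = "\<lambda>C. plus_ex E i (Suc d) \<beta> B (chi C) - nex E n \<beta> B (chi C)"
    have iw: "{i, w} \<in> E" using w by (simp add: nbrs_def)
    have wV: "w \<in> {1..n}" using E iw by (auto simp: graph_on_def doubleton_eq_iff)
    have ne: "i \<noteq> w" using edge_pair[OF lf iw] by auto
    have wL: "w \<in> ?L" using gball_nbr[OF root_in_gball iw, of 0] gball_mono[of 1 "Suc d" E i] by auto
    have finL: "finite ?L" by (rule finite_gball_lf[OF lf])
    obtain p where p: "\<And>y. y \<in> cfg ({1..n} - ?L) all_up \<Longrightarrow> 0 \<le> p y" "(\<Sum>y\<in>cfg ({1..n} - ?L) all_up. p y) = 1"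
      "\<And>f. gex {1..n} all_up (ham E {1..n} \<beta> B) f = (\<Sum>y\<in>cfg ({1..n} - ?L) all_up. p y * gex ?L y (ham E {1..n} \<beta> B) f)"
      by (rule gex_tower[OF finL finite_atLeastAtMost gball_in_V[OF i], where \<xi> = all_up and H = "ham E {1..n} \<beta> B"])
         (rule that, assumption+)
    let ?Dy = "\<lambda>y C. gex ?L all_up (ham E {1..n} \<beta> B) (chi C) - gex ?L y (ham E {1..n} \<beta> B) (chi C)"
    have D: "?D C = (\<Sum>y\<in>cfg ({1..n} - ?L) all_up. p y * ?Dy y C)" for C
      unfolding nex_def plus_ex_full[OF i] p(3)
      by (simp only: right_diff_distrib sum_subtractf sum_distrib_right[symmetric] p(2) mult_1)
    have "?D {i, w} \<le> (\<Sum>y\<in>cfg ({1..n} - ?L) all_up. p y * (?c * (?Dy y {i} + ?Dy y {w})))"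
      unfolding D
      by (intro sum_mono mult_left_mono p(1) edge_vs_magnetization[OF finL finE finite_atLeastAtMost edge_fin assms])
         (use i wV wL ne in auto)
    also have "\<dots> = ?c * (?D {i} + ?D {w})"
      unfolding D by (simp add: sum_distrib_left sum.distrib[symmetric] algebra_simps)
    also have "\<dots> \<le> ?c * (?g i + ?g w)"
    proof (rule mult_left_mono[OF _ c])
      have sub: "gball E w d \<subseteq> gball E i (Suc d)"
      proof
        fix v assume "v \<in> gball E w d"
        then obtain k where k: "k \<le> d" "(w, v) \<in> adj E ^^ k" by (auto simp: gball_iff)
        have "(i, w) \<in> adj E" using iw by (simp add: adj_def)
        then have "(i, v) \<in> adj E ^^ Suc k" using k(2) by (rule relpow_Suc_I2)
        then show "v \<in> gball E i (Suc d)" unfolding gball_iff using k(1) by (intro exI[of _ "Suc k"]) simp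
      qed
      have "plus_ex E i (Suc d) \<beta> B (chi {i}) \<le> plus_ex E i d \<beta> B (chi {i})"
        by (rule plus_le_plus[OF i i]) (use assms in \<open>auto simp: gball_Suc\<close>)
      moreover have "plus_ex E i (Suc d) \<beta> B (chi {w}) \<le> plus_ex E w d \<beta> B (chi {w})"
        by (rule plus_le_plus[OF i wV sub]) (use assms in auto)
      moreover have "free_ex E i d \<beta> B (chi {i}) \<le> nex E n \<beta> B (chi {i})"
        "free_ex E w d \<beta> B (chi {w}) \<le> nex E n \<beta> B (chi {w})"
        by (rule free_le_nex; use i wV assms in simp)+
      ultimately show "?D {i} + ?D {w} \<le> ?g i + ?g w" unfolding mag_gap_def by linarith
    qed
    finally show ?thesis .
  qed
  have "(\<Sum>i\<in>{1..n}. edge_sum (Suc d) \<beta> B E i) - 2 * (\<Sum>e\<in>E. nex E n \<beta> B (chi e))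
    = (\<Sum>i\<in>{1..n}. \<Sum>w\<in>nbrs E i. plus_ex E i (Suc d) \<beta> B (chi {i, w}) - nex E n \<beta> B (chi {i, w}))"
    unfolding sum_edges[OF E, of "\<lambda>e. nex E n \<beta> B (chi e)", symmetric] by (simp add: edge_sum_def sum_subtractf)
  also have "\<dots> \<le> (\<Sum>i\<in>{1..n}. \<Sum>w\<in>nbrs E i. ?c * (?g i + ?g w))" by (intro sum_mono pair)
  also have "\<dots> = ?c * ((\<Sum>i\<in>{1..n}. \<Sum>w\<in>nbrs E i. ?g i) + (\<Sum>i\<in>{1..n}. \<Sum>w\<in>nbrs E i. ?g w))"
    by (simp only: sum_distrib_left[symmetric] sum.distrib)
  also have "(\<Sum>i\<in>{1..n}. \<Sum>w\<in>nbrs E i. ?g w) = (\<Sum>w\<in>{1..n}. \<Sum>i\<in>nbrs E w. ?g w)"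
  proof -
    have nb: "nbrs E i = {w\<in>{1..n}. {i, w} \<in> E}" for i
      using E by (auto simp: nbrs_def graph_on_def doubleton_eq_iff)
    have "(\<Sum>i\<in>{1..n}. \<Sum>w\<in>{w\<in>{1..n}. {i, w} \<in> E}. ?g w) = (\<Sum>w\<in>{1..n}. \<Sum>i\<in>{i\<in>{1..n}. {i, w} \<in> E}. ?g w)"
      by (rule sum.swap_restrict) auto
    then show ?thesis unfolding nb by (simp add: insert_commute)
  qed
  also have "(\<Sum>i\<in>{1..n}. \<Sum>w\<in>nbrs E i. ?g i) = (\<Sum>i\<in>{1..n}. real (vdeg E i) * ?g i)"
    by (simp add: vdeg_def)
  finally show ?thesis by (simp add: vdeg_def mult_ac)
qed

end

lemma edge_sum_mono_field:
  assumes "simple_lf E" "0 \<le> \<beta>" "0 \<le> B" shows "edge_sum (Suc d) \<beta> 0 E v \<le> edge_sum (Suc d) \<beta> B E v"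
  unfolding edge_sum_def
proof (rule sum_mono)
  fix w assume w: "w \<in> nbrs E v"
  have "{v, w} \<subseteq> gball E v (Suc d)"
    using nbrs_subset_gball[of E v] w gball_mono[of 1 "Suc d" E v] by auto
  then show "plus_ex E v (Suc d) \<beta> 0 (chi {v, w}) \<le> plus_ex E v (Suc d) \<beta> B (chi {v, w})"
    unfolding plus_ex_def
    by (intro griffiths) (use assms finite_gball_lf[OF assms(1)] finite_induced edge_finite[OF assms(1)] in \<open>auto simp: induced_def\<close>)
qed

lemma abs_plus_ex: "simple_lf E \<Longrightarrow> \<bar>plus_ex E v d \<beta> B (chi C)\<bar> \<le> 1"
  unfolding plus_ex_def by (rule gex_abs_le[OF finite_gball_lf]) auto

lemma abs_free_ex: "simple_lf E \<Longrightarrow> \<bar>free_ex E v d \<beta> B (chi C)\<bar> \<le> 1"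
  unfolding free_ex_def by (rule gex_abs_le[OF finite_gball_lf]) auto

lemma abs_edge_sum: assumes "simple_lf E" shows "\<bar>edge_sum d \<beta> B E v\<bar> \<le> 1 * real (vdeg E v)"
proof -
  have "\<bar>edge_sum d \<beta> B E v\<bar> \<le> (\<Sum>w\<in>nbrs E v. 1)"
    unfolding edge_sum_def by (rule order_trans[OF sum_abs sum_mono]) (rule abs_plus_ex[OF assms])
  then show ?thesis by (simp add: vdeg_def)
qed

lemma abs_mag_gap: assumes "simple_lf E" shows "\<bar>real (vdeg E v) * mag_gap d \<beta> B E v\<bar> \<le> 2 * real (vdeg E v)"
proof -
  have "\<bar>mag_gap d \<beta> B E v\<bar> \<le> 2"
    using abs_plus_ex[OF assms, of v d \<beta> B "{v}"] abs_free_ex[OF assms, of v d \<beta> B "{v}"] by (simp add: mag_gap_def)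
  then have "real (vdeg E v) * \<bar>mag_gap d \<beta> B E v\<bar> \<le> real (vdeg E v) * 2" by (rule mult_left_mono) simp
  then show ?thesis by (simp add: abs_mult mult.commute)
qed

lemma local_fun_deg_gap: "local_fun (Suc d) (\<lambda>E v. real (vdeg E v) * mag_gap d \<beta> B E v)"
  by (rule local_fun_comp2[of _ vdeg "mag_gap d \<beta> B" "\<lambda>a b. real a * b"])
     (auto intro: local_fun_mag_gap local_fun_mono[OF local_fun_degree])

context
  fixes E :: "nat \<Rightarrow> nat set set" and \<mu> :: "rooted_graph measure"
  assumes E: "\<And>n. graph_on {1..n} (E n)" and \<mu>: "\<mu> \<in> U_star" and lwc: "graphs_loc_weak_conv E \<mu>"
begin

lemma trees_sets: "trees \<in> sets \<mu>" and AE_trees: "AE X in \<mu>. X \<in> trees"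
proof -
  have one: "emeasure \<mu> trees = 1" using \<mu> by (simp add: U_star_def)
  show s: "trees \<in> sets \<mu>"
  proof (rule ccontr)
    assume "trees \<notin> sets \<mu>"
    then have "emeasure \<mu> trees = 0" by (rule emeasure_notin_sets)
    then show False using one by simp
  qed
  interpret prob_space \<mu> by (rule \<mu>_prob[OF E \<mu> lwc])
  have "prob trees = 1" using one by (simp add: measure_def)
  then show "AE X in \<mu>. X \<in> trees" using s by (simp add: prob_eq_1)
qed

text \<open>
  The averages with plus boundary decrease to those of the infinite-volume measure, and the root has
  an integrable number of neighbours.
\<close>

lemma U_fun_lim:
  assumes \<beta>: "0 \<le> \<beta>"
  shows "(\<lambda>d. \<integral>X. at_root (edge_sum (Suc d) \<beta> 0) X \<partial>\<mu>) \<longlonglongrightarrow> 2 * U_fun \<mu> \<beta> 0"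
proof -
  let ?f = "\<lambda>X :: rooted_graph. let T = rep_network X in \<Sum>i\<in>nbrs (edges T) (rt T).
       \<integral>x. spin_val (x (rt T)) * spin_val (x i) \<partial>ising_limit T Up \<beta> 0"
  note lf = local_fun_edge_sum[of "Suc d" \<beta> 0 for d, simplified]
  have lim: "(\<lambda>d. at_root (edge_sum (Suc d) \<beta> 0) X) \<longlonglongrightarrow> ?f X" for X :: rooted_graph
  proof -
    let ?T = "rep_network X"
    have T: "rooted_net ?T" by (rule rooted_net_rep)
    have "(\<lambda>d. plus_ex (edges ?T) (rt ?T) (Suc d) \<beta> 0 (chi {rt ?T, i})) \<longlonglongrightarrow>
        (\<integral>x. spin_val (x (rt ?T)) * spin_val (x i) \<partial>ising_limit ?T Up \<beta> 0)"
      if i: "i \<in> nbrs (edges ?T) (rt ?T)" for i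
    proof -
      have e: "{rt ?T, i} \<in> edges ?T" using i by (simp add: nbrs_def)
      have ne: "rt ?T \<noteq> i" using edge_pair[OF rooted_simple[OF T] e] by auto
      have sub: "{rt ?T, i} \<subseteq> verts ?T" using T e by (auto simp: rooted_net_def graph_on_def doubleton_eq_iff)
      have "(\<lambda>d. bc_ex (edges ?T) (rt ?T) d Up \<beta> (chi {rt ?T, i})) \<longlonglongrightarrow> (\<integral>x. chi {rt ?T, i} x \<partial>ising_limit ?T Up \<beta> 0)"
        by (rule ising_limit(3)[OF T \<beta> _ sub local_on_chi]) auto
      then have "(\<lambda>d. plus_ex (edges ?T) (rt ?T) d \<beta> 0 (chi {rt ?T, i})) \<longlonglongrightarrow>
        (\<integral>x. spin_val (x (rt ?T)) * spin_val (x i) \<partial>ising_limit ?T Up \<beta> 0)"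
        by (simp add: bc_ex_up chi_pair[OF ne])
      then show ?thesis by (rule LIMSEQ_Suc)
    qed
    then show ?thesis unfolding at_root_def edge_sum_def Let_def by (intro tendsto_sum)
  qed
  have m: "(at_root (edge_sum (Suc d) \<beta> 0) :: rooted_graph \<Rightarrow> real) \<in> borel_measurable \<mu>" for d
    by (rule at_root_measurable_\<mu>[OF E \<mu> lwc lf])
  have mf: "?f \<in> borel_measurable \<mu>" by (rule borel_measurable_LIMSEQ_real[OF lim m])
  have "(\<lambda>d. \<integral>X. at_root (edge_sum (Suc d) \<beta> 0) X \<partial>\<mu>) \<longlonglongrightarrow> (\<integral>X. indicator trees X * ?f X \<partial>\<mu>)"
  proof (rule integral_dominated_convergence[where w = "at_root (\<lambda>F v. real (vdeg F v))"])
    show "(\<lambda>X. indicator trees X * ?f X) \<in> borel_measurable \<mu>" using mf trees_sets by simp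
    show "integrable \<mu> (at_root (\<lambda>F v. real (vdeg F v)))" by (rule integrable_degree[OF E \<mu> lwc])
    show "AE X in \<mu>. (\<lambda>d. at_root (edge_sum (Suc d) \<beta> 0) X) \<longlonglongrightarrow> indicator trees X * ?f X"
      using AE_trees
    proof eventually_elim
      case (elim X) then show ?case using lim[of X] by simp
    qed
    show "AE X in \<mu>. norm (at_root (edge_sum (Suc d) \<beta> 0) X) \<le> at_root (\<lambda>F v. real (vdeg F v)) X" for d
      using abs_edge_sum[OF rooted_simple[OF rooted_net_rep]] by (intro AE_I2) (simp add: at_root_def)
  qed (rule m)
  then show ?thesis by (simp add: U_fun_def set_lebesgue_integral_def)
qed

lemma U_fun_le:
  assumes \<beta>: "0 \<le> \<beta>" shows "2 * U_fun \<mu> \<beta> 0 \<le> (\<integral>X. at_root (edge_sum (Suc d) \<beta> 0) X \<partial>\<mu>)"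
proof (rule LIMSEQ_le_const2[OF U_fun_lim[OF \<beta>]])
  note lf = local_fun_edge_sum[of "Suc d" \<beta> 0 for d, simplified]
  have int: "integrable \<mu> (at_root (edge_sum (Suc d) \<beta> 0))" for d
    by (rule integrable_degree_bound[OF E \<mu> lwc lf abs_edge_sum])
  have "(\<integral>X. at_root (edge_sum (Suc d') \<beta> 0) X \<partial>\<mu>) \<le> (\<integral>X. at_root (edge_sum (Suc d) \<beta> 0) X \<partial>\<mu>)" if "d \<le> d'" for d'
  proof (rule integral_mono[OF int int])
    fix X :: rooted_graph
    let ?E = "edges (rep_network X)" and ?o = "rt (rep_network X)"
    have sub: "{?o, w} \<subseteq> gball ?E ?o (Suc d)" if "w \<in> nbrs ?E ?o" for w
      using nbrs_subset_gball[of ?E ?o] gball_mono[of 1 "Suc d" ?E ?o] that by auto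
    show "at_root (edge_sum (Suc d') \<beta> 0) X \<le> at_root (edge_sum (Suc d) \<beta> 0) X"
      unfolding at_root_def edge_sum_def
      by (intro sum_mono plus_ex_antimono[OF rooted_simple[OF rooted_net_rep] sub \<beta>]) (use that in auto)
  qed
  then show "\<exists>N. \<forall>n\<ge>N. (\<integral>X. at_root (edge_sum (Suc n) \<beta> 0) X \<partial>\<mu>) \<le> (\<integral>X. at_root (edge_sum (Suc d) \<beta> 0) X \<partial>\<mu>)"
    by blast
qed

text \<open>
  In a positive field, the boundary has no effect in the limit on almost every graph, since almost
  every graph is a tree.
\<close>

lemma gap_lim:
  assumes "0 < \<beta>" "0 < B"
  shows "(\<lambda>d. \<integral>X. at_root (\<lambda>E v. real (vdeg E v) * mag_gap d \<beta> B E v) X \<partial>\<mu>) \<longlonglongrightarrow> 0"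
proof -
  have "(\<lambda>d. \<integral>X. at_root (\<lambda>E v. real (vdeg E v) * mag_gap d \<beta> B E v) X \<partial>\<mu>) \<longlonglongrightarrow> (\<integral>X. 0 \<partial>\<mu>)"
  proof (rule integral_dominated_convergence[where w = "\<lambda>X. 2 * at_root (\<lambda>F v. real (vdeg F v)) X"])
    show "integrable \<mu> (\<lambda>X. 2 * at_root (\<lambda>F v. real (vdeg F v)) X)"
      by (intro integrable_mult_right integrable_degree[OF E \<mu> lwc])
    show "AE X in \<mu>. (\<lambda>d. at_root (\<lambda>E v. real (vdeg E v) * mag_gap d \<beta> B E v) X) \<longlonglongrightarrow> 0"
      using AE_trees
    proof eventually_elim
      case (elim X)
      let ?E = "edges (rep_network X)"
      have ac: "acyclic_graph ?E" using elim by (simp add: trees_def)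
      have s: "simple_lf ?E" by (rule rooted_simple[OF rooted_net_rep])
      have "(\<lambda>d. real (vdeg ?E (rt (rep_network X))) * mag_gap d \<beta> B ?E (rt (rep_network X))) \<longlonglongrightarrow> real (vdeg ?E (rt (rep_network X))) * 0"
        unfolding mag_gap_def by (intro tendsto_mult_left tree_plus_free[OF s acyclic_treelike[OF s ac] assms])
      then show ?case by (simp add: at_root_def)
    qed
    show "AE X in \<mu>. norm (at_root (\<lambda>E v. real (vdeg E v) * mag_gap d \<beta> B E v) X) \<le> 2 * at_root (\<lambda>F v. real (vdeg F v)) X" for d
      using abs_mag_gap[OF rooted_simple[OF rooted_net_rep]] by (intro AE_I2) (simp add: at_root_def)
  qed (auto intro: at_root_measurable_\<mu>[OF E \<mu> lwc local_fun_deg_gap])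
  then show ?thesis by simp
qed

text \<open>
  The average plus energy in a ball tends to \<open>2 U(\<beta>)\<close>. The true energy is at most a little smaller
  than the energy at some \<open>b < \<beta>\<close> with a small field \<open>B\<close>, which is local and at least \<open>2 U(b)\<close> in
  the limit. Left continuity of \<open>U\<close> at \<open>\<beta>\<close> closes the gap.
\<close>

theorem energy_deficit:
  assumes \<beta>: "0 < \<beta>" and cont: "continuous (at \<beta> within {0..}) (\<lambda>b. U_fun \<mu> b 0)" and \<epsilon>: "0 < \<epsilon>"
  shows "\<exists>d0. \<forall>d\<ge>d0. \<forall>\<^sub>F n in sequentially.
    avg n (\<lambda>i. \<Sum>w\<in>nbrs (E n) i. plus_ex (E n) i (Suc d) \<beta> 0 (chi {i, w}) - nex (E n) n \<beta> 0 (chi {i, w})) < \<epsilon>"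
proof -
  note lf = local_fun_edge_sum[of "Suc d" b 0 for d b, simplified]
  have "((\<lambda>b. U_fun \<mu> b 0) \<longlongrightarrow> U_fun \<mu> \<beta> 0) (at \<beta> within {0..})" using cont by (simp add: continuous_within)
  from tendstoD[OF this, of "\<epsilon> / 10"] \<epsilon>
  have "\<forall>\<^sub>F b in at \<beta> within {0..}. dist (U_fun \<mu> b 0) (U_fun \<mu> \<beta> 0) < \<epsilon> / 10" by simp
  then obtain \<delta> where \<delta>: "0 < \<delta>" "\<And>b. 0 \<le> b \<Longrightarrow> b \<noteq> \<beta> \<Longrightarrow> dist b \<beta> < \<delta> \<Longrightarrow> dist (U_fun \<mu> b 0) (U_fun \<mu> \<beta> 0) < \<epsilon> / 10"
    unfolding eventually_at by auto
  define b where "b = max (\<beta> / 2) (\<beta> - \<delta> / 2)"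
  have b: "0 < b" "b < \<beta>" "dist b \<beta> < \<delta>" using \<beta> \<delta>(1) by (auto simp: b_def dist_real_def max_def)
  have Ub: "\<bar>U_fun \<mu> b 0 - U_fun \<mu> \<beta> 0\<bar> < \<epsilon> / 10" using \<delta>(2)[of b] b by (simp add: dist_real_def)
  \<comment> \<open>the error \<open>2 n B\<close> of the convexity bound is then \<open>(\<beta> - b) n \<epsilon> / 10\<close>\<close>
  define B where "B = \<epsilon> * (\<beta> - b) / 20"
  have B: "0 < B" using \<epsilon> b by (simp add: B_def)
  let ?c = "2 * (cosh (2 * B) / sinh (2 * B))"
  have c: "0 < ?c" using B by simp
  have "0 < \<epsilon> / (5 * ?c)" by (rule divide_pos_pos[OF \<epsilon> mult_pos_pos[OF _ c]]) simp
  from order_tendstoD(2)[OF gap_lim[OF b(1) B] this]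
  obtain k where k: "(\<integral>X. at_root (\<lambda>E v. real (vdeg E v) * mag_gap k b B E v) X \<partial>\<mu>) < \<epsilon> / (5 * ?c)"
    unfolding eventually_sequentially by blast
  from order_tendstoD(2)[OF U_fun_lim, of \<beta> "2 * U_fun \<mu> \<beta> 0 + \<epsilon> / 5"] \<beta> \<epsilon>
  obtain d0 where d0: "\<And>d. d \<ge> d0 \<Longrightarrow> (\<integral>X. at_root (edge_sum (Suc d) \<beta> 0) X \<partial>\<mu>) < 2 * U_fun \<mu> \<beta> 0 + \<epsilon> / 5"
    by (auto simp: eventually_sequentially)
  show ?thesis
  proof (intro exI[of _ d0] allI impI)
    fix d assume d: "d0 \<le> d"
    let ?a1 = "\<lambda>n. avg n (\<lambda>i. edge_sum (Suc d) \<beta> 0 (E n) i)"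
    let ?a2 = "\<lambda>n. avg n (\<lambda>i. edge_sum (Suc k) b 0 (E n) i)"
    let ?a3 = "\<lambda>n. avg n (\<lambda>i. real (vdeg (E n) i) * mag_gap k b B (E n) i)"
    let ?I1 = "\<integral>X. at_root (edge_sum (Suc d) \<beta> 0) X \<partial>\<mu>"
    let ?I2 = "\<integral>X. at_root (edge_sum (Suc k) b 0) X \<partial>\<mu>"
    let ?I3 = "\<integral>X. at_root (\<lambda>E v. real (vdeg E v) * mag_gap k b B E v) X \<partial>\<mu>"
    have l1: "?a1 \<longlonglongrightarrow> ?I1" by (rule lwc_degree[OF E \<mu> lwc lf abs_edge_sum]) auto
    have l2: "?a2 \<longlonglongrightarrow> ?I2" by (rule lwc_degree[OF E \<mu> lwc lf abs_edge_sum]) auto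
    have l3: "?a3 \<longlonglongrightarrow> ?I3" by (rule lwc_degree[OF E \<mu> lwc local_fun_deg_gap abs_mag_gap]) auto
    have lim: "(\<lambda>n. ?a1 n - ?a2 n + ?c * ?a3 n + \<epsilon> / 5) \<longlonglongrightarrow> ?I1 - ?I2 + ?c * ?I3 + \<epsilon> / 5"
      by (intro tendsto_intros l1 l2 l3)
    have "?c * ?I3 < \<epsilon> / 5"
    proof -
      have cancel: "x * (y / (5 * x)) = y / 5" if "0 < x" for x y :: real using that by simp
      have "?c * ?I3 < ?c * (\<epsilon> / (5 * ?c))" by (rule mult_strict_left_mono[OF k c])
      then show ?thesis unfolding cancel[OF c] .
    qed
    moreover have "2 * U_fun \<mu> b 0 \<le> ?I2" by (rule U_fun_le) (use b in simp)
    ultimately have "?I1 - ?I2 + ?c * ?I3 + \<epsilon> / 5 < \<epsilon>" using d0[OF d] Ub unfolding abs_less_iff by linarith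
    from order_tendstoD(2)[OF lim this]
    have "\<forall>\<^sub>F n in sequentially. ?a1 n - ?a2 n + ?c * ?a3 n + \<epsilon> / 5 < \<epsilon>" .
    then show "\<forall>\<^sub>F n in sequentially. avg n (\<lambda>i. \<Sum>w\<in>nbrs (E n) i.
        plus_ex (E n) i (Suc d) \<beta> 0 (chi {i, w}) - nex (E n) n \<beta> 0 (chi {i, w})) < \<epsilon>"
      using eventually_gt_at_top[of 0]
    proof eventually_elim
      case (elim n)
      let ?E0 = "\<Sum>e\<in>E n. nex (E n) n \<beta> 0 (chi e)" and ?E1 = "\<Sum>e\<in>E n. nex (E n) n b B (chi e)"
      have n: "0 < real n" using elim by simp
      have "(\<beta> - b) * ?E1 \<le> (\<beta> - b) * ?E0 + 2 * real n * B"
        by (rule energy_lower_bound[OF E b(2)]) (use B in simp)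
      also have "2 * real n * B = (\<beta> - b) * (real n * \<epsilon> / 10)" by (simp add: B_def)
      finally have "(\<beta> - b) * ?E1 \<le> (\<beta> - b) * (?E0 + real n * \<epsilon> / 10)" by (simp add: distrib_left)
      then have e1: "?E1 \<le> ?E0 + real n * \<epsilon> / 10" using b by simp
      have e2: "(\<Sum>i\<in>{1..n}. edge_sum (Suc k) b B (E n) i) - 2 * ?E1
        \<le> ?c * (\<Sum>i\<in>{1..n}. real (vdeg (E n) i) * mag_gap k b B (E n) i)"
        by (rule energy_local[OF E]) (use b B in auto)
      have e3: "(\<Sum>i\<in>{1..n}. edge_sum (Suc k) b 0 (E n) i) \<le> (\<Sum>i\<in>{1..n}. edge_sum (Suc k) b B (E n) i)"
        by (intro sum_mono edge_sum_mono_field E_simple[OF E \<mu> lwc]) (use b B in auto)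
      have "(\<Sum>i\<in>{1..n}. \<Sum>w\<in>nbrs (E n) i. plus_ex (E n) i (Suc d) \<beta> 0 (chi {i, w}) - nex (E n) n \<beta> 0 (chi {i, w}))
        = (\<Sum>i\<in>{1..n}. edge_sum (Suc d) \<beta> 0 (E n) i) - 2 * ?E0"
        unfolding sum_edges[OF E, of "\<lambda>e. nex (E n) n \<beta> 0 (chi e)", symmetric] by (simp add: edge_sum_def sum_subtractf)
      also have "\<dots> \<le> (\<Sum>i\<in>{1..n}. edge_sum (Suc d) \<beta> 0 (E n) i) - (\<Sum>i\<in>{1..n}. edge_sum (Suc k) b 0 (E n) i)
        + ?c * (\<Sum>i\<in>{1..n}. real (vdeg (E n) i) * mag_gap k b B (E n) i) + real n * (\<epsilon> / 5)"
        using e1 e2 e3 by simp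
      finally have "avg n (\<lambda>i. \<Sum>w\<in>nbrs (E n) i. plus_ex (E n) i (Suc d) \<beta> 0 (chi {i, w}) - nex (E n) n \<beta> 0 (chi {i, w}))
        \<le> ((\<Sum>i\<in>{1..n}. edge_sum (Suc d) \<beta> 0 (E n) i) - (\<Sum>i\<in>{1..n}. edge_sum (Suc k) b 0 (E n) i)
        + ?c * (\<Sum>i\<in>{1..n}. real (vdeg (E n) i) * mag_gap k b B (E n) i) + real n * (\<epsilon> / 5)) / real n"
        unfolding avg_def by (rule divide_right_mono) simp
      also have "\<dots> = ?a1 n - ?a2 n + ?c * ?a3 n + \<epsilon> / 5"
        unfolding avg_def using n
        by (simp only: add_divide_distrib diff_divide_distrib nonzero_mult_div_cancel_left[OF less_imp_neq[THEN not_sym]])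
           (simp only: times_divide_eq_right)
      finally show ?case using elim by linarith
    qed
  qed
qed

end

section \<open>Probability measures on a countable discrete space\<close>

abbreviation pdisc :: "'a set \<Rightarrow> 'a measure set" where
  "pdisc S \<equiv> prob_measures_on (discrete_topology S)"

lemma pdisc_iff: "\<nu> \<in> pdisc S \<longleftrightarrow> prob_space \<nu> \<and> sets \<nu> = Pow S"
proof -
  have "{U. openin (discrete_topology S) U} = Pow S" by auto
  moreover have "sigma_sets S (Pow S) = Pow S"
    by (metis order_refl sets_count_space sets.sigma_sets_eq space_count_space)
  ultimately show ?thesis by (simp add: prob_measures_on_def)
qed

lemma space_prob_algebra_count: "space (prob_algebra (count_space S)) = pdisc S"
  by (auto simp: space_prob_algebra pdisc_iff)

lemma pdisc_space: "\<nu> \<in> pdisc S \<Longrightarrow> space \<nu> = S"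
  using sets_eq_imp_space_eq[of \<nu> "count_space S"] by (simp add: pdisc_iff)

lemma integral_finite_part:
  assumes \<nu>: "\<nu> \<in> pdisc S" and F: "finite F" "F \<subseteq> S" and g: "\<And>z. z \<in> S \<Longrightarrow> \<bar>g z\<bar> \<le> (c :: real)"
  shows "\<bar>(\<integral>z. g z \<partial>\<nu>) - (\<Sum>z\<in>F. g z * measure \<nu> {z})\<bar> \<le> c * (1 - (\<Sum>z\<in>F. measure \<nu> {z}))"
proof -
  interpret prob_space \<nu> using \<nu> by (simp add: pdisc_iff)
  have sp: "space \<nu> = S" by (rule pdisc_space[OF \<nu>])
  have sets: "sets \<nu> = Pow S" using \<nu> by (simp add: pdisc_iff)
  have meas: "h \<in> borel_measurable \<nu>" for h :: "'a \<Rightarrow> real"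
    by (rule measurableI) (auto simp: sp sets)
  have int: "integrable \<nu> h" if "\<And>z. z \<in> S \<Longrightarrow> \<bar>h z\<bar> \<le> d" for h :: "'a \<Rightarrow> real" and d
    by (rule integrable_const_bound[of _ d]) (use that sp meas in auto)
  have FS: "{z} \<in> sets \<nu>" if "z \<in> F" for z using that F sets by auto
  have mF: "(\<Sum>z\<in>F. measure \<nu> {z}) = measure \<nu> F"
    using F by (intro measure_eq_sum_singleton[symmetric]) (use FS in auto)
  have "(\<Sum>z\<in>F. g z * measure \<nu> {z}) = (\<integral>z. (\<Sum>w\<in>F. g w * indicator {w} z) \<partial>\<nu>)"
    using FS by (subst Bochner_Integration.integral_sum) (auto simp: emeasure_eq_measure)
  also have "\<dots> = (\<integral>z. g z * indicator F z \<partial>\<nu>)"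
  proof (rule Bochner_Integration.integral_cong[OF refl])
    fix z
    show "(\<Sum>w\<in>F. g w * indicator {w} z) = g z * indicator F z"
      using F(1) by (cases "z \<in> F") (auto simp: indicator_def sum.delta if_distrib cong: if_cong)
  qed
  finally have s: "(\<Sum>z\<in>F. g z * measure \<nu> {z}) = (\<integral>z. g z * indicator F z \<partial>\<nu>)" .
  have i1: "integrable \<nu> g" by (rule int[OF g])
  have i2: "integrable \<nu> (\<lambda>z. g z * indicator F z)"
    by (rule int[of _ c]) (use g in \<open>force simp: indicator_def intro: order_trans[OF abs_ge_zero]\<close>)
  have i3: "integrable \<nu> (indicator F :: 'a \<Rightarrow> real)" by (rule int[of _ 1]) (simp add: indicator_def)
  have "\<bar>(\<integral>z. g z \<partial>\<nu>) - (\<integral>z. g z * indicator F z \<partial>\<nu>)\<bar> = \<bar>\<integral>z. g z - g z * indicator F z \<partial>\<nu>\<bar>"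
    using i1 i2 by simp
  also have "\<dots> \<le> (\<integral>z. \<bar>g z - g z * indicator F z\<bar> \<partial>\<nu>)" by (rule integral_abs_bound)
  also have "\<dots> \<le> (\<integral>z. c * (1 - indicator F z) \<partial>\<nu>)"
  proof (rule integral_mono)
    show "integrable \<nu> (\<lambda>z. c * (1 - indicator F z))"
      by (intro integrable_mult_right Bochner_Integration.integrable_diff integrable_const i3)
    show "\<bar>g z - g z * indicator F z\<bar> \<le> c * (1 - indicator F z)" if "z \<in> space \<nu>" for z
      using g[of z] that sp by (auto simp: indicator_def)
  qed (use i1 i2 in auto)
  also have "\<dots> = c * (1 - measure \<nu> F)" using i3 F sets by (simp add: prob_space)
  finally show ?thesis unfolding s mF .
qed

lemma finite_almost_all:
  assumes \<nu>: "\<nu> \<in> pdisc S" and S: "countable S" and "0 < \<epsilon>"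
  shows "\<exists>F. finite F \<and> F \<subseteq> S \<and> 1 - \<epsilon> < (\<Sum>z\<in>F. measure \<nu> {z})"
proof -
  interpret prob_space \<nu> using \<nu> by (simp add: pdisc_iff)
  have sp: "space \<nu> = S" by (rule pdisc_space[OF \<nu>])
  have sets: "sets \<nu> = Pow S" using \<nu> by (simp add: pdisc_iff)
  have ne: "S \<noteq> {}" using not_empty sp by simp
  let ?A = "\<lambda>n. from_nat_into S ` {..n}"
  have sub: "?A n \<subseteq> S" for n using from_nat_into[OF ne] by auto
  have "(\<Union>n. ?A n) = S"
  proof
    show "S \<subseteq> (\<Union>n. ?A n)"
    proof
      fix z assume "z \<in> S"
      then have "z = from_nat_into S (to_nat_on S z)" using S by simp
      then show "z \<in> (\<Union>n. ?A n)" by blast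
    qed
  qed (use sub in auto)
  moreover have "(\<lambda>n. measure \<nu> (?A n)) \<longlonglongrightarrow> measure \<nu> (\<Union>n. ?A n)"
    by (rule finite_Lim_measure_incseq) (use sub sets in \<open>auto simp: incseq_def\<close>)
  ultimately have "(\<lambda>n. measure \<nu> (?A n)) \<longlonglongrightarrow> 1" using prob_space sp by simp
  from order_tendstoD(1)[OF this, of "1 - \<epsilon>"] \<open>0 < \<epsilon>\<close> obtain n where "1 - \<epsilon> < measure \<nu> (?A n)"
    by (auto simp: eventually_sequentially)
  moreover have "measure \<nu> (?A n) = (\<Sum>z\<in>?A n. measure \<nu> {z})"
    by (rule measure_eq_sum_singleton) (use sub[of n] sets in auto)
  ultimately show ?thesis using sub by (intro exI[of _ "?A n"]) auto
qed

text \<open>Pointwise convergence of the masses implies convergence of all bounded averages (Scheffe).\<close>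

lemma mass_convergence:
  assumes S: "countable S" and \<nu>: "\<And>k. \<nu> k \<in> pdisc S" "\<nu>' \<in> pdisc S"
    and conv: "\<And>z. z \<in> S \<Longrightarrow> (\<lambda>k. measure (\<nu> k) {z}) \<longlonglongrightarrow> measure \<nu>' {z}"
    and g: "\<And>z. z \<in> S \<Longrightarrow> \<bar>g z\<bar> \<le> (c :: real)"
  shows "(\<lambda>k. \<integral>z. g z \<partial>\<nu> k) \<longlonglongrightarrow> (\<integral>z. g z \<partial>\<nu>')"
proof (rule LIMSEQ_I)
  fix \<epsilon> :: real assume \<epsilon>: "0 < \<epsilon>"
  define d where "d = \<bar>c\<bar> + 1"
  have d: "0 < d" "\<And>z. z \<in> S \<Longrightarrow> \<bar>g z\<bar> \<le> d" using g by (force simp: d_def)+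
  obtain F where F: "finite F" "F \<subseteq> S" "1 - \<epsilon> / (4 * d) < (\<Sum>z\<in>F. measure \<nu>' {z})"
    using finite_almost_all[OF \<nu>(2) S, of "\<epsilon> / (4 * d)"] \<epsilon> d by auto
  let ?B = "\<lambda>k. \<bar>(\<Sum>z\<in>F. g z * measure (\<nu> k) {z}) - (\<Sum>z\<in>F. g z * measure \<nu>' {z})\<bar>
    + d * (1 - (\<Sum>z\<in>F. measure (\<nu> k) {z})) + d * (1 - (\<Sum>z\<in>F. measure \<nu>' {z}))"
  have cF: "(\<lambda>k. measure (\<nu> k) {z}) \<longlonglongrightarrow> measure \<nu>' {z}" if "z \<in> F" for z using conv F(2) that by blast
  have "?B \<longlonglongrightarrow> \<bar>(\<Sum>z\<in>F. g z * measure \<nu>' {z}) - (\<Sum>z\<in>F. g z * measure \<nu>' {z})\<bar>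
    + d * (1 - (\<Sum>z\<in>F. measure \<nu>' {z})) + d * (1 - (\<Sum>z\<in>F. measure \<nu>' {z}))"
    by (intro tendsto_intros cF)
  moreover have "\<bar>(\<Sum>z\<in>F. g z * measure \<nu>' {z}) - (\<Sum>z\<in>F. g z * measure \<nu>' {z})\<bar>
    + d * (1 - (\<Sum>z\<in>F. measure \<nu>' {z})) + d * (1 - (\<Sum>z\<in>F. measure \<nu>' {z})) < \<epsilon>"
  proof -
    have "d * (1 - (\<Sum>z\<in>F. measure \<nu>' {z})) < d * (\<epsilon> / (4 * d))" using F(3) d(1) by (intro mult_strict_left_mono) auto
    also have "\<dots> = \<epsilon> / 4" using d(1) by simp
    finally show ?thesis using \<epsilon> by simp
  qed
  ultimately have "\<forall>\<^sub>F k in sequentially. ?B k < \<epsilon>" by (rule order_tendstoD(2))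
  then obtain k0 where k0: "\<And>k. k \<ge> k0 \<Longrightarrow> ?B k < \<epsilon>" by (auto simp: eventually_sequentially)
  have "norm ((\<integral>z. g z \<partial>\<nu> k) - (\<integral>z. g z \<partial>\<nu>')) < \<epsilon>" if "k \<ge> k0" for k
  proof -
    have "\<bar>(\<integral>z. g z \<partial>\<nu> k) - (\<Sum>z\<in>F. g z * measure (\<nu> k) {z})\<bar> \<le> d * (1 - (\<Sum>z\<in>F. measure (\<nu> k) {z}))"
      by (rule integral_finite_part[OF \<nu>(1) F(1,2)]) (rule d(2))
    moreover have "\<bar>(\<integral>z. g z \<partial>\<nu>') - (\<Sum>z\<in>F. g z * measure \<nu>' {z})\<bar> \<le> d * (1 - (\<Sum>z\<in>F. measure \<nu>' {z}))"
      by (rule integral_finite_part[OF \<nu>(2) F(1,2)]) (rule d(2))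
    ultimately show ?thesis using k0[OF that] unfolding real_norm_def by linarith
  qed
  then show "\<exists>k0. \<forall>k\<ge>k0. norm ((\<integral>z. g z \<partial>\<nu> k) - (\<integral>z. g z \<partial>\<nu>')) < \<epsilon>" by blast
qed

lemma limitin_generated:
  assumes "l \<in> \<Union>\<S>" "\<And>U. U \<in> \<S> \<Longrightarrow> l \<in> U \<Longrightarrow> eventually (\<lambda>k. x k \<in> U) F"
  shows "limitin (topology_generated_by \<S>) x l F"
proof -
  have "generate_topology_on \<S> U \<Longrightarrow> l \<in> U \<Longrightarrow> eventually (\<lambda>k. x k \<in> U) F" for U
  proof (induction rule: generate_topology_on.induct)
    case (Int a b)
    then have "eventually (\<lambda>k. x k \<in> a) F" "eventually (\<lambda>k. x k \<in> b) F" by auto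
    then show ?case by eventually_elim simp
  next
    case (UN K)
    then obtain k where "k \<in> K" "l \<in> k" by blast
    then have "eventually (\<lambda>i. x i \<in> k) F" using UN.IH by blast
    then show ?case by eventually_elim (use \<open>k \<in> K\<close> in blast)
  qed (use assms(2) in auto)
  then show ?thesis using assms(1) by (auto simp: limitin_def openin_topology_generated_by_iff)
qed

lemma topspace_weak: "topspace (weak_topology (discrete_topology S)) = pdisc S"
proof -
  have "pdisc S \<in> {{\<nu> \<in> pdisc S. (\<integral>x. f x \<partial>\<nu>) \<in> U} | f U.
      continuous_map (discrete_topology S) euclideanreal f \<and> bounded (f ` topspace (discrete_topology S)) \<and> open (U :: real set)}"
    by (intro CollectI exI[of _ "\<lambda>_. 0"] exI[of _ UNIV]) (auto simp: image_constant_conv)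
  then show ?thesis unfolding weak_topology_def topology_generated_by_topspace by blast
qed

lemma weak_continuous_limit:
  assumes f: "continuous_map (weak_topology (discrete_topology S)) euclideanreal f" and S: "countable S"
    and \<nu>: "\<And>k. \<nu> k \<in> pdisc S" "\<nu>' \<in> pdisc S"
    and conv: "\<And>z. z \<in> S \<Longrightarrow> (\<lambda>k. measure (\<nu> k) {z}) \<longlonglongrightarrow> measure \<nu>' {z}"
  shows "(\<lambda>k. f (\<nu> k)) \<longlonglongrightarrow> f \<nu>'"
proof -
  have "limitin (weak_topology (discrete_topology S)) \<nu> \<nu>' sequentially"
    unfolding weak_topology_def
  proof (rule limitin_generated)
    show "\<nu>' \<in> \<Union>{{\<nu> \<in> pdisc S. (\<integral>x. f x \<partial>\<nu>) \<in> U} | f U.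
      continuous_map (discrete_topology S) euclideanreal f \<and> bounded (f ` topspace (discrete_topology S)) \<and> open (U :: real set)}"
      using \<nu>(2) topspace_weak[of S] unfolding weak_topology_def topology_generated_by_topspace by simp
    fix A assume "A \<in> {{\<nu> \<in> pdisc S. (\<integral>x. f x \<partial>\<nu>) \<in> U} | f U.
      continuous_map (discrete_topology S) euclideanreal f \<and> bounded (f ` topspace (discrete_topology S)) \<and> open (U :: real set)}"
      and mem: "\<nu>' \<in> A"
    then obtain g and U :: "real set" where
      "A = {\<nu> \<in> pdisc S. (\<integral>x. g x \<partial>\<nu>) \<in> U} \<and> continuous_map (discrete_topology S) euclideanreal g
        \<and> bounded (g ` topspace (discrete_topology S)) \<and> open U"
      unfolding mem_Collect_eq by (elim exE) (rule that)
    then have A: "A = {\<nu> \<in> pdisc S. (\<integral>x. g x \<partial>\<nu>) \<in> U}" and g: "bounded (g ` S)" and U: "open U" by auto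
    obtain c where c: "\<And>z. z \<in> S \<Longrightarrow> \<bar>g z\<bar> \<le> c" using g by (auto simp: bounded_iff)
    have "(\<lambda>k. \<integral>z. g z \<partial>\<nu> k) \<longlonglongrightarrow> (\<integral>z. g z \<partial>\<nu>')" by (rule mass_convergence[OF S \<nu> conv c])
    then have "\<forall>\<^sub>F k in sequentially. (\<integral>z. g z \<partial>\<nu> k) \<in> U" by (rule topological_tendstoD[OF _ U]) (use mem A in simp)
    then show "\<forall>\<^sub>F k in sequentially. \<nu> k \<in> A" by eventually_elim (use \<nu>(1) A in simp)
  qed
  from continuous_map_limit[OF f this] show ?thesis by (simp add: comp_def)
qed

text \<open>
  A weakly continuous function is the limit of functions that depend on finitely many masses rounded
  to multiples of \<open>1 / (k + 1)\<close>. So it is measurable.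
\<close>

lemma weak_continuous_measurable:
  assumes f: "continuous_map (weak_topology (discrete_topology S)) euclideanreal f" and S: "countable S"
  shows "f \<in> borel_measurable (prob_algebra (count_space S))"
proof (cases "S = {}")
  case True
  have "pdisc S = {}" using True prob_space.not_empty pdisc_space by (fastforce simp: pdisc_iff)
  then have "space (prob_algebra (count_space S)) = {}" by (simp only: space_prob_algebra_count)
  then show ?thesis by (intro measurableI) auto
next
  case False
  define A where "A k = from_nat_into S ` {..k}" for k
  have A: "finite (A k)" "A k \<subseteq> S" for k using from_nat_into[OF False] by (auto simp: A_def)
  \<comment> \<open>the rounded masses at finitely many points take finitely many values\<close>
  define code where "code k \<nu> = (\<lambda>z\<in>A k. \<lfloor>real (Suc k) * measure \<nu> {z}\<rfloor>)" for k and \<nu> :: "'a measure"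
  define rep where "rep k c = (SOME \<nu>. \<nu> \<in> pdisc S \<and> code k \<nu> = c)" for k c
  have rep: "rep k (code k \<nu>) \<in> pdisc S \<and> code k (rep k (code k \<nu>)) = code k \<nu>" if "\<nu> \<in> pdisc S" for k \<nu>
    unfolding rep_def by (rule someI[of _ \<nu>]) (use that in simp)
  let ?C = "\<lambda>k. PiE (A k) (\<lambda>_. {0..int (Suc k)})"
  have codeC: "code k \<nu> \<in> ?C k" if \<nu>: "\<nu> \<in> pdisc S" for k \<nu>
  proof -
    interpret prob_space \<nu> using \<nu> by (simp add: pdisc_iff)
    have "real (Suc k) * measure \<nu> {z} \<le> real (Suc k) * 1" for z by (intro mult_left_mono) auto
    then have "\<lfloor>real (Suc k) * measure \<nu> {z}\<rfloor> \<le> int (Suc k)" for z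
      using floor_mono[of "real (Suc k) * measure \<nu> {z}" "real (Suc k)"] by simp
    then show ?thesis by (auto simp: code_def)
  qed
  show ?thesis
  proof (rule borel_measurable_LIMSEQ_real[where u = "\<lambda>k \<nu>. f (rep k (code k \<nu>))"])
    fix k
    let ?P = "prob_algebra (count_space S)"
    let ?D = "\<lambda>c. {\<nu> \<in> space ?P. \<forall>z\<in>A k. \<lfloor>real (Suc k) * measure \<nu> {z}\<rfloor> = c z}"
    have D: "?D c \<in> sets ?P" for c
    proof -
      have m: "(\<lambda>\<nu>. measure \<nu> {z}) \<in> borel_measurable ?P" if "z \<in> A k" for z
        using that A(2) by (intro measurable_measure_prob_algebra) auto
      have "{\<nu> \<in> space ?P. \<lfloor>real (Suc k) * measure \<nu> {z}\<rfloor> = c z} \<in> sets ?P" if "z \<in> A k" for z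
        using m[OF that] by measurable
      then show ?thesis using A(1) by (intro sets.sets_Collect_finite_All) auto
    qed
    have "f (rep k (code k \<nu>)) = (\<Sum>c\<in>?C k. f (rep k c) * indicator (?D c) \<nu>)" if \<nu>: "\<nu> \<in> space ?P" for \<nu>
    proof -
      have n: "\<nu> \<in> pdisc S" using \<nu> by (simp only: space_prob_algebra_count)
      have "f (rep k c) * indicator (?D c) \<nu> = (if c = code k \<nu> then f (rep k c) else 0)" if "c \<in> ?C k" for c
      proof -
        have "(\<forall>z\<in>A k. \<lfloor>real (Suc k) * measure \<nu> {z}\<rfloor> = c z) \<longleftrightarrow> c = code k \<nu>"
          using that by (auto simp: code_def fun_eq_iff PiE_iff extensional_def)
        then show ?thesis using \<nu> by (simp add: indicator_def)
      qed
      then have "(\<Sum>c\<in>?C k. f (rep k c) * indicator (?D c) \<nu>) = (\<Sum>c\<in>?C k. if c = code k \<nu> then f (rep k c) else 0)"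
        by (rule sum.cong[OF refl])
      also have "\<dots> = f (rep k (code k \<nu>))" using codeC[OF n] A(1) by (simp add: sum.delta finite_PiE)
      finally show ?thesis ..
    qed
    moreover have "(\<lambda>\<nu>. \<Sum>c\<in>?C k. f (rep k c) * indicator (?D c) \<nu>) \<in> borel_measurable ?P"
      using D by (intro borel_measurable_sum borel_measurable_times borel_measurable_const borel_measurable_indicator)
    ultimately show "(\<lambda>\<nu>. f (rep k (code k \<nu>))) \<in> borel_measurable ?P" by (simp cong: measurable_cong)
  next
    fix \<nu> assume "\<nu> \<in> space (prob_algebra (count_space S))"
    then have \<nu>: "\<nu> \<in> pdisc S" by (simp only: space_prob_algebra_count)
    show "(\<lambda>k. f (rep k (code k \<nu>))) \<longlonglongrightarrow> f \<nu>"
    proof (rule weak_continuous_limit[OF f S _ \<nu>])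
      show "rep k (code k \<nu>) \<in> pdisc S" for k using rep[OF \<nu>] by simp
      fix z assume z: "z \<in> S"
      have "\<bar>measure (rep k (code k \<nu>)) {z} - measure \<nu> {z}\<bar> \<le> inverse (real (Suc k))" if k: "to_nat_on S z \<le> k" for k
      proof -
        have "z = from_nat_into S (to_nat_on S z)" using S z by simp
        then have zA: "z \<in> A k" unfolding A_def using k by blast
        have "code k (rep k (code k \<nu>)) z = code k \<nu> z" using rep[OF \<nu>] by simp
        then have "\<lfloor>real (Suc k) * measure (rep k (code k \<nu>)) {z}\<rfloor> = \<lfloor>real (Suc k) * measure \<nu> {z}\<rfloor>"
          using zA by (simp add: code_def)
        then have "\<bar>real (Suc k) * measure (rep k (code k \<nu>)) {z} - real (Suc k) * measure \<nu> {z}\<bar> \<le> 1" by linarith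
        then have "real (Suc k) * \<bar>measure (rep k (code k \<nu>)) {z} - measure \<nu> {z}\<bar> \<le> 1"
          unfolding right_diff_distrib[symmetric] abs_mult by simp
        then show ?thesis by (simp add: field_simps)
      qed
      then have "\<forall>\<^sub>F k in sequentially. norm (measure (rep k (code k \<nu>)) {z} - measure \<nu> {z}) \<le> inverse (real (Suc k))"
        unfolding eventually_sequentially by auto
      then show "(\<lambda>k. measure (rep k (code k \<nu>)) {z}) \<longlonglongrightarrow> measure \<nu> {z}"
        by (intro LIM_zero_cancel[OF Lim_null_comparison[OF _ LIMSEQ_inverse_real_of_nat]])
    qed
  qed
qed

text \<open>
  A sequence of vectors indexed by a finite set and bounded by 1 has a convergent subsequence.
\<close>

lemma finite_Bolzano_Weierstrass:
  fixes a :: "nat \<Rightarrow> 'a \<Rightarrow> real"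
  assumes "finite F" "\<And>k z. z \<in> F \<Longrightarrow> \<bar>a k z\<bar> \<le> 1"
  shows "\<exists>r. strict_mono r \<and> (\<forall>z\<in>F. convergent (\<lambda>k. a (r k) z))"
  using assms
proof (induction F rule: finite_induct)
  case empty then show ?case by (intro exI[of _ id]) (auto simp: strict_mono_def)
next
  case (insert y F)
  then obtain r where r: "strict_mono r" "\<forall>z\<in>F. convergent (\<lambda>k. a (r k) z)" by auto
  have "\<forall>k. a (r k) y \<in> {-1..1}" using insert.prems[of y] by (simp add: abs_le_iff minus_le_iff)
  then obtain l s where s: "strict_mono s" "((\<lambda>k. a (r k) y) \<circ> s) \<longlonglongrightarrow> l"
    using compact_Icc[of "-1" "1 :: real"] unfolding compact_def by metis
  have "convergent (\<lambda>k. a (r (s k)) z)" if "z \<in> insert y F" for z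
  proof (cases "z = y")
    case True then show ?thesis using s(2) by (auto simp: convergent_def comp_def)
  next
    case False
    then have "convergent (\<lambda>k. a (r k) z)" using r(2) that by blast
    from convergent_subseq_convergent[OF this s(1)] show ?thesis by (simp add: comp_def)
  qed
  then show ?case using strict_mono_o[OF r(1) s(1)] by (intro exI[of _ "r \<circ> s"]) (simp add: comp_def)
qed

definition mass_measure :: "'a set \<Rightarrow> ('a \<Rightarrow> real) \<Rightarrow> 'a measure" where
  "mass_measure S m = density (count_space S) (\<lambda>z. ennreal (m z))"

lemma mass_measure:
  assumes "finite F" "F \<subseteq> S" "\<And>z. z \<in> S \<Longrightarrow> 0 \<le> m z" "\<And>z. z \<in> S - F \<Longrightarrow> m z = 0" "(\<Sum>z\<in>F. m z) = 1"
  shows "mass_measure S m \<in> pdisc S" "z \<in> S \<Longrightarrow> measure (mass_measure S m) {z} = m z"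
proof -
  have "emeasure (mass_measure S m) S = (\<integral>\<^sup>+z. ennreal (m z) * indicator S z \<partial>count_space S)"
    unfolding mass_measure_def by (rule emeasure_density) auto
  also have "\<dots> = (\<integral>\<^sup>+z. ennreal (m z) \<partial>count_space S)" by (intro nn_integral_cong) simp
  also have "\<dots> = (\<Sum>z\<in>F. ennreal (m z))"
    by (rule nn_integral_count_space'[OF assms(1) _ assms(2)]) (use assms(4) in auto)
  also have "\<dots> = ennreal (\<Sum>z\<in>F. m z)" by (rule sum_ennreal) (use assms(2,3) in auto)
  finally have "emeasure (mass_measure S m) S = 1" using assms(5) by simp
  then have "prob_space (mass_measure S m)" by (intro prob_spaceI) (simp add: mass_measure_def)
  then show "mass_measure S m \<in> pdisc S" by (simp add: pdisc_iff mass_measure_def)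
  assume z: "z \<in> S"
  have "emeasure (mass_measure S m) {z} = (\<integral>\<^sup>+w. ennreal (m w) * indicator {z} w \<partial>count_space S)"
    unfolding mass_measure_def using z by (intro emeasure_density) auto
  also have "\<dots> = ennreal (m z)"
    using z by (subst nn_integral_count_space'[of "{z}"]) auto
  finally show "measure (mass_measure S m) {z} = m z" using assms(3)[OF z] by (simp add: measure_def)
qed

text \<open>
  On the measures carried by a fixed finite set, a simplex, a weakly continuous function is uniformly
  continuous in the masses.
\<close>

lemma weak_uniformly_continuous:
  assumes f: "continuous_map (weak_topology (discrete_topology S)) euclideanreal f" and S: "countable S"
    and F: "finite F" "F \<subseteq> S" and \<epsilon>: "0 < \<epsilon>"
  shows "\<exists>\<delta>>0. \<forall>\<nu>\<in>pdisc S. \<forall>\<nu>'\<in>pdisc S. (\<forall>z\<in>S - F. measure \<nu> {z} = 0 \<and> measure \<nu>' {z} = 0) \<longrightarrow>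
    (\<Sum>z\<in>F. measure \<nu> {z}) = 1 \<longrightarrow> (\<forall>z\<in>F. \<bar>measure \<nu> {z} - measure \<nu>' {z}\<bar> < \<delta>) \<longrightarrow> \<bar>f \<nu> - f \<nu>'\<bar> < \<epsilon>"
proof (rule ccontr)
  let ?bad = "\<lambda>\<delta> \<nu> \<nu>'. \<nu> \<in> pdisc S \<and> \<nu>' \<in> pdisc S \<and> (\<forall>z\<in>S - F. measure \<nu> {z} = 0 \<and> measure \<nu>' {z} = 0) \<and>
    (\<Sum>z\<in>F. measure \<nu> {z}) = 1 \<and> (\<forall>z\<in>F. \<bar>measure \<nu> {z} - measure \<nu>' {z}\<bar> < \<delta>) \<and> \<epsilon> \<le> \<bar>f \<nu> - f \<nu>'\<bar>"
  assume no: "\<not> ?thesis"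
  have ex: "\<exists>p. ?bad (inverse (real (Suc k))) (fst p) (snd p)" for k
  proof (rule ccontr)
    assume c: "\<not> (\<exists>p. ?bad (inverse (real (Suc k))) (fst p) (snd p))"
    have good: "\<bar>f \<nu> - f \<nu>'\<bar> < \<epsilon>"
      if "\<nu> \<in> pdisc S" "\<nu>' \<in> pdisc S" "\<forall>z\<in>S - F. measure \<nu> {z} = 0 \<and> measure \<nu>' {z} = 0"
        "(\<Sum>z\<in>F. measure \<nu> {z}) = 1" "\<forall>z\<in>F. \<bar>measure \<nu> {z} - measure \<nu>' {z}\<bar> < inverse (real (Suc k))" for \<nu> \<nu>'
    proof (rule ccontr)
      assume "\<not> \<bar>f \<nu> - f \<nu>'\<bar> < \<epsilon>"
      then have "?bad (inverse (real (Suc k))) (fst (\<nu>, \<nu>')) (snd (\<nu>, \<nu>'))" using that by simp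
      then have "\<exists>p. ?bad (inverse (real (Suc k))) (fst p) (snd p)" by (rule exI)
      then show False using c by simp
    qed
    show False
      by (rule no[THEN notE], intro exI[of _ "inverse (real (Suc k))"] conjI ballI impI good) simp_all
  qed
  define p where "p k = (SOME p. ?bad (inverse (real (Suc k))) (fst p) (snd p))" for k
  have p: "?bad (inverse (real (Suc k))) (fst (p k)) (snd (p k))" for k
    unfolding p_def by (rule someI_ex[OF ex])
  define \<nu> where "\<nu> k = fst (p k)" for k
  define \<nu>' where "\<nu>' k = snd (p k)" for k
  have \<nu>: "\<nu> k \<in> pdisc S" "\<nu>' k \<in> pdisc S" "z \<in> S - F \<Longrightarrow> measure (\<nu> k) {z} = 0"
    "z \<in> S - F \<Longrightarrow> measure (\<nu>' k) {z} = 0" "(\<Sum>z\<in>F. measure (\<nu> k) {z}) = 1"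
    "z \<in> F \<Longrightarrow> \<bar>measure (\<nu> k) {z} - measure (\<nu>' k) {z}\<bar> < inverse (real (Suc k))" "\<epsilon> \<le> \<bar>f (\<nu> k) - f (\<nu>' k)\<bar>" for k z
    using p[of k] by (simp_all add: \<nu>_def \<nu>'_def)
  have "\<bar>measure (\<nu> k) {z}\<bar> \<le> 1" for k z
  proof -
    interpret prob_space "\<nu> k" using \<nu>(1) by (simp add: pdisc_iff)
    show ?thesis by simp
  qed
  then obtain r where r: "strict_mono r" "\<forall>z\<in>F. convergent (\<lambda>k. measure (\<nu> (r k)) {z})"
    using finite_Bolzano_Weierstrass[OF F(1), of "\<lambda>k z. measure (\<nu> k) {z}"] by auto
  define m where "m z = (if z \<in> F then lim (\<lambda>k. measure (\<nu> (r k)) {z}) else 0)" for z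
  have m: "(\<lambda>k. measure (\<nu> (r k)) {z}) \<longlonglongrightarrow> m z" if "z \<in> S" for z
  proof (cases "z \<in> F")
    case True then show ?thesis using r(2) by (simp add: m_def convergent_LIMSEQ_iff)
  next
    case False then show ?thesis using \<nu>(3)[of z] that by (simp add: m_def)
  qed
  have "(\<lambda>k. \<Sum>z\<in>F. measure (\<nu> (r k)) {z}) \<longlonglongrightarrow> (\<Sum>z\<in>F. m z)" by (intro tendsto_sum m) (use F(2) in auto)
  then have m1: "(\<Sum>z\<in>F. m z) = 1" unfolding \<nu>(5) using LIMSEQ_unique[OF _ tendsto_const] by metis
  have m0: "0 \<le> m z" if "z \<in> S" for z by (rule LIMSEQ_le_const[OF m[OF that]]) auto
  have mF: "m z = 0" if "z \<in> S - F" for z using that by (simp add: m_def)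
  have mm: "mass_measure S m \<in> pdisc S" "\<And>z. z \<in> S \<Longrightarrow> measure (mass_measure S m) {z} = m z"
    using m0 mF by (auto intro!: mass_measure[OF F _ _ m1])
  have c1: "(\<lambda>k. f (\<nu> (r k))) \<longlonglongrightarrow> f (mass_measure S m)"
    by (rule weak_continuous_limit[OF f S \<nu>(1) mm(1)]) (simp add: mm(2) m)
  have "(\<lambda>k. measure (\<nu>' (r k)) {z}) \<longlonglongrightarrow> m z" if z: "z \<in> S" for z
  proof -
    have "\<bar>measure (\<nu>' (r k)) {z} - measure (\<nu> (r k)) {z}\<bar> \<le> inverse (real (Suc k))" for k
    proof (cases "z \<in> F")
      case True
      have "inverse (real (Suc (r k))) \<le> inverse (real (Suc k))"
        using seq_suble[OF r(1), of k] by (simp add: field_simps)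
      then show ?thesis using \<nu>(6)[OF True, of "r k"] by linarith
    next
      case False then show ?thesis using \<nu>(3,4)[of z] z by simp
    qed
    then have "(\<lambda>k. measure (\<nu>' (r k)) {z} - measure (\<nu> (r k)) {z}) \<longlonglongrightarrow> 0"
      by (intro Lim_null_comparison[OF _ LIMSEQ_inverse_real_of_nat] always_eventually allI) simp
    from tendsto_add[OF this m[OF z]] show ?thesis by simp
  qed
  then have c2: "(\<lambda>k. f (\<nu>' (r k))) \<longlonglongrightarrow> f (mass_measure S m)"
    by (intro weak_continuous_limit[OF f S \<nu>(2) mm(1)]) (simp add: mm(2))
  have "(\<lambda>k. \<bar>f (\<nu> (r k)) - f (\<nu>' (r k))\<bar>) \<longlonglongrightarrow> \<bar>f (mass_measure S m) - f (mass_measure S m)\<bar>"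
    by (intro tendsto_intros c1 c2)
  then have "\<epsilon> \<le> \<bar>f (mass_measure S m) - f (mass_measure S m)\<bar>"
    by (rule LIMSEQ_le_const) (use \<nu>(7) in auto)
  then show False using \<epsilon> by simp
qed

section \<open>Marked balls\<close>

abbreviation marked_ball :: "nat set set \<Rightarrow> nat \<Rightarrow> nat \<Rightarrow> (nat \<Rightarrow> spin) \<Rightarrow> spin network" where
  "marked_ball E t v \<equiv> sub_network E (gball E v t) v"

lemma abs_network_eqI:
  assumes "rooted_net R" "rooted_net S" "net_iso f R S" shows "abs_network R = abs_network S"
proof -
  have "net_eq R S" unfolding net_eq_def using assms by blast
  then show ?thesis by (rule Quotient_rel_abs[OF Quotient_network])
qed

lemma rooted_marked_ball: "simple_lf E \<Longrightarrow> rooted_net (RNet (gball E v t) (induced E (gball E v t)) v x)"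
proof -
  assume s: "simple_lf E"
  have "nbrs (induced E (gball E v t)) w \<subseteq> gball E v t" for w by (auto simp: nbrs_def induced_def)
  then have "finite (nbrs (induced E (gball E v t)) w)" for w using finite_gball_lf[OF s] finite_subset by blast
  then show ?thesis by (simp add: rooted_net_def graph_on_gball[OF s] connected_gball root_in_gball)
qed

lemma marked_ball_cong:
  assumes "simple_lf E" "\<And>w. w \<in> gball E v t \<Longrightarrow> x w = y w" shows "marked_ball E t v x = marked_ball E t v y"
  unfolding sub_network_def
  by (rule abs_network_eqI[OF rooted_marked_ball[OF assms(1)] rooted_marked_ball[OF assms(1)], of id])
     (use assms(2) in \<open>simp add: net_iso_def\<close>)

lemma trunc_abs:
  assumes "rooted_net R" shows "trunc t (abs_network R) = marked_ball (edges R) t (rt R) (mark R)"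
proof -
  have "net_eq R R" unfolding net_eq_def using assms net_iso_refl by blast
  then show ?thesis unfolding sub_network_def by (simp add: trunc.abs_eq raw_trunc_def Let_def)
qed

lemma marked_ball_induced:
  assumes "gball E v t \<subseteq> W" shows "marked_ball (induced E W) t v = marked_ball E t v"
  using gball_induced_sup[OF assms order_refl] induced_induced[OF assms]
  by (simp add: sub_network_def fun_eq_iff)

lemma marked_ball_in_trunc_space:
  assumes "simple_lf E" shows "marked_ball E t v x \<in> trunc_space t"
proof -
  have "trunc t (abs_network (RNet (gball E v t) (induced E (gball E v t)) v x))
    = marked_ball (induced E (gball E v t)) t v x"
    using trunc_abs[OF rooted_marked_ball[OF assms, of v t x], of t] by simp
  also have "\<dots> = marked_ball E t v x" by (simp add: marked_ball_induced)
  finally show ?thesis by (simp add: trunc_space_def sub_network_def)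
qed

lemma marked_ball_iso:
  assumes "net_iso f R S" "rooted_net R" "rooted_net (S :: unit rnet)"
    and "\<And>v. v \<in> gball (edges R) (rt R) t \<Longrightarrow> y v = x (f v)"
  shows "marked_ball (edges S) t (rt S) x = marked_ball (edges R) t (rt R) y"
proof -
  have i: "net_iso f (raw_trunc t R) (raw_trunc t S)" by (rule net_iso_trunc[OF assms(1-3)])
  have "net_iso f (RNet (gball (edges R) (rt R) t) (induced (edges R) (gball (edges R) (rt R) t)) (rt R) y)
      (RNet (gball (edges S) (rt S) t) (induced (edges S) (gball (edges S) (rt S) t)) (rt S) x)"
    using i assms(4) by (simp add: net_iso_def)
  then show ?thesis unfolding sub_network_def
    by (intro abs_network_eqI[symmetric] rooted_marked_ball rooted_simple assms)
qed

text \<open>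
  A finite set that contains the connected marked rooted graphs with at most \<open>K\<close> vertices, up to
  isomorphism. Marks at numbers from \<open>K\<close> on are up, so that there are finitely many markings.
\<close>

definition nets :: "nat \<Rightarrow> spin network set" where
  "nets K = (\<lambda>(k, F, r, m). abs_network (RNet {..<k} F r m)) `
     ({..K} \<times> Pow (Pow {..<K}) \<times> {..<K} \<times> cfg {..<K} all_up)"

lemma finite_nets: "finite (nets K)"
  unfolding nets_def by (intro finite_imageI finite_cartesian_product) auto

lemma abs_in_nets:
  assumes R: "rooted_net (R :: spin rnet)" and fin: "finite (verts R)" "card (verts R) \<le> K"
  shows "abs_network R \<in> nets K"
proof -
  let ?k = "card (verts R)"
  obtain h where h: "bij_betw h (verts R) {..<?k}"
    using ex_bij_betw_finite_nat[OF fin(1)] by (auto simp: lessThan_atLeast0)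
  have g: "graph_on (verts R) (edges R)" "rt R \<in> verts R" "connected_graph (verts R) (edges R)"
    using R by (auto simp: rooted_net_def)
  have inj: "inj_on h (verts R)" and im: "h ` verts R = {..<?k}" using h by (auto simp: bij_betw_def)
  have sub: "e \<subseteq> verts R" if "e \<in> edges R" for e using g(1) that by (auto simp: graph_on_def)
  let ?F = "(`) h ` edges R"
  define m where "m v = (if v < ?k then mark R (inv_into (verts R) h v) else Up)" for v
  let ?S = "RNet {..<?k} ?F (h (rt R)) m"
  have F: "?F \<subseteq> Pow {..<?k}" using sub im by blast
  have "graph_on {..<?k} ?F"
    unfolding graph_on_def
  proof
    fix e' assume "e' \<in> ?F"
    then obtain e where e: "e \<in> edges R" "e' = h ` e" by blast
    then obtain u v where uv: "e = {u, v}" "u \<in> verts R" "v \<in> verts R" "u \<noteq> v" using g(1) by (auto simp: graph_on_def)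
    then have "h u \<noteq> h v" using inj by (auto dest: inj_onD)
    moreover have "h u \<in> {..<?k}" "h v \<in> {..<?k}" using uv im by blast+
    moreover have "e' = {h u, h v}" using e uv by simp
    ultimately show "e' \<in> {{u, v} |u v. u \<in> {..<?k} \<and> v \<in> {..<?k} \<and> u \<noteq> v}" by blast
  qed
  moreover have "connected_graph {..<?k} ?F"
  proof (rule connected_from_root[of _ "h (rt R)"])
    fix w assume "w \<in> {..<?k}"
    then obtain v where v: "v \<in> verts R" "w = h v" using im by blast
    have "(rt R, v) \<in> (adj (edges R))\<^sup>*" using g v by (auto simp: connected_graph_def)
    then have "(h (rt R), h v) \<in> (adj ?F)\<^sup>*"
    proof (induction rule: rtrancl_induct)
      case (step y z)
      have "{h y, h z} \<in> ?F" using step(2) by (intro image_eqI[of _ _ "{y, z}"]) (auto simp: adj_def)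
      then have "(h y, h z) \<in> adj ?F" by (simp add: adj_def)
      then show ?case using step.IH by (rule rtrancl_into_rtrancl[rotated])
    qed simp
    then show "(h (rt R), w) \<in> (adj ?F)\<^sup>*" using v by simp
  qed
  moreover have "finite (nbrs ?F v)" for v
    by (rule finite_subset[of _ "{..<?k}"]) (use F in \<open>auto simp: nbrs_def\<close>)
  moreover have r: "h (rt R) < ?k" using g(2) im by blast
  ultimately have S: "rooted_net ?S" by (simp add: rooted_net_def)
  have "net_iso h R ?S"
  proof -
    have "{h u, h v} \<in> ?F \<longleftrightarrow> {u, v} \<in> edges R" if uv: "u \<in> verts R" "v \<in> verts R" for u v
    proof
      assume "{h u, h v} \<in> ?F"
      then obtain e where e: "e \<in> edges R" "h ` {u, v} = h ` e" by auto
      have "{u, v} = e" by (rule inj_on_image_eq_iff[OF inj, THEN iffD1, OF _ _ e(2)]) (use uv sub[OF e(1)] in auto)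
      then show "{u, v} \<in> edges R" using e by simp
    next
      assume "{u, v} \<in> edges R"
      then show "{h u, h v} \<in> ?F" by (intro image_eqI[of _ _ "{u, v}"]) auto
    qed
    moreover have "m (h v) = mark R v" if "v \<in> verts R" for v
    proof -
      have "h v < ?k" using im that by blast
      then show ?thesis using inj that by (simp add: m_def)
    qed
    ultimately show ?thesis using h by (simp add: net_iso_def)
  qed
  then have eq: "abs_network R = abs_network ?S" by (rule abs_network_eqI[OF R S])
  have "m \<in> cfg {..<K} all_up" using fin(2) by (auto simp: cfg_def m_def)
  moreover have "?F \<in> Pow (Pow {..<K})" by (rule PowI, rule order_trans[OF F Pow_mono]) (use fin(2) in auto)
  moreover have "h (rt R) \<in> {..<K}" using fin(2) r by simp
  moreover have "?k \<in> {..K}" using fin(2) by simp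
  ultimately have "(?k, ?F, h (rt R), m) \<in> {..K} \<times> Pow (Pow {..<K}) \<times> {..<K} \<times> cfg {..<K} all_up"
    by (intro SigmaI)
  then show ?thesis unfolding nets_def eq by (rule rev_image_eqI) (simp only: prod.case)
qed

lemma marked_ball_in_nets:
  "simple_lf E \<Longrightarrow> card (gball E v t) \<le> K \<Longrightarrow> marked_ball E t v x \<in> nets K"
  unfolding sub_network_def by (rule abs_in_nets[OF rooted_marked_ball]) (auto simp: finite_gball_lf)

text \<open>
  The balls of a locally finite graph are finite, and there are finitely many finite marked graphs of
  each size.
\<close>

lemma countable_trunc_space: "countable (trunc_space t :: spin network set)"
proof -
  have "X \<in> (\<Union>K. nets K)" if "X \<in> trunc_space t" for X :: "spin network"
  proof -
    have "X = trunc t (abs_network (rep_network X))" using that by (simp add: trunc_space_def abs_rep_network)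
    then have "X = marked_ball (edges (rep_network X)) t (rt (rep_network X)) (mark (rep_network X))"
      by (simp only: trunc_abs[OF rooted_net_rep])
    then show ?thesis using marked_ball_in_nets[OF rooted_simple[OF rooted_net_rep] order_refl] by (metis UN_I UNIV_I)
  qed
  then have "trunc_space t \<subseteq> (\<Union>K. nets K)" by blast
  moreover have "countable (\<Union>K. nets K)" using finite_nets by (auto intro: countable_finite)
  ultimately show ?thesis by (rule countable_subset)
qed

text \<open>
  The symmetrized indicator of the event that the marked ball is \<open>Z\<close>. An average of it with plus
  boundary condition is a mean of the probabilities for plus and for minus boundary conditions.
\<close>

definition half_ind :: "nat \<Rightarrow> spin network \<Rightarrow> nat set set \<Rightarrow> nat \<Rightarrow> (nat \<Rightarrow> spin) \<Rightarrow> real" where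
  "half_ind t Z E v x = (of_bool (marked_ball E t v x = Z) + of_bool (marked_ball E t v (sflip x) = Z)) / 2"

lemma half_ind_bounds: "0 \<le> half_ind t Z E v x" "half_ind t Z E v x \<le> 1"
  by (simp_all add: half_ind_def)

lemma half_ind_sflip: "half_ind t Z E v (sflip x) = half_ind t Z E v x"
  by (simp add: half_ind_def add.commute)

lemma half_ind_cong:
  assumes "simple_lf E" "\<And>w. w \<in> gball E v t \<Longrightarrow> x w = y w" shows "half_ind t Z E v x = half_ind t Z E v y"
proof -
  have "marked_ball E t v x = marked_ball E t v y" by (rule marked_ball_cong[OF assms])
  moreover have "marked_ball E t v (sflip x) = marked_ball E t v (sflip y)"
    by (rule marked_ball_cong[OF assms(1)]) (simp add: sflip_def assms(2))
  ultimately show ?thesis by (simp add: half_ind_def)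
qed

lemma half_ind_local: "simple_lf E \<Longrightarrow> local_on (gball E v t) (half_ind t Z E v)"
  unfolding local_on_def using half_ind_cong by blast

lemma half_ind_sum:
  assumes "finite F" "\<And>x. marked_ball E t v x \<in> F" shows "(\<Sum>Z\<in>F. half_ind t Z E v x) = 1"
proof -
  have "(\<Sum>Z\<in>F. of_bool (marked_ball E t v y = Z) :: real) = 1" for y
    using assms by (simp add: of_bool_def sum.delta)
  then show ?thesis by (simp add: half_ind_def sum_divide_distrib[symmetric] sum.distrib)
qed

lemma half_ind_outside: "(\<And>x. marked_ball E t v x \<noteq> Z) \<Longrightarrow> half_ind t Z E v = (\<lambda>_. 0)"
  by (simp add: half_ind_def fun_eq_iff)

text \<open>
  The law of the marked ball of radius \<open>t\<close> when the spins outside the ball of radius \<open>d\<close> are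
  all up or all down, each with probability one half.
\<close>

definition ball_mass :: "nat \<Rightarrow> nat \<Rightarrow> real \<Rightarrow> spin network \<Rightarrow> nat set set \<Rightarrow> nat \<Rightarrow> real" where
  "ball_mass t d \<beta> Z E v = plus_ex E v d \<beta> 0 (half_ind t Z E v)"

definition ball_law :: "nat \<Rightarrow> nat \<Rightarrow> real \<Rightarrow> nat set set \<Rightarrow> nat \<Rightarrow> spin network measure" where
  "ball_law t d \<beta> E v = mass_measure (trunc_space t) (\<lambda>Z. ball_mass t d \<beta> Z E v)"

lemma local_fun_ball_mass:
  assumes "t \<le> d" shows "local_fun (Suc d) (ball_mass t d \<beta> Z)"
proof (rule local_funI)
  fix E v W assume E: "simple_lf E" and W: "gball E v (Suc d) \<subseteq> W"
  have "gball E v t \<subseteq> W" using gball_mono[of t "Suc d" E v] assms W by auto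
  then have "half_ind t Z (induced E W) v = half_ind t Z E v"
    by (simp add: half_ind_def fun_eq_iff marked_ball_induced)
  then show "ball_mass t d \<beta> Z (induced E W) v = ball_mass t d \<beta> Z E v"
    unfolding ball_mass_def by (simp add: plus_ex_induced[OF W])
next
  fix R S :: "unit rnet" and f assume RS: "rooted_net R" "rooted_net S" "net_iso f R S"
  show "ball_mass t d \<beta> Z (edges S) (rt S) = ball_mass t d \<beta> Z (edges R) (rt R)"
    unfolding ball_mass_def
  proof (rule plus_ex_iso[OF RS(3,1,2)])
    fix x
    let ?y = "\<lambda>v. if v \<in> gball (edges R) (rt R) d then x (f v) else Up"
    have sub: "gball (edges R) (rt R) t \<subseteq> gball (edges R) (rt R) d" by (rule gball_mono[OF assms])
    have "marked_ball (edges S) t (rt S) x = marked_ball (edges R) t (rt R) ?y"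
      by (rule marked_ball_iso[OF RS(3,1,2)]) (use sub in auto)
    moreover have "marked_ball (edges S) t (rt S) (sflip x) = marked_ball (edges R) t (rt R) (sflip ?y)"
      by (rule marked_ball_iso[OF RS(3,1,2)]) (use sub in \<open>auto simp: sflip_def\<close>)
    ultimately show "half_ind t Z (edges S) (rt S) x = half_ind t Z (edges R) (rt R) ?y" by (simp add: half_ind_def)
  qed
qed

lemma local_fun_ball_law:
  assumes "t \<le> d" shows "local_fun (Suc d) (ball_law t d \<beta>)"
proof (rule local_funI)
  fix E v W assume E: "simple_lf E" and W: "gball E v (Suc d) \<subseteq> W"
  then show "ball_law t d \<beta> (induced E W) v = ball_law t d \<beta> E v"
    unfolding ball_law_def by (simp add: local_fun_induced[OF local_fun_ball_mass[OF assms]])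
next
  fix R S :: "unit rnet" and f assume "rooted_net R" "rooted_net S" "net_iso f R S"
  then show "ball_law t d \<beta> (edges S) (rt S) = ball_law t d \<beta> (edges R) (rt R)"
    unfolding ball_law_def by (simp add: local_fun_iso[OF local_fun_ball_mass[OF assms]])
qed

lemma ball_law:
  assumes "simple_lf E"
  shows "ball_law t d \<beta> E v \<in> pdisc (trunc_space t)"
    and "Z \<in> trunc_space t \<Longrightarrow> measure (ball_law t d \<beta> E v) {Z} = ball_mass t d \<beta> Z E v"
proof -
  let ?F = "nets (card (gball E v t)) \<inter> trunc_space t"
  note fin = finite_gball_lf[OF assms, of v d]
  have mem: "marked_ball E t v x \<in> ?F" for x
    using marked_ball_in_nets[OF assms order_refl] marked_ball_in_trunc_space[OF assms] by blast
  have F: "finite ?F" "?F \<subseteq> trunc_space t" using finite_nets by auto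
  have pos: "0 \<le> ball_mass t d \<beta> Z E v" for Z
  proof -
    have "plus_ex E v d \<beta> 0 (\<lambda>_. 0) \<le> ball_mass t d \<beta> Z E v"
      unfolding ball_mass_def plus_ex_def by (rule gex_mono[OF fin half_ind_bounds(1)])
    then show ?thesis unfolding plus_ex_def by (simp add: gex_const[OF fin])
  qed
  have out: "ball_mass t d \<beta> Z E v = 0" if "Z \<in> trunc_space t - ?F" for Z
  proof -
    have "half_ind t Z E v = (\<lambda>_. 0)" by (rule half_ind_outside) (use mem that in auto)
    then show ?thesis unfolding ball_mass_def plus_ex_def by (simp add: gex_const[OF fin])
  qed
  have "(\<Sum>Z\<in>?F. ball_mass t d \<beta> Z E v) = plus_ex E v d \<beta> 0 (\<lambda>x. \<Sum>Z\<in>?F. half_ind t Z E v x)"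
    unfolding ball_mass_def plus_ex_def by (rule gex_sum[symmetric])
  also have "\<dots> = 1" unfolding half_ind_sum[OF F(1) mem] plus_ex_def by (rule gex_const[OF fin])
  finally have one: "(\<Sum>Z\<in>?F. ball_mass t d \<beta> Z E v) = 1" .
  show "ball_law t d \<beta> E v \<in> pdisc (trunc_space t)"
    unfolding ball_law_def by (rule mass_measure(1)[OF F pos out one])
  show "measure (ball_law t d \<beta> E v) {Z} = ball_mass t d \<beta> Z E v" if "Z \<in> trunc_space t"
    unfolding ball_law_def by (rule mass_measure(2)[OF F pos out one that])
qed

lemma ising_finite:
  shows "sets (ising E n \<beta>) = Pow (PiE {1..n} (\<lambda>_. UNIV))" "prob_space (ising E n \<beta>)"
    and "graph_on {1..n} E \<Longrightarrow> local_on {1..n} f \<Longrightarrow> (\<integral>x. f x \<partial>ising E n \<beta>) = nex E n \<beta> 0 f"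
proof -
  let ?V = "{1..n}" and ?L = "PiE {1..n} (\<lambda>_. UNIV :: spin set)"
  let ?w = "ising_weight ?V E \<beta> 0"
  have sp: "spin_space ?V = count_space ?L" unfolding spin_space_def by (rule count_space_PiM_finite) auto
  have fin: "finite ?L" by (rule finite_PiE) auto
  have w: "0 \<le> ?w x" for x by (simp add: ising_weight_def)
  have ne: "?L \<noteq> {}" by (simp add: PiE_eq_empty_iff)
  have pos: "0 < (\<Sum>x\<in>?L. ?w x)" by (rule sum_pos[OF fin ne]) (simp add: ising_weight_def)
  have eq: "ising E n \<beta> = gibbs (count_space ?L) ?L ?w" unfolding ising_def sp by simp
  note G = gibbs_finite[of ?L "count_space ?L" ?w, OF fin _ w pos, folded eq]
  show "sets (ising E n \<beta>) = Pow ?L" using G(1) by (simp only: sets_count_space space_count_space order_refl)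
  show "prob_space (ising E n \<beta>)" by (rule G(2)) simp
  assume E: "graph_on {1..n} E" and f: "local_on {1..n} f"
  let ?i = "\<lambda>x :: nat \<Rightarrow> spin. restrict x ?V" and ?j = "\<lambda>(x :: nat \<Rightarrow> spin) v. if v \<in> ?V then x v else Up"
  have bij: "bij_betw ?i (cfg ?V all_up) ?L"
    by (rule bij_betw_byWitness[of _ ?j]) (auto simp: cfg_def fun_eq_iff PiE_iff extensional_def)
  have wi: "?w (?i x) = exp (ham E ?V \<beta> 0 x)" for x
  proof -
    have "(\<Prod>v\<in>e. spin_val (?i x v)) = chi e x" if "e \<in> E" for e
      unfolding chi_def by (rule prod.cong) (use that E in \<open>auto simp: graph_on_def\<close>)
    then show ?thesis by (simp add: ising_weight_def ham_def)
  qed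
  have S: "(\<Sum>x\<in>?L. ?w x * g x) = gsum ?V all_up (ham E ?V \<beta> 0) (\<lambda>x. g (?i x))" for g :: "_ \<Rightarrow> real"
    unfolding gsum_def sum.reindex_bij_betw[OF bij, symmetric] wi ..
  have fi: "f (?i x) = f x" for x using f unfolding local_on_def by (metis restrict_apply')
  have "(\<integral>x. f x \<partial>ising E n \<beta>) = (\<Sum>x\<in>?L. ?w x * f x) / (\<Sum>x\<in>?L. ?w x)" by (rule G(3)) simp_all
  also have "\<dots> = nex E n \<beta> 0 f" using S[of f] S[of "\<lambda>_. 1"] unfolding nex_def gex_def fi by (simp only: mult_1_right)
  finally show "(\<integral>x. f x \<partial>ising E n \<beta>) = nex E n \<beta> 0 f" .
qed

text \<open>
  The Ising measure without a field is invariant under a global flip of the spins.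
\<close>

lemma nex_sflip:
  assumes "graph_on {1..n} E" "local_on {1..n} f"
  shows "nex E n \<beta> 0 (\<lambda>x. f (sflip x)) = nex E n \<beta> 0 f"
proof -
  have chi: "chi e x = chi e y" if "e \<in> E" "\<And>v. v \<in> {1..n} \<Longrightarrow> x v = y v" for e and x y :: "nat \<Rightarrow> spin"
    by (rule chi_cong) (use that assms(1) in \<open>auto simp: graph_on_def\<close>)
  have "gex {1..n} (sflip all_up) (ham E {1..n} \<beta> 0) f = gex {1..n} all_up (ham E {1..n} \<beta> 0) f"
  proof (rule gex_restrict)
    fix x y :: "nat \<Rightarrow> spin" assume xy: "\<And>v. v \<in> {1..n} \<Longrightarrow> x v = y v"
    then show "ham E {1..n} \<beta> 0 x = ham E {1..n} \<beta> 0 y" using chi[of _ x y] by (simp add: ham_def)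
    show "f x = f y" using assms(2) xy by (simp add: local_on_def)
  qed auto
  then show ?thesis
    unfolding nex_def using gex_sflip[OF graph_on_simple(1)[OF assms(1)] order_refl] by simp
qed

lemma local_law_pdisc:
  assumes E: "graph_on {1..n} E" shows "local_law E (ising E n \<beta>) t i \<in> pdisc (trunc_space t)"
proof -
  interpret prob_space "ising E n \<beta>" by (rule ising_finite(2))
  have sp: "space (ising E n \<beta>) = PiE {1..n} (\<lambda>_. UNIV)"
    using sets_eq_imp_space_eq[of "ising E n \<beta>" "count_space (PiE {1..n} (\<lambda>_. UNIV))"] by (simp add: ising_finite(1))
  have m: "marked_ball E t i \<in> measurable (ising E n \<beta>) (count_space (trunc_space t))"
    by (rule measurableI) (use marked_ball_in_trunc_space[OF graph_on_simple(1)[OF E]] in \<open>auto simp: sp ising_finite(1)\<close>)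
  show ?thesis by (auto simp: pdisc_iff local_law_def intro: prob_space_distr[OF m])
qed

text \<open>
  By flip invariance, the indicator of the event may be replaced by its symmetrization.
\<close>

lemma local_law_mass:
  assumes E: "graph_on {1..n} E" and i: "i \<in> {1..n}" and Z: "Z \<in> trunc_space t"
  shows "measure (local_law E (ising E n \<beta>) t i) {Z} = nex E n \<beta> 0 (half_ind t Z E i)"
proof -
  interpret prob_space "ising E n \<beta>" by (rule ising_finite(2))
  note s = graph_on_simple(1)[OF E]
  have sp: "space (ising E n \<beta>) = PiE {1..n} (\<lambda>_. UNIV)"
    using sets_eq_imp_space_eq[of "ising E n \<beta>" "count_space (PiE {1..n} (\<lambda>_. UNIV))"] by (simp add: ising_finite(1))
  have m: "marked_ball E t i \<in> measurable (ising E n \<beta>) (count_space (trunc_space t))"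
    by (rule measurableI) (use marked_ball_in_trunc_space[OF s] in \<open>auto simp: sp ising_finite(1)\<close>)
  let ?g = "\<lambda>x. of_bool (marked_ball E t i x = Z) :: real"
  have loc: "local_on {1..n} ?g"
    unfolding local_on_def
  proof (intro allI impI)
    fix x y :: "nat \<Rightarrow> spin" assume "\<forall>v\<in>{1..n}. x v = y v"
    then have "marked_ball E t i x = marked_ball E t i y"
      by (intro marked_ball_cong[OF s]) (use gball_in_V[OF E i] in auto)
    then show "?g x = ?g y" by simp
  qed
  have "measure (local_law E (ising E n \<beta>) t i) {Z} = measure (ising E n \<beta>) (marked_ball E t i -` {Z} \<inter> space (ising E n \<beta>))"
    unfolding local_law_def by (rule measure_distr[OF m]) (use Z in simp)
  also have "\<dots> = (\<integral>x. indicator (marked_ball E t i -` {Z} \<inter> space (ising E n \<beta>)) x \<partial>ising E n \<beta>)"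
    by (simp add: Int_absorb2 Int_commute)
  also have "\<dots> = (\<integral>x. ?g x \<partial>ising E n \<beta>)"
    by (rule Bochner_Integration.integral_cong[OF refl]) (simp add: indicator_def)
  also have "\<dots> = nex E n \<beta> 0 ?g" by (rule ising_finite(3)[OF E loc])
  finally have 1: "measure (local_law E (ising E n \<beta>) t i) {Z} = nex E n \<beta> 0 ?g" .
  have "nex E n \<beta> 0 (half_ind t Z E i) = (1 / 2) * (nex E n \<beta> 0 ?g + nex E n \<beta> 0 (\<lambda>x. ?g (sflip x)))"
    unfolding nex_def gex_add[symmetric] gex_cmult[symmetric] by (rule gex_cong) (simp add: half_ind_def)
  then show ?thesis unfolding nex_sflip[OF E loc] 1 by simp
qed

section \<open>The limit measures\<close>

definition ball_event :: "nat \<Rightarrow> spin network \<Rightarrow> spin network set" where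
  "ball_event t Z = {Y. trunc t Y = Z}"

lemma trunc_in_trunc_space: "trunc t Y \<in> trunc_space t"
  by (simp add: trunc_space_def trunc_trunc)

lemma open_ball_event: "open (ball_event t Z)"
  unfolding open_dist
proof
  fix Y assume Y: "Y \<in> ball_event t Z"
  have "trunc t Y' = Z" if "dist Y' Y < 1 / (real t + 1)" for Y'
    using dist_trunc[OF that] Y by (simp add: ball_event_def)
  then show "\<exists>e>0. \<forall>Y'. dist Y' Y < e \<longrightarrow> Y' \<in> ball_event t Z"
    by (intro exI[of _ "1 / (real t + 1)"]) (auto simp: ball_event_def)
qed

lemma trunc_dist:
  assumes "trunc t X = trunc t Y" shows "dist X (Y :: 'm network) \<le> 1 / (real t + 1)"
proof -
  have "enat t \<le> agree_radius X Y" unfolding agree_radius_def by (rule SUP_upper) (use assms in simp)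
  then show ?thesis by (cases "agree_radius X Y") (auto simp: dist_network_def intro!: divide_left_mono)
qed

text \<open>
  An open set is a countable union of events about finite balls. These events are stable under
  intersection, so measurability of \<^const>\<open>phi\<close> can be checked on them.
\<close>

lemma sets_borel_network:
  "sets (borel :: spin network measure) = sigma_sets UNIV (insert {} {ball_event t Z | t Z. Z \<in> trunc_space t})"
  (is "_ = sigma_sets UNIV ?G")
proof -
  have "U \<in> sigma_sets UNIV ?G" if U: "open U" for U :: "spin network set"
  proof -
    let ?I = "{(t, Z). Z \<in> trunc_space t \<and> ball_event t Z \<subseteq> U}"
    have c: "countable ?I"
      by (rule countable_subset[of _ "Sigma UNIV trunc_space"]) (auto intro: countable_SIGMA countable_trunc_space)
    have "U \<subseteq> (\<Union>i\<in>?I. ball_event (fst i) (snd i))"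
    proof
      fix Y assume "Y \<in> U"
      then obtain e where e: "0 < e" "\<And>Y'. dist Y' Y < e \<Longrightarrow> Y' \<in> U" using U by (auto simp: open_dist)
      obtain t where t: "inverse (real (Suc t)) < e" using reals_Archimedean[OF e(1)] by blast
      have "ball_event t (trunc t Y) \<subseteq> U"
      proof
        fix Y' assume "Y' \<in> ball_event t (trunc t Y)"
        then have "dist Y' Y \<le> 1 / (real t + 1)" by (intro trunc_dist) (simp add: ball_event_def)
        moreover have "1 / (real t + 1) < e" using t by (simp add: inverse_eq_divide add.commute)
        ultimately show "Y' \<in> U" by (intro e(2)) linarith
      qed
      moreover have "Y \<in> ball_event t (trunc t Y)" by (simp add: ball_event_def)
      ultimately show "Y \<in> (\<Union>i\<in>?I. ball_event (fst i) (snd i))"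
        using trunc_in_trunc_space[of t Y] by (intro UN_I[of "(t, trunc t Y)"]) auto
    qed
    then have eq: "U = (\<Union>i\<in>?I. ball_event (fst i) (snd i))" by auto
    have "(\<Union>i\<in>?I. ball_event (fst i) (snd i)) \<in> sets (sigma UNIV ?G)"
      by (rule sets.countable_UN'[OF c]) auto
    then show ?thesis using eq by simp
  qed
  then have "sigma_sets UNIV {U. open U} \<subseteq> sigma_sets UNIV ?G" by (intro sigma_sets_mono) auto
  moreover have "sigma_sets UNIV ?G \<subseteq> sigma_sets UNIV {U. open U}"
    by (intro sigma_sets_mono) (auto intro: open_ball_event)
  ultimately show ?thesis by (auto simp: sets_borel)
qed

lemma trunc_measurable: "trunc t \<in> measurable borel (count_space (trunc_space t :: spin network set))"
  unfolding measurable_count_space_eq_countable[OF countable_trunc_space]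
proof (intro conjI ballI)
  fix Z :: "spin network"
  have "trunc t -` {Z} \<inter> space borel = ball_event t Z" by (auto simp: ball_event_def)
  then show "trunc t -` {Z} \<inter> space borel \<in> sets borel" using open_ball_event by simp
qed (use trunc_in_trunc_space in auto)

lemma marking_measurable:
  assumes R: "rooted_net (R :: 'm rnet)"
  shows "(\<lambda>x. abs_network (RNet (verts R) (edges R) (rt R) x)) \<in> measurable (spin_space (verts R)) borel"
    and "trunc t (abs_network (RNet (verts R) (edges R) (rt R) x)) = marked_ball (edges R) t (rt R) (x :: nat \<Rightarrow> spin)"
    and "local_on (gball (edges R) (rt R) t) (\<lambda>x. of_bool (marked_ball (edges R) t (rt R) x = Z))"
proof -
  let ?N = "\<lambda>x :: nat \<Rightarrow> spin. abs_network (RNet (verts R) (edges R) (rt R) x)"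
  let ?W = "\<lambda>t. gball (edges R) (rt R) t"
  have N: "rooted_net (RNet (verts R) (edges R) (rt R) x)" for x :: "nat \<Rightarrow> spin"
    using R by (simp add: rooted_net_def)
  show tr: "trunc t (?N x) = marked_ball (edges R) t (rt R) x" for t x
    using trunc_abs[OF N] by simp
  show loc: "local_on (?W t) (\<lambda>x. of_bool (marked_ball (edges R) t (rt R) x = Z))" for t Z
    unfolding local_on_def
  proof (intro allI impI)
    fix x y :: "nat \<Rightarrow> spin" assume "\<forall>v\<in>?W t. x v = y v"
    then have "marked_ball (edges R) t (rt R) x = marked_ball (edges R) t (rt R) y"
      by (intro marked_ball_cong rooted_simple R) auto
    then show "of_bool (marked_ball (edges R) t (rt R) x = Z) = (of_bool (marked_ball (edges R) t (rt R) y = Z) :: real)"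
      by simp
  qed
  let ?G = "insert {} {ball_event t Z | t Z. Z \<in> trunc_space t}"
  have "?N \<in> measurable (spin_space (verts R)) (sigma UNIV ?G)"
  proof (rule measurable_measure_of)
    fix A assume "A \<in> ?G"
    then consider "A = {}" | t Z where "A = ball_event t Z" by auto
    then show "?N -` A \<inter> space (spin_space (verts R)) \<in> sets (spin_space (verts R))"
    proof cases
      case 2
      let ?f = "\<lambda>x. of_bool (marked_ball (edges R) t (rt R) x = Z) :: real"
      have "?f \<in> borel_measurable (spin_space (verts R))"
        by (rule local_measurable[OF finite_gball[OF R] gball_subset[OF R] loc])
      then have "?f -` {1} \<inter> space (spin_space (verts R)) \<in> sets (spin_space (verts R))" by (rule measurable_sets) simp
      moreover have "?f -` {1} \<inter> space (spin_space (verts R)) = ?N -` A \<inter> space (spin_space (verts R))"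
        unfolding 2 by (auto simp: ball_event_def tr)
      ultimately show ?thesis by simp
    qed simp
  qed auto
  moreover have "sets (sigma UNIV ?G) = sets borel" unfolding sets_borel_network by simp
  ultimately show "?N \<in> measurable (spin_space (verts R)) borel" using measurable_cong_sets by blast
qed

lemma equal_mixture:
  assumes M: "prob_space M" and N: "prob_space N" and eq: "sets N = sets M"
  shows "sets (equal_mixture M N) = sets M" "prob_space (equal_mixture M N)"
    and "A \<in> sets M \<Longrightarrow> measure (equal_mixture M N) A = (measure M A + measure N A) / 2"
proof -
  let ?m = "\<lambda>A. (1 / 2) * emeasure M A + (1 / 2) * emeasure N A"
  show s: "sets (equal_mixture M N) = sets M" unfolding equal_mixture_def by simp
  have em: "emeasure (equal_mixture M N) A = ?m A" if "A \<in> sets M" for A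
  proof (rule emeasure_measure_of[OF equal_mixture_def])
    show "positive (sets (equal_mixture M N)) ?m" by (simp add: positive_def)
    show "countably_additive (sets (equal_mixture M N)) ?m"
    proof (rule countably_additiveI)
      fix A :: "nat \<Rightarrow> _" assume A: "range A \<subseteq> sets (equal_mixture M N)" "disjoint_family A"
      have "(\<Sum>i. ?m (A i)) = (\<Sum>i. (1 / 2) * emeasure M (A i)) + (\<Sum>i. (1 / 2) * emeasure N (A i))"
        by (rule suminf_add[symmetric]) auto
      also have "\<dots> = ?m (\<Union>i. A i)"
        using A s eq by (simp add: ennreal_suminf_cmult suminf_emeasure)
      finally show "(\<Sum>i. ?m (A i)) = ?m (\<Union>i. A i)" .
    qed
  qed (use that s sets.space_closed in auto)
  have half: "?m A = ennreal ((measure M A + measure N A) / 2)" for A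
  proof -
    have h: "(1 / 2 :: ennreal) = ennreal (1 / 2)" by (subst ennreal_divide_numeral[symmetric]) auto
    have "?m A = ennreal (1 / 2) * ennreal (measure M A) + ennreal (1 / 2) * ennreal (measure N A)"
      unfolding h using finite_measure.emeasure_eq_measure[OF prob_space.finite_measure[OF M]]
        finite_measure.emeasure_eq_measure[OF prob_space.finite_measure[OF N]] by simp
    also have "\<dots> = ennreal ((measure M A + measure N A) / 2)"
    proof -
      have "ennreal (1 / 2) * ennreal a = ennreal (a / 2)" if "0 \<le> a" for a
        using that by (subst ennreal_mult[symmetric]) auto
      then show ?thesis by (simp only: measure_nonneg add_divide_distrib ennreal_plus divide_nonneg_nonneg zero_le_numeral)
    qed
    finally show ?thesis .
  qed
  show "measure (equal_mixture M N) A = (measure M A + measure N A) / 2" if "A \<in> sets M"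
    using em[OF that] half by (simp add: measure_def[of "equal_mixture M N"])
  show "prob_space (equal_mixture M N)"
  proof (rule prob_spaceI)
    have sp: "space (equal_mixture M N) = space M" "space N = space M" using s eq by (auto dest: sets_eq_imp_space_eq)
    show "emeasure (equal_mixture M N) (space (equal_mixture M N)) = 1"
      using em[OF sets.top] prob_space.prob_space[OF M] prob_space.prob_space[OF N] unfolding sp half by (simp add: sp(2))
  qed
qed

lemma phi_law:
  assumes \<beta>: "0 \<le> \<beta>"
  shows "sets (phi \<beta> X) = sets borel" "prob_space (phi \<beta> X)"
    and "(\<lambda>d. at_root (ball_mass t d \<beta> Z) X) \<longlonglongrightarrow> measure (phi \<beta> X) (ball_event t Z)"
proof -
  define R where "R = rep_network X"
  have R: "rooted_net R" unfolding R_def by (rule rooted_net_rep)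
  let ?V = "verts R" and ?W = "gball (edges R) (rt R) t"
  let ?M = "\<lambda>s. ising_limit R s \<beta> 0"
  let ?N = "\<lambda>x. abs_network (RNet (verts R) (edges R) (rt R) x)"
  let ?mix = "equal_mixture (?M Up) (?M Down)"
  note IL = ising_limit[OF R \<beta>]
  note mix = equal_mixture[OF IL(2) IL(2), of Down Up, unfolded IL(1), OF refl]
  have phi: "phi \<beta> X = distr ?mix borel ?N" by (simp add: phi_def marked_law_def Let_def R_def)
  have m: "?N \<in> measurable ?mix borel"
    using marking_measurable(1)[OF R] measurable_cong_sets[OF mix(1) refl] by blast
  show "sets (phi \<beta> X) = sets borel" by (simp add: phi)
  show "prob_space (phi \<beta> X)" unfolding phi by (rule prob_space.prob_space_distr[OF mix(2) m])
  let ?f = "\<lambda>x. of_bool (marked_ball (edges R) t (rt R) x = Z) :: real"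
  let ?A = "{x \<in> space (spin_space ?V). marked_ball (edges R) t (rt R) x = Z}"
  have loc: "local_on ?W ?f" by (rule marking_measurable(3)[OF R])
  have W: "finite ?W" "?W \<subseteq> ?V" by (rule finite_gball[OF R]) (rule gball_subset[OF R])
  have sp: "space ?mix = space (spin_space ?V)" "space (?M s) = space (spin_space ?V)" for s
    using mix(1) IL(1) by (auto dest: sets_eq_imp_space_eq)
  have pre: "?N -` ball_event t Z \<inter> space ?mix = ?A" by (auto simp: ball_event_def marking_measurable(2)[OF R] sp)
  have A: "?A \<in> sets (spin_space ?V)"
    using measurable_sets[OF m borel_open[OF open_ball_event], of t Z] unfolding pre mix(1) .
  have int: "measure (?M s) ?A = (\<integral>x. ?f x \<partial>?M s)" for s
  proof -
    have "measure (?M s) ?A = (\<integral>x. indicator ?A x \<partial>?M s)"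
    proof -
      have "?A \<inter> space (?M s) = ?A" unfolding sp by auto
      then show ?thesis by simp
    qed
    also have "\<dots> = (\<integral>x. ?f x \<partial>?M s)"
      by (rule Bochner_Integration.integral_cong[OF refl]) (simp add: indicator_def sp)
    finally show ?thesis .
  qed
  have "measure (phi \<beta> X) (ball_event t Z) = measure ?mix ?A"
    unfolding phi using measure_distr[OF m borel_open[OF open_ball_event], of t Z] unfolding pre .
  also have "\<dots> = ((\<integral>x. ?f x \<partial>?M Up) + (\<integral>x. ?f x \<partial>?M Down)) / 2" unfolding mix(3)[OF A] int ..
  finally have meas: "measure (phi \<beta> X) (ball_event t Z) = ((\<integral>x. ?f x \<partial>?M Up) + (\<integral>x. ?f x \<partial>?M Down)) / 2" .
  have "(\<lambda>d. (bc_ex (edges R) (rt R) d Up \<beta> ?f + bc_ex (edges R) (rt R) d Down \<beta> ?f) / 2)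
      \<longlonglongrightarrow> ((\<integral>x. ?f x \<partial>?M Up) + (\<integral>x. ?f x \<partial>?M Down)) / 2"
    by (intro tendsto_intros IL(3)[OF W loc]) simp
  moreover have "(bc_ex (edges R) (rt R) d Up \<beta> ?f + bc_ex (edges R) (rt R) d Down \<beta> ?f) / 2 = at_root (ball_mass t d \<beta> Z) X" for d
  proof -
    have "at_root (ball_mass t d \<beta> Z) X = plus_ex (edges R) (rt R) d \<beta> 0 (\<lambda>x. (1 / 2) * (?f x + ?f (sflip x)))"
      unfolding at_root_def ball_mass_def R_def[symmetric] plus_ex_def by (rule gex_cong) (simp add: half_ind_def)
    also have "\<dots> = (1 / 2) * (plus_ex (edges R) (rt R) d \<beta> 0 ?f + plus_ex (edges R) (rt R) d \<beta> 0 (\<lambda>x. ?f (sflip x)))"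
      unfolding plus_ex_def by (simp only: gex_add gex_cmult)
    finally show ?thesis unfolding bc_ex_up bc_ex_down[OF rooted_simple[OF R]] by simp
  qed
  ultimately show "(\<lambda>d. at_root (ball_mass t d \<beta> Z) X) \<longlonglongrightarrow> measure (phi \<beta> X) (ball_event t Z)"
    unfolding meas by simp
qed

lemma phi_measurable:
  assumes \<beta>: "0 \<le> \<beta>" shows "phi \<beta> \<in> measurable borel (prob_algebra borel)"
proof (rule measurable_prob_algebra_generated[OF sets_borel_network])
  let ?G = "insert {} {ball_event t Z | t Z. Z \<in> trunc_space t}"
  show "Int_stable ?G"
  proof (rule Int_stableI)
    fix A B assume AB: "A \<in> ?G" "B \<in> ?G"
    have key: "ball_event t Z \<inter> ball_event s Y \<in> ?G" if "t \<le> s" "Y \<in> trunc_space s" for t s Z Y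
    proof (cases "trunc t Y = Z")
      note tr = trunc_trunc[OF that(1)]
      have down: "trunc t X = trunc t Y" if "trunc s X = Y" for X using tr[of X] that by simp
      case True
      have "ball_event t Z \<inter> ball_event s Y = ball_event s Y"
        using True down by (auto simp: ball_event_def)
      then show ?thesis using that(2) by auto
    next
      case False
      have "X \<notin> ball_event s Y" if "X \<in> ball_event t Z" for X
        using False that trunc_trunc[OF \<open>t \<le> s\<close>, of X] by (auto simp: ball_event_def)
      then have "ball_event t Z \<inter> ball_event s Y = {}" by auto
      then show ?thesis by simp
    qed
    show "A \<inter> B \<in> ?G"
    proof (cases "A = {} \<or> B = {}")
      case False
      then obtain t Z s Y where tZ: "A = ball_event t Z" "Z \<in> trunc_space t" and sY: "B = ball_event s Y" "Y \<in> trunc_space s"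
        using AB by auto
      show ?thesis
      proof (cases "t \<le> s")
        case True then show ?thesis using key[OF True sY(2), of Z] tZ(1) sY(1) by simp
      next
        case False
        then have "s \<le> t" by simp
        from key[OF this tZ(2), of Y] show ?thesis using tZ(1) sY(1) by (simp add: Int_commute)
      qed
    qed auto
  qed
  fix A assume "A \<in> ?G"
  then consider "A = {}" | t Z where "A = ball_event t Z" by auto
  then show "(\<lambda>X. emeasure (phi \<beta> X) A) \<in> borel_measurable borel"
  proof cases
    case 2
    have "(\<lambda>X. measure (phi \<beta> X) A) \<in> borel_measurable borel"
    proof (rule borel_measurable_LIMSEQ_real)
      show "(\<lambda>d. at_root (ball_mass t (d + t) \<beta> Z) X) \<longlonglongrightarrow> measure (phi \<beta> X) A" for X
        unfolding 2 by (rule LIMSEQ_ignore_initial_segment[OF phi_law(3)[OF \<beta>]])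
      show "(at_root (ball_mass t (d + t) \<beta> Z) :: rooted_graph \<Rightarrow> real) \<in> borel_measurable borel" for d
        by (rule at_root_measurable[OF local_fun_ball_mass]) simp
    qed
    moreover have "emeasure (phi \<beta> X) A = ennreal (measure (phi \<beta> X) A)" for X
      by (rule finite_measure.emeasure_eq_measure[OF prob_space.finite_measure[OF phi_law(2)[OF \<beta>]]])
    ultimately show ?thesis by simp
  qed simp
qed (use phi_law(1,2)[OF \<beta>] in auto)

lemma trunc_phi:
  assumes \<beta>: "0 \<le> \<beta>"
  shows "trunc_law t (phi \<beta> X) \<in> pdisc (trunc_space t)"
    and "Z \<in> trunc_space t \<Longrightarrow> (\<lambda>d. at_root (ball_mass t d \<beta> Z) X) \<longlonglongrightarrow> measure (trunc_law t (phi \<beta> X)) {Z}"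
proof -
  have m: "trunc t \<in> measurable (phi \<beta> X) (count_space (trunc_space t))"
    using trunc_measurable measurable_cong_sets[OF phi_law(1)[OF \<beta>] refl] by blast
  show "trunc_law t (phi \<beta> X) \<in> pdisc (trunc_space t)"
    by (simp add: pdisc_iff trunc_law_def prob_space.prob_space_distr[OF phi_law(2)[OF \<beta>] m])
  assume Z: "Z \<in> trunc_space t"
  have sp: "space (phi \<beta> X) = UNIV" using phi_law(1)[OF \<beta>, of X] by (auto dest: sets_eq_imp_space_eq)
  have "measure (trunc_law t (phi \<beta> X)) {Z} = measure (phi \<beta> X) (trunc t -` {Z} \<inter> space (phi \<beta> X))"
    unfolding trunc_law_def by (rule measure_distr[OF m]) (use Z in simp)
  also have "trunc t -` {Z} \<inter> space (phi \<beta> X) = ball_event t Z" by (auto simp: ball_event_def sp)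
  finally show "(\<lambda>d. at_root (ball_mass t d \<beta> Z) X) \<longlonglongrightarrow> measure (trunc_law t (phi \<beta> X)) {Z}"
    using phi_law(3)[OF \<beta>] by simp
qed

context
  fixes E :: "nat \<Rightarrow> nat set set" and \<mu> :: "rooted_graph measure"
  assumes E: "\<And>n. graph_on {1..n} (E n)" and \<mu>: "\<mu> \<in> U_star" and lwc: "graphs_loc_weak_conv E \<mu>"
begin

text \<open>
  Dominated convergence, from the convergence of the laws of the marked balls on every rooted graph.
\<close>

lemma limit_law_integral:
  fixes t :: nat and f :: "spin network measure \<Rightarrow> real"
  assumes \<beta>: "0 \<le> \<beta>" and f: "continuous_map (weak_topology (discrete_topology (trunc_space t))) euclideanreal f"
    and bd: "\<And>\<nu>. \<nu> \<in> pdisc (trunc_space t) \<Longrightarrow> \<bar>f \<nu>\<bar> \<le> C"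
  shows "(\<lambda>d. \<integral>X. at_root (\<lambda>F v. f (ball_law t (d + t) \<beta> F v)) X \<partial>\<mu>)
    \<longlonglongrightarrow> (\<integral>\<nu>. f \<nu> \<partial>distr (limit_law \<mu> \<beta>) (prob_algebra (count_space (trunc_space t))) (trunc_law t))"
proof -
  let ?P = "prob_algebra (count_space (trunc_space t :: spin network set))"
  let ?h = "\<lambda>X. f (trunc_law t (phi \<beta> X))"
  have fm: "f \<in> borel_measurable ?P" by (rule weak_continuous_measurable[OF f countable_trunc_space])
  have tl: "trunc_law t \<in> measurable (prob_algebra borel) ?P"
    unfolding trunc_law_def[abs_def] by (rule measurable_distr_prob_space[OF trunc_measurable])
  have phi\<mu>: "phi \<beta> \<in> measurable \<mu> (prob_algebra borel)"
    using phi_measurable[OF \<beta>] measurable_cong_sets[OF \<mu>_sets[OF E \<mu> lwc] refl] by blast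
  have phir: "phi \<beta> \<in> measurable (restrict_space \<mu> trees) (prob_algebra borel)"
    by (rule measurable_restrict_space1[OF phi\<mu>])
  have hm: "?h \<in> borel_measurable \<mu>"
    using measurable_compose[OF measurable_compose[OF phi\<mu> tl] fm] .
  have "(\<integral>\<nu>. f \<nu> \<partial>distr (limit_law \<mu> \<beta>) ?P (trunc_law t)) = (\<integral>\<nu>. f (trunc_law t \<nu>) \<partial>limit_law \<mu> \<beta>)"
    by (rule integral_distr[OF _ fm]) (use tl in \<open>simp add: limit_law_def\<close>)
  also have "\<dots> = (\<integral>X. ?h X \<partial>restrict_space \<mu> trees)"
    unfolding limit_law_def by (rule integral_distr[OF phir measurable_compose[OF tl fm]])
  also have "\<dots> = (\<integral>X. indicator trees X * ?h X \<partial>\<mu>)"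
    using trees_sets[OF E \<mu> lwc] by (subst integral_restrict_space) auto
  also have "\<dots> = (\<integral>X. ?h X \<partial>\<mu>)"
  proof (rule integral_cong_AE)
    show "AE X in \<mu>. indicator trees X * ?h X = ?h X"
      using AE_trees[OF E \<mu> lwc] by eventually_elim simp
  qed (use hm trees_sets[OF E \<mu> lwc] in auto)
  finally have rhs: "(\<integral>\<nu>. f \<nu> \<partial>distr (limit_law \<mu> \<beta>) ?P (trunc_law t)) = (\<integral>X. ?h X \<partial>\<mu>)" .
  interpret prob_space \<mu> by (rule \<mu>_prob[OF E \<mu> lwc])
  have s: "simple_lf (edges (rep_network X))" for X :: rooted_graph by (rule rooted_simple[OF rooted_net_rep])
  show ?thesis
    unfolding rhs
  proof (rule integral_dominated_convergence[where w = "\<lambda>_. C"])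
    show "at_root (\<lambda>F v. f (ball_law t (d + t) \<beta> F v)) \<in> borel_measurable \<mu>" for d
      by (rule at_root_measurable_\<mu>[OF E \<mu> lwc local_fun_comp[OF local_fun_ball_law]]) simp
    show "AE X in \<mu>. (\<lambda>d. at_root (\<lambda>F v. f (ball_law t (d + t) \<beta> F v)) X) \<longlonglongrightarrow> ?h X"
    proof (rule AE_I2)
      fix X
      show "(\<lambda>d. at_root (\<lambda>F v. f (ball_law t (d + t) \<beta> F v)) X) \<longlonglongrightarrow> ?h X"
        unfolding at_root_def
      proof (rule weak_continuous_limit[OF f countable_trunc_space ball_law(1)[OF s] trunc_phi(1)[OF \<beta>]])
        fix Z :: "spin network" assume Z: "Z \<in> trunc_space t"
        show "(\<lambda>d. measure (ball_law t (d + t) \<beta> (edges (rep_network X)) (rt (rep_network X))) {Z})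
          \<longlonglongrightarrow> measure (trunc_law t (phi \<beta> X)) {Z}"
          using LIMSEQ_ignore_initial_segment[OF trunc_phi(2)[OF \<beta> Z, of X], of t]
          unfolding ball_law(2)[OF s Z] at_root_def .
      qed
    qed
    show "AE X in \<mu>. norm (at_root (\<lambda>F v. f (ball_law t (d + t) \<beta> F v)) X) \<le> C" for d
      using bd ball_law(1)[OF s] by (intro AE_I2) (simp add: at_root_def)
  qed (use hm in auto)
qed

end

section \<open>Comparison of the Ising measure with the symmetric boundary condition\<close>

lemma gball_trans: "u \<in> gball E i a \<Longrightarrow> v \<in> gball E u b \<Longrightarrow> v \<in> gball E i (a + b)"
  unfolding gball_iff by (meson add_mono relpow_trans)

lemma gball_sym: assumes "u \<in> gball E i a" shows "i \<in> gball E u a"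
proof -
  have "(i, u) \<in> adj E ^^ k \<Longrightarrow> (u, i) \<in> adj E ^^ k" for k
  proof (induction k arbitrary: u)
    case (Suc k)
    then obtain w where w: "(i, w) \<in> adj E ^^ k" "(w, u) \<in> adj E" by auto
    have "(u, w) \<in> adj E" using w(2) sym_adj[of E] by (simp add: sym_def)
    then show ?case using Suc.IH[OF w(1)] by (rule relpow_Suc_I2)
  qed simp
  then show ?thesis using assms unfolding gball_iff by blast
qed

text \<open>
  How much the true correlations of the edges at \<open>u\<close> fall below those with plus boundary.
\<close>

definition deficit :: "nat \<Rightarrow> real \<Rightarrow> nat set set \<Rightarrow> nat \<Rightarrow> nat \<Rightarrow> real" where
  "deficit k \<beta> E n u =
    (\<Sum>w\<in>nbrs E u. plus_ex E u (Suc k) \<beta> 0 (chi {u, w}) - nex E n \<beta> 0 (chi {u, w}))"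

lemma leb_const_nonneg: "0 < \<beta> \<Longrightarrow> 0 \<le> leb_const \<beta> M n"
  unfolding leb_const_def by (intro divide_nonneg_nonneg mult_nonneg_nonneg zero_le_power) auto

context
  fixes E :: "nat set set" and n :: nat
  assumes E: "graph_on {1..n} E"
begin

private lemma simple: "simple_lf E" and finite_edges: "finite E" using graph_on_simple[OF E] by auto

lemma nbrs_gball_Suc: "w \<in> nbrs E u \<Longrightarrow> {u, w} \<subseteq> gball E u (Suc k)"
  using nbrs_subset_gball[of E u] gball_mono[of 1 "Suc k" E u] by auto

lemma deficit_nonneg: "u \<in> {1..n} \<Longrightarrow> 0 \<le> \<beta> \<Longrightarrow> 0 \<le> deficit k \<beta> E n u"
  unfolding deficit_def using nex_le_plus[OF E _ nbrs_gball_Suc] by (intro sum_nonneg) simp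

text \<open>
  For an edge at \<open>u\<close>, the ball of radius \<open>k + 1\<close> around \<open>u\<close> lies in the larger ball around \<open>i\<close>, so
  that the plus boundary condition of the smaller ball gives the larger correlation.
\<close>

lemma edge_deficits:
  assumes i: "i \<in> {1..n}" and \<beta>: "0 \<le> \<beta>"
  shows "(\<Sum>e\<in>induced E (gball E i t). plus_ex E i (t + Suc k) \<beta> 0 (chi e) - nex E n \<beta> 0 (chi e))
    \<le> (\<Sum>u\<in>gball E i t. deficit k \<beta> E n u)"
proof -
  let ?W = "gball E i t" and ?I = "induced E (gball E i t)"
  let ?a = "\<lambda>e. plus_ex E i (t + Suc k) \<beta> 0 (chi e) - nex E n \<beta> 0 (chi e)"
  have W: "finite ?W" "finite ?I" using finite_gball_lf[OF simple] by (auto intro: finite_induced)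
  have a: "0 \<le> ?a e" if "e \<in> ?I" for e
    using nex_le_plus[OF E i, of e "t + Suc k" \<beta> 0] that \<beta> gball_mono[of t "t + Suc k" E i] by (auto simp: induced_def)
  have "(\<Sum>e\<in>?I. ?a e) \<le> (\<Sum>e\<in>?I. \<Sum>u\<in>{u\<in>?W. u \<in> e}. ?a e)"
  proof (rule sum_mono)
    fix e assume e: "e \<in> ?I"
    then have "e \<in> E" "e \<subseteq> ?W" by (auto simp: induced_def)
    from edge_pair[OF simple this(1)] this(2) obtain u where "u \<in> {u\<in>?W. u \<in> e}" by auto
    then have "1 \<le> card {u\<in>?W. u \<in> e}" using W(1) by (auto simp: Suc_le_eq card_gt_0_iff)
    then have "1 * ?a e \<le> real (card {u\<in>?W. u \<in> e}) * ?a e" by (intro mult_right_mono a[OF e]) simp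
    then show "?a e \<le> (\<Sum>u\<in>{u\<in>?W. u \<in> e}. ?a e)" by simp
  qed
  also have "\<dots> = (\<Sum>u\<in>?W. \<Sum>e\<in>{e\<in>?I. u \<in> e}. ?a e)" by (rule sum.swap_restrict[OF W(2,1)])
  also have "\<dots> \<le> (\<Sum>u\<in>?W. deficit k \<beta> E n u)"
  proof (rule sum_mono)
    fix u assume u: "u \<in> ?W"
    then have uV: "u \<in> {1..n}" using gball_in_V[OF E i] by blast
    let ?p = "\<lambda>w. {u, w}"
    have sub: "{e\<in>?I. u \<in> e} \<subseteq> ?p ` nbrs E u"
    proof
      fix e assume e: "e \<in> {e\<in>?I. u \<in> e}"
      then have "e \<in> E" by (simp add: induced_def)
      from edge_pair[OF simple this] obtain v w where vw: "e = {v, w}" by blast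
      then have "e = ?p v \<or> e = ?p w" using e by auto
      then show "e \<in> ?p ` nbrs E u" using \<open>e \<in> E\<close> by (auto simp: nbrs_def)
    qed
    have gsub: "gball E u (Suc k) \<subseteq> gball E i (t + Suc k)" using gball_trans[OF u] by blast
    have le: "?a (?p w) \<le> plus_ex E u (Suc k) \<beta> 0 (chi (?p w)) - nex E n \<beta> 0 (chi (?p w))" if "w \<in> nbrs E u" for w
      using plus_le_plus[OF E i uV gsub nbrs_gball_Suc[OF that] \<beta>, of 0] by simp
    have ge: "0 \<le> plus_ex E u (Suc k) \<beta> 0 (chi (?p w)) - nex E n \<beta> 0 (chi (?p w))" if "w \<in> nbrs E u" for w
      using nex_le_plus[OF E uV nbrs_gball_Suc[OF that] \<beta>, of 0 k] by simp
    have fin: "finite (nbrs E u)" using simple by (simp add: simple_lf_def)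
    have "(\<Sum>e\<in>{e\<in>?I. u \<in> e}. ?a e) \<le> (\<Sum>e\<in>{e\<in>?I. u \<in> e}. plus_ex E u (Suc k) \<beta> 0 (chi e) - nex E n \<beta> 0 (chi e))"
      by (rule sum_mono) (use sub le in blast)
    also have "\<dots> \<le> (\<Sum>e\<in>?p ` nbrs E u. plus_ex E u (Suc k) \<beta> 0 (chi e) - nex E n \<beta> 0 (chi e))"
      by (rule sum_mono2) (use fin sub ge in auto)
    also have "\<dots> = deficit k \<beta> E n u"
      unfolding deficit_def by (subst sum.reindex) (auto simp: inj_on_def doubleton_eq_iff)
    finally show "(\<Sum>e\<in>{e\<in>?I. u \<in> e}. ?a e) \<le> deficit k \<beta> E n u" .
  qed
  finally show ?thesis .
qed

text \<open>
  Conditioning on the spins outside the ball turns the Ising measure into a mixture of boundary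
  conditions, and the comparison on trees holds for each of them.
\<close>

lemma even_comparison:
  assumes i: "i \<in> {1..n}" and \<beta>: "0 < \<beta>" and tree: "treelike E i (Suc (t + Suc k))"
    and K: "card (gball E i (Suc t)) \<le> K" and C: "C \<subseteq> gball E i t" "even (card C)"
  shows "plus_ex E i (t + Suc k) \<beta> 0 (chi C) - nex E n \<beta> 0 (chi C)
    \<le> leb_const \<beta> (\<beta> * K) (card (gball E i t)) * (\<Sum>u\<in>gball E i t. deficit k \<beta> E n u)"
proof -
  let ?L = "gball E i (t + Suc k)" and ?I = "induced E (gball E i t)"
  let ?H = "ham E {1..n} \<beta> 0" and ?c = "leb_const \<beta> (\<beta> * K) (card (gball E i t))"
  have finL: "finite ?L" by (rule finite_gball_lf[OF simple])
  have loc: "gex ?L \<xi> (ham (induced E (gball E i (Suc (t + Suc k)))) ?L \<beta> 0) f = gex ?L \<xi> ?H f" for \<xi> f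
    by (rule ham_local[OF simple, symmetric]) (use finite_edges gball_in_V[OF E i] in \<open>auto simp: induced_def\<close>)
  have deg: "\<beta> * real (card (nbrs E v)) \<le> \<beta> * real K" if "v \<in> gball E i t" for v
  proof -
    have "nbrs E v \<subseteq> gball E i (Suc t)" using gball_nbr[OF that] by (auto simp: nbrs_def)
    then have "card (nbrs E v) \<le> card (gball E i (Suc t))" by (rule card_mono[OF finite_gball_lf[OF simple]])
    then show ?thesis using K \<beta> by (intro mult_left_mono) auto
  qed
  obtain p where p: "\<And>y. y \<in> cfg ({1..n} - ?L) all_up \<Longrightarrow> 0 \<le> p y" "(\<Sum>y\<in>cfg ({1..n} - ?L) all_up. p y) = 1"
    "\<And>f. gex {1..n} all_up ?H f = (\<Sum>y\<in>cfg ({1..n} - ?L) all_up. p y * gex ?L y ?H f)"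
    by (rule gex_tower[OF finL finite_atLeastAtMost gball_in_V[OF E i], where \<xi> = all_up and H = "ham E {1..n} \<beta> 0"])
       (rule that, assumption+)
  let ?D = "\<lambda>y C. gex ?L all_up ?H (chi C) - gex ?L y ?H (chi C)"
  have D: "plus_ex E i (t + Suc k) \<beta> 0 (chi C) - nex E n \<beta> 0 (chi C) = (\<Sum>y\<in>cfg ({1..n} - ?L) all_up. p y * ?D y C)" for C
    unfolding nex_def plus_ex_full[OF E i] p(3)
    by (simp only: right_diff_distrib sum_subtractf sum_distrib_right[symmetric] p(2) mult_1)
  have "?D y C \<le> ?c * (\<Sum>e\<in>?I. ?D y e)" for y
    using tree_even_correlations[OF simple tree \<beta> C deg, of y] unfolding loc .
  then have "(\<Sum>y\<in>cfg ({1..n} - ?L) all_up. p y * ?D y C) \<le> (\<Sum>y\<in>cfg ({1..n} - ?L) all_up. p y * (?c * (\<Sum>e\<in>?I. ?D y e)))"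
    by (intro sum_mono mult_left_mono p(1))
  also have "\<dots> = ?c * (\<Sum>y\<in>cfg ({1..n} - ?L) all_up. \<Sum>e\<in>?I. p y * ?D y e)"
    by (simp add: sum_distrib_left mult.left_commute)
  also have "(\<Sum>y\<in>cfg ({1..n} - ?L) all_up. \<Sum>e\<in>?I. p y * ?D y e) = (\<Sum>e\<in>?I. \<Sum>y\<in>cfg ({1..n} - ?L) all_up. p y * ?D y e)"
    by (rule sum.swap)
  also have "\<dots> = (\<Sum>e\<in>?I. plus_ex E i (t + Suc k) \<beta> 0 (chi e) - nex E n \<beta> 0 (chi e))" unfolding D ..
  also have "?c * \<dots> \<le> ?c * (\<Sum>u\<in>gball E i t. deficit k \<beta> E n u)"
    by (rule mult_left_mono[OF edge_deficits[OF i less_imp_le[OF \<beta>]] leb_const_nonneg[OF \<beta>]])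
  finally show ?thesis unfolding D .
qed

text \<open>
  For a function that is invariant under a global flip, the odd coefficients cancel.
\<close>

lemma walsh_even:
  assumes f: "finite W" "local_on W f" "\<And>x. f (sflip x) = f x" "\<And>x. 0 \<le> f x" "\<And>x. f x \<le> 1"
  shows "\<exists>c. (\<forall>A. \<bar>c A\<bar> \<le> 1) \<and> (\<forall>x. f x = (\<Sum>A\<in>{A\<in>Pow W. even (card A)}. c A * chi A x))"
proof -
  define c where "c A = (\<Sum>\<xi>\<in>cfg W all_up. f \<xi> * chi A \<xi>) / 2 ^ card W" for A
  have c1: "\<bar>c A\<bar> \<le> 1" for A
  proof -
    have "\<bar>\<Sum>\<xi>\<in>cfg W all_up. f \<xi> * chi A \<xi>\<bar> \<le> (\<Sum>\<xi>\<in>cfg W all_up. 1)"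
      by (rule order_trans[OF sum_abs sum_mono]) (use f(4,5) in \<open>simp add: abs_mult\<close>)
    then show ?thesis by (simp add: c_def card_cfg[OF f(1)])
  qed
  have "f x = (\<Sum>A\<in>{A\<in>Pow W. even (card A)}. c A * chi A x)" for x
  proof -
    have w: "f y = (\<Sum>A\<in>Pow W. c A * chi A y)" for y unfolding c_def by (rule walsh[OF f(1,2)])
    have "2 * f x = f x + f (sflip x)" by (simp add: f(3))
    also have "\<dots> = (\<Sum>A\<in>Pow W. c A * chi A x + c A * chi A (sflip x))" unfolding w[of x] w[of "sflip x"] by (simp add: sum.distrib)
    also have "\<dots> = (\<Sum>A\<in>Pow W. if even (card A) then 2 * (c A * chi A x) else 0)"
      by (rule sum.cong[OF refl]) (auto simp: chi_sflip)
    also have "\<dots> = 2 * (\<Sum>A\<in>{A\<in>Pow W. even (card A)}. c A * chi A x)"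
      using f(1) by (simp add: sum.inter_filter[symmetric] sum_distrib_left)
    finally show ?thesis by simp
  qed
  then show ?thesis using c1 by blast
qed

text \<open>
  The symmetrized indicator is a combination of even spin products, each of which changes by at most
  a multiple of the deficits in the ball. The sum over \<open>j\<close> makes the constant depend on \<open>K\<close> only.
\<close>

lemma ball_mass_comparison:
  assumes i: "i \<in> {1..n}" and \<beta>: "0 < \<beta>" and tree: "treelike E i (Suc (t + Suc k))"
    and K: "card (gball E i (Suc t)) \<le> K"
  shows "\<bar>ball_mass t (t + Suc k) \<beta> Z E i - nex E n \<beta> 0 (half_ind t Z E i)\<bar>
    \<le> (\<Sum>j\<le>K. 2 ^ j * leb_const \<beta> (\<beta> * K) j) * (\<Sum>u\<in>gball E i t. deficit k \<beta> E n u)"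
proof -
  let ?W = "gball E i t" and ?P = "{A\<in>Pow (gball E i t). even (card A)}"
  let ?S = "\<Sum>u\<in>?W. deficit k \<beta> E n u" and ?l = "leb_const \<beta> (\<beta> * K) (card ?W)"
  have W: "finite ?W" by (rule finite_gball_lf[OF simple])
  have S: "0 \<le> ?S" using \<beta> by (intro sum_nonneg deficit_nonneg) (simp_all only: subsetD[OF gball_in_V[OF E i]] less_imp_le)
  obtain c where c: "\<And>A. \<bar>c A\<bar> \<le> 1" "\<And>x. half_ind t Z E i x = (\<Sum>A\<in>?P. c A * chi A x)"
    using walsh_even[OF W half_ind_local[OF simple] half_ind_sflip half_ind_bounds] by blast
  have ex: "gex L \<xi> H (half_ind t Z E i) = (\<Sum>A\<in>?P. c A * gex L \<xi> H (chi A))" for L \<xi> H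
  proof -
    have "half_ind t Z E i = (\<lambda>x. \<Sum>A\<in>?P. c A * chi A x)" by (rule ext) (rule c(2))
    then show ?thesis by (simp only: gex_sum gex_cmult)
  qed
  have "\<bar>ball_mass t (t + Suc k) \<beta> Z E i - nex E n \<beta> 0 (half_ind t Z E i)\<bar>
    = \<bar>\<Sum>A\<in>?P. c A * (plus_ex E i (t + Suc k) \<beta> 0 (chi A) - nex E n \<beta> 0 (chi A))\<bar>"
    unfolding ball_mass_def plus_ex_def nex_def ex by (simp add: sum_subtractf right_diff_distrib)
  also have "\<dots> \<le> (\<Sum>A\<in>?P. ?l * ?S)"
  proof (rule order_trans[OF sum_abs sum_mono])
    fix A assume A: "A \<in> ?P"
    let ?d = "plus_ex E i (t + Suc k) \<beta> 0 (chi A) - nex E n \<beta> 0 (chi A)"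
    have "A \<subseteq> gball E i (t + Suc k)" using A gball_mono[of t "t + Suc k" E i] by auto
    then have d: "0 \<le> ?d" using nex_le_plus[OF E i, of A "t + Suc k" \<beta> 0] \<beta> by simp
    have "\<bar>c A * ?d\<bar> \<le> 1 * ?d" unfolding abs_mult using c(1)[of A] d by (intro mult_mono) auto
    also have "\<dots> \<le> ?l * ?S" using even_comparison[OF i \<beta> tree K, of A] A by simp
    finally show "\<bar>c A * ?d\<bar> \<le> ?l * ?S" .
  qed
  also have "\<dots> = real (card ?P) * (?l * ?S)" by simp
  also have "\<dots> \<le> 2 ^ card ?W * (?l * ?S)"
  proof (rule mult_right_mono)
    have "card ?P \<le> card (Pow ?W)" by (rule card_mono) (use W in auto)
    then have "real (card ?P) \<le> real (2 ^ card ?W)" unfolding card_Pow[OF W] by (rule of_nat_mono)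
    then show "real (card ?P) \<le> 2 ^ card ?W" by simp
    show "0 \<le> ?l * ?S" using leb_const_nonneg[OF \<beta>] S by simp
  qed
  also have "\<dots> = (2 ^ card ?W * ?l) * ?S" by simp
  also have "\<dots> \<le> (\<Sum>j\<le>K. 2 ^ j * leb_const \<beta> (\<beta> * K) j) * ?S"
  proof (rule mult_right_mono[OF _ S])
    have "card ?W \<le> card (gball E i (Suc t))" by (rule card_mono[OF finite_gball_lf[OF simple] gball_mono]) simp
    then show "2 ^ card ?W * ?l \<le> (\<Sum>j\<le>K. 2 ^ j * leb_const \<beta> (\<beta> * K) j)"
      using K by (intro member_le_sum mult_nonneg_nonneg leb_const_nonneg[OF \<beta>]) simp_all
  qed
  finally show ?thesis .
qed

text \<open>At infinite temperature both measures are uniform.\<close>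

lemma ball_mass_zero:
  assumes i: "i \<in> {1..n}" shows "ball_mass t (t + d) 0 Z E i = nex E n 0 0 (half_ind t Z E i)"
proof -
  have zero: "ham F V 0 0 = (\<lambda>_. 0)" for F V by (simp add: ham_def fun_eq_iff)
  have sub: "gball E i t \<subseteq> gball E i (t + d)" by (rule gball_mono) simp
  have res: "gex M all_up (\<lambda>_. 0) (half_ind t Z E i) = gex (gball E i t) all_up (\<lambda>_. 0) (half_ind t Z E i)"
    if "finite M" "gball E i t \<subseteq> M" for M
  proof (rule gex_restrict[OF that])
    fix x y :: "nat \<Rightarrow> spin" assume "\<And>v. v \<in> gball E i t \<Longrightarrow> x v = y v"
    then show "half_ind t Z E i x = half_ind t Z E i y" by (rule half_ind_cong[OF simple])
  qed simp
  show ?thesis unfolding ball_mass_def plus_ex_def nex_def zero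
    by (rule trans[OF res[OF finite_gball_lf[OF simple] sub] res[OF finite_atLeastAtMost gball_in_V[OF E i], symmetric]])
qed

text \<open>
  If the balls around \<open>i\<close> in a set of vertices have at most \<open>K\<close> elements, a vertex \<open>u\<close> lies
  in at most \<open>K\<close> of them.
\<close>

lemma sum_over_balls:
  fixes g :: "nat \<Rightarrow> real"
  assumes G: "G \<subseteq> {1..n}" "\<And>i. i \<in> G \<Longrightarrow> card (gball E i (2 * t)) \<le> K" and g: "\<And>u. u \<in> {1..n} \<Longrightarrow> 0 \<le> g u"
  shows "(\<Sum>i\<in>G. \<Sum>u\<in>gball E i t. g u) \<le> real K * (\<Sum>u\<in>{1..n}. g u)"
proof -
  have fG: "finite G" by (rule finite_subset[OF G(1)]) simp
  have "(\<Sum>i\<in>G. \<Sum>u\<in>gball E i t. g u) = (\<Sum>i\<in>G. \<Sum>u\<in>{u\<in>{1..n}. u \<in> gball E i t}. g u)"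
  proof (rule sum.cong[OF refl])
    fix i assume "i \<in> G"
    then have "gball E i t \<subseteq> {1..n}" using G(1) gball_in_V[OF E] by blast
    then have "{u\<in>{1..n}. u \<in> gball E i t} = gball E i t" by auto
    then show "(\<Sum>u\<in>gball E i t. g u) = (\<Sum>u\<in>{u\<in>{1..n}. u \<in> gball E i t}. g u)" by simp
  qed
  also have "\<dots> = (\<Sum>u\<in>{1..n}. \<Sum>i\<in>{i\<in>G. u \<in> gball E i t}. g u)"
    by (rule sum.swap_restrict[OF fG finite_atLeastAtMost])
  also have "\<dots> \<le> (\<Sum>u\<in>{1..n}. real K * g u)"
  proof (rule sum_mono)
    fix u assume u: "u \<in> {1..n}"
    have "card {i\<in>G. u \<in> gball E i t} \<le> K"
    proof (cases "{i\<in>G. u \<in> gball E i t} = {}")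
      case False
      then obtain j where j: "j \<in> G" "u \<in> gball E j t" by blast
      have "{i\<in>G. u \<in> gball E i t} \<subseteq> gball E j (2 * t)"
        using gball_trans[OF j(2) gball_sym, of _ t] by (auto simp: mult_2)
      then have "card {i\<in>G. u \<in> gball E i t} \<le> card (gball E j (2 * t))" by (rule card_mono[OF finite_gball_lf[OF simple]])
      then show ?thesis using G(2)[OF j(1)] by simp
    next
      case True then show ?thesis by (simp only: True card.empty)
    qed
    then show "(\<Sum>i\<in>{i\<in>G. u \<in> gball E i t}. g u) \<le> real K * g u"
      using g[OF u] by (simp add: mult_right_mono)
  qed
  finally show ?thesis by (simp add: sum_distrib_left)
qed

end

section \<open>Local weak convergence of the Ising measures\<close>

context
  fixes E :: "nat \<Rightarrow> nat set set" and \<mu> :: "rooted_graph measure"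
  assumes E: "\<And>n. graph_on {1..n} (E n)" and \<mu>: "\<mu> \<in> U_star" and lwc: "graphs_loc_weak_conv E \<mu>"
begin

text \<open>
  The constant \<open>C\<close> is chosen before the radius, so that a large radius makes the product of \<open>C\<close> and the
  mean deficit small. For \<open>\<beta> = 0\<close> the constant 0 does.
\<close>

lemma deficit_vanishes:
  assumes \<beta>: "0 \<le> \<beta>" and cont: "continuous (at \<beta> within {0..}) (\<lambda>b. U_fun \<mu> b 0)" and \<epsilon>: "0 < \<epsilon>"
  shows "\<exists>C\<ge>0. \<exists>k0. \<forall>k\<ge>k0.
    (\<forall>n i Z. i \<in> {1..n} \<longrightarrow> treelike (E n) i (Suc (t + Suc k)) \<longrightarrow> card (gball (E n) i (Suc t)) \<le> K \<longrightarrow>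
      \<bar>ball_mass t (t + Suc k) \<beta> Z (E n) i - nex (E n) n \<beta> 0 (half_ind t Z (E n) i)\<bar>
        \<le> C * (\<Sum>u\<in>gball (E n) i t. deficit k \<beta> (E n) n u)) \<and>
    (\<forall>\<^sub>F n in sequentially. C * avg n (deficit k \<beta> (E n) n) < \<epsilon>)"
proof (cases "\<beta> = 0")
  case True
  have z: "ball_mass t (t + Suc k) \<beta> Z (E n) i = nex (E n) n \<beta> 0 (half_ind t Z (E n) i)"
    if "i \<in> {1..n}" for n i k Z
    unfolding True by (rule ball_mass_zero[OF E that])
  show ?thesis
  proof (intro exI[of _ "0 :: real"] exI[of _ "0 :: nat"] conjI allI impI)
    fix k n i :: nat and Z assume "i \<in> {1..n}"
    from z[OF this] show "\<bar>ball_mass t (t + Suc k) \<beta> Z (E n) i - nex (E n) n \<beta> 0 (half_ind t Z (E n) i)\<bar>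
        \<le> 0 * (\<Sum>u\<in>gball (E n) i t. deficit k \<beta> (E n) n u)" by (simp only: diff_self abs_zero mult_zero_left)
  qed (use \<epsilon> in auto)
next
  case False
  then have b: "0 < \<beta>" using \<beta> by simp
  define C where "C = (\<Sum>j\<le>K. 2 ^ j * leb_const \<beta> (\<beta> * K) j)"
  have C: "0 \<le> C" unfolding C_def by (intro sum_nonneg mult_nonneg_nonneg leb_const_nonneg[OF b]) simp
  have "0 < \<epsilon> / (C + 1)" using C \<epsilon> by simp
  from energy_deficit[OF E \<mu> lwc b cont this]
  obtain k0 where k0: "\<forall>k\<ge>k0. \<forall>\<^sub>F n in sequentially. avg n (deficit k \<beta> (E n) n) < \<epsilon> / (C + 1)"
    unfolding deficit_def[abs_def] by blast
  show ?thesis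
  proof (intro exI[of _ C] exI[of _ k0] conjI allI impI C)
    fix k n i Z assume "i \<in> {1..n}" "treelike (E n) i (Suc (t + Suc k))" "card (gball (E n) i (Suc t)) \<le> K"
    then show "\<bar>ball_mass t (t + Suc k) \<beta> Z (E n) i - nex (E n) n \<beta> 0 (half_ind t Z (E n) i)\<bar>
        \<le> C * (\<Sum>u\<in>gball (E n) i t. deficit k \<beta> (E n) n u)"
      unfolding C_def by (intro ball_mass_comparison[OF E _ b])
  next
    fix k assume "k0 \<le> k"
    then have "\<forall>\<^sub>F n in sequentially. avg n (deficit k \<beta> (E n) n) < \<epsilon> / (C + 1)" using k0 by blast
    then show "\<forall>\<^sub>F n in sequentially. C * avg n (deficit k \<beta> (E n) n) < \<epsilon>"
    proof eventually_elim
      case (elim n)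
      have "C * avg n (deficit k \<beta> (E n) n) \<le> C * (\<epsilon> / (C + 1))" using elim C by (intro mult_left_mono) auto
      also have "\<dots> < \<epsilon>" using C \<epsilon> by (simp add: field_simps)
      finally show ?case .
    qed
  qed
qed

lemma large_balls:
  assumes \<epsilon>: "0 < \<epsilon>"
  shows "\<exists>K. \<forall>\<^sub>F n in sequentially. avg n (\<lambda>i. of_bool (\<not> card (gball (E n) i r) \<le> K)) < \<epsilon>"
proof -
  let ?Q = "\<lambda>K F v. of_bool (\<not> card (gball F v r) \<le> K) :: real"
  have loc: "local_fun r (?Q K)" for K
    using local_fun_comp[OF local_fun_card_gball, of r "\<lambda>m. of_bool (\<not> m \<le> K)"] .
  interpret prob_space \<mu> by (rule \<mu>_prob[OF E \<mu> lwc])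
  have "(\<lambda>K. \<integral>X. at_root (?Q K) X \<partial>\<mu>) \<longlonglongrightarrow> (\<integral>X. 0 \<partial>\<mu>)"
  proof (rule integral_dominated_convergence[where w = "\<lambda>_. 1"])
    show "at_root (?Q K) \<in> borel_measurable \<mu>" for K by (rule at_root_measurable_\<mu>[OF E \<mu> lwc loc])
    show "AE X in \<mu>. (\<lambda>K. at_root (?Q K) X) \<longlonglongrightarrow> 0"
    proof (rule AE_I2)
      fix X :: rooted_graph
      have "\<forall>\<^sub>F K in sequentially. at_root (?Q K) X = 0"
        using eventually_ge_at_top[of "card (gball (edges (rep_network X)) (rt (rep_network X)) r)"]
        by eventually_elim (simp add: at_root_def)
      then show "(\<lambda>K. at_root (?Q K) X) \<longlonglongrightarrow> 0" by (rule tendsto_eventually)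
    qed
    show "AE X in \<mu>. norm (at_root (?Q K) X) \<le> 1" for K by (simp add: at_root_def)
  qed auto
  then have "(\<lambda>K. \<integral>X. at_root (?Q K) X \<partial>\<mu>) \<longlonglongrightarrow> 0" by simp
  from order_tendstoD(2)[OF this \<epsilon>] obtain K where K: "(\<integral>X. at_root (?Q K) X \<partial>\<mu>) < \<epsilon>"
    unfolding eventually_sequentially by blast
  have "(\<lambda>n. avg n (\<lambda>i. ?Q K (E n) i)) \<longlonglongrightarrow> (\<integral>X. at_root (?Q K) X \<partial>\<mu>)"
    by (rule lwc_bounded[OF E \<mu> lwc loc, where C = 1]) simp
  from order_tendstoD(2)[OF this K] show ?thesis by blast
qed

lemma cycles_rare:
  assumes \<epsilon>: "0 < \<epsilon>"
  shows "\<forall>\<^sub>F n in sequentially. avg n (\<lambda>i. of_bool (\<not> treelike (E n) i r)) < \<epsilon>"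
proof -
  let ?Q = "\<lambda>F v. of_bool (\<not> treelike F v r) :: real"
  have loc: "local_fun r ?Q"
    using local_fun_comp[OF local_fun_treelike, of r "\<lambda>b. of_bool (\<not> b)"] .
  have "(\<integral>X. at_root ?Q X \<partial>\<mu>) = (\<integral>X. 0 \<partial>\<mu>)"
  proof (rule integral_cong_AE)
    show "AE X in \<mu>. at_root ?Q X = 0"
      using AE_trees[OF E \<mu> lwc]
    proof eventually_elim
      case (elim X)
      then have "acyclic_graph (edges (rep_network X))" by (simp add: trees_def)
      from acyclic_treelike[OF rooted_simple[OF rooted_net_rep] this] show ?case by (simp add: at_root_def)
    qed
  qed (use at_root_measurable_\<mu>[OF E \<mu> lwc loc] in auto)
  moreover have "(\<lambda>n. avg n (\<lambda>i. ?Q (E n) i)) \<longlonglongrightarrow> (\<integral>X. at_root ?Q X \<partial>\<mu>)"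
    by (rule lwc_bounded[OF E \<mu> lwc loc, where C = 1]) simp
  ultimately have "(\<lambda>n. avg n (\<lambda>i. ?Q (E n) i)) \<longlonglongrightarrow> 0" by simp
  from order_tendstoD(2)[OF this \<epsilon>] show ?thesis .
qed

lemma integral_local_law:
  fixes f :: "spin network measure \<Rightarrow> real"
  assumes n: "0 < n" and f: "f \<in> borel_measurable (prob_algebra (count_space (trunc_space t)))"
  shows "(\<integral>\<nu>. f \<nu> \<partial>distr (measure_pmf (pmf_of_set {1..n})) (prob_algebra (count_space (trunc_space t)))
      (local_law (E n) (ising (E n) n \<beta>) t)) = avg n (\<lambda>i. f (local_law (E n) (ising (E n) n \<beta>) t i))"
proof -
  let ?P = "prob_algebra (count_space (trunc_space t :: spin network set))"
  have m: "local_law (E n) (ising (E n) n \<beta>) t \<in> measurable (measure_pmf (pmf_of_set {1..n})) ?P"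
  proof (rule measurableI)
    show "local_law (E n) (ising (E n) n \<beta>) t i \<in> space ?P" for i
      unfolding space_prob_algebra_count by (rule local_law_pdisc[OF E])
  qed simp
  have "(\<integral>\<nu>. f \<nu> \<partial>distr (measure_pmf (pmf_of_set {1..n})) ?P (local_law (E n) (ising (E n) n \<beta>) t))
    = measure_pmf.expectation (pmf_of_set {1..n}) (\<lambda>i. f (local_law (E n) (ising (E n) n \<beta>) t i))"
    by (rule integral_distr[OF m f])
  also have "\<dots> = (\<Sum>i\<in>{1..n}. f (local_law (E n) (ising (E n) n \<beta>) t i)) / real (card {1..n})"
    by (rule integral_pmf_of_set) (use n in auto)
  finally show ?thesis by (simp add: avg_def)
qed

text \<open>
  At a vertex whose neighbourhood is a small tree and around which the deficit is small, the two
  laws of the marked ball have nearly the same masses.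
\<close>

lemma good_vertex:
  assumes i: "i \<in> {1..n}" and K: "card (gball (E n) i t) \<le> K" and F: "F = nets K \<inter> trunc_space t"
    and d: "\<And>\<nu> \<nu>'. \<nu> \<in> pdisc (trunc_space t) \<Longrightarrow> \<nu>' \<in> pdisc (trunc_space t) \<Longrightarrow>
      \<forall>z\<in>trunc_space t - F. measure \<nu> {z} = 0 \<and> measure \<nu>' {z} = 0 \<Longrightarrow> (\<Sum>z\<in>F. measure \<nu> {z}) = 1 \<Longrightarrow>
      \<forall>z\<in>F. \<bar>measure \<nu> {z} - measure \<nu>' {z}\<bar> < \<delta> \<Longrightarrow> \<bar>f \<nu> - f \<nu>'\<bar> < (\<epsilon> :: real)"
    and small: "\<And>Z. \<bar>ball_mass t d \<beta> Z (E n) i - nex (E n) n \<beta> 0 (half_ind t Z (E n) i)\<bar> < \<delta>"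
  shows "\<bar>f (ball_law t d \<beta> (E n) i) - f (local_law (E n) (ising (E n) n \<beta>) t i)\<bar> < \<epsilon>"
proof -
  note s = E_simple[OF E \<mu> lwc, of n]
  let ?\<nu> = "ball_law t d \<beta> (E n) i" and ?\<nu>' = "local_law (E n) (ising (E n) n \<beta>) t i"
  have m: "measure ?\<nu> {Z} = ball_mass t d \<beta> Z (E n) i" "measure ?\<nu>' {Z} = nex (E n) n \<beta> 0 (half_ind t Z (E n) i)"
    if "Z \<in> trunc_space t" for Z
    using ball_law(2)[OF s that] local_law_mass[OF E i that] by auto
  have mem: "marked_ball (E n) t i x \<in> F" for x
    unfolding F using marked_ball_in_nets[OF s K] marked_ball_in_trunc_space[OF s] by blast
  have fin: "finite F" "F \<subseteq> trunc_space t" unfolding F using finite_nets by auto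
  have z: "half_ind t Z (E n) i = (\<lambda>_. 0)" if "Z \<notin> F" for Z by (rule half_ind_outside) (use mem that in metis)
  have out: "ball_mass t d \<beta> Z (E n) i = 0" "nex (E n) n \<beta> 0 (half_ind t Z (E n) i) = 0" if "Z \<notin> F" for Z
    unfolding ball_mass_def plus_ex_def nex_def z[OF that] by (simp_all add: gex_const finite_gball_lf[OF s])
  have "(\<Sum>Z\<in>F. measure ?\<nu> {Z}) = (\<Sum>Z\<in>F. ball_mass t d \<beta> Z (E n) i)"
    by (rule sum.cong[OF refl], rule m) (use fin in auto)
  also have "\<dots> = plus_ex (E n) i d \<beta> 0 (\<lambda>x. \<Sum>Z\<in>F. half_ind t Z (E n) i x)"
    unfolding ball_mass_def plus_ex_def by (rule gex_sum[symmetric])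
  also have "\<dots> = 1" unfolding half_ind_sum[OF fin(1) mem] plus_ex_def by (rule gex_const[OF finite_gball_lf[OF s]])
  finally have one: "(\<Sum>Z\<in>F. measure ?\<nu> {Z}) = 1" .
  show ?thesis
  proof (rule d[OF ball_law(1)[OF s] local_law_pdisc[OF E] _ one])
    show "\<forall>z\<in>trunc_space t - F. measure ?\<nu> {z} = 0 \<and> measure ?\<nu>' {z} = 0" using m out by simp
    show "\<forall>z\<in>F. \<bar>measure ?\<nu> {z} - measure ?\<nu>' {z}\<bar> < \<delta>"
    proof
      fix z assume "z \<in> F"
      then have "z \<in> trunc_space t" using fin(2) by blast
      then show "\<bar>measure ?\<nu> {z} - measure ?\<nu>' {z}\<bar> < \<delta>" using small[of z] m by simp
    qed
  qed
qed

text \<open>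
  The average of \<open>f\<close> at the symmetrized laws in balls of radius \<open>t + k + 1\<close> converges by local weak
  convergence, to a number that is close to the claimed limit for large \<open>k\<close>. The averages at the true
  laws are close to it: a vertex is bad if its neighbourhood is large (\<open>b1\<close>), is not a tree (\<open>b2\<close>), or
  has large deficits (\<open>b3\<close>), and bad vertices are rare. As the balls are small, the deficits around good
  vertices add up to at most \<open>K\<close> times the total deficit.
\<close>

lemma ising_weak_limit:
  fixes f :: "spin network measure \<Rightarrow> real"
  assumes \<beta>: "0 \<le> \<beta>" and cont: "continuous (at \<beta> within {0..}) (\<lambda>b. U_fun \<mu> b 0)"
    and f: "continuous_map (weak_topology (discrete_topology (trunc_space t))) euclideanreal f"
    and bd: "\<And>\<nu>. \<nu> \<in> pdisc (trunc_space t) \<Longrightarrow> \<bar>f \<nu>\<bar> \<le> C0"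
  shows "(\<lambda>n. avg n (\<lambda>i. f (local_law (E n) (ising (E n) n \<beta>) t i)))
    \<longlonglongrightarrow> (\<integral>\<nu>. f \<nu> \<partial>distr (limit_law \<mu> \<beta>) (prob_algebra (count_space (trunc_space t))) (trunc_law t))"
    (is "?avg \<longlonglongrightarrow> ?I")
proof (rule tendstoI)
  fix \<epsilon> :: real assume \<epsilon>: "0 < \<epsilon>"
  have C0: "0 \<le> C0"
  proof -
    have "simple_lf {}" by (simp add: simple_lf_def nbrs_def)
    from bd[OF ball_law(1)[OF this]] show ?thesis by (meson abs_ge_zero order_trans)
  qed
  define \<eta> where "\<eta> = \<epsilon> / (16 * (C0 + 1))"
  have \<eta>: "0 < \<eta>" "2 * C0 * (3 * \<eta>) \<le> 3 * \<epsilon> / 8"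
    using C0 \<epsilon> by (auto simp: \<eta>_def field_simps)
  obtain K where K: "\<forall>\<^sub>F n in sequentially. avg n (\<lambda>i. of_bool (\<not> card (gball (E n) i (2 * t + 2)) \<le> K)) < \<eta>"
    using large_balls[OF \<eta>(1)] by blast
  \<comment> \<open>the possible marked balls around vertices with small neighbourhoods\<close>
  define F where "F = nets K \<inter> trunc_space t"
  have F: "finite F" "F \<subseteq> trunc_space t" unfolding F_def using finite_nets by auto
  have "0 < \<epsilon> / 4" using \<epsilon> by simp
  from weak_uniformly_continuous[OF f countable_trunc_space F this]
  obtain \<delta> where \<delta>: "0 < \<delta>" and \<delta>2: "\<And>\<nu> \<nu>'. \<nu> \<in> pdisc (trunc_space t) \<Longrightarrow> \<nu>' \<in> pdisc (trunc_space t) \<Longrightarrow>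
      \<forall>z\<in>trunc_space t - F. measure \<nu> {z} = 0 \<and> measure \<nu>' {z} = 0 \<Longrightarrow> (\<Sum>z\<in>F. measure \<nu> {z}) = 1 \<Longrightarrow>
      \<forall>z\<in>F. \<bar>measure \<nu> {z} - measure \<nu>' {z}\<bar> < \<delta> \<Longrightarrow> \<bar>f \<nu> - f \<nu>'\<bar> < \<epsilon> / 4"
    by metis
  have "0 < \<eta> * \<delta> / (real K + 1)" using \<eta> \<delta> by simp
  from deficit_vanishes[OF \<beta> cont this, of t K]
  obtain C k0 where C: "0 \<le> C" and k0: "\<And>k. k0 \<le> k \<Longrightarrow>
    (\<forall>n i Z. i \<in> {1..n} \<longrightarrow> treelike (E n) i (Suc (t + Suc k)) \<longrightarrow> card (gball (E n) i (Suc t)) \<le> K \<longrightarrow>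
      \<bar>ball_mass t (t + Suc k) \<beta> Z (E n) i - nex (E n) n \<beta> 0 (half_ind t Z (E n) i)\<bar>
        \<le> C * (\<Sum>u\<in>gball (E n) i t. deficit k \<beta> (E n) n u)) \<and>
    (\<forall>\<^sub>F n in sequentially. C * avg n (deficit k \<beta> (E n) n) < \<eta> * \<delta> / (real K + 1))"
    by blast
  have "0 < \<epsilon> / 8" using \<epsilon> by simp
  from tendstoD[OF limit_law_integral[OF E \<mu> lwc \<beta> f bd] this]
  obtain d0 where d0: "\<And>d. d0 \<le> d \<Longrightarrow> dist (\<integral>X. at_root (\<lambda>F v. f (ball_law t (d + t) \<beta> F v)) X \<partial>\<mu>) ?I < \<epsilon> / 8"
    unfolding eventually_sequentially by blast
  define k where "k = max k0 d0"
  define J where "J = (\<integral>X. at_root (\<lambda>F v. f (ball_law t (t + Suc k) \<beta> F v)) X \<partial>\<mu>)"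
  have J: "\<bar>J - ?I\<bar> < \<epsilon> / 8"
    using d0[of "Suc k"] unfolding J_def by (simp add: k_def dist_real_def add.commute)
  have comp: "\<bar>ball_mass t (t + Suc k) \<beta> Z (E n) i - nex (E n) n \<beta> 0 (half_ind t Z (E n) i)\<bar>
        \<le> C * (\<Sum>u\<in>gball (E n) i t. deficit k \<beta> (E n) n u)"
    if "i \<in> {1..n}" "treelike (E n) i (Suc (t + Suc k))" "card (gball (E n) i (Suc t)) \<le> K" for n i Z
    using k0[of k] that by (simp add: k_def)
  have ev1: "\<forall>\<^sub>F n in sequentially. C * avg n (deficit k \<beta> (E n) n) < \<eta> * \<delta> / (real K + 1)"
    using k0[of k] by (simp add: k_def)
  have ev2: "\<forall>\<^sub>F n in sequentially. avg n (\<lambda>i. of_bool (\<not> treelike (E n) i (Suc (t + Suc k)))) < \<eta>"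
    by (rule cycles_rare[OF \<eta>(1)])
  have s: "simple_lf (E n)" for n by (rule E_simple[OF E \<mu> lwc])
  have "(\<lambda>n. avg n (\<lambda>i. f (ball_law t (t + Suc k) \<beta> (E n) i))) \<longlonglongrightarrow> J"
    unfolding J_def
    by (rule lwc_bounded[OF E \<mu> lwc local_fun_comp[OF local_fun_ball_law], where C = C0])
       (use bd ball_law(1) in auto)
  from tendstoD[OF this \<open>0 < \<epsilon> / 8\<close>]
  have ev3: "\<forall>\<^sub>F n in sequentially. dist (avg n (\<lambda>i. f (ball_law t (t + Suc k) \<beta> (E n) i))) J < \<epsilon> / 8" .
  show "\<forall>\<^sub>F n in sequentially. dist (?avg n) ?I < \<epsilon>"
    using K ev1 ev2 ev3 eventually_gt_at_top[of 0]
  proof eventually_elim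
    case (elim n)
    let ?P = "\<lambda>i. f (local_law (E n) (ising (E n) n \<beta>) t i)" and ?Q = "\<lambda>i. f (ball_law t (t + Suc k) \<beta> (E n) i)"
    let ?b1 = "\<lambda>i. of_bool (\<not> card (gball (E n) i (2 * t + 2)) \<le> K) :: real"
    let ?b2 = "\<lambda>i. of_bool (\<not> treelike (E n) i (Suc (t + Suc k))) :: real"
    let ?S = "\<lambda>i. \<Sum>u\<in>gball (E n) i t. deficit k \<beta> (E n) n u"
    define G where "G = {i\<in>{1..n}. card (gball (E n) i (2 * t + 2)) \<le> K}"
    let ?b3 = "\<lambda>i. if i \<in> G then C * ?S i / \<delta> else 0"
    have S0: "0 \<le> ?S i" if "i \<in> {1..n}" for i
      by (rule sum_nonneg, rule deficit_nonneg[OF E _ \<beta>]) (use gball_in_V[OF E that] in blast)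
    have n: "0 < real n" using elim by simp
    have sub: "card (gball (E n) i r) \<le> K" if "i \<in> G" "r \<le> 2 * t + 2" for i r
    proof -
      have "card (gball (E n) i r) \<le> card (gball (E n) i (2 * t + 2))"
        by (rule card_mono[OF finite_gball_lf[OF s] gball_mono[OF that(2)]])
      then show ?thesis using that(1) by (simp add: G_def)
    qed
    have pt: "\<bar>?Q i - ?P i\<bar> \<le> \<epsilon> / 4 + 2 * C0 * (?b1 i + ?b2 i + ?b3 i)" if i: "i \<in> {1..n}" for i
    proof (cases "i \<in> G \<and> treelike (E n) i (Suc (t + Suc k)) \<and> C * ?S i < \<delta>")
      case True
      then have "i \<in> G" by simp
      have cmp: "\<bar>ball_mass t (t + Suc k) \<beta> Z (E n) i - nex (E n) n \<beta> 0 (half_ind t Z (E n) i)\<bar> < \<delta>" for Z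
        using comp[OF i, of Z] True sub[OF \<open>i \<in> G\<close>, of "Suc t"] by simp
      have "\<bar>?Q i - ?P i\<bar> < \<epsilon> / 4"
        by (rule good_vertex[OF i sub[OF \<open>i \<in> G\<close>] F_def \<delta>2 cmp]) simp
      moreover have "0 \<le> 2 * C0 * (?b1 i + ?b2 i + ?b3 i)"
        using C0 C \<delta> S0[OF i] by simp
      ultimately show ?thesis by linarith
    next
      case False
      have "1 \<le> ?b1 i + ?b2 i + ?b3 i"
      proof (cases "i \<in> G \<and> treelike (E n) i (Suc (t + Suc k))")
        case True
        then have "1 \<le> C * ?S i / \<delta>" using False \<delta> by (simp add: field_simps)
        then show ?thesis using True by simp
      next
        case False
        then have "1 \<le> ?b1 i + ?b2 i" using i by (auto simp: G_def)
        moreover have "0 \<le> ?b3 i" using C \<delta> S0[OF i] by simp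
        ultimately show ?thesis by linarith
      qed
      then have "2 * C0 * 1 \<le> 2 * C0 * (?b1 i + ?b2 i + ?b3 i)" using C0 by (intro mult_left_mono) auto
      moreover have "\<bar>?Q i\<bar> \<le> C0" "\<bar>?P i\<bar> \<le> C0" by (rule bd, rule ball_law(1)[OF s], rule bd, rule local_law_pdisc[OF E])
      ultimately show ?thesis using \<epsilon> by linarith
    qed
    have b3: "avg n ?b3 < \<eta>"
    proof -
      have "(\<Sum>i\<in>{1..n}. ?b3 i) = (\<Sum>i\<in>G. C * ?S i / \<delta>)"
        by (subst sum.inter_restrict[symmetric]) (auto simp: G_def intro: sum.cong)
      also have "\<dots> = C / \<delta> * (\<Sum>i\<in>G. ?S i)"
        by (subst sum_distrib_left) (rule sum.cong[OF refl], simp only: times_divide_eq_left)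
      also have "\<dots> \<le> C / \<delta> * (real K * (\<Sum>u\<in>{1..n}. deficit k \<beta> (E n) n u))"
      proof (rule mult_left_mono[OF sum_over_balls[OF E]])
        show "G \<subseteq> {1..n}" unfolding G_def by blast
        show "card (gball (E n) i (2 * t)) \<le> K" if "i \<in> G" for i by (rule sub[OF that]) simp
        show "0 \<le> deficit k \<beta> (E n) n u" if "u \<in> {1..n}" for u by (rule deficit_nonneg[OF E that \<beta>])
        show "0 \<le> C / \<delta>" using C \<delta> by simp
      qed
      finally have "avg n ?b3 \<le> C / \<delta> * (real K * (\<Sum>u\<in>{1..n}. deficit k \<beta> (E n) n u)) / real n"
        unfolding avg_def by (rule divide_right_mono) simp
      also have "\<dots> = real K / \<delta> * (C * avg n (deficit k \<beta> (E n) n))" by (simp add: avg_def)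
      also have "\<dots> \<le> real K / \<delta> * (\<eta> * \<delta> / (real K + 1))"
        by (rule mult_left_mono[OF less_imp_le[OF elim(2)]]) (use \<delta> in simp)
      also have "\<dots> = \<eta> * (real K / (real K + 1))" using \<delta> by simp
      also have "\<dots> < \<eta> * 1" by (rule mult_strict_left_mono[OF _ \<eta>(1)]) simp
      also have "\<eta> * 1 = \<eta>" by simp
      finally show ?thesis .
    qed
    have "\<bar>avg n ?Q - avg n ?P\<bar> \<le> avg n (\<lambda>i. \<bar>?Q i - ?P i\<bar>)"
      using avg_abs[of n "\<lambda>i. ?Q i - ?P i"] by (simp only: avg_diff)
    also have "\<dots> \<le> avg n (\<lambda>i. \<epsilon> / 4 + 2 * C0 * (?b1 i + ?b2 i + ?b3 i))" by (rule avg_mono[OF pt])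
    also have "\<dots> = avg n (\<lambda>i. \<epsilon> / 4) + 2 * C0 * (avg n ?b1 + avg n ?b2 + avg n ?b3)"
      by (simp only: avg_add avg_cmult)
    also have "avg n (\<lambda>i. \<epsilon> / 4) = \<epsilon> / 4" using n by (simp add: avg_def)
    also have "2 * C0 * (avg n ?b1 + avg n ?b2 + avg n ?b3) \<le> 2 * C0 * (3 * \<eta>)"
      by (rule mult_left_mono) (use elim(1,3) b3 C0 in linarith, use C0 in simp)
    also have "\<dots> \<le> 3 * \<epsilon> / 8" by (rule \<eta>(2))
    finally have "\<bar>avg n ?Q - avg n ?P\<bar> \<le> \<epsilon> / 4 + 3 * \<epsilon> / 8" by simp
    moreover have "\<bar>avg n ?Q - J\<bar> < \<epsilon> / 8" using elim(4) by (simp add: dist_real_def)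
    ultimately show ?case using J \<epsilon> unfolding dist_real_def by linarith
  qed
qed

end

theorem theorem1p6:
  fixes E :: "nat \<Rightarrow> nat set set" and \<mu> :: "rooted_graph measure" and \<beta> :: real
  assumes "\<And>n. graph_on {1..n} (E n)"
    and "\<mu> \<in> U_star"
    and "graphs_loc_weak_conv E \<mu>"
    and "0 \<le> \<beta>"
    and "continuous (at \<beta> within {0..}) (\<lambda>b. U_fun \<mu> b 0)"
  shows "measures_loc_weak_conv E (\<lambda>n. ising (E n) n \<beta>) (limit_law \<mu> \<beta>)"
  unfolding measures_loc_weak_conv_def weak_conv_on_def
proof (intro allI impI)
  fix t :: nat and f :: "spin network measure \<Rightarrow> real"
  assume "continuous_map (weak_topology (discrete_topology (trunc_space t))) euclideanreal f
    \<and> bounded (f ` topspace (weak_topology (discrete_topology (trunc_space t))))"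
  then have f: "continuous_map (weak_topology (discrete_topology (trunc_space t))) euclideanreal f"
    and "bounded (f ` pdisc (trunc_space t))" by (simp_all only: topspace_weak)
  then obtain C where C: "\<And>\<nu>. \<nu> \<in> pdisc (trunc_space t) \<Longrightarrow> \<bar>f \<nu>\<bar> \<le> C" unfolding bounded_iff by auto
  note fm = weak_continuous_measurable[OF f countable_trunc_space]
  have "(\<lambda>n. avg n (\<lambda>i. f (local_law (E n) (ising (E n) n \<beta>) t i)))
    \<longlonglongrightarrow> (\<integral>\<nu>. f \<nu> \<partial>distr (limit_law \<mu> \<beta>) (prob_algebra (count_space (trunc_space t))) (trunc_law t))"
    by (rule ising_weak_limit[OF assms f C])
  moreover have "\<forall>\<^sub>F n in sequentially. avg n (\<lambda>i. f (local_law (E n) (ising (E n) n \<beta>) t i))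
    = (\<integral>\<nu>. f \<nu> \<partial>distr (measure_pmf (pmf_of_set {1..n})) (prob_algebra (count_space (trunc_space t)))
      (local_law (E n) (ising (E n) n \<beta>) t))"
    using eventually_gt_at_top[of 0]
    by eventually_elim (rule integral_local_law[OF assms(1-3) _ fm, symmetric])
  ultimately show "(\<lambda>n. \<integral>\<nu>. f \<nu> \<partial>distr (measure_pmf (pmf_of_set {1..n})) (prob_algebra (count_space (trunc_space t)))
      (local_law (E n) (ising (E n) n \<beta>) t))
    \<longlonglongrightarrow> (\<integral>\<nu>. f \<nu> \<partial>distr (limit_law \<mu> \<beta>) (prob_algebra (count_space (trunc_space t))) (trunc_law t))"
    by (rule Lim_transform_eventually)
qed

end
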